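(* Let $\mathbb K=\mathbb R$ or $\mathbb C$. Let $\omega_0$ and $\omega_1$ be germs at $0$ of smooth (respectively $\mathbb K$-analytic) singular symplectic forms on $\mathbb K^{2n}$ with a common structurally smooth Martinet hypersurface $\Sigma_2$ at $0$, let $\iota:\Sigma_2\hookrightarrow\mathbb K^{2n}$ be the inclusion, and suppose $\operatorname{rank}(\iota^{*}\omega_0|_0)=\operatorname{rank}(\iota^{*}\omega_1|_0)=2n-4$. If $\iota^{*}\omega_0=\iota^{*}\omega_1=\sigma$, if $\omega_0$ and $\omega_1$ define the same canonical orientation of $\Sigma_2$ (this condition being imposed only when $\mathbb K=\mathbb R$), and if the vector space $\operatorname{span} j^1_0\sigma^{n-1}$ has dimension $2$, then there exists a smooth (respectively $\mathbb K$-analytic) diffeomorphism-germ $\Psi:(\mathbb K^{2n},0)\to(\mathbb K^{2n},0)$ such that $\Psi^{*}\omega_1=\omega_0$.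
   Context: The smooth ($C^\infty$) category refers to $\mathbb K=\mathbb R$. A closed $2$-form-germ $\omega$ at $0$ on $\mathbb K^{2n}$ is a singular symplectic form-germ if its Martinet hypersurface $\Sigma_2(\omega)=\{p:\omega^n|_p=0\}$ is nowhere dense. Write $\omega^n=f\,\Omega$ with $\Omega$ the germ at $0$ of a volume form, so $\Sigma_2(\omega)=\{f=0\}$; it is structurally smooth at $0$ if $f(0)=0$ and $df|_0\ne0$. "Common Martinet hypersurface" means $\Sigma_2(\omega_0)=\Sigma_2(\omega_1)=\Sigma_2$. The rank of a $2$-form at a point is its rank as a skew-symmetric bilinear form. Canonical orientation of $\Sigma_2$ defined by $\omega$ (for $\mathbb K=\mathbb R$): if $\Sigma_2=\{f=0\}$ with $df|_0\neq0$, it is the orientation determined by the volume form $\Omega_{\Sigma_2}$ on $\Sigma_2$ given by $df\wedge\Omega_{\Sigma_2}=\omega^n/f$ (at points of $\Sigma_2$); it does not depend on the choice of such $f$. Definition of $\operatorname{span}j^1_0\sigma^{n-1}$: in local coordinates $(q_1,\dots,q_{2n-1})$ on $\Sigma_2\cong\mathbb K^{2n-1}$ centred at $0$ write $$\sigma^{n-1}=\sum_{i=1}^{2n-1}g_i\,dq_1\wedge\cdots\wedge dq_{i-1}\wedge dq_{i+1}\wedge\cdots\wedge dq_{2n-1}.$$ Let $j^1_0g$ denote the $1$-jet at $0$ of a function-germ $g$, an element of the $\mathbb K$-vector space $J^1_0(\mathbb K^{2n-1},\mathbb K)$ of $1$-jets at $0$. Then $\operatorname{span}j^1_0\sigma^{n-1}$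 is the $\mathbb K$-linear span of $j^1_0g_1,\dots,j^1_0g_{2n-1}$. (When $\operatorname{rank}(\sigma|_0)=2n-4$, all $g_i(0)=0$, and this notion does not depend on the choice of coordinates.) *)

theory Defs
  imports "HOL-Analysis.Analysis"
begin

text \<open>
  Germs at the origin are represented by globally defined functions; only their values near the
  origin matter, and identities between germs are stated with the filter \<open>nhds 0\<close>.
  The scalar field is a type variable, instantiated by \<open>real\<close> or \<open>complex\<close> in the end.
\<close>

subsection \<open>Regularity of function-germs\<close>

primrec Ck_on :: "nat \<Rightarrow> 'a::real_normed_vector set \<Rightarrow> ('a \<Rightarrow> 'b::real_normed_vector) \<Rightarrow> bool" where
  "Ck_on 0 U f \<longleftrightarrow> continuous_on U f"
| "Ck_on (Suc k) U f \<longleftrightarrow> (\<forall>x\<in>U. f differentiable (at x)) \<and>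
     (\<forall>v. Ck_on k U (\<lambda>x. frechet_derivative f (at x) v))"

definition smooth_germ :: "('a::real_normed_vector \<Rightarrow> 'b::real_normed_vector) \<Rightarrow> bool" where
  "smooth_germ f \<longleftrightarrow> (\<exists>U. open U \<and> 0 \<in> U \<and> (\<forall>k. Ck_on k U f))"

text \<open>The germ is the sum of a power series in several variables with coefficients in the scalar
  field; multi-indices are functions into \<open>nat\<close>. Over \<open>complex\<close> these are the holomorphic germs.\<close>

definition analytic_germ :: "('k::real_normed_field^'m \<Rightarrow> 'k) \<Rightarrow> bool" where
  "analytic_germ f \<longleftrightarrow> (\<exists>c :: ('m \<Rightarrow> nat) \<Rightarrow> 'k.
     \<forall>\<^sub>F x in nhds 0. ((\<lambda>a. c a * (\<Prod>i\<in>UNIV. x $ i ^ a i)) has_sum f x) UNIV)"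

text \<open>\<open>Smooth\<close> is only meaningful over \<open>real\<close>: over \<open>complex\<close> it would mean real smoothness.\<close>

datatype regularity = Smooth | Analytic

fun regular_germ :: "regularity \<Rightarrow> ('k::real_normed_field^'m \<Rightarrow> 'k) \<Rightarrow> bool" where
  "regular_germ Smooth f \<longleftrightarrow> smooth_germ f"
| "regular_germ Analytic f \<longleftrightarrow> analytic_germ f"

definition regular_map_germ ::
    "regularity \<Rightarrow> ('k::real_normed_field^'m \<Rightarrow> 'k^'l) \<Rightarrow> bool" where
  "regular_map_germ r F \<longleftrightarrow> (\<forall>i. regular_germ r (\<lambda>x. F x $ i))"

definition diffeo_germ ::
    "regularity \<Rightarrow> ('k::real_normed_field^'m \<Rightarrow> 'k^'m) \<Rightarrow> bool" where
  "diffeo_germ r F \<longleftrightarrow> F 0 = 0 \<and> regular_map_germ r F \<and>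
     (\<exists>G. G 0 = 0 \<and> regular_map_germ r G \<and>
          (\<forall>\<^sub>F x in nhds 0. G (F x) = x) \<and> (\<forall>\<^sub>F y in nhds 0. F (G y) = y))"

subsection \<open>Differential forms\<close>

text \<open>A \<open>k\<close>-covector is a function on lists of vectors, of which only the values on lists of
  length \<open>k\<close> matter. A form assigns a covector to each point.\<close>

type_synonym ('k, 'm) covector = "('k^'m) list \<Rightarrow> 'k"
type_synonym ('k, 'm) form = "'k^'m \<Rightarrow> ('k, 'm) covector"

definition alternating_multilinear :: "nat \<Rightarrow> ('k::field, 'm::finite) covector \<Rightarrow> bool" where
  "alternating_multilinear k \<alpha> \<longleftrightarrow>
     (\<forall>vs i. length vs = k \<and> i < k \<longrightarrow> Vector_Spaces.linear (*s) (*) (\<lambda>x. \<alpha> (vs[i := x]))) \<and>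
     (\<forall>vs i j. length vs = k \<and> i < j \<and> j < k \<and> vs ! i = vs ! j \<longrightarrow> \<alpha> vs = 0)"

text \<open>Regularity of the values on constant vector fields amounts to regularity of the coefficients.\<close>

definition form_germ :: "regularity \<Rightarrow> nat \<Rightarrow> ('k::real_normed_field, 'm::finite) form \<Rightarrow> bool" where
  "form_germ r k \<omega> \<longleftrightarrow> (\<forall>\<^sub>F p in nhds 0. alternating_multilinear k (\<omega> p)) \<and>
     (\<forall>vs. length vs = k \<longrightarrow> regular_germ r (\<lambda>p. \<omega> p vs))"

definition form_germ_eq :: "nat \<Rightarrow> ('k::real_normed_field, 'm::finite) form \<Rightarrow> ('k, 'm) form \<Rightarrow> bool" where
  "form_germ_eq k \<omega> \<eta> \<longleftrightarrow> (\<forall>\<^sub>F p in nhds 0. \<forall>vs. length vs = k \<longrightarrow> \<omega> p vs = \<eta> p vs)"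

text \<open>Wedge product of a \<open>k\<close>-covector and an \<open>l\<close>-covector, normalised such that
  \<open>dx\<^sub>1 \<and> \<dots> \<and> dx\<^sub>k\<close> takes the value 1 on \<open>(e\<^sub>1, \<dots>, e\<^sub>k)\<close>.\<close>

definition wedge :: "nat \<Rightarrow> nat \<Rightarrow> ('k::real_normed_field, 'm::finite) covector \<Rightarrow> ('k, 'm) covector
    \<Rightarrow> ('k, 'm) covector" where
  "wedge k l \<alpha> \<beta> vs =
     (\<Sum>\<pi> | \<pi> permutes {..<k + l}. of_int (sign \<pi>) *
        \<alpha> (map (\<lambda>i. vs ! \<pi> i) [0..<k]) * \<beta> (map (\<lambda>i. vs ! \<pi> i) [k..<k + l])) / (fact k * fact l)"

primrec wedge_power :: "('k::real_normed_field, 'm::finite) covector \<Rightarrow> nat \<Rightarrow> ('k, 'm) covector" where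
  "wedge_power \<alpha> 0 = (\<lambda>_. 1)"
| "wedge_power \<alpha> (Suc j) = wedge 2 (2 * j) \<alpha> (wedge_power \<alpha> j)"

text \<open>For analytic germs over \<open>complex\<close> the real Frechet derivative used below is complex linear
  and is the complex derivative.\<close>

definition differential :: "('k::real_normed_field^'m \<Rightarrow> 'k) \<Rightarrow> ('k, 'm) form" where
  "differential f p vs = frechet_derivative f (at p) (hd vs)"

definition ext_deriv :: "nat \<Rightarrow> ('k::real_normed_field, 'm::finite) form \<Rightarrow> ('k, 'm) form" where
  "ext_deriv k \<omega> p vs =
     (\<Sum>i<Suc k. (- 1) ^ i *
        frechet_derivative (\<lambda>x. \<omega> x (take i vs @ drop (Suc i) vs)) (at p) (vs ! i))"

definition pullback :: "('k::real_normed_field^'l \<Rightarrow> 'k^'m) \<Rightarrow> ('k, 'm) form \<Rightarrow> ('k, 'l) form" where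
  "pullback F \<omega> q vs = \<omega> (F q) (map (frechet_derivative F (at q)) vs)"

definition volume_form_germ :: "regularity \<Rightarrow> ('k::real_normed_field, 'm::finite) form \<Rightarrow> bool" where
  "volume_form_germ r \<Omega> \<longleftrightarrow> form_germ r CARD('m) \<Omega> \<and>
     (\<forall>\<^sub>F p in nhds 0. \<exists>vs. length vs = CARD('m) \<and> \<Omega> p vs \<noteq> 0)"

definition form2_rank :: "('k::real_normed_field, 'm::finite) covector \<Rightarrow> nat" where
  "form2_rank \<alpha> = rank (\<chi> i j. \<alpha> [axis i 1, axis j 1])"

subsection \<open>Singular symplectic forms\<close>

definition martinet_set :: "nat \<Rightarrow> ('k::real_normed_field, 'm::finite) form \<Rightarrow> ('k^'m) set" where
  "martinet_set n \<omega> = {p. \<forall>vs. length vs = 2 * n \<longrightarrow> wedge_power (\<omega> p) n vs = 0}"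

definition singular_symplectic_germ ::
    "regularity \<Rightarrow> nat \<Rightarrow> ('k::real_normed_field, 'm::finite) form \<Rightarrow> bool" where
  "singular_symplectic_germ r n \<omega> \<longleftrightarrow> form_germ r 2 \<omega> \<and>
     form_germ_eq 3 (ext_deriv 2 \<omega>) (\<lambda>_ _. 0) \<and>
     (\<exists>U. open U \<and> 0 \<in> U \<and> interior (closure (martinet_set n \<omega> \<inter> U)) = {})"

definition martinet_equation :: "regularity \<Rightarrow> nat \<Rightarrow> ('k::real_normed_field, 'm::finite) form \<Rightarrow>
    ('k^'m \<Rightarrow> 'k) \<Rightarrow> ('k, 'm) form \<Rightarrow> bool" where
  "martinet_equation r n \<omega> f \<Omega> \<longleftrightarrow> regular_germ r f \<and> volume_form_germ r \<Omega> \<and>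
     form_germ_eq (2 * n) (\<lambda>p. wedge_power (\<omega> p) n) (\<lambda>p vs. f p * \<Omega> p vs)"

definition structurally_smooth_martinet ::
    "regularity \<Rightarrow> nat \<Rightarrow> ('k::real_normed_field, 'm::finite) form \<Rightarrow> bool" where
  "structurally_smooth_martinet r n \<omega> \<longleftrightarrow> (\<exists>f \<Omega>. martinet_equation r n \<omega> f \<Omega> \<and>
     f 0 = 0 \<and> (\<exists>v. frechet_derivative f (at 0) v \<noteq> 0))"

text \<open>Local coordinates on a hypersurface germ \<open>S\<close>, centred at 0, given by the inverse chart
  followed by the inclusion of \<open>S\<close>. Pulling back by this map is restricting to \<open>S\<close> and writing the
  result in the chosen coordinates.\<close>

definition local_parametrization ::
    "regularity \<Rightarrow> ('k::real_normed_field^'m) set \<Rightarrow> ('k^'p \<Rightarrow> 'k^'m) \<Rightarrow> bool" where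
  "local_parametrization r S \<phi> \<longleftrightarrow> \<phi> 0 = 0 \<and> regular_map_germ r \<phi> \<and>
     inj (frechet_derivative \<phi> (at 0)) \<and>
     (\<exists>U W \<psi>. open U \<and> 0 \<in> U \<and> open W \<and> 0 \<in> W \<and> homeomorphism U (S \<inter> W) \<phi> \<psi>)"

text \<open>The canonical orientation is the class, in the coordinates \<open>\<phi>\<close>, of the volume form on the
  Martinet hypersurface whose product with \<open>df\<close> is \<open>\<omega>\<^sup>n / f\<close>. This quotient is the volume form \<open>\<Omega>\<close>
  with \<open>\<omega>\<^sup>n = f \<Omega>\<close>, which makes sense also where \<open>f = 0\<close>. The form on the hypersurface is
  represented by an ambient form \<open>\<Theta>\<close>; its restriction does not depend on the choice of \<open>\<Theta>\<close>.
  An orientation is a class of volume forms modulo positive functions.\<close>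

definition canonical_volume_form :: "regularity \<Rightarrow> nat \<Rightarrow> (real, 'm::finite) form \<Rightarrow>
    (real^'p \<Rightarrow> real^'m) \<Rightarrow> (real, 'p::finite) form \<Rightarrow> bool" where
  "canonical_volume_form r n \<omega> \<phi> \<theta> \<longleftrightarrow> (\<exists>f \<Omega> \<Theta>. martinet_equation r n \<omega> f \<Omega> \<and>
     f 0 = 0 \<and> (\<exists>v. frechet_derivative f (at 0) v \<noteq> 0) \<and>
     form_germ r (2 * n - 1) \<Theta> \<and>
     (\<forall>\<^sub>F p in nhds 0. p \<in> martinet_set n \<omega> \<longrightarrow>
        (\<forall>vs. length vs = 2 * n \<longrightarrow>
           wedge 1 (2 * n - 1) (differential f p) (\<Theta> p) vs = \<Omega> p vs)) \<and>
     form_germ_eq (2 * n - 1) \<theta> (pullback \<phi> \<Theta>))"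

definition canonical_orientation :: "regularity \<Rightarrow> nat \<Rightarrow> (real, 'm::finite) form \<Rightarrow>
    (real^'p \<Rightarrow> real^'m) \<Rightarrow> (real, 'p::finite) form set" where
  "canonical_orientation r n \<omega> \<phi> = {\<eta>. volume_form_germ r \<eta> \<and>
     (\<exists>\<theta> h. canonical_volume_form r n \<omega> \<phi> \<theta> \<and> (\<forall>\<^sub>F q in nhds 0. h q > 0) \<and>
        form_germ_eq (2 * n - 1) \<eta> (\<lambda>q vs. h q * \<theta> q vs))}"

subsection \<open>The span of the 1-jets of the coefficients\<close>

text \<open>The component \<open>None\<close> of a 1-jet is the value, the component \<open>Some j\<close> the \<open>j\<close>-th partial
  derivative.\<close>

definition jet1 :: "('k::real_normed_field^'p \<Rightarrow> 'k) \<Rightarrow> 'k^('p option)" where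
  "jet1 g = (\<chi> i. case i of None \<Rightarrow> g 0 | Some j \<Rightarrow> frechet_derivative g (at 0) (axis j 1))"

text \<open>For a form \<open>\<tau>\<close> of degree \<open>CARD('p) - 1\<close>, the coefficient of the product of all \<open>dq\<^sub>j\<close> with
  \<open>j \<noteq> i\<close>, in increasing order, is the value on the corresponding list of basis vectors.\<close>

definition corank1_coeff :: "('k::real_normed_field, 'p::{finite,linorder}) form \<Rightarrow> 'p \<Rightarrow> ('k, 'p) vec \<Rightarrow> 'k"
  where
  "corank1_coeff \<tau> i q = \<tau> q (map (\<lambda>j. axis j 1) (sorted_list_of_set (UNIV - {i})))"

definition span_jet1 :: "('k::real_normed_field, 'p::{finite,linorder}) form \<Rightarrow> ('k^('p option)) set"
  where
  "span_jet1 \<tau> = vec.span (range (\<lambda>i. jet1 (corank1_coeff \<tau> i)))"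

end

theory Submission
 imports Defs "HOL-Complex_Analysis.Cauchy_Integral_Formula"
begin

text \<open>In coordinates in which the Martinet hypersurface is \<open>x\<^sub>t = 0\<close>, a form of the theorem is a matrix of corank two along that
hyperplane, with kernel fields \<open>p\<close>, \<open>r\<close> tangent to it at \<open>0\<close>. The coefficients of \<open>\<sigma>\<^sup>n\<^sup>-\<^sup>1\<close> lie to first order in the ideal of the
transversal components of \<open>p\<close> and \<open>r\<close>, so the hypothesis on 1-jets makes these components a regular sequence. Hence some
diffeomorphism fixing the hyperplane makes both forms equal along it, and their difference has a primitive vanishing there to
second order. Moser's equation can then be solved, since inverting the matrix costs only one division by \<open>x\<^sub>t\<close>. Smooth,
real analytic and complex analytic germs are treated uniformly; the flow inherits analyticity from its complexification.\<close>

text \<open>Matrices have to be inverted exactly where they degenerate, so each inversion goes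
  through a completion: \<open>A + swap_matrix a b\<close> stays invertible near 0, and its inverse
  yields p and r, depending regularly on the point, with A p = k e_a and A r = k e_b. Here k is the
  Pfaffian up to a unit, and structural smoothness makes k equal to x_t times a unit. The primitive
  carries the square of x_t: one factor pays for the division by k, the other makes the Moser field
  vanish on the hyperplane, so that the flow fixes 0. On the linear path between forms that agree
  along the hyperplane, the matrix at 0 is constant, and closedness keeps the transversal derivative
  of k constant too. The common restriction leaves only the column M e_t of the matrix open. It can
  be matched modulo e_t, and the multiple c of e_t that is needed is a quotient by the pair p_t,
  r_t; this is where a regular sequence enters. Time is treated as one more scalar coordinate of a
  germ. Flows are therefore short, and connectedness of the real line joins the short
  equivalences.\<close>

abbreviation (input) fd :: "('a::real_normed_vector => 'b::real_normed_vector) => 'a => 'a => 'b" where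
 "fd f x \<equiv> frechet_derivative f (at x)"

abbreviation (input) Near0 :: "('a::{zero,topological_space} => bool) => bool" (binder "near0 " 10) where
 "Near0 P \<equiv> eventually P (nhds 0)"

lemmas near0D = eventually_nhds_x_imp_x
lemmas fd_eq = frechet_derivative_at[symmetric]

subsection \<open>Time-dependent functions of class \<open>C\<^sup>k\<close>\<close>

text \<open>Only derivatives in the space variable are taken; time runs through the unit interval.\<close>

primrec Tk :: "nat => 'a::real_normed_vector set => (real => 'a => 'b::real_normed_vector) => bool" where
 "Tk 0 U u \<longleftrightarrow> continuous_on ({0..1} \<times> U) (\<lambda>z. u (fst z) (snd z))"
| "Tk (Suc k) U u \<longleftrightarrow> continuous_on ({0..1} \<times> U) (\<lambda>z. u (fst z) (snd z)) \<and>
   (\<forall>s\<in>{0..1}. \<forall>x\<in>U. u s differentiable (at x)) \<and>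
   (\<forall>v. Tk k U (\<lambda>s x. fd (u s) x v))"

lemma Tk_continuous: "Tk k U u ==> continuous_on ({0..1} \<times> U) (\<lambda>z. u (fst z) (snd z))"
 by (cases k) auto

lemma Tk_SucD: "Tk (Suc k) U u ==> Tk k U u"
 by (induction k arbitrary: u) auto

lemma Tk_mono: "Tk k U u ==> j \<le> k ==> Tk j U u"
 by (induction k) (auto simp: le_Suc_eq dest: Tk_SucD simp del: Tk.simps)

lemma Tk_subset: "Tk k U u ==> V \<subseteq> U ==> Tk k V u"
proof (induction k arbitrary: u)
 case 0
 then show ?case by (auto intro: continuous_on_subset)
next
 case (Suc k)
 then show ?case by (auto intro: continuous_on_subset[of "{0..1} \<times> U"])
qed

lemma fd_cong_open:
 assumes "open U" "x \<in> U" "!!y. y \<in> U ==> f y = g y"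
 shows "fd f x = fd g x"
proof -
 have "(f has_derivative f') (at x) \<longleftrightarrow> (g has_derivative f') (at x)" for f'
  using assms has_derivative_transform_within_open[of f f' x UNIV U g]
   has_derivative_transform_within_open[of g f' x UNIV U f] by auto
 then show ?thesis by (simp add: frechet_derivative_def)
qed

lemma differentiable_cong_open:
 assumes "open U" "x \<in> U" "!!y. y \<in> U ==> f y = g y"
 shows "f differentiable (at x) \<longleftrightarrow> g differentiable (at x)"
proof -
 have "(f has_derivative f') (at x) \<longleftrightarrow> (g has_derivative f') (at x)" for f'
  using assms has_derivative_transform_within_open[of f f' x UNIV U g]
   has_derivative_transform_within_open[of g f' x UNIV U f] by auto
 then show ?thesis by (simp add: differentiable_def)
qed

lemma Tk_cong:
 assumes "open U" "!!s x. s \<in> {0..1} ==> x \<in> U ==> u s x = v s x"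
 shows "Tk k U u \<longleftrightarrow> Tk k U v"
 using assms(2)
proof (induction k arbitrary: u v)
 case 0
 then show ?case by (auto intro!: continuous_on_cong)
next
 case (Suc k)
 have c: "continuous_on ({0..1} \<times> U) (\<lambda>z. u (fst z) (snd z)) \<longleftrightarrow>
   continuous_on ({0..1} \<times> U) (\<lambda>z. v (fst z) (snd z))"
  using Suc.prems by (auto intro!: continuous_on_cong)
 have d: "(\<forall>s\<in>{0..1}. \<forall>x\<in>U. u s differentiable (at x)) \<longleftrightarrow> (\<forall>s\<in>{0..1}. \<forall>x\<in>U. v s differentiable (at x))"
  using differentiable_cong_open[OF assms(1)] Suc.prems by blast
 have e: "Tk k U (\<lambda>s x. fd (u s) x w) \<longleftrightarrow> Tk k U (\<lambda>s x. fd (v s) x w)" for w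
  by (rule Suc.IH) (simp add: fd_cong_open[OF assms(1) _ Suc.prems])
 show ?case by (simp add: c d e)
qed

text \<open>Lets an explicitly known derivative \<open>u'\<close> stand in for the chosen one in
  \<open>frechet_derivative\<close>; the inductive closure proofs below go through it.\<close>

lemma Tk_SucI:
 assumes "open U" "continuous_on ({0..1} \<times> U) (\<lambda>z. u (fst z) (snd z))"
  and "!!s x. s \<in> {0..1} ==> x \<in> U ==> (u s has_derivative u' s x) (at x)"
  and "!!v. Tk k U (\<lambda>s x. u' s x v)"
 shows "Tk (Suc k) U u"
proof -
 have "Tk k U (\<lambda>s x. fd (u s) x v)" for v
  using assms(4)[of v] frechet_derivative_at[OF assms(3)]
  by (subst Tk_cong[OF assms(1), where v = "\<lambda>s x. u' s x v"]) (auto simp: fun_eq_iff)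
 moreover have "u s differentiable (at x)" if "s \<in> {0..1}" "x \<in> U" for s x
  using assms(3)[OF that] by (auto simp: differentiable_def)
 ultimately show ?thesis
  using assms(2) by auto
qed

lemma Tk_Suc_has_derivative:
 "Tk (Suc k) U u ==> s \<in> {0..1} ==> x \<in> U ==> (u s has_derivative fd (u s) x) (at x)"
 by (auto simp: frechet_derivative_works[symmetric])

lemma Ck_on_cong:
 assumes "open U" "!!x. x \<in> U ==> f x = g x"
 shows "Ck_on k U f \<longleftrightarrow> Ck_on k U g"
 using assms(2)
proof (induction k arbitrary: f g)
 case 0
 then show ?case by (auto intro!: continuous_on_cong)
next
 case (Suc k)
 have d: "(\<forall>x\<in>U. f differentiable (at x)) \<longleftrightarrow> (\<forall>x\<in>U. g differentiable (at x))"
  using differentiable_cong_open[OF assms(1)] Suc.prems by blast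
 have e: "Ck_on k U (\<lambda>x. fd f x w) \<longleftrightarrow> Ck_on k U (\<lambda>x. fd g x w)" for w
  by (rule Suc.IH) (simp add: fd_cong_open[OF assms(1) _ Suc.prems])
 show ?case by (simp add: d e)
qed

text \<open>At positive order \<open>Ck_on\<close> has no continuity clause of its own, but
  differentiability everywhere supplies it. Closure properties of \<open>Ck_on\<close> can thus be
  read off from those of \<open>Tk\<close>.\<close>

lemma Ck_on_eq_Tk: "Ck_on k U f \<longleftrightarrow> Tk k U (\<lambda>s. f)"
proof (induction k arbitrary: f)
 case 0
 have "continuous_on U f" if c: "continuous_on ({0..1::real} \<times> U) (\<lambda>z. f (snd z))"
 proof -
  have "continuous_on U (\<lambda>x. f (snd (0::real, x)))"
   by (rule continuous_on_compose2[OF c, where f = "\<lambda>x. (0, x)"]) (auto intro!: continuous_intros)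
  then show ?thesis by simp
 qed
 moreover have "continuous_on ({0..1::real} \<times> U) (\<lambda>z. f (snd z))" if "continuous_on U f"
  by (rule continuous_on_compose2[OF that]) (auto intro!: continuous_intros)
 ultimately show ?case by auto
next
 case (Suc k)
 have "continuous_on ({0..1::real} \<times> U) (\<lambda>z. f (snd z))" if d: "\<forall>x\<in>U. f differentiable (at x)"
 proof -
  have "continuous_on U f"
   using d by (meson differentiable_imp_continuous_within continuous_at_imp_continuous_on)
  then show ?thesis
   by (rule continuous_on_compose2) (auto intro!: continuous_intros)
 qed
 then show ?case using Suc by auto
qed

lemma Ck_on_Tk: "Tk k U u ==> s \<in> {0..1} ==> Ck_on k U (u s)"
proof (induction k arbitrary: u)
 case 0
 have "continuous_on U (\<lambda>x. u (fst (s, x)) (snd (s, x)))"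
  by (rule continuous_on_compose2[OF Tk_continuous[OF 0(1)], where f = "\<lambda>x. (s, x)"])
   (use 0 in \<open>auto intro!: continuous_intros\<close>)
 then show ?case by simp
qed auto

lemma Tk_const [intro, simp]: "Tk k U (\<lambda>s x. c)"
 by (induction k arbitrary: c) auto

lemma Tk_bounded_linear:
 assumes "bounded_linear h" "open U" "Tk k U u"
 shows "Tk k U (\<lambda>s x. h (u s x))"
 using assms(3)
proof (induction k arbitrary: u)
 case 0
 then show ?case
  using bounded_linear.continuous_on[OF assms(1)] by auto
next
 case (Suc k)
 show ?case
 proof (rule Tk_SucI[OF assms(2)])
  show "continuous_on ({0..1} \<times> U) (\<lambda>z. h (u (fst z) (snd z)))"
   using bounded_linear.continuous_on[OF assms(1) Tk_continuous[OF Suc.prems]] .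
  show "((\<lambda>x. h (u s x)) has_derivative (\<lambda>v. h (fd (u s) x v))) (at x)"
   if "s \<in> {0..1}" "x \<in> U" for s x
   by (rule bounded_linear.has_derivative[OF assms(1) Tk_Suc_has_derivative[OF Suc.prems that]])
  show "Tk k U (\<lambda>s x. h (fd (u s) x v))" for v
   using Suc by auto
 qed
qed

lemma Tk_space_linear:
 assumes "bounded_linear h" "open U"
 shows "Tk k U (\<lambda>s. h)"
proof (cases k)
 case 0
 then show ?thesis using bounded_linear.continuous_on[OF assms(1) continuous_on_snd[OF continuous_on_id]]
  by auto
next
 case (Suc j)
 show ?thesis unfolding Suc
  by (rule Tk_SucI[where u' = "\<lambda>s x. h"])
    (use assms bounded_linear.continuous_on[OF assms(1) continuous_on_snd[OF continuous_on_id]]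
     in \<open>auto intro!: bounded_linear_imp_has_derivative\<close>)
qed

lemma Tk_time:
 assumes "continuous_on {0..1} g" "open U"
 shows "Tk k U (\<lambda>s x. g s)"
proof (cases k)
 case 0
 then show ?thesis
  by (auto intro!: continuous_on_compose2[OF assms(1)] continuous_intros)
next
 case (Suc j)
 show ?thesis unfolding Suc
  by (rule Tk_SucI[where u' = "\<lambda>s x h. 0"])
    (use assms in \<open>auto intro!: continuous_intros continuous_on_compose2[OF assms(1)]\<close>)
qed

lemma Tk_add:
 assumes "open U" "Tk k U u" "Tk k U v"
 shows "Tk k U (\<lambda>s x. u s x + v s x)"
 using assms(2,3)
proof (induction k arbitrary: u v)
 case 0
 then show ?case by (auto intro!: continuous_intros)
next
 case (Suc k)
 show ?case
  by (rule Tk_SucI[OF assms(1) _ has_derivative_add[OF Tk_Suc_has_derivative[OF Suc.prems(1)] Tk_Suc_has_derivative[OF Suc.prems(2)]]])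
    (use Suc in \<open>auto intro!: continuous_intros\<close>)
qed

lemma Tk_sum:
 assumes "open U" "!!i. i \<in> I ==> Tk k U (u i)"
 shows "Tk k U (\<lambda>s x. \<Sum>i\<in>I. u i s x)"
 using assms(2)
 by (induction I rule: infinite_finite_induct) (auto intro!: Tk_add[OF assms(1)])

lemma Tk_bilinear:
 assumes bl: "bounded_bilinear pr" and "open U" "Tk k U u" "Tk k U v"
 shows "Tk k U (\<lambda>s x. pr (u s x) (v s x))"
 using assms(3,4)
proof (induction k arbitrary: u v)
 case 0
 then show ?case using bounded_bilinear.continuous_on[OF bl] by auto
next
 case (Suc k)
 show ?case
 proof (rule Tk_SucI[OF assms(2)])
  show "continuous_on ({0..1} \<times> U) (\<lambda>z. pr (u (fst z) (snd z)) (v (fst z) (snd z)))"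
   by (rule bounded_bilinear.continuous_on[OF bl Tk_continuous[OF Suc.prems(1)] Tk_continuous[OF Suc.prems(2)]])
  show "((\<lambda>x. pr (u s x) (v s x)) has_derivative (\<lambda>w. pr (u s x) (fd (v s) x w)
      + pr (fd (u s) x w) (v s x))) (at x)" if "s \<in> {0..1}" "x \<in> U" for s x
   using bounded_bilinear.FDERIV[OF bl Tk_Suc_has_derivative[OF Suc.prems(1) that] Tk_Suc_has_derivative[OF Suc.prems(2) that]] .
  show "Tk k U (\<lambda>s x. pr (u s x) (fd (v s) x w) + pr (fd (u s) x w) (v s x))" for w
  proof (rule Tk_add[OF assms(2)])
   show "Tk k U (\<lambda>s x. pr (u s x) (fd (v s) x w))"
    using Suc.prems by (intro Suc.IH Tk_SucD[OF Suc.prems(1)]) simp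
   show "Tk k U (\<lambda>s x. pr (fd (u s) x w) (v s x))"
    using Suc.prems by (intro Suc.IH Tk_SucD[OF Suc.prems(2)]) simp
  qed
 qed
qed

lemma Tk_compose:
 fixes F :: "real => 'a::euclidean_space => 'b::real_normed_vector" and u :: "real => 'c::real_normed_vector => 'a"
 assumes "open U" "open D" "Tk k D F" "Tk k U u" "!!s x. s \<in> {0..1} ==> x \<in> U ==> u s x \<in> D"
 shows "Tk k U (\<lambda>s x. F s (u s x))"
 using assms(3,4,5)
proof (induction k arbitrary: F u)
 case 0
 have "continuous_on ({0..1} \<times> U) (\<lambda>z. (fst z, u (fst z) (snd z)))"
  using 0(2) by (auto intro!: continuous_intros)
 from continuous_on_compose2[OF Tk_continuous[OF 0(1)] this]
 show ?case using 0(3) by (auto simp: image_subset_iff)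
next
 case (Suc k)
 let ?Du = "\<lambda>s x. fd (u s) x"
 let ?DF = "\<lambda>s y. fd (F s) y"
 have T0: "continuous_on ({0..1} \<times> U) (\<lambda>z. (fst z, u (fst z) (snd z)))"
  using Suc.prems(2) by (auto intro!: continuous_intros)
 show ?case
 proof (rule Tk_SucI[OF assms(1)])
  show "continuous_on ({0..1} \<times> U) (\<lambda>z. F (fst z) (u (fst z) (snd z)))"
   using continuous_on_compose2[OF Tk_continuous[OF Suc.prems(1)] T0] Suc.prems(3)
   by (auto simp: image_subset_iff)
  \<comment> \<open>\<open>Tk\<close> controls derivatives in fixed directions only, while the chain
    rule produces the moving direction \<open>?Du s x w\<close>. Expanding it over the basis leaves
    products to which the induction hypothesis applies.\<close>
  show "((\<lambda>x. F s (u s x)) has_derivative (\<lambda>w. \<Sum>b\<in>Basis. (?Du s x w \<bullet> b) *\<^sub>R ?DF s (u s x) b)) (at x)"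
   if "s \<in> {0..1}" "x \<in> U" for s x
  proof -
   have dF: "(F s has_derivative ?DF s (u s x)) (at (u s x))"
    using Tk_Suc_has_derivative[OF Suc.prems(1) that(1)] Suc.prems(3) that by auto
   have "((\<lambda>x. F s (u s x)) has_derivative (\<lambda>w. ?DF s (u s x) (?Du s x w))) (at x)"
    using has_derivative_compose[OF Tk_Suc_has_derivative[OF Suc.prems(2) that] dF] .
   moreover have "(\<lambda>w. ?DF s (u s x) (?Du s x w)) = (\<lambda>w. \<Sum>b\<in>Basis. (?Du s x w \<bullet> b) *\<^sub>R ?DF s (u s x) b)"
   proof
    fix w
    have l: "linear (?DF s (u s x))" using dF has_derivative_linear by blast
    have "?DF s (u s x) (?Du s x w) = ?DF s (u s x) (\<Sum>b\<in>Basis. (?Du s x w \<bullet> b) *\<^sub>R b)"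
     by (simp only: euclidean_representation)
    also have "... = (\<Sum>b\<in>Basis. (?Du s x w \<bullet> b) *\<^sub>R ?DF s (u s x) b)"
     by (simp only: linear_sum[OF l] linear_scale[OF l])
    finally show "?DF s (u s x) (?Du s x w) = (\<Sum>b\<in>Basis. (?Du s x w \<bullet> b) *\<^sub>R ?DF s (u s x) b)" .
   qed
   ultimately show ?thesis by (simp only:)
  qed
  show "Tk k U (\<lambda>s x. \<Sum>b\<in>Basis. (?Du s x w \<bullet> b) *\<^sub>R ?DF s (u s x) b)" for w
  proof (rule Tk_sum[OF assms(1)], rule Tk_bilinear[OF bounded_bilinear_scaleR assms(1)])
   fix b :: 'a
   show "Tk k U (\<lambda>s x. ?Du s x w \<bullet> b)"
    using Suc.prems(2) by (intro Tk_bounded_linear[OF bounded_linear_inner_left assms(1)]) auto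
   show "Tk k U (\<lambda>s x. ?DF s (u s x) b)"
    using Suc.prems Tk_SucD[OF Suc.prems(2)] by (intro Suc.IH) auto
  qed
 qed
qed

lemma Tk_inverse:
 fixes u :: "real => 'c::real_normed_vector => 'a::real_normed_field"
 assumes "open U" "Tk k U u" "!!s x. s \<in> {0..1} ==> x \<in> U ==> u s x \<noteq> 0"
 shows "Tk k U (\<lambda>s x. inverse (u s x))"
 using assms(2,3)
proof (induction k arbitrary: u)
 case 0
 then show ?case by (auto intro!: continuous_intros)
next
 case (Suc k)
 let ?Du = "\<lambda>s x. fd (u s) x"
 have i: "Tk k U (\<lambda>s x. inverse (u s x))"
  using Suc Tk_SucD by blast
 show ?case
 proof (rule Tk_SucI[OF assms(1)])
  show "continuous_on ({0..1} \<times> U) (\<lambda>z. inverse (u (fst z) (snd z)))"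
   using Suc.prems Tk_continuous[OF Suc.prems(1)] by (auto intro!: continuous_intros)
  show "((\<lambda>x. inverse (u s x)) has_derivative (\<lambda>w. - (inverse (u s x) * ?Du s x w * inverse (u s x)))) (at x)"
   if "s \<in> {0..1}" "x \<in> U" for s x
   using Deriv.has_derivative_inverse[OF Suc.prems(2) Tk_Suc_has_derivative[OF Suc.prems(1)]] that by auto
  have "Tk k U (\<lambda>s x. inverse (u s x) * ?Du s x w * inverse (u s x))" for w
   using Suc.prems by (intro Tk_bilinear[OF bounded_bilinear_mult assms(1)] i) auto
  then show "Tk k U (\<lambda>s x. - (inverse (u s x) * ?Du s x w * inverse (u s x)))" for w
   by (rule Tk_bounded_linear[OF bounded_linear_minus[OF bounded_linear_ident] assms(1)])
 qed
qed

lemma Tk_Pair: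
 assumes "open U" "Tk k U u" "Tk k U v"
 shows "Tk k U (\<lambda>s x. (u s x, v s x))"
proof -
 have "Tk k U (\<lambda>s x. (u s x, 0) + (0, v s x))"
  by (intro Tk_add[OF assms(1)] Tk_bounded_linear[OF _ assms(1,2), of "\<lambda>a. (a, 0)"]
    Tk_bounded_linear[OF _ assms(1,3), of "\<lambda>a. (0, a)"] bounded_linear_Pair bounded_linear_ident bounded_linear_zero)
 then show ?thesis by simp
qed

section \<open>Absorption estimates and integral equations on the unit interval\<close>

text \<open>Replaces Gronwall's inequality: with \<open>M\<close> the maximum of the norm, the
  assumption bounds the maximum by \<open>a\<close> plus \<open>q\<close> times itself, and
  \<open>q < 1\<close> lets the last term be absorbed.\<close>

lemma contraction_bound:
 fixes f :: "real => 'a::real_normed_vector"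
 assumes "continuous_on {0..1} f" "q < 1"
  and "!!M s. (!!t. t \<in> {0..1} ==> norm (f t) \<le> M) ==> s \<in> {0..1} ==> norm (f s) \<le> a + q * M"
 shows "!!s. s \<in> {0..1} ==> norm (f s) \<le> a / (1 - q)"
proof -
 have "continuous_on {0..1} (\<lambda>t. norm (f t))" using assms(1) by (intro continuous_intros)
 then obtain m where m: "m \<in> {0..1}" "!!t. t \<in> {0..1} ==> norm (f t) \<le> norm (f m)"
  using continuous_attains_sup[of "{0..1::real}" "\<lambda>t. norm (f t)"] by auto
 have "norm (f m) \<le> a + q * norm (f m)" using assms(3)[OF m(2) m(1)] .
 then have "norm (f m) * (1 - q) \<le> a" by (simp add: algebra_simps)
 then have "norm (f m) \<le> a / (1 - q)" using assms(2) by (simp add: pos_le_divide_eq)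
 then show "!!s. s \<in> {0..1} ==> norm (f s) \<le> a / (1 - q)" using m(2) by force
qed

lemma integral_unit_bound:
 fixes g :: "real => 'a::euclidean_space"
 assumes "continuous_on {0..1} g" "!!t. t \<in> {0..1} ==> norm (g t) \<le> B" "s \<in> {0..1}"
 shows "norm (integral {0..s} g) \<le> B"
proof -
 have B: "0 \<le> B" using order_trans[OF norm_ge_zero assms(2)[of 0]] by simp
 have "norm (integral {0..s} g) \<le> B * (s - 0)"
  by (rule integral_bound) (use assms in \<open>auto intro: continuous_on_subset\<close>)
 also have "... \<le> B" using B assms(3) by (simp add: mult_left_le)
 finally show ?thesis .
qed

lemma integral_unit_diff:
 fixes g :: "real => 'a::euclidean_space"
 assumes "continuous_on {0..1} g" "continuous_on {0..1} h" "s \<in> {0..1}"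
 shows "integral {0..s} g - integral {0..s} h = integral {0..s} (\<lambda>t. g t - h t)"
proof -
 have "g integrable_on {0..s}" "h integrable_on {0..s}"
  using assms by (auto intro!: integrable_continuous_real intro: continuous_on_subset)
 then show ?thesis by (simp add: integral_diff)
qed

text \<open>Picard's operator contracts the bounded continuous functions on the line by the factor
  1/2, because the interval has length 1 and the Lipschitz constant is 1/2; neither a weighted norm
  nor a subdivision is required.\<close>

lemma integral_equation_exists:
 fixes G :: "real => 'e::euclidean_space => 'e"
 assumes "continuous_on ({0..1} \<times> UNIV) (\<lambda>z. G (fst z) (snd z))"
  and "!!s y y'. s \<in> {0..1} ==> norm (G s y - G s y') \<le> norm (y - y') / 2"
 shows "\<exists>w. continuous_on {0..1} w \<and> (\<forall>s\<in>{0..1}. w s = c + integral {0..s} (\<lambda>t. G t (w t)))"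
proof -
 \<comment> \<open>Clamping time to the unit interval makes the image of the operator bounded and
   continuous on the whole line.\<close>
 define cl :: "real => real" where "cl = (\<lambda>s. max 0 (min 1 s))"
 have cl: "cl s \<in> {0..1}" for s by (auto simp: cl_def)
 define I where "I f s = c + integral {0..s} (\<lambda>t. G t (apply_bcontfun f t))" for f s
 have cG: "continuous_on {0..1} (\<lambda>t. G t (apply_bcontfun f t))" for f :: "real \<Rightarrow>\<^sub>C 'e"
 proof -
  have "continuous_on {0..1} (\<lambda>t. (t, apply_bcontfun f t))"
   by (intro continuous_intros) (auto intro!: continuous_on_apply_bcontfun)
  from continuous_on_compose2[OF assms(1) this] show ?thesis by auto
 qed
 have cI: "continuous_on {0..1} (I f)" for f
  unfolding I_def using cG[of f] by (intro continuous_intros indefinite_integral_continuous_1 integrable_continuous_real)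
 have mem: "(\<lambda>s. I f (cl s)) \<in> bcontfun" for f
 proof -
  have "continuous_on UNIV (\<lambda>s. I f (cl s))"
   by (rule continuous_on_compose2[OF cI[of f]]) (auto simp: cl_def intro!: continuous_intros)
  moreover have "bounded (I f ` {0..1})"
   using compact_continuous_image[OF cI[of f]] compact_imp_bounded by blast
  then have "bounded (range (\<lambda>s. I f (cl s)))"
   by (rule bounded_subset) (use cl in auto)
  ultimately show ?thesis by (auto simp: bcontfun_def)
 qed
 define T where "T f = Bcontfun (\<lambda>s. I f (cl s))" for f
 have T: "apply_bcontfun (T f) s = I f (cl s)" for f s
  unfolding T_def using Bcontfun_inverse[OF mem[of f]] by simp
 have "dist (T f) (T g) \<le> (1/2) * dist f g" for f g
 proof (rule dist_bound)
  fix s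
  have "I f (cl s) - I g (cl s) = integral {0..cl s} (\<lambda>t. G t (apply_bcontfun f t) - G t (apply_bcontfun g t))"
   unfolding I_def using integral_unit_diff[OF cG cG cl] by simp
  moreover have "norm (integral {0..cl s} (\<lambda>t. G t (apply_bcontfun f t) - G t (apply_bcontfun g t))) \<le> dist f g / 2"
  proof (rule integral_unit_bound[OF continuous_on_diff[OF cG cG] _ cl])
   fix t :: real assume t: "t \<in> {0..1}"
   have "norm (apply_bcontfun f t - apply_bcontfun g t) \<le> dist f g"
    using dist_bounded[of f t g] by (simp add: dist_norm)
   then show "norm (G t (apply_bcontfun f t) - G t (apply_bcontfun g t)) \<le> dist f g / 2"
    using assms(2)[OF t, of "apply_bcontfun f t" "apply_bcontfun g t"] by simp
  qed
  ultimately show "dist (apply_bcontfun (T f) s) (apply_bcontfun (T g) s) \<le> 1 / 2 * dist f g"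
   by (simp add: T dist_norm)
 qed
 then have "\<exists>!f. T f = f" by (intro banach_fix_type[of "1/2"]) auto
 then obtain f where f: "T f = f" by blast
 have "apply_bcontfun f s = c + integral {0..s} (\<lambda>t. G t (apply_bcontfun f t))" if "s \<in> {0..1}" for s
 proof -
  have "cl s = s" using that by (auto simp: cl_def)
  then show ?thesis using T[of f s] f by (simp add: I_def)
 qed
 then show ?thesis
  by (intro exI[of _ "apply_bcontfun f"]) (auto intro!: continuous_on_apply_bcontfun)
qed

lemma uniform_in_time:
 fixes g :: "real \<times> 'a::euclidean_space => 'b::metric_space"
 assumes "continuous_on ({0..1} \<times> V) g" "open V" "x0 \<in> V" "e > 0"
 obtains D where "D > 0" "ball x0 D \<subseteq> V" "!!t x. t \<in> {0..1} ==> x \<in> ball x0 D ==> dist (g (t, x)) (g (t, x0)) < e"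
proof -
 obtain r where r: "r > 0" "cball x0 r \<subseteq> V" using assms(2,3) open_contains_cball by blast
 have "uniformly_continuous_on ({0..1} \<times> cball x0 r) g"
  using r by (intro compact_uniformly_continuous continuous_on_subset[OF assms(1)] compact_Times) auto
 then obtain d where d: "d > 0" "!!a b. a \<in> {0..1} \<times> cball x0 r ==> b \<in> {0..1} \<times> cball x0 r ==> dist b a < d ==> dist (g b) (g a) < e"
  using uniformly_continuous_onE[OF _ assms(4)] by blast
 show thesis
 proof (rule that[of "min d r"])
  show "min d r > 0" using d r by auto
  show "ball x0 (min d r) \<subseteq> V" using r by (auto simp: subset_iff)
  fix t x assume "t \<in> {0..1::real}" "x \<in> ball x0 (min d r)"
  then show "dist (g (t, x)) (g (t, x0)) < e"
   using r(1) by (intro d(2)) (auto simp: dist_prod_def dist_commute)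
 qed
qed

lemma lipschitz_derivative_bound:
 fixes f :: "'a::real_normed_vector => 'b::real_normed_vector"
 assumes "(f has_derivative f') (at x)" "open B" "x \<in> B"
  and "!!y. y \<in> B ==> norm (f y - f x) \<le> K * norm (y - x)"
 shows "norm (f' w) \<le> K * norm w"
proof -
 interpret bounded_linear f' using assms(1) has_derivative_bounded_linear by blast
 have "((\<lambda>h::real. x + h *\<^sub>R w) has_derivative (\<lambda>h. h *\<^sub>R w)) (at 0)"
  by (auto intro!: derivative_eq_intros)
 from has_derivative_compose[OF this, of f f'] assms(1)
 have "((\<lambda>h::real. f (x + h *\<^sub>R w)) has_derivative (\<lambda>h. f' (h *\<^sub>R w))) (at 0)" by simp
 then have "((\<lambda>h. norm (f (x + h *\<^sub>R w) - f x - f' (h *\<^sub>R w)) / norm h) \<longlongrightarrow> 0) (at 0)"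
  by (simp add: has_derivative_at)
 then have lim: "((\<lambda>h. K * norm w + norm (f (x + h *\<^sub>R w) - f x - f' (h *\<^sub>R w)) / norm h) \<longlongrightarrow> K * norm w + 0) (at 0)"
  by (intro tendsto_intros)
 have "\<forall>\<^sub>F h in at 0. x + h *\<^sub>R w \<in> B"
 proof -
  have "((\<lambda>h. x + h *\<^sub>R w) \<longlongrightarrow> x + 0 *\<^sub>R w) (at 0)" by (intro tendsto_intros)
  then show ?thesis using assms(2,3) by (auto simp: tendsto_def)
 qed
 then have "\<forall>\<^sub>F h in at 0. norm (f' w) \<le> K * norm w + norm (f (x + h *\<^sub>R w) - f x - f' (h *\<^sub>R w)) / norm h"
  using eventually_neq_at_within[of 0 0 UNIV]
 proof eventually_elim
  case (elim h)
  have "\<bar>h\<bar> * norm (f' w) = norm (f' (h *\<^sub>R w))" by (simp add: scaleR)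
  also have "... \<le> norm (f (x + h *\<^sub>R w) - f x) + norm (f (x + h *\<^sub>R w) - f x - f' (h *\<^sub>R w))"
   by (metis norm_minus_commute norm_triangle_sub)
  also have "... \<le> K * (\<bar>h\<bar> * norm w) + norm (f (x + h *\<^sub>R w) - f x - f' (h *\<^sub>R w))"
   using assms(4)[OF elim(1)] by simp
  finally show ?case using elim(2) by (simp add: field_simps)
 qed
 then show ?thesis using tendsto_lowerbound[OF lim] by simp
qed

lemma linear_Basis_bound:
 fixes T :: "'a::euclidean_space => 'b::real_normed_vector"
 assumes T: "linear T" and C: "!!b. b \<in> Basis ==> norm (T b) \<le> C b"
 shows "norm (T v) \<le> (\<Sum>b\<in>Basis. C b) * norm v"
proof -
 have "T v = T (\<Sum>b\<in>Basis. (v \<bullet> b) *\<^sub>R b)" by (simp only: euclidean_representation)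
 also have "... = (\<Sum>b\<in>Basis. (v \<bullet> b) *\<^sub>R T b)" by (simp only: linear_sum[OF T] linear_scale[OF T])
 also have "norm ... \<le> (\<Sum>b\<in>Basis. C b * norm v)"
 proof (rule sum_norm_le)
  fix b :: 'a assume "b \<in> Basis"
  then show "norm ((v \<bullet> b) *\<^sub>R T b) \<le> C b * norm v"
   using mult_mono[OF C Basis_le_norm[of b v]] order_trans[OF norm_ge_zero C] by (simp add: mult.commute)
 qed
 finally show ?thesis by (simp add: sum_distrib_right)
qed

text \<open>The curve \<open>z\<close> has compact image, so one radius \<open>h\<close> serves all
  times. The estimate is the mean value inequality for \<open>F t\<close> minus its linearisation at
  \<open>z t\<close>.\<close>

lemma uniform_differentiability:
 fixes F :: "real => 'a::euclidean_space => 'b::real_normed_vector"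
 assumes F: "Tk (Suc 0) D F" and D: "open D" and z: "continuous_on {0..1} z" "!!t. t \<in> {0..1} ==> z t \<in> D"
  and "E > 0"
 obtains h where "h > 0" "!!t u. t \<in> {0..1} ==> norm u < h ==> z t + u \<in> D \<and>
   norm (F t (z t + u) - F t (z t) - fd (F t) (z t) u) \<le> E * norm u"
proof -
 let ?D = "\<lambda>t y. fd (F t) y"
 have "compact (z ` {0..1})" using compact_continuous_image[OF z(1)] by simp
 then obtain r where r: "r > 0" "(\<Union>x\<in>z ` {0..1}. cball x r) \<subseteq> D"
  using compact_subset_open_imp_cball_epsilon_subset[OF _ D, of "z ` {0..1}"] z(2) by blast
 let ?K = "{a + b |a b. a \<in> z ` {0..1} \<and> b \<in> cball 0 r}"
 have K: "compact ?K"
  by (rule compact_sums) (auto intro: \<open>compact (z ` {0..1})\<close>)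
 have KD: "?K \<subseteq> D"
 proof
  fix y assume "y \<in> ?K"
  then obtain a b where "y = a + b" "a \<in> z ` {0..1}" "norm b \<le> r" by auto
  then have "y \<in> cball a r" by (simp add: dist_norm)
  then show "y \<in> D" using r(2) \<open>a \<in> _\<close> by blast
 qed
 \<comment> \<open>Each basis direction contributes at most \<open>e\<close>, and
   \<open>linear_Basis_bound\<close> adds these up to \<open>DIM('a) * e\<close>, which is at most
   \<open>E\<close>.\<close>
 define e where "e = E / (of_nat DIM('a) + 1)"
 have e: "e > 0" using assms(5) by (simp add: e_def add_nonneg_pos)
 have "\<forall>b. \<exists>d. d > 0 \<and> (\<forall>t\<in>{0..1}. \<forall>y\<in>?K. \<forall>y'\<in>?K. dist y' y < d --> norm (?D t y' b - ?D t y b) \<le> e)"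
 proof
  fix b
  have "continuous_on ({0..1} \<times> D) (\<lambda>p. ?D (fst p) (snd p) b)" using F by simp
  then have "uniformly_continuous_on ({0..1} \<times> ?K) (\<lambda>p. ?D (fst p) (snd p) b)"
   using K KD by (intro compact_uniformly_continuous compact_Times) (auto elim!: continuous_on_subset)
  then obtain d where d: "d > 0" "!!p q. p \<in> {0..1} \<times> ?K ==> q \<in> {0..1} \<times> ?K ==> dist q p < d ==>
    dist (?D (fst q) (snd q) b) (?D (fst p) (snd p) b) < e"
   by (rule uniformly_continuous_onE[OF _ e]) (rule that)
  have "norm (?D t y' b - ?D t y b) \<le> e" if "t \<in> {0..1}" "y \<in> ?K" "y' \<in> ?K" "dist y' y < d" for t y y'
   using d(2)[of "(t, y)" "(t, y')"] that by (simp add: dist_prod_def dist_norm)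
  then show "\<exists>d>0. \<forall>t\<in>{0..1}. \<forall>y\<in>?K. \<forall>y'\<in>?K. dist y' y < d --> norm (?D t y' b - ?D t y b) \<le> e"
   using d(1) by blast
 qed
 from choice[OF this] obtain d where
  dd: "\<forall>b. d b > 0 \<and> (\<forall>t\<in>{0..1}. \<forall>y\<in>?K. \<forall>y'\<in>?K. dist y' y < d b --> norm (?D t y' b - ?D t y b) \<le> e)" ..
 have d: "d b > 0" "t \<in> {0..1} ==> y \<in> ?K ==> y' \<in> ?K ==> dist y' y < d b ==> norm (?D t y' b - ?D t y b) \<le> e"
  for b t y y' using dd by blast+
 define h where "h = Min (insert r (d ` Basis))"
 have h: "h > 0" "h \<le> r" "!!b. b \<in> Basis ==> h \<le> d b"
  using r(1) d(1) by (auto simp: h_def intro!: min.coboundedI2 Min_le)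
 show thesis
 proof (rule that[OF h(1)], rule conjI)
  fix t :: real and u :: 'a assume t: "t \<in> {0..1}" and u: "norm u < h"
  have inK: "z t + v \<in> ?K" if "norm v < h" for v
  proof -
   have "z t \<in> z ` {0..1}" "v \<in> cball 0 r" using that h(2) t by auto
   then show ?thesis by blast
  qed
  then show "z t + u \<in> D" using u KD by blast
  let ?g = "\<lambda>y. F t y - ?D t (z t) y"
  have lin: "bounded_linear (?D t (z t))"
   using Tk_Suc_has_derivative[OF F t z(2)[OF t]] has_derivative_bounded_linear by blast
  have "norm (?g (z t + u) - ?g (z t)) \<le> E * norm ((z t + u) - z t)"
  proof (rule differentiable_bound[of "ball (z t) h" ?g "\<lambda>y w. ?D t y w - ?D t (z t) w"])
   fix y assume y: "y \<in> ball (z t) h"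
   then have yK: "y \<in> ?K" using inK[of "y - z t"] by (simp add: dist_norm norm_minus_commute)
   have hd: "(F t has_derivative ?D t y) (at y)" using Tk_Suc_has_derivative[OF F t] KD yK by blast
   show "(?g has_derivative (\<lambda>w. ?D t y w - ?D t (z t) w)) (at y within ball (z t) h)"
    by (rule has_derivative_diff[OF has_derivative_at_withinI[OF hd] bounded_linear_imp_has_derivative[OF lin]])
   have ly: "linear (?D t y)" and lz: "linear (?D t (z t))"
    using hd has_derivative_linear lin bounded_linear.linear by blast+
   show "onorm (\<lambda>w. ?D t y w - ?D t (z t) w) \<le> E"
   proof (rule onorm_le)
    fix w
    have "norm (?D t y b - ?D t (z t) b) \<le> e" if "b \<in> Basis" for b
     using d(2)[OF t inK[of 0] yK, of b] h(1) h(3)[OF that] y by (auto simp: dist_commute)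
    from linear_Basis_bound[OF linear_compose_sub[OF ly lz] this, of w]
    have "norm (?D t y w - ?D t (z t) w) \<le> of_nat DIM('a) * e * norm w" by simp
    also have "... \<le> E * norm w"
     using assms(5) by (intro mult_right_mono) (simp_all add: e_def field_simps)
    finally show "norm (?D t y w - ?D t (z t) w) \<le> E * norm w" .
   qed
  qed (use h(1) u in \<open>auto simp: dist_norm\<close>)
  moreover have "?g (z t + u) - ?g (z t) = F t (z t + u) - F t (z t) - ?D t (z t) u"
   using linear_add[OF bounded_linear.linear[OF lin]] by simp
  ultimately show "norm (F t (z t + u) - F t (z t) - ?D t (z t) u) \<le> E * norm u" by simp
 qed
qed

lemma continuous_on_uncurried:
 assumes "continuous_on (S \<times> T) (\<lambda>z. g (fst z) (snd z))" "continuous_on A a" "continuous_on A b"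
  and "!!x. x \<in> A ==> a x \<in> S" "!!x. x \<in> A ==> b x \<in> T"
 shows "continuous_on A (\<lambda>x. g (a x) (b x))"
proof -
 have "continuous_on A (\<lambda>x. (a x, b x))" using assms by (intro continuous_intros)
 from continuous_on_compose2[OF assms(1) this] assms(4,5) show ?thesis by (auto simp: image_subset_iff)
qed

text \<open>Solutions of an integral equation with a parameter: regularity is inherited because the space
 derivative solves the linearised equation, which is of the same form.\<close>

locale integral_equation =
 fixes V :: "'p::euclidean_space set" and B :: "'e::euclidean_space set"
  and F :: "real => 'p \<times> 'e => 'e" and c :: "'p => 'e" and y :: "real => 'p => 'e"
 assumes open_V: "open V" and open_B: "open B"
  and contF: "continuous_on ({0..1} \<times> (V \<times> B)) (\<lambda>z. F (fst z) (snd z))"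
  and lipF: "!!s x y y'. s \<in> {0..1} ==> x \<in> V ==> y \<in> B ==> y' \<in> B ==> norm (F s (x, y) - F s (x, y')) \<le> norm (y - y') / 2"
  and contc: "continuous_on V c"
  and y_B: "!!s x. s \<in> {0..1} ==> x \<in> V ==> y s x \<in> B"
  and y_cont: "!!x. x \<in> V ==> continuous_on {0..1} (\<lambda>s. y s x)"
  and y_eq: "!!s x. s \<in> {0..1} ==> x \<in> V ==> y s x = c x + integral {0..s} (\<lambda>t. F t (x, y t x))"
begin

lemma contF_along: "x \<in> V ==> continuous_on {0..1} u ==> (!!t. t \<in> {0..1} ==> u t \<in> B) ==> continuous_on {0..1} (\<lambda>t. F t (x, u t))"
 by (rule continuous_on_uncurried[OF contF, of _ "\<lambda>t. t" "\<lambda>t. (x, u t)"]) (auto intro!: continuous_intros)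

text \<open>Absorption with factor 1/2: the initial value and the parameter inside \<open>F\<close>
  contribute e/4 each, and (e/4 + e/4) / (1 - 1/2) = e.\<close>

lemma y_uniform:
 assumes "x0 \<in> V" "e > 0"
 obtains d where "d > 0" "ball x0 d \<subseteq> V" "!!s x. s \<in> {0..1} ==> x \<in> ball x0 d ==> norm (y s x - y s x0) \<le> e"
proof -
 have "continuous_on ({0..1} \<times> V) (\<lambda>z. F (fst z) (snd z, y (fst z) x0))"
 proof (rule continuous_on_compose2[OF contF, of _ "\<lambda>z. (fst z, (snd z, y (fst z) x0))", simplified])
  show "continuous_on ({0..1} \<times> V) (\<lambda>z. (fst z, snd z, y (fst z) x0))"
   by (intro continuous_intros continuous_on_compose2[OF y_cont[OF assms(1)]]) auto
 qed (use assms y_B in auto)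
 then obtain d1 where d1: "d1 > 0" "ball x0 d1 \<subseteq> V" "!!t x. t \<in> {0..1} ==> x \<in> ball x0 d1 ==>
   dist (F t (x, y t x0)) (F t (x0, y t x0)) < e / 4"
  using uniform_in_time[OF _ open_V assms(1), of "\<lambda>z. F (fst z) (snd z, y (fst z) x0)" "e/4"] assms(2) by (auto simp del: split_paired_All)
 obtain d2 where d2: "d2 > 0" "!!x. x \<in> V ==> dist x x0 < d2 ==> dist (c x) (c x0) < e / 4"
  using contc assms unfolding continuous_on_iff by (metis zero_less_divide_iff zero_less_numeral)
 show thesis
 proof (rule that[of "min d1 d2"])
  show "ball x0 (min d1 d2) \<subseteq> V" using d1(2) by auto
  fix s :: real and x assume s: "s \<in> {0..1}" and x: "x \<in> ball x0 (min d1 d2)"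
  then have xV: "x \<in> V" and xd: "dist x x0 < d2" "x \<in> ball x0 d1" using d1(2) by (auto simp: dist_commute)
  have cy: "continuous_on {0..1} (\<lambda>t. F t (x, y t x))" "continuous_on {0..1} (\<lambda>t. F t (x0, y t x0))"
   using contF_along y_cont y_B xV assms(1) by auto
  have "norm (y s x - y s x0) \<le> (e / 2) / (1 - 1/2)"
  proof (rule contraction_bound[where q = "1/2", OF _ _ _ s])
   show "continuous_on {0..1} (\<lambda>s. y s x - y s x0)" using y_cont xV assms(1) by (intro continuous_intros)
   fix M and s :: real assume M: "!!t. t \<in> {0..1} ==> norm (y t x - y t x0) \<le> M" and s: "s \<in> {0..1}"
   have "y s x - y s x0 = (c x - c x0) + integral {0..s} (\<lambda>t. F t (x, y t x) - F t (x0, y t x0))"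
    using y_eq[OF s xV] y_eq[OF s assms(1)] integral_unit_diff[OF cy s] by simp
   also have "norm ... \<le> e / 4 + (e / 4 + M / 2)"
   proof (rule norm_triangle_le[OF add_mono])
    show "norm (c x - c x0) \<le> e / 4" using d2(2)[OF xV xd(1)] by (simp add: dist_norm)
    show "norm (integral {0..s} (\<lambda>t. F t (x, y t x) - F t (x0, y t x0))) \<le> e / 4 + M / 2"
    proof (rule integral_unit_bound[OF continuous_on_diff[OF cy] _ s])
     fix t :: real assume t: "t \<in> {0..1}"
     have "norm (F t (x, y t x) - F t (x, y t x0)) \<le> norm (y t x - y t x0) / 2"
      using lipF y_B t xV assms(1) by auto
     also have "... \<le> M / 2" using M[OF t] by simp
     finally have 1: "norm (F t (x, y t x) - F t (x, y t x0)) \<le> M / 2" .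
     have 2: "norm (F t (x, y t x0) - F t (x0, y t x0)) \<le> e / 4"
      using d1(3)[OF t xd(2)] by (simp add: dist_norm)
     show "norm (F t (x, y t x) - F t (x0, y t x0)) \<le> e / 4 + M / 2"
      using norm_triangle_le[OF add_mono[OF 1 2]] by simp
    qed
   qed
   finally show "norm (y s x - y s x0) \<le> e / 2 + 1 / 2 * M" by simp
  qed simp
  then show "norm (y s x - y s x0) \<le> e" by simp
 qed (use d1 d2 in auto)
qed

lemma y_continuous: "continuous_on ({0..1} \<times> V) (\<lambda>z. y (fst z) (snd z))"
 unfolding continuous_on_iff
proof (intro ballI allI impI)
 fix z :: "real \<times> 'p" and e :: real assume z: "z \<in> {0..1} \<times> V" and e: "0 < e"
 obtain s0 x0 where [simp]: "z = (s0, x0)" by (cases z)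
 have s0: "s0 \<in> {0..1}" and x0: "x0 \<in> V" using z by auto
 obtain d where d: "d > 0" "ball x0 d \<subseteq> V" "!!s x. s \<in> {0..1} ==> x \<in> ball x0 d ==> norm (y s x - y s x0) \<le> e / 2"
  using y_uniform[OF x0, of "e/2"] e by auto
 obtain d' where d': "d' > 0" "!!s. s \<in> {0..1} ==> dist s s0 < d' ==> dist (y s x0) (y s0 x0) < e / 2"
  using y_cont[OF x0] s0 e unfolding continuous_on_iff by (metis half_gt_zero)
 show "\<exists>d>0. \<forall>x'\<in>{0..1} \<times> V. dist x' z < d --> dist (y (fst x') (snd x')) (y (fst z) (snd z)) < e"
 proof (intro exI[of _ "min d d'"] conjI ballI impI)
  fix w :: "real \<times> 'p" assume w: "w \<in> {0..1} \<times> V" "dist w z < min d d'"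
  have "dist (fst w) s0 < d'" "dist (snd w) x0 < d"
   using dist_fst_le[of w z] dist_snd_le[of w z] w(2) by auto
  then have "dist (y (fst w) x0) (y s0 x0) < e / 2" "dist (y (fst w) (snd w)) (y (fst w) x0) \<le> e / 2"
   using d(3)[of "fst w" "snd w"] d'(2)[of "fst w"] w(1) by (auto simp: dist_norm norm_minus_commute)
  then show "dist (y (fst w) (snd w)) (y (fst z) (snd z)) < e"
   using dist_triangle_half_l[of "y (fst w) x0"] dist_triangle[of "y (fst w) (snd w)" "y s0 x0" "y (fst w) x0"] by simp
 qed (use d d' in auto)
qed

section \<open>Differentiability of the solution in the parameter\<close>

context
 assumes F1: "Tk (Suc 0) (V \<times> B) F" and c1: "Ck_on (Suc 0) V c"
begin

abbreviation "DF t z \<equiv> fd (F t) z"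

lemma F_deriv: "t \<in> {0..1} ==> x \<in> V ==> u \<in> B ==> (F t has_derivative DF t (x, u)) (at (x, u))"
 using Tk_Suc_has_derivative[OF F1] by auto

lemma DF_lin: "t \<in> {0..1} ==> x \<in> V ==> u \<in> B ==> linear (DF t (x, u))"
 using F_deriv has_derivative_linear by blast

lemma DF_split: "t \<in> {0..1} ==> x \<in> V ==> u \<in> B ==>
  DF t (x, u) (v, w) = DF t (x, u) (v, 0) + (\<Sum>b\<in>Basis. (w \<bullet> b) *\<^sub>R DF t (x, u) (0, b))"
proof -
 assume a: "t \<in> {0..1}" "x \<in> V" "u \<in> B"
 note l = DF_lin[OF a]
 have "(v, w) = (v, 0) + (\<Sum>b\<in>Basis. (w \<bullet> b) *\<^sub>R (0::'p, b))"
  by (simp add: prod_eq_iff fst_sum snd_sum euclidean_representation)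
 then show ?thesis
  using linear_add[OF l] linear_sum[OF l] linear_scale[OF l] by (metis (no_types, lifting) sum.cong)
qed

text \<open>The Lipschitz constant of \<open>F\<close> in the unknown passes to its derivative, so
  the linearised equation is again a contraction with factor 1/2.\<close>

lemma DF_bound: "t \<in> {0..1} ==> x \<in> V ==> u \<in> B ==> norm (DF t (x, u) (0, w)) \<le> norm w / 2"
proof -
 assume a: "t \<in> {0..1}" "x \<in> V" "u \<in> B"
 have "((\<lambda>u'. F t (x, u')) has_derivative (\<lambda>w. DF t (x, u) (0, w))) (at u)"
 proof -
  have "((\<lambda>u'. (x, u')) has_derivative (\<lambda>w. (0, w))) (at u)"
   by (auto intro!: derivative_eq_intros)
  from has_derivative_compose[OF this F_deriv[OF a]] show ?thesis .
 qed
 from lipschitz_derivative_bound[OF this open_B a(3), of "1/2" w]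
 show ?thesis using lipF[OF a(1,2) _ a(3)] by simp
qed

lemma linearised_unique:
 assumes "x \<in> V" "continuous_on {0..1} e" "!!s. s \<in> {0..1} ==> e s = integral {0..s} (\<lambda>t. DF t (x, y t x) (0, e t))"
  "continuous_on {0..1} (\<lambda>t. DF t (x, y t x) (0, e t))" "s \<in> {0..1}"
 shows "e s = 0"
proof -
 have "norm (e s) \<le> 0 / (1 - 1/2)"
 proof (rule contraction_bound[OF assms(2) _ _ assms(5)])
  fix M and s :: real assume M: "!!t. t \<in> {0..1} ==> norm (e t) \<le> M" and s: "s \<in> {0..1}"
  have "norm (integral {0..s} (\<lambda>t. DF t (x, y t x) (0, e t))) \<le> M / 2"
  proof (rule integral_unit_bound[OF assms(4) _ s])
   fix t :: real assume t: "t \<in> {0..1}"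
   show "norm (DF t (x, y t x) (0, e t)) \<le> M / 2"
    using DF_bound[OF t assms(1) y_B[OF t assms(1)], of "e t"] M[OF t] by simp
  qed
  then show "norm (e s) \<le> 0 + 1/2 * M" using assms(3)[OF s] by simp
 qed simp
 then show ?thesis by simp
qed

text \<open>As a function of the pair (parameter, unknown) this right-hand side is affine in the
  unknown. \<open>DF_split\<close> writes it with derivatives of \<open>F t\<close> in fixed
  directions, which costs one order of regularity.\<close>

lemma Tk_linearised:
 assumes "Tk (Suc k) (V \<times> B) F" "Tk k V y"
 shows "Tk k (V \<times> UNIV) (\<lambda>t z. DF t (fst z, y t (fst z)) (v, snd z))"
proof -
 have oVU: "open (V \<times> (UNIV :: 'e set))" and oVB: "open (V \<times> B)"
  using open_V open_B by (auto intro: open_Times)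
 have tf: "Tk k (V \<times> (UNIV :: 'e set)) (\<lambda>s. fst)"
  by (rule Tk_space_linear[OF bounded_linear_fst oVU])
 have inner: "Tk k (V \<times> (UNIV :: 'e set)) (\<lambda>t z. (fst z, y t (fst z)))"
  by (intro Tk_Pair[OF oVU] tf Tk_compose[OF oVU open_V assms(2) tf]) auto
 have D: "Tk k (V \<times> (UNIV :: 'e set)) (\<lambda>t z. DF t (fst z, y t (fst z)) h)" for h
  by (cases h, rule Tk_compose[OF oVU oVB _ inner]) (use assms(1) y_B in auto)
 have "Tk k (V \<times> (UNIV :: 'e set)) (\<lambda>t z. DF t (fst z, y t (fst z)) (v, 0) +
   (\<Sum>b\<in>Basis. (snd z \<bullet> b) *\<^sub>R DF t (fst z, y t (fst z)) (0, b)))"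
  by (intro Tk_add[OF oVU] D Tk_sum[OF oVU] Tk_bilinear[OF bounded_bilinear_scaleR oVU]
    Tk_space_linear[OF _ oVU] bounded_linear_compose[OF bounded_linear_inner_left bounded_linear_snd])
 then show ?thesis
  by (subst Tk_cong[OF oVU, where v = "\<lambda>t z. DF t (fst z, y t (fst z)) (v, 0) +
   (\<Sum>b\<in>Basis. (snd z \<bullet> b) *\<^sub>R DF t (fst z, y t (fst z)) (0, b))"]) (auto intro!: DF_split y_B)
qed

lemma DF_along:
 assumes "x \<in> V" "continuous_on {0..1} w"
 shows "continuous_on {0..1} (\<lambda>t. DF t (x, y t x) (v, w t))"
proof -
 have "Tk 0 (V \<times> UNIV) (\<lambda>t z. DF t (fst z, y t (fst z)) (v, snd z))"
  using Tk_linearised[of 0 v] F1 y_continuous by simp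
 from continuous_on_uncurried[OF Tk_continuous[OF this], of "{0..1}" "\<lambda>t. t" "\<lambda>t. (x, w t)"] assms
 show ?thesis by (auto simp: continuous_on_Pair)
qed

lemma linearised_exists:
 assumes "x \<in> V"
 shows "\<exists>w. continuous_on {0..1} w \<and> (\<forall>s\<in>{0..1}. w s = fd c x v + integral {0..s} (\<lambda>t. DF t (x, y t x) (v, w t)))"
proof (rule integral_equation_exists)
 have "Tk 0 (V \<times> UNIV) (\<lambda>t z. DF t (fst z, y t (fst z)) (v, snd z))"
  using Tk_linearised[of 0 v] F1 y_continuous by simp
 from continuous_on_uncurried[OF Tk_continuous[OF this], of "{0..1} \<times> UNIV" fst "\<lambda>z. (x, snd z)"] assms
 show "continuous_on ({0..1} \<times> UNIV) (\<lambda>z. DF (fst z) (x, y (fst z) x) (v, snd z))"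
  by (auto simp: continuous_on_Pair continuous_on_fst continuous_on_snd)
 fix s :: real and w w' assume s: "s \<in> {0..1}"
 note a = s assms y_B[OF s assms]
 have "DF s (x, y s x) (v, w) - DF s (x, y s x) (v, w') = DF s (x, y s x) (0, w - w')"
  using linear_diff[OF DF_lin[OF a], of "(v, w)" "(v, w')"] by simp
 then show "norm (DF s (x, y s x) (v, w) - DF s (x, y s x) (v, w')) \<le> norm (w - w') / 2"
  using DF_bound[OF a] by simp
qed

text \<open>The candidate for the derivative of the solution in direction \<open>v\<close>: a
  solution of the linearised equation. It is picked by choice, and \<open>linearised_unique\<close>
  is what makes it linear in \<open>v\<close>.\<close>

definition Dy :: "'p => 'p => real => 'e" where
 "Dy x v = (SOME w. continuous_on {0..1} w \<and> (\<forall>s\<in>{0..1}. w s = fd c x v + integral {0..s} (\<lambda>t. DF t (x, y t x) (v, w t))))"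

lemma Dy:
 assumes "x \<in> V"
 shows "continuous_on {0..1} (Dy x v)"
  and "s \<in> {0..1} ==> Dy x v s = fd c x v + integral {0..s} (\<lambda>t. DF t (x, y t x) (v, Dy x v t))"
 using someI_ex[OF linearised_exists[OF assms, of v], folded Dy_def] by blast+

lemma c_deriv: "x \<in> V ==> (c has_derivative fd c x) (at x)"
 using c1 by (auto simp: frechet_derivative_works[symmetric])

lemma Dy_linear:
 assumes x: "x \<in> V" and s: "s \<in> {0..1}"
 shows "linear (\<lambda>v. Dy x v s)"
proof -
 have lc: "linear (fd c x)" using c_deriv[OF x] has_derivative_linear by blast
 have comb: "Dy x (a *\<^sub>R v + b *\<^sub>R v') s - (a *\<^sub>R Dy x v s + b *\<^sub>R Dy x v' s) = 0" for a b v v'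
 proof (rule linearised_unique[OF x _ _ _ s, where e = "\<lambda>s. Dy x (a *\<^sub>R v + b *\<^sub>R v') s - (a *\<^sub>R Dy x v s + b *\<^sub>R Dy x v' s)"])
  let ?e = "\<lambda>s. Dy x (a *\<^sub>R v + b *\<^sub>R v') s - (a *\<^sub>R Dy x v s + b *\<^sub>R Dy x v' s)"
  show ce: "continuous_on {0..1} ?e" by (intro continuous_intros Dy(1)[OF x])
  show "continuous_on {0..1} (\<lambda>t. DF t (x, y t x) (0, ?e t))" by (rule DF_along[OF x ce])
  fix s :: real assume s: "s \<in> {0..1}"
  have int: "(\<lambda>t. DF t (x, y t x) (v, Dy x v t)) integrable_on {0..s}" for v
   by (rule integrable_continuous_real, rule continuous_on_subset[OF DF_along[OF x Dy(1)[OF x]]]) (use s in auto)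
  have "integral {0..s} (\<lambda>t. DF t (x, y t x) (0, ?e t)) = integral {0..s} (\<lambda>t. DF t (x, y t x) (a *\<^sub>R v + b *\<^sub>R v', Dy x (a *\<^sub>R v + b *\<^sub>R v') t)
    - (a *\<^sub>R DF t (x, y t x) (v, Dy x v t) + b *\<^sub>R DF t (x, y t x) (v', Dy x v' t)))"
  proof (rule integral_cong)
   fix t assume "t \<in> {0..s}"
   then have t: "t \<in> {0..1}" using s by auto
   note l = DF_lin[OF t x y_B[OF t x]]
   show "DF t (x, y t x) (0, ?e t) = DF t (x, y t x) (a *\<^sub>R v + b *\<^sub>R v', Dy x (a *\<^sub>R v + b *\<^sub>R v') t)
    - (a *\<^sub>R DF t (x, y t x) (v, Dy x v t) + b *\<^sub>R DF t (x, y t x) (v', Dy x v' t))"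
    by (simp add: linear_diff[OF l, symmetric] linear_add[OF l, symmetric] linear_scale[OF l, symmetric])
  qed
  also have "... = integral {0..s} (\<lambda>t. DF t (x, y t x) (a *\<^sub>R v + b *\<^sub>R v', Dy x (a *\<^sub>R v + b *\<^sub>R v') t))
    - (a *\<^sub>R integral {0..s} (\<lambda>t. DF t (x, y t x) (v, Dy x v t)) + b *\<^sub>R integral {0..s} (\<lambda>t. DF t (x, y t x) (v', Dy x v' t)))"
   by (subst integral_diff, rule int, intro integrable_add integrable_cmul int,
     subst integral_add, (intro integrable_cmul int)+, simp)
  also have "... = ?e s"
   by (simp add: Dy(2)[OF x s, of "a *\<^sub>R v + b *\<^sub>R v'"] Dy(2)[OF x s, of v] Dy(2)[OF x s, of v'] linear_add[OF lc] linear_scale[OF lc] algebra_simps)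
  finally show "?e s = integral {0..s} (\<lambda>t. DF t (x, y t x) (0, ?e t))" ..
 qed
 show ?thesis
 proof (rule linearI)
  show "Dy x (v + v') s = Dy x v s + Dy x v' s" for v v' using comb[of 1 v 1 v'] by simp
  show "Dy x (a *\<^sub>R v) s = a *\<^sub>R Dy x v s" for a v using comb[of a v 0 v] by simp
 qed
qed

text \<open>Bounds the increment of the solution by a multiple of \<open>h\<close>, so that
  remainders that are small relative to the pair (h, increment) become small relative to
  \<open>h\<close> in \<open>y_derivative\<close>. The absorbed factor 3/4 is 1/2 from
  \<open>DF_bound\<close> plus the tolerance 1/4 chosen for \<open>d1\<close>.\<close>

lemma y_lipschitz:
 assumes x: "x \<in> V"
 obtains d C where "d > 0" "C \<ge> 0" "!!(h :: 'p) s. norm h < d ==> s \<in> {0..1} ==> x + h \<in> V \<and> norm (y s (x + h) - y s x) \<le> C * norm h"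
proof -
 have oVB: "open (V \<times> B)" using open_V open_B by (rule open_Times)
 have cz: "continuous_on {0..1} (\<lambda>t. (x, y t x))" by (intro continuous_intros y_cont[OF x])
 obtain d1 where d1: "d1 > 0" "!!t u. t \<in> {0..1} ==> norm u < d1 ==> (x, y t x) + u \<in> V \<times> B \<and>
   norm (F t ((x, y t x) + u) - F t (x, y t x) - DF t (x, y t x) u) \<le> (1/4) * norm u"
  by (rule uniform_differentiability[OF F1 oVB cz, of "1/4"]) (use x y_B in auto)
 obtain d2 where d2: "d2 > 0" "ball x d2 \<subseteq> V" "!!s x'. s \<in> {0..1} ==> x' \<in> ball x d2 ==> norm (y s x' - y s x) \<le> d1 / 2"
  using y_uniform[OF x, of "d1/2"] d1(1) by auto
 interpret bounded_linear "fd c x"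
  using c_deriv[OF x] has_derivative_bounded_linear by blast
 obtain K1 where K1: "K1 \<ge> 0" "!!h. norm (fd c x h) \<le> norm h * K1"
  using nonneg_bounded by blast
 obtain d3 where d3: "d3 > 0" "!!h. norm h < d3 ==> norm (c (x + h) - c x - fd c x h) \<le> 1 * norm h"
 proof -
  from c_deriv[OF x] obtain d where "d > 0" "\<forall>y. norm (y - x) < d --> norm (c y - c x - fd c x (y - x)) \<le> 1 * norm (y - x)"
   unfolding has_derivative_at_alt by (metis zero_less_one)
  then show thesis by (intro that[of d]) (metis add_diff_cancel_left')+
 qed
 have "continuous_on ({0..1} \<times> V) (\<lambda>z. DF (fst z) (snd z, y (fst z) (snd z)) (b, 0))" for b
 proof -
  have "Tk 0 (V \<times> UNIV) (\<lambda>t z. DF t (fst z, y t (fst z)) (b, snd z))"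
   using Tk_linearised[of 0 b] F1 y_continuous by simp
  from continuous_on_uncurried[OF Tk_continuous[OF this], of "{0..1} \<times> V" fst "\<lambda>z. (snd z, 0)"]
  show ?thesis by (auto simp: continuous_on_Pair continuous_on_fst continuous_on_snd)
 qed
 have "\<exists>L. \<forall>t\<in>{0..1}. norm (DF t (x, y t x) (b, 0)) \<le> L" for b
 proof -
  have "compact ((\<lambda>t. DF t (x, y t x) (b, 0)) ` {0..1})"
   using DF_along[OF x, of "\<lambda>t. 0" b] by (intro compact_continuous_image) auto
  then show ?thesis using compact_imp_bounded by (fastforce simp: bounded_iff)
 qed
 then obtain L where L: "!!b t. t \<in> {0..1} ==> norm (DF t (x, y t x) (b, 0)) \<le> L b" by metis
 define K2 where "K2 = (\<Sum>b\<in>Basis. \<bar>L b\<bar>)"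
 have K2: "norm (DF t (x, y t x) (h, 0)) \<le> K2 * norm h" if t: "t \<in> {0..1}" for t h
 proof -
  note l = DF_lin[OF t x y_B[OF t x]]
  have "(h, 0::'e) = (\<Sum>b\<in>Basis. (h \<bullet> b) *\<^sub>R (b, 0))"
   by (simp add: prod_eq_iff fst_sum snd_sum euclidean_representation)
  then have "DF t (x, y t x) (h, 0) = (\<Sum>b\<in>Basis. (h \<bullet> b) *\<^sub>R DF t (x, y t x) (b, 0))"
   by (simp only: linear_sum[OF l] linear_scale[OF l])
  also have "norm ... \<le> (\<Sum>b\<in>Basis. \<bar>L b\<bar> * norm h)"
  proof (rule sum_norm_le)
   fix b :: 'p assume b: "b \<in> Basis"
   have "norm ((h \<bullet> b) *\<^sub>R DF t (x, y t x) (b, 0)) = \<bar>h \<bullet> b\<bar> * norm (DF t (x, y t x) (b, 0))" by simp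
   also have "... \<le> norm h * \<bar>L b\<bar>"
    using L[OF t, of b] Basis_le_norm[OF b, of h] by (intro mult_mono) auto
   finally show "norm ((h \<bullet> b) *\<^sub>R DF t (x, y t x) (b, 0)) \<le> \<bar>L b\<bar> * norm h" by (simp add: mult.commute)
  qed
  finally show ?thesis by (simp add: K2_def sum_distrib_right)
 qed
 have K20: "K2 \<ge> 0" by (auto simp: K2_def intro: sum_nonneg)
 define d where "d = min (min d2 d3) (d1 / 2)"
 \<comment> \<open>The factor 4 is 1 / (1 - 3/4). Inside, \<open>K1 + 1\<close> comes from the
   increment of \<open>c\<close> with its remainder, \<open>K2\<close> from the parameter directions
   of \<open>F\<close>, and 1/4 from the remainder of \<open>F\<close>.\<close>
 define C where "C = 4 * (K1 + 1 + K2 + 1 / 4)"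
 show thesis
 proof (rule that[of d C])
  show "d > 0" "C \<ge> 0" using d1 d2 d3 K1 K20 by (auto simp: d_def C_def)
  fix h :: 'p and s assume h: "norm h < d" and s: "s \<in> {0..1::real}"
  have h2: "x + h \<in> ball x d2" and h3: "norm h < d3" and h1: "norm h < d1 / 2" using h by (auto simp: d_def dist_norm)
  have xh: "x + h \<in> V" using h2 d2 by blast
  have cy: "continuous_on {0..1} (\<lambda>t. F t (x + h, y t (x + h)))" "continuous_on {0..1} (\<lambda>t. F t (x, y t x))"
   using contF_along y_cont y_B xh x by auto
  have "norm (y s (x + h) - y s x) \<le> ((K1 + 1 + K2 + 1 / 4) * norm h) / (1 - 3/4)"
  proof (rule contraction_bound[where q = "3/4", OF _ _ _ s])
   show "continuous_on {0..1} (\<lambda>s. y s (x + h) - y s x)" using y_cont xh x by (intro continuous_intros)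
   fix M and s :: real assume M: "!!t. t \<in> {0..1} ==> norm (y t (x + h) - y t x) \<le> M" and s: "s \<in> {0..1}"
   have "y s (x + h) - y s x = (c (x + h) - c x) + integral {0..s} (\<lambda>t. F t (x + h, y t (x + h)) - F t (x, y t x))"
    using y_eq[OF s xh] y_eq[OF s x] integral_unit_diff[OF cy s] by simp
   also have "norm ... \<le> (K1 + 1) * norm h + ((K2 + 1 / 4) * norm h + 3 / 4 * M)"
   proof (rule norm_triangle_le[OF add_mono])
    have "norm (c (x + h) - c x) \<le> norm (c (x + h) - c x - fd c x h) + norm (fd c x h)"
     using norm_triangle_sub[of "c (x + h) - c x" "fd c x h"] by simp
    then show "norm (c (x + h) - c x) \<le> (K1 + 1) * norm h"
     using d3(2)[OF h3] K1(2)[of h] by (simp add: algebra_simps)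
    show "norm (integral {0..s} (\<lambda>t. F t (x + h, y t (x + h)) - F t (x, y t x))) \<le> (K2 + 1 / 4) * norm h + 3 / 4 * M"
    proof (rule integral_unit_bound[OF continuous_on_diff[OF cy] _ s])
     fix t :: real assume t: "t \<in> {0..1}"
     let ?D = "y t (x + h) - y t x"
     have "norm (h, ?D) \<le> norm h + norm ?D" by (simp add: norm_Pair_le)
     moreover have "norm ?D \<le> d1 / 2" using d2(3)[OF t h2] .
     ultimately have "norm (h, ?D) < d1" using h1 by linarith
     from d1(2)[OF t this]
     have R: "norm (F t (x + h, y t (x + h)) - F t (x, y t x) - DF t (x, y t x) (h, ?D)) \<le> (1/4) * (norm h + norm ?D)"
      using norm_Pair_le[of h ?D] by simp
     have "DF t (x, y t x) (h, ?D) = DF t (x, y t x) (h, 0) + DF t (x, y t x) (0, ?D)"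
      using linear_add[OF DF_lin[OF t x y_B[OF t x]], of "(h, 0)" "(0, ?D)"] by simp
     then have "norm (DF t (x, y t x) (h, ?D)) \<le> K2 * norm h + norm ?D / 2"
      using norm_triangle_le[OF add_mono[OF K2[OF t, of h] DF_bound[OF t x y_B[OF t x], of ?D]]] by simp
     then have "norm (F t (x + h, y t (x + h)) - F t (x, y t x)) \<le> (1/4) * (norm h + norm ?D) + (K2 * norm h + norm ?D / 2)"
      using R norm_triangle_sub[of "F t (x + h, y t (x + h)) - F t (x, y t x)" "DF t (x, y t x) (h, ?D)"] by linarith
     then show "norm (F t (x + h, y t (x + h)) - F t (x, y t x)) \<le> (K2 + 1 / 4) * norm h + 3 / 4 * M"
      using M[OF t] by (simp add: algebra_simps)
    qed
   qed
   finally show "norm (y s (x + h) - y s x) \<le> (K1 + 1 + K2 + 1 / 4) * norm h + 3 / 4 * M"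
    by (simp add: algebra_simps)
  qed simp
  then show "x + h \<in> V \<and> norm (y s (x + h) - y s x) \<le> C * norm h" using xh by (simp add: C_def algebra_simps)
 qed
qed

lemma y_derivative:
 assumes x: "x \<in> V" and s: "s \<in> {0..1}"
 shows "(y s has_derivative (\<lambda>v. Dy x v s)) (at x)"
 unfolding has_derivative_at_alt
proof (intro conjI allI impI)
 show "bounded_linear (\<lambda>v. Dy x v s)" using Dy_linear[OF x s] by (simp add: linear_conv_bounded_linear)
 fix e :: real assume e: "0 < e"
 obtain d0 C where d0: "d0 > 0" "C \<ge> 0" "!!h s. norm h < d0 ==> s \<in> {0..1} ==> x + h \<in> V \<and> norm (y s (x + h) - y s x) \<le> C * norm h"
  using y_lipschitz[OF x] by blast
 \<comment> \<open>With \<open>norm (h, increment) \<le> (1 + C) * norm h\<close> the remainder of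
   \<open>F\<close> is at most e/4 times the norm of \<open>h\<close>; the remainder of
   \<open>c\<close> gives another e/4, and absorption with factor 1/2 doubles the sum.\<close>
 define E where "E = e / (4 * (1 + C))"
 have E: "E > 0" using e d0(2) by (simp add: E_def)
 have oVB: "open (V \<times> B)" using open_V open_B by (rule open_Times)
 have cz: "continuous_on {0..1} (\<lambda>t. (x, y t x))" by (intro continuous_intros y_cont[OF x])
 obtain d1 where d1: "d1 > 0" "!!t u. t \<in> {0..1} ==> norm u < d1 ==> (x, y t x) + u \<in> V \<times> B \<and>
   norm (F t ((x, y t x) + u) - F t (x, y t x) - DF t (x, y t x) u) \<le> E * norm u"
  by (rule uniform_differentiability[OF F1 oVB cz _ E]) (use x y_B in auto)
 obtain d2 where d2: "d2 > 0" "!!h. norm h < d2 ==> norm (c (x + h) - c x - fd c x h) \<le> (e/4) * norm h"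
 proof -
  have "e/4 > 0" using e by simp
  with c_deriv[OF x] obtain d where "d > 0" "\<forall>y. norm (y - x) < d --> norm (c y - c x - fd c x (y - x)) \<le> (e/4) * norm (y - x)"
   unfolding has_derivative_at_alt by metis
  then show thesis by (intro that[of d]) (metis add_diff_cancel_left')+
 qed
 define d where "d = min (min d0 d2) (d1 / (1 + C))"
 have d: "d > 0" using d0 d1 d2 by (simp add: d_def add_pos_nonneg)
 have main: "norm (y s (x + h) - y s x - Dy x h s) \<le> e * norm h" if h: "norm h < d" for h
 proof -
  have h0: "norm h < d0" and h2: "norm h < d2" and h1: "(1 + C) * norm h < d1"
   using h d0(2) by (auto simp: d_def pos_less_divide_eq mult.commute)
  have xh: "x + h \<in> V" using d0(3)[OF h0 s] by simp
  have cy: "continuous_on {0..1} (\<lambda>t. F t (x + h, y t (x + h)))" "continuous_on {0..1} (\<lambda>t. F t (x, y t x))"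
   using contF_along y_cont y_B xh x by auto
  have cD: "continuous_on {0..1} (\<lambda>t. DF t (x, y t x) (h, Dy x h t))" by (rule DF_along[OF x Dy(1)[OF x]])
  have cyy: "continuous_on {0..1} (\<lambda>t. F t (x + h, y t (x + h)) - F t (x, y t x))" by (rule continuous_on_diff[OF cy])
  have "norm (y s (x + h) - y s x - Dy x h s) \<le> (e/4 * norm h + E * (1 + C) * norm h) / (1 - 1/2)"
  proof (rule contraction_bound[where q = "1/2", OF _ _ _ s])
   show "continuous_on {0..1} (\<lambda>s. y s (x + h) - y s x - Dy x h s)"
    using y_cont xh x Dy(1)[OF x] by (intro continuous_intros)
   fix M and s :: real assume M: "!!t. t \<in> {0..1} ==> norm (y t (x + h) - y t x - Dy x h t) \<le> M" and s: "s \<in> {0..1}"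
   have "y s (x + h) - y s x - Dy x h s = (c (x + h) - c x - fd c x h) +
     integral {0..s} (\<lambda>t. F t (x + h, y t (x + h)) - F t (x, y t x) - DF t (x, y t x) (h, Dy x h t))"
    using y_eq[OF s xh] y_eq[OF s x] integral_unit_diff[OF cy s] integral_unit_diff[OF cyy cD s] Dy(2)[OF x s, of h] by simp
   also have "norm ... \<le> e / 4 * norm h + (E * (1 + C) * norm h + 1 / 2 * M)"
   proof (rule norm_triangle_le[OF add_mono])
    show "norm (c (x + h) - c x - fd c x h) \<le> e / 4 * norm h" using d2(2)[OF h2] .
    show "norm (integral {0..s} (\<lambda>t. F t (x + h, y t (x + h)) - F t (x, y t x) - DF t (x, y t x) (h, Dy x h t)))
      \<le> E * (1 + C) * norm h + 1 / 2 * M"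
    proof (rule integral_unit_bound[OF continuous_on_diff[OF cyy cD] _ s])
     fix t :: real assume t: "t \<in> {0..1}"
     let ?D = "y t (x + h) - y t x"
     have n: "norm (h, ?D) \<le> (1 + C) * norm h"
      using norm_Pair_le[of h ?D] d0(3)[OF h0 t] by (simp add: algebra_simps)
     then have "norm (h, ?D) < d1" using h1 by linarith
     from d1(2)[OF t this]
     have "norm (F t (x + h, y t (x + h)) - F t (x, y t x) - DF t (x, y t x) (h, ?D)) \<le> E * norm (h, ?D)" by simp
     also have "... \<le> E * ((1 + C) * norm h)" using n E by (intro mult_left_mono) auto
     finally have R: "norm (F t (x + h, y t (x + h)) - F t (x, y t x) - DF t (x, y t x) (h, ?D)) \<le> E * (1 + C) * norm h"
      by (simp add: mult.assoc)
     have "DF t (x, y t x) (h, ?D) - DF t (x, y t x) (h, Dy x h t) = DF t (x, y t x) (0, ?D - Dy x h t)"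
      using linear_diff[OF DF_lin[OF t x y_B[OF t x]], of "(h, ?D)" "(h, Dy x h t)"] by simp
     then have "norm (DF t (x, y t x) (h, ?D) - DF t (x, y t x) (h, Dy x h t)) \<le> 1 / 2 * M"
      using DF_bound[OF t x y_B[OF t x], of "?D - Dy x h t"] M[OF t] by simp
     from norm_triangle_le[OF add_mono[OF R this]]
     show "norm (F t (x + h, y t (x + h)) - F t (x, y t x) - DF t (x, y t x) (h, Dy x h t)) \<le> E * (1 + C) * norm h + 1 / 2 * M"
      by simp
    qed
   qed
   finally show "norm (y s (x + h) - y s x - Dy x h s) \<le> e / 4 * norm h + E * (1 + C) * norm h + 1 / 2 * M" by simp
  qed simp
  also have "E * (1 + C) = e / 4" using d0(2) by (simp add: E_def field_simps)
  finally show ?thesis by simp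
 qed
 show "\<exists>d>0. \<forall>z. norm (z - x) < d --> norm (y s z - y s x - Dy x (z - x) s) \<le> e * norm (z - x)"
 proof (intro exI[of _ d] conjI d allI impI)
  fix z assume "norm (z - x) < d"
  from main[OF this] show "norm (y s z - y s x - Dy x (z - x) s) \<le> e * norm (z - x)" by simp
 qed
qed

lemma y_derivative_eq:
 assumes x: "x \<in> V"
 shows "continuous_on {0..1} (\<lambda>s. fd (y s) x v)"
  and "s \<in> {0..1} ==> fd (y s) x v = fd c x v +
     integral {0..s} (\<lambda>t. DF t (x, y t x) (v, fd (y t) x v))"
proof -
 have e: "fd (y s) x v = Dy x v s" if "s \<in> {0..1}" for s
  using frechet_derivative_at[OF y_derivative[OF x that]] by metis
 show "continuous_on {0..1} (\<lambda>s. fd (y s) x v)"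
  using Dy(1)[OF x] by (rule continuous_on_eq) (simp add: e)
 assume s: "s \<in> {0..1}"
 have "integral {0..s} (\<lambda>t. DF t (x, y t x) (v, fd (y t) x v)) = integral {0..s} (\<lambda>t. DF t (x, y t x) (v, Dy x v t))"
  by (rule integral_cong) (use s e in auto)
 then show "fd (y s) x v = fd c x v +
     integral {0..s} (\<lambda>t. DF t (x, y t x) (v, fd (y t) x v))"
  using Dy(2)[OF x s, of v] e[OF s] by simp
qed

end

end

text \<open>Induction on the order with the equation itself varying. The derivative
  \<open>Dy x v\<close> solves the linearised equation, whose unknown ranges over
  \<open>UNIV\<close>. Its right-hand side is of class k because the induction hypothesis, applied
  first to the given equation, already makes \<open>y\<close> of class k.\<close>

theorem Tk_integral_equation:
 assumes "integral_equation V B F c y" "Tk k (V \<times> B) F" "Ck_on k V c"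
 shows "Tk k V y"
 using assms
proof (induction k arbitrary: F c y B)
 case 0
 interpret integral_equation V B F c y by fact
 show ?case using y_continuous by simp
next
 case (Suc k)
 interpret integral_equation V B F c y by fact
 have F1: "Tk (Suc 0) (V \<times> B) F" using Tk_mono[OF Suc.prems(2)] by blast
 have c1: "Ck_on (Suc 0) V c" using Tk_mono[of "Suc k" V "\<lambda>s. c" "Suc 0"] Suc.prems(3) by (auto simp: Ck_on_eq_Tk simp del: Ck_on.simps Tk.simps)
 have IH: "Tk k V y"
  using Suc.IH[OF Suc.prems(1) Tk_SucD[OF Suc.prems(2)]] Suc.prems(3) Tk_SucD[of k V "\<lambda>s. c"] by (auto simp: Ck_on_eq_Tk simp del: Ck_on.simps Tk.simps)
 show ?case
 proof (rule Tk_SucI[OF open_V y_continuous y_derivative[OF F1 c1]])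
  fix v
  let ?G = "\<lambda>t z. fd (F t) (fst z, y t (fst z)) (v, snd z)"
  have TG: "Tk k (V \<times> UNIV) ?G" by (rule Tk_linearised[OF F1 c1 Suc.prems(2) IH])
  show "Tk k V (\<lambda>s x. Dy x v s)"
  proof (rule Suc.IH[OF _ TG])
   show "Ck_on k V (\<lambda>x. fd c x v)" using Suc.prems(3) by simp
   show "integral_equation V UNIV ?G (\<lambda>x. fd c x v) (\<lambda>s x. Dy x v s)"
   proof
    show "continuous_on ({0..1} \<times> V \<times> UNIV) (\<lambda>z. ?G (fst z) (snd z))" using Tk_continuous[OF TG] .
    show "continuous_on V (\<lambda>x. fd c x v)" using c1 by simp
    fix s x u u' assume s: "s \<in> {0..1::real}" and x: "x \<in> V"
    note a = s x y_B[OF s x]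
    have "?G s (x, u) - ?G s (x, u') = fd (F s) (x, y s x) (0, u - u')"
     using linear_diff[OF DF_lin[OF F1 c1 a], of "(v, u)" "(v, u')"] by simp
    then show "norm (?G s (x, u) - ?G s (x, u')) \<le> norm (u - u') / 2"
     using DF_bound[OF F1 c1 a] by simp
   qed (use open_V Dy[OF F1 c1] in auto)
  qed
 qed
qed

subsection \<open>Symmetry of second derivatives\<close>

lemma line_has_derivative:
 assumes "(f has_derivative f') (at (a + t *\<^sub>R v))"
 shows "((\<lambda>t. f (a + t *\<^sub>R v)) has_vector_derivative f' v) (at t within S)"
proof -
 have "((\<lambda>t. a + t *\<^sub>R v) has_derivative (\<lambda>h. h *\<^sub>R v)) (at t within S)"
  by (auto intro!: derivative_eq_intros)
 from has_derivative_compose[OF this assms] show ?thesis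
  unfolding has_vector_derivative_def
  using linear_scale[OF has_derivative_linear[OF assms]] by simp
qed

text \<open>The mean value theorem twice: first in direction \<open>u\<close> for the difference
  \<open>g\<close> of two parallel segments, then in direction \<open>v\<close> for the
  derivative.\<close>

lemma second_difference:
 fixes f :: "'a::real_normed_vector => real"
 assumes C2: "Ck_on 2 U f" and h: "h > 0"
  and sub: "!!s t. s \<in> {0..h} ==> t \<in> {0..h} ==> x + s *\<^sub>R u + t *\<^sub>R v \<in> U"
 obtains s t where "s \<in> {0..h}" "t \<in> {0..h}"
  "f (x + h *\<^sub>R u + h *\<^sub>R v) - f (x + h *\<^sub>R u) - f (x + h *\<^sub>R v) + f x =
   h\<^sup>2 * fd (\<lambda>x. fd f x u) (x + s *\<^sub>R u + t *\<^sub>R v) v"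
proof -
 let ?Df = "\<lambda>x. fd f x u"
 have fd: "!!x. x \<in> U ==> (f has_derivative fd f x) (at x)"
  and dd: "!!x. x \<in> U ==> (?Df has_derivative fd ?Df x) (at x)"
  using C2 by (auto simp: numeral_2_eq_2 frechet_derivative_works[symmetric])
 have fd': "((\<lambda>s. f (a + s *\<^sub>R u)) has_real_derivative ?Df (a + s *\<^sub>R u)) (at s)" if "a + s *\<^sub>R u \<in> U" for a s
  using line_has_derivative[OF fd[OF that]] by (simp add: has_real_derivative_iff_has_vector_derivative)
 have dd': "((\<lambda>s. ?Df (a + s *\<^sub>R v)) has_real_derivative fd ?Df (a + s *\<^sub>R v) v) (at s)" if "a + s *\<^sub>R v \<in> U" for a s
  using line_has_derivative[OF dd[OF that]] by (simp add: has_real_derivative_iff_has_vector_derivative)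
 define g where "g s = f (x + h *\<^sub>R v + s *\<^sub>R u) - f (x + s *\<^sub>R u)" for s
 have "\<exists>s. 0 < s \<and> s < h \<and> g h - g 0 = (h - 0) * (?Df (x + h *\<^sub>R v + s *\<^sub>R u) - ?Df (x + s *\<^sub>R u))"
 proof (rule MVT2[OF h])
  fix s assume s: "0 \<le> s" "s \<le> h"
  show "(g has_real_derivative ?Df (x + h *\<^sub>R v + s *\<^sub>R u) - ?Df (x + s *\<^sub>R u)) (at s)"
   unfolding g_def using sub[of s h] sub[of s 0] s h by (intro DERIV_diff fd') (auto simp: add_ac)
 qed
 then obtain s where s: "0 < s" "s < h" "g h - g 0 = h * (?Df (x + h *\<^sub>R v + s *\<^sub>R u) - ?Df (x + s *\<^sub>R u))" by auto
 have "\<exists>t. 0 < t \<and> t < h \<and> ?Df (x + s *\<^sub>R u + h *\<^sub>R v) - ?Df (x + s *\<^sub>R u + 0 *\<^sub>R v) =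
   (h - 0) * fd ?Df (x + s *\<^sub>R u + t *\<^sub>R v) v"
  by (rule MVT2[OF h, of "\<lambda>t. ?Df (x + s *\<^sub>R u + t *\<^sub>R v)"], rule dd') (use sub s in auto)
 then obtain t where t: "0 < t" "t < h" "?Df (x + s *\<^sub>R u + h *\<^sub>R v) - ?Df (x + s *\<^sub>R u) =
   h * fd ?Df (x + s *\<^sub>R u + t *\<^sub>R v) v" by auto
 have "g h - g 0 = h * (h * fd ?Df (x + s *\<^sub>R u + t *\<^sub>R v) v)"
  using s(3) t(3) by (simp add: add_ac)
 then show thesis
  using s t by (intro that[of s t]) (auto simp: g_def power2_eq_square algebra_simps)
qed

text \<open>The mixed second difference is symmetric in \<open>u\<close> and \<open>v\<close>, so
  the two iterated derivatives take a common value at suitable points arbitrarily near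
  \<open>x\<close>. Continuity within half of their supposed distance then gives a
  contradiction.\<close>

lemma symmetric_second_derivative_real:
 fixes f :: "'a::real_normed_vector => real"
 assumes C2: "Ck_on 2 U f" and U: "open U" and x: "x \<in> U"
 shows "fd (\<lambda>x. fd f x u) x v =
     fd (\<lambda>x. fd f x v) x u" (is "?P x = ?Q x")
proof (rule ccontr)
 assume ne: "?P x \<noteq> ?Q x"
 define e where "e = \<bar>?P x - ?Q x\<bar> / 2"
 have e: "e > 0" using ne by (simp add: e_def)
 have cont: "continuous_on U ?P" "continuous_on U ?Q"
  using C2 by (auto simp: numeral_2_eq_2)
 obtain d1 where d1: "d1 > 0" "!!y. y \<in> U ==> dist y x < d1 ==> dist (?P y) (?P x) < e"
  using cont(1) x e unfolding continuous_on_iff by blast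
 obtain d2 where d2: "d2 > 0" "!!y. y \<in> U ==> dist y x < d2 ==> dist (?Q y) (?Q x) < e"
  using cont(2) x e unfolding continuous_on_iff by blast
 obtain r where r: "r > 0" "ball x r \<subseteq> U" using U x open_contains_ball by blast
 define d where "d = min r (min d1 d2)"
 have d: "d > 0" using d1 d2 r by (simp add: d_def)
 define N where "N = norm u + norm v + 1"
 have N: "N > 0" by (simp add: N_def add_nonneg_pos)
 \<comment> \<open>Keeps the parallelogram spanned by \<open>h *\<^sub>R u\<close> and
   \<open>h *\<^sub>R v\<close> at \<open>x\<close> within distance d/2 of \<open>x\<close>.\<close>
 define h where "h = d / (2 * N)"
 have h: "h > 0" using d N by (simp add: h_def)
 have near: "dist (x + s *\<^sub>R u + t *\<^sub>R v) x < d" if st: "s \<in> {0..h}" "t \<in> {0..h}" for s t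
 proof -
  have "norm (s *\<^sub>R u + t *\<^sub>R v) \<le> s * norm u + t * norm v"
   using norm_triangle_ineq[of "s *\<^sub>R u" "t *\<^sub>R v"] st by simp
  also have "... \<le> h * norm u + h * norm v" using st by (intro add_mono mult_right_mono) auto
  also have "... \<le> h * N" using h by (simp add: N_def algebra_simps)
  also have "... = d / 2" using N by (simp add: h_def)
  also have "... < d" using d by simp
  finally show ?thesis by (simp add: dist_norm)
 qed
 have inU: "x + s *\<^sub>R u + t *\<^sub>R v \<in> U" if "s \<in> {0..h}" "t \<in> {0..h}" for s t
  using near[OF that] r(2) by (auto simp: d_def dist_commute)
 have inU': "x + s *\<^sub>R v + t *\<^sub>R u \<in> U" and near': "dist (x + s *\<^sub>R v + t *\<^sub>R u) x < d"
  if "s \<in> {0..h}" "t \<in> {0..h}" for s t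
  using near[OF that(2,1)] inU[OF that(2,1)] by (simp_all add: add_ac)
 obtain s t where 1: "s \<in> {0..h}" "t \<in> {0..h}"
  "f (x + h *\<^sub>R u + h *\<^sub>R v) - f (x + h *\<^sub>R u) - f (x + h *\<^sub>R v) + f x = h\<^sup>2 * ?P (x + s *\<^sub>R u + t *\<^sub>R v)"
  by (rule second_difference[OF C2 h inU])
 obtain s' t' where 2: "s' \<in> {0..h}" "t' \<in> {0..h}"
  "f (x + h *\<^sub>R v + h *\<^sub>R u) - f (x + h *\<^sub>R v) - f (x + h *\<^sub>R u) + f x = h\<^sup>2 * ?Q (x + s' *\<^sub>R v + t' *\<^sub>R u)"
  by (rule second_difference[OF C2 h inU'])
 have "h\<^sup>2 * ?P (x + s *\<^sub>R u + t *\<^sub>R v) = h\<^sup>2 * ?Q (x + s' *\<^sub>R v + t' *\<^sub>R u)"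
  using 1(3) 2(3) by (simp add: algebra_simps)
 then have eq: "?P (x + s *\<^sub>R u + t *\<^sub>R v) = ?Q (x + s' *\<^sub>R v + t' *\<^sub>R u)" using h by simp
 have "dist (?P (x + s *\<^sub>R u + t *\<^sub>R v)) (?P x) < e"
  using near[OF 1(1,2)] by (intro d1(2) inU 1) (auto simp: d_def)
 moreover have "dist (?Q (x + s' *\<^sub>R v + t' *\<^sub>R u)) (?Q x) < e"
  using near'[OF 2(1,2)] by (intro d2(2) inU' 2) (auto simp: d_def)
 moreover have False if "\<bar>a - p\<bar> < \<bar>p - q\<bar> / 2" "\<bar>a - q\<bar> < \<bar>p - q\<bar> / 2" for a p q :: real
  using that by (auto simp: abs_if split: if_splits)
 ultimately show False using eq unfolding dist_real_def e_def by metis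
qed

lemma Ck_on_mono: "Ck_on k U f ==> j \<le> k ==> Ck_on j U f"
 unfolding Ck_on_eq_Tk by (rule Tk_mono)

lemma Ck_on_subset: "Ck_on k U f ==> V \<subseteq> U ==> Ck_on k V f"
 unfolding Ck_on_eq_Tk by (rule Tk_subset)

lemma Ck_on_has_derivative: "Ck_on (Suc k) U f ==> x \<in> U ==> (f has_derivative fd f x) (at x)"
 by (auto simp: frechet_derivative_works[symmetric])

lemma symmetric_second_derivative:
 fixes f :: "'a::real_normed_vector => 'b::euclidean_space"
 assumes C2: "Ck_on 2 U f" and U: "open U" and x: "x \<in> U"
 shows "fd (\<lambda>x. fd f x u) x v =
     fd (\<lambda>x. fd f x v) x u"
proof (rule euclidean_eqI)
 fix b :: 'b
 have inner: "fd (\<lambda>x. g x \<bullet> b) y w = fd g y w \<bullet> b"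
  if "Ck_on 1 U g" "y \<in> U" for g y w
 proof -
  have "(g has_derivative fd g y) (at y)" using Ck_on_has_derivative[of 0 U g y] that by simp
  then have "((\<lambda>x. g x \<bullet> b) has_derivative (\<lambda>w. fd g y w \<bullet> b)) (at y)"
   by (rule has_derivative_inner_left)
  from frechet_derivative_at[OF this] show ?thesis by metis
 qed
 have c: "Ck_on 2 U (\<lambda>x. f x \<bullet> b)"
  using Tk_bounded_linear[OF bounded_linear_inner_left U] C2 by (simp add: Ck_on_eq_Tk)
 have f1: "Ck_on 1 U f" by (rule Ck_on_mono[OF C2]) simp
 have g1: "Ck_on 1 U (\<lambda>x. fd f x u)" for u
  using C2 by (simp add: numeral_2_eq_2)
 have "fd (\<lambda>x. fd (\<lambda>x. f x \<bullet> b) x u) x v =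
   fd (\<lambda>x. fd f x u) x v \<bullet> b" for u v
  using fd_cong_open[OF U x, of "\<lambda>x. fd (\<lambda>x. f x \<bullet> b) x u" "\<lambda>x. fd f x u \<bullet> b"]
   inner[OF f1] inner[OF g1 x] by simp
 then show "fd (\<lambda>x. fd f x u) x v \<bullet> b =
     fd (\<lambda>x. fd f x v) x u \<bullet> b"
  using symmetric_second_derivative_real[OF c U x, of u v] by simp
qed

subsection \<open>Scalar-regular functions\<close>

text \<open>Smooth functions whose derivative is linear over the scalar field: smooth functions over
 \<open>real\<close>, holomorphic functions over \<open>complex\<close>.\<close>

definition kreg_on :: "('k::real_normed_field^'m) set => ('k^'m => 'k) => bool" where
 "kreg_on U f \<longleftrightarrow> open U \<and> (\<forall>k. Ck_on k U f) \<and>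
   (\<forall>x\<in>U. \<forall>c v. fd f x (c *s v) = c * fd f x v)"

lemma kreg_on_open: "kreg_on U f ==> open U" by (simp add: kreg_on_def)
lemma kreg_on_Ck: "kreg_on U f ==> Ck_on k U f" by (simp add: kreg_on_def)
lemma kreg_on_Tk: "kreg_on U f ==> Tk k U (\<lambda>s. f)" by (simp add: kreg_on_def Ck_on_eq_Tk)
lemma kreg_on_scale: "kreg_on U f ==> x \<in> U ==> fd f x (c *s v) = c * fd f x v"
 by (simp add: kreg_on_def)
lemma kreg_on_deriv: "kreg_on U f ==> x \<in> U ==> (f has_derivative fd f x) (at x)"
 using Ck_on_has_derivative[OF kreg_on_Ck[of U f "Suc 0"]] .

lemma kreg_on_continuous: "kreg_on U f ==> continuous_on U f"
 using kreg_on_Ck[of U f 0] by simp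

lemma kreg_onI:
 assumes "open U" "!!k. Ck_on k U f" "!!x. x \<in> U ==> (f has_derivative f' x) (at x)"
  "!!x c v. x \<in> U ==> f' x (c *s v) = c * f' x v"
 shows "kreg_on U f"
proof -
 have "fd f x = f' x" if "x \<in> U" for x
  using frechet_derivative_at[OF assms(3)[OF that]] by simp
 then show ?thesis using assms unfolding kreg_on_def by simp
qed

lemma kreg_on_cong:
 assumes "kreg_on U f" "!!x. x \<in> U ==> f x = g x"
 shows "kreg_on U g"
proof -
 have U: "open U" using assms(1) by (rule kreg_on_open)
 show ?thesis
  using assms(1) Ck_on_cong[OF U assms(2)] fd_cong_open[OF U _ assms(2)] unfolding kreg_on_def by simp
qed

lemma kreg_on_subset: "kreg_on U f ==> open V ==> V \<subseteq> U ==> kreg_on V f"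
 unfolding kreg_on_def using Ck_on_subset by blast

lemma kreg_on_const: "open U ==> kreg_on U (\<lambda>x. c)"
 by (rule kreg_onI[where f' = "\<lambda>x v. 0"]) (auto simp: Ck_on_eq_Tk)

lemma bounded_linear_nth: "bounded_linear (\<lambda>x. x $ i)"
 by (rule bounded_linear_vec_nth)

lemmas nth_has_derivative = bounded_linear_imp_has_derivative[OF bounded_linear_nth]

lemma kreg_on_nth: "open U ==> kreg_on U (\<lambda>x. x $ i)"
 by (rule kreg_onI[where f' = "\<lambda>x v. v $ i"])
   (auto simp: Ck_on_eq_Tk intro!: Tk_space_linear bounded_linear_nth bounded_linear_imp_has_derivative)

lemma kreg_on_add:
 assumes "kreg_on U f" "kreg_on U g"
 shows "kreg_on U (\<lambda>x. f x + g x)"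
 by (rule kreg_onI[OF kreg_on_open[OF assms(1)] _ has_derivative_add[OF kreg_on_deriv[OF assms(1)] kreg_on_deriv[OF assms(2)]]])
   (auto simp: Ck_on_eq_Tk kreg_on_scale[OF assms(1)] kreg_on_scale[OF assms(2)] algebra_simps
    intro!: Tk_add kreg_on_Tk[OF assms(1)] kreg_on_Tk[OF assms(2)] kreg_on_open[OF assms(1)])

lemma kreg_on_mult:
 assumes "kreg_on U f" "kreg_on U g"
 shows "kreg_on U (\<lambda>x. f x * g x)"
 by (rule kreg_onI[OF kreg_on_open[OF assms(1)] _ has_derivative_mult[OF kreg_on_deriv[OF assms(1)] kreg_on_deriv[OF assms(2)]]])
   (auto simp: Ck_on_eq_Tk kreg_on_scale[OF assms(1)] kreg_on_scale[OF assms(2)] algebra_simps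
    intro!: Tk_bilinear[OF bounded_bilinear_mult] kreg_on_Tk[OF assms(1)] kreg_on_Tk[OF assms(2)] kreg_on_open[OF assms(1)])

lemma kreg_on_inverse:
 assumes "kreg_on U f" "!!x. x \<in> U ==> f x \<noteq> 0"
 shows "kreg_on U (\<lambda>x. inverse (f x))"
 by (rule kreg_onI[OF kreg_on_open[OF assms(1)] _ Deriv.has_derivative_inverse[OF assms(2) kreg_on_deriv[OF assms(1)]]])
   (auto simp: Ck_on_eq_Tk kreg_on_scale[OF assms(1)] algebra_simps assms(2)
    intro!: Tk_inverse kreg_on_Tk[OF assms(1)] kreg_on_open[OF assms(1)])

text \<open>Only scalar-linearity of the new derivative is at stake. Symmetry of second derivatives
  moves the scalar into the inner direction, where it is known to come out.\<close>

lemma kreg_on_frechet: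
 fixes f :: "'k::{real_normed_field,euclidean_space}^'m => 'k"
 assumes "kreg_on U f"
 shows "kreg_on U (\<lambda>x. fd f x v)"
 unfolding kreg_on_def
proof (intro conjI allI ballI)
 show U: "open U" using assms by (rule kreg_on_open)
 show "Ck_on k U (\<lambda>x. fd f x v)" for k using kreg_on_Ck[OF assms, of "Suc k"] by simp
 fix x c u assume x: "x \<in> U"
 let ?D = "\<lambda>u x. fd f x u"
 note sym = symmetric_second_derivative[OF kreg_on_Ck[OF assms] U x]
 have "fd (?D v) x (c *s u) = fd (?D (c *s u)) x v" by (rule sym)
 also have "... = fd (\<lambda>y. c * ?D u y) x v"
  by (subst fd_cong_open[OF U x, of _ "\<lambda>y. c * ?D u y"]) (auto simp: kreg_on_scale[OF assms])
 also have "... = c * fd (?D u) x v"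
 proof -
  have "(?D u has_derivative fd (?D u) x) (at x)"
   using kreg_on_Ck[OF assms, of "Suc (Suc 0)"] x by (auto simp: frechet_derivative_works[symmetric])
  then have "((\<lambda>y. c * ?D u y) has_derivative (\<lambda>v. c * fd (?D u) x v)) (at x)"
   by (rule has_derivative_mult_right)
  from frechet_derivative_at[OF this] show ?thesis by metis
 qed
 also have "... = c * fd (?D v) x u" using sym[of u v] by simp
 finally show "fd (?D v) x (c *s u) = c * fd (?D v) x u" .
qed

definition kmap_on :: "('k::real_normed_field^'m) set => ('k^'m => 'k^'l) => bool" where
 "kmap_on U G \<longleftrightarrow> (\<forall>i. kreg_on U (\<lambda>x. G x $ i))"

lemma bounded_linear_axis: "bounded_linear (axis i :: 'k::real_normed_vector => 'k^'m)"
proof (rule bounded_linear_intro[of _ 1])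
 show "axis i (x + y) = axis i x + (axis i y :: 'k^'m)" for x y by (simp add: axis_def vec_eq_iff)
 show "axis i (r *\<^sub>R x) = r *\<^sub>R (axis i x :: 'k^'m)" for r x by (simp add: axis_def vec_eq_iff)
 show "norm (axis i x :: 'k^'m) \<le> norm x * 1" for x
 proof -
  have "norm (axis i x :: 'k^'m) = sqrt (\<Sum>j\<in>UNIV. if j = i then (norm x)\<^sup>2 else 0)"
   unfolding norm_vec_def L2_set_def by (intro arg_cong[of _ _ sqrt] sum.cong) (auto simp: axis_def)
  then show ?thesis by simp
 qed
qed

lemma vec_sum_axis: "(\<Sum>i\<in>UNIV. axis i (x $ i)) = (x :: 'k::comm_monoid_add^'m)"
 by (simp add: vec_eq_iff axis_def if_distrib cong: if_cong)

lemma vec_has_derivative: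
 fixes G :: "'a::real_normed_vector => 'k::real_normed_vector^'m"
 assumes "!!i. ((\<lambda>x. G x $ i) has_derivative G' i) (at x within S)"
 shows "(G has_derivative (\<lambda>v. \<chi> i. G' i v)) (at x within S)"
proof -
 have "((\<lambda>x. \<Sum>i\<in>UNIV. axis i (G x $ i)) has_derivative (\<lambda>v. \<Sum>i\<in>UNIV. axis i (G' i v))) (at x within S)"
  by (intro has_derivative_sum bounded_linear.has_derivative[OF bounded_linear_axis] assms)
 moreover have "(\<Sum>i\<in>UNIV. axis i (G' i v)) = (\<chi> i. G' i v)" for v
  using vec_sum_axis[of "\<chi> i. G' i v"] by simp
 ultimately show ?thesis by (simp add: vec_sum_axis)
qed

lemma Tk_vec:
 fixes G :: "real => 'a::real_normed_vector => 'k::real_normed_field^'m"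
 assumes "open U" "!!i. Tk k U (\<lambda>s x. G s x $ i)"
 shows "Tk k U G"
proof -
 have "Tk k U (\<lambda>s x. \<Sum>i\<in>UNIV. axis i (G s x $ i))"
  by (intro Tk_sum[OF assms(1)] Tk_bounded_linear[OF bounded_linear_axis assms(1)] assms(2))
 then show ?thesis by (simp add: vec_sum_axis)
qed

lemma kmap_on_open: "kmap_on U G ==> open U"
 unfolding kmap_on_def using kreg_on_open by blast
lemma kmap_on_nth: "kmap_on U G ==> kreg_on U (\<lambda>x. G x $ i)"
 unfolding kmap_on_def by blast
lemma kmap_on_Tk: "kmap_on U G ==> Tk k U (\<lambda>s. G)"
 by (rule Tk_vec[OF kmap_on_open kreg_on_Tk[OF kmap_on_nth]])
lemma kmap_on_Ck: "kmap_on U G ==> Ck_on k U G"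
 by (simp add: Ck_on_eq_Tk kmap_on_Tk)
lemma kmap_on_continuous: "kmap_on U G ==> continuous_on U G"
 using kmap_on_Ck[of U G 0] by simp
lemma kmap_on_deriv: "kmap_on U G ==> x \<in> U ==> (G has_derivative fd G x) (at x)"
 using Ck_on_has_derivative[OF kmap_on_Ck[of U G "Suc 0"]] .
lemma kmap_on_deriv_nth: "kmap_on U G ==> x \<in> U ==> fd G x v $ i = fd (\<lambda>x. G x $ i) x v"
proof -
 assume a: "kmap_on U G" "x \<in> U"
 have "(G has_derivative (\<lambda>v. \<chi> i. fd (\<lambda>x. G x $ i) x v)) (at x)"
  by (rule vec_has_derivative) (rule kreg_on_deriv[OF kmap_on_nth[OF a(1)] a(2)])
 from frechet_derivative_at[OF this] show ?thesis by (metis vec_lambda_beta)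
qed
lemma kmap_on_scale: "kmap_on U G ==> x \<in> U ==> fd G x (c *s v) = c *s fd G x v"
 by (simp add: vec_eq_iff kmap_on_deriv_nth kreg_on_scale[OF kmap_on_nth])
lemma kmap_on_subset: "kmap_on U f ==> open V ==> V \<subseteq> U ==> kmap_on V f"
 unfolding kmap_on_def using kreg_on_subset by blast

lemma kreg_on_compose:
 fixes f :: "'k::{real_normed_field,euclidean_space}^'m => 'k" and G :: "'k^'l => 'k^'m"
 assumes "kreg_on V f" "kmap_on U G" "!!x. x \<in> U ==> G x \<in> V"
 shows "kreg_on U (\<lambda>x. f (G x))"
proof (rule kreg_onI[OF kmap_on_open[OF assms(2)]])
 show "Ck_on k U (\<lambda>x. f (G x))" for k
  unfolding Ck_on_eq_Tk
  by (rule Tk_compose[OF kmap_on_open[OF assms(2)] kreg_on_open[OF assms(1)] kreg_on_Tk[OF assms(1)] kmap_on_Tk[OF assms(2)] assms(3)])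
 show "((\<lambda>x. f (G x)) has_derivative (\<lambda>v. fd f (G x) (fd G x v))) (at x)"
  if "x \<in> U" for x
  by (rule has_derivative_compose[OF kmap_on_deriv[OF assms(2) that] kreg_on_deriv[OF assms(1) assms(3)[OF that]]])
 show "fd f (G x) (fd G x (c *s v)) = c * fd f (G x) (fd G x v)"
  if "x \<in> U" for x c v
  by (simp add: kmap_on_scale[OF assms(2) that] kreg_on_scale[OF assms(1) assms(3)[OF that]])
qed

lemma kreg_on_sum:
 assumes "open U" "!!i. i \<in> I ==> kreg_on U (f i)"
 shows "kreg_on U (\<lambda>x. \<Sum>i\<in>I. f i x)"
 using assms(2) by (induction I rule: infinite_finite_induct) (auto intro!: kreg_on_add kreg_on_const assms(1))

lemma kreg_on_prod:
 assumes "open U" "!!i. i \<in> I ==> kreg_on U (f i)"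
 shows "kreg_on U (\<lambda>x. \<Prod>i\<in>I. f i x)"
 using assms(2) by (induction I rule: infinite_finite_induct) (auto intro!: kreg_on_mult kreg_on_const assms(1))

lemma kreg_on_det:
 fixes M :: "'k::real_normed_field^'m => 'k^'l^'l"
 assumes "open U" "!!i j. kreg_on U (\<lambda>x. M x $ i $ j)"
 shows "kreg_on U (\<lambda>x. det (M x))"
 unfolding det_def
 by (intro kreg_on_sum kreg_on_mult kreg_on_const kreg_on_prod assms)

lemma kreg_on_divide:
 assumes "kreg_on U f" "kreg_on U g" "!!x. x \<in> U ==> g x \<noteq> 0"
 shows "kreg_on U (\<lambda>x. f x / g x)"
 using kreg_on_mult[OF assms(1) kreg_on_inverse[OF assms(2,3)]] by (simp add: divide_inverse)

subsection \<open>Averaging along a coordinate\<close>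

text \<open>As \<open>s\<close> runs from 0 to 1 this traces the segment from the projection of
  \<open>x\<close> to the hyperplane x_t = 0 up to \<open>x\<close> itself;
  \<open>shrink t 0\<close> later serves as that projection.\<close>

definition shrink :: "'m => real => 'k::real_normed_field^'m => 'k^'m" where
 "shrink t s x = (\<chi> i. if i = t then s *\<^sub>R x $ i else x $ i)"

text \<open>Applied to a partial derivative along e_t this is the quotient in Hadamard's lemma;
  multiplied by x_t it is an antiderivative along e_t.\<close>

definition average :: "'m => ('k::{real_normed_field,euclidean_space}^'m => 'k) => 'k^'m => 'k" where
 "average t f x = integral {0..1} (\<lambda>s. f (shrink t s x))"

lemma shrink_eq: "shrink t s x = x + (s - 1) *\<^sub>R axis t (x $ t)"
 by (simp add: shrink_def vec_eq_iff axis_def algebra_simps)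

lemma shrink_scale: "shrink t s (c *s x) = c *s shrink t s x"
 by (simp add: shrink_def vec_eq_iff)

lemma bounded_linear_shrink: "bounded_linear (shrink t s :: 'k::real_normed_field^'m => _)"
proof -
 have "bounded_linear (\<lambda>x::'k^'m. x + (s - 1) *\<^sub>R axis t (x $ t))"
  by (intro bounded_linear_add bounded_linear_ident bounded_linear_scaleR_right[THEN bounded_linear_compose]
    bounded_linear_compose[OF bounded_linear_axis] bounded_linear_nth)
 then show ?thesis by (simp add: shrink_eq[abs_def])
qed

lemma norm_shrink:
 assumes "s \<in> {0..1}" shows "norm (shrink t s (x :: 'k::real_normed_field^'m)) \<le> norm x"
 unfolding norm_vec_def using assms
 by (intro L2_set_mono) (auto simp: shrink_def intro!: mult_left_le_one_le)

lemma shrink_in_ball: "s \<in> {0..1} ==> x \<in> ball 0 R ==> shrink t s (x :: 'k::real_normed_field^'m) \<in> ball 0 R"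
 using norm_shrink[of s t x] by simp

lemma Tk_shrink:
 assumes "open U"
 shows "Tk k U (\<lambda>s. shrink t s :: 'k::real_normed_field^'m => _)"
proof -
 have "Tk k U (\<lambda>s x. x + (s - 1) *\<^sub>R (axis t (x $ t) :: 'k^'m))"
  by (intro Tk_add[OF assms] Tk_bilinear[OF bounded_bilinear_scaleR assms] Tk_time[OF _ assms]
    Tk_space_linear[OF _ assms] bounded_linear_ident bounded_linear_compose[OF bounded_linear_axis bounded_linear_nth] continuous_intros)
 then show ?thesis by (simp add: shrink_eq[abs_def])
qed

text \<open>Differentiation under the integral sign is an instance of
  \<open>Tk_integral_equation\<close> whose right-hand side does not involve the unknown; the second
  component of the argument of \<open>F\<close> is a dummy.\<close>

lemma kreg_on_average:
 fixes f :: "'k::{real_normed_field,euclidean_space}^'m => 'k"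
 assumes f: "kreg_on (ball 0 R) f"
 shows "kreg_on (ball 0 R) (average t f)"
  and "x \<in> ball 0 R ==> fd (average t f) x v =
   integral {0..1} (\<lambda>s. fd f (shrink t s x) (shrink t s v))"
  and "x \<in> ball 0 R ==> (\<lambda>s. fd f (shrink t s x) (shrink t s v)) integrable_on {0..1}"
proof -
 let ?V = "ball 0 R :: ('k^'m) set"
 define F where "F = (\<lambda>s (z :: ('k^'m) \<times> 'k). f (shrink t s (fst z)))"
 define y where "y = (\<lambda>s x. integral {0..s} (\<lambda>r. f (shrink t r x)))"
 have oV: "open ?V" and oVU: "open (?V \<times> (UNIV :: 'k set))" by (auto intro: open_Times)
 have TF: "Tk k (?V \<times> UNIV) F" for k
  unfolding F_def
  by (rule Tk_compose[OF oVU oV kreg_on_Tk[OF f]], rule Tk_compose[OF oVU open_UNIV Tk_shrink[OF open_UNIV]],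
    rule Tk_space_linear[OF bounded_linear_fst oVU]) (auto intro!: le_less_trans[OF norm_shrink])
 have cont: "continuous_on {0..1} (\<lambda>r. f (shrink t r x))" if "x \<in> ?V" for x
  using continuous_on_uncurried[OF Tk_continuous[OF TF[of 0]], of "{0..1}" "\<lambda>r. r" "\<lambda>r. (x, 0)"] that
  by (auto simp: F_def intro!: continuous_intros)
 interpret integral_equation ?V UNIV F "\<lambda>x. 0" y
 proof
  show "continuous_on ({0..1} \<times> ?V \<times> UNIV) (\<lambda>z. F (fst z) (snd z))" using Tk_continuous[OF TF[of 0]] .
  show "continuous_on {0..1} (\<lambda>s. y s x)" if "x \<in> ?V" for x
   unfolding y_def by (intro indefinite_integral_continuous_1 integrable_continuous_real cont that)
 qed (auto simp: F_def y_def)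
 have T: "Tk k ?V y" for k
  by (rule Tk_integral_equation[OF integral_equation_axioms TF]) (simp add: Ck_on_eq_Tk)
 have y1: "y 1 = average t f" by (auto simp: y_def average_def)
 have c1: "Ck_on (Suc 0) ?V (\<lambda>x. 0 :: 'k)" by (simp add: Ck_on_eq_Tk del: Ck_on.simps Tk.simps)
 have D0: "fd (\<lambda>x::'k^'m. 0::'k) x v = 0" for x v by simp
 have dF: "fd (F s) (x, u) (v, w) = fd f (shrink t s x) (shrink t s v)"
  if "s \<in> {0..1}" "x \<in> ?V" for s x u v w
 proof -
  have 1: "((\<lambda>z :: ('k^'m) \<times> 'k. shrink t s (fst z)) has_derivative (\<lambda>z. shrink t s (fst z))) (at (x, u))"
   by (rule bounded_linear_imp_has_derivative[OF bounded_linear_compose[OF bounded_linear_shrink bounded_linear_fst]])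
  have 2: "(f has_derivative fd f (shrink t s x)) (at (shrink t s (fst (x, u))))"
   using kreg_on_deriv[OF f shrink_in_ball[OF that]] by simp
  from frechet_derivative_at[OF has_derivative_compose[OF 1 2]]
  show ?thesis unfolding F_def by (metis fst_conv)
 qed
 have Dy: "fd (y 1) x v = integral {0..1} (\<lambda>s. fd f (shrink t s x) (shrink t s v))"
  if "x \<in> ?V" for x v
 proof -
  have "fd (y 1) x v = integral {0..1} (\<lambda>s. fd (F s) (x, y s x) (v, fd (y s) x v))"
   using y_derivative_eq(2)[OF TF c1 that, of 1 v] by (simp add: D0)
  also have "... = integral {0..1} (\<lambda>s. fd f (shrink t s x) (shrink t s v))"
   by (rule integral_cong) (simp add: dF[OF _ that])
  finally show ?thesis .
 qed
 show "fd (average t f) x v =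
   integral {0..1} (\<lambda>s. fd f (shrink t s x) (shrink t s v))" if "x \<in> ball 0 R" for x v
  using Dy[OF that] by (simp add: y1)
 have int: "(\<lambda>s. fd f (shrink t s x) (shrink t s v)) integrable_on {0..1}" if x: "x \<in> ball 0 R" for x v
 proof -
  have "continuous_on {0..1} (\<lambda>s. fd (F s) (x, y s x) (v, fd (y s) x v))"
   by (rule DF_along[OF TF c1 x y_derivative_eq(1)[OF TF c1 x]])
  then show ?thesis
   by (intro integrable_continuous_real) (rule continuous_on_eq, assumption, simp add: dF[OF _ x])
 qed
 then show "x \<in> ball 0 R ==> (\<lambda>s. fd f (shrink t s x) (shrink t s v)) integrable_on {0..1}" .
 show "kreg_on (ball 0 R) (average t f)" unfolding kreg_on_def
 proof (intro conjI allI ballI oV)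
  show "Ck_on k ?V (average t f)" for k using Ck_on_Tk[OF T, of 1] by (simp add: y1)
  fix x c v assume x: "x \<in> ?V"
  have "integral {0..1} (\<lambda>s. fd f (shrink t s x) (shrink t s (c *s v))) =
    integral {0..1} (\<lambda>s. c * fd f (shrink t s x) (shrink t s v))"
   by (rule integral_cong) (use kreg_on_scale[OF f shrink_in_ball[OF _ x]] in \<open>auto simp: shrink_scale\<close>)
  also have "... = c * integral {0..1} (\<lambda>s. fd f (shrink t s x) (shrink t s v))"
   using integral_linear[OF int[OF x] bounded_linear_mult_right[of c]] by (simp add: o_def)
  finally show "fd (average t f) x (c *s v) = c * fd (average t f) x v"
   unfolding y1[symmetric] Dy[OF x] .
 qed
qed

subsection \<open>Inverse functions\<close>

definition jacobian :: "('k::real_normed_field^'m => 'k^'l) => 'k^'m => 'k^'m^'l" where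
 "jacobian G x = (\<chi> i j. fd G x (axis j 1) $ i)"

lemma klinear_matrix:
 fixes f :: "'k::real_normed_field^'m => 'k^'l"
 assumes "linear f" "!!c v. f (c *s v) = c *s f v"
 shows "f v = (\<chi> i j. f (axis j 1) $ i) *v v"
proof -
 have "v = (\<Sum>j\<in>UNIV. v $ j *s axis j 1)"
  by (simp add: vec_eq_iff axis_def if_distrib cong: if_cong)
 then have "f v = (\<Sum>j\<in>UNIV. v $ j *s f (axis j 1))"
  using linear_sum[OF assms(1), of "\<lambda>j. v $ j *s axis j 1" UNIV] by (simp only: assms(2))
 then show ?thesis
  by (simp add: vec_eq_iff matrix_vector_mult_def mult.commute)
qed

lemma jacobian_works:
 assumes "kmap_on U G" "x \<in> U"
 shows "fd G x v = jacobian G x *v v"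
 unfolding jacobian_def
 by (rule klinear_matrix[OF has_derivative_linear[OF kmap_on_deriv[OF assms]] kmap_on_scale[OF assms]])

lemma kreg_on_jacobian:
 fixes G :: "'k::{real_normed_field,euclidean_space}^'m => 'k^'l"
 assumes "kmap_on U G"
 shows "kreg_on U (\<lambda>x. jacobian G x $ i $ j)"
 by (rule kreg_on_cong[OF kreg_on_frechet[OF kmap_on_nth[OF assms, of i], of "axis j 1"]])
   (simp add: jacobian_def kmap_on_deriv_nth[OF assms])

text \<open>The inverse function theorem gives a differentiable local inverse. Higher regularity is
  bootstrapped: by Cramer's rule its derivative is \<open>Q v i\<close> evaluated at
  \<open>H y\<close>, hence of class k as soon as \<open>H\<close> is, which makes \<open>H\<close>
  of class k + 1.\<close>

theorem kmap_on_inverse: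
 fixes G :: "'k::{real_normed_field,euclidean_space}^'m => 'k^'m"
 assumes G: "kmap_on U G" and x0: "x0 \<in> U" and inj: "inj (fd G x0)"
 obtains V W H where "open V" "V \<subseteq> U" "x0 \<in> V" "open W" "G x0 \<in> W" "homeomorphism V W G H" "kmap_on W H"
proof -
 let ?f = "\<lambda>x. Blinfun (fd G x)"
 have f: "blinfun_apply (?f x) = fd G x" if "x \<in> U" for x
  using has_derivative_bounded_linear[OF kmap_on_deriv[OF G that]] bounded_linear_Blinfun_apply by blast
 have lin0: "linear (fd G x0)"
  using has_derivative_linear[OF kmap_on_deriv[OF G x0]] .
 obtain g where g: "linear g" "g \<circ> fd G x0 = id"
  using linear_injective_left_inverse[OF lin0 inj] by blast
 have cont: "continuous_on U ?f"
 proof (rule continuous_on_blinfun_componentwise)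
  fix b :: "'k^'m"
  have "continuous_on U (\<lambda>x. fd G x b)"
   using kmap_on_Ck[OF G, of "Suc 0"] by simp
  then show "continuous_on U (\<lambda>x. blinfun_apply (?f x) b)"
   by (rule continuous_on_eq) (simp add: f)
 qed
 have inv: "Blinfun g o\<^sub>L ?f x0 = id_blinfun"
 proof (rule blinfun_eqI)
  fix i
  show "blinfun_apply (Blinfun g o\<^sub>L ?f x0) i = blinfun_apply id_blinfun i"
   using g f[OF x0] by (simp add: bounded_linear_Blinfun_apply linear_conv_bounded_linear[symmetric] fun_eq_iff)
 qed
 have "!!x. x \<in> U ==> (G has_derivative blinfun_apply (?f x)) (at x)" using kmap_on_deriv[OF G] f by simp
 from inverse_function_theorem[OF kmap_on_open[OF G] this cont x0 inv]
 obtain V W H H' where V: "open V" "V \<subseteq> U" "x0 \<in> V" "open W" "G x0 \<in> W" and hom: "homeomorphism V W G H"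
  and dH: "!!y. y \<in> W ==> (H has_derivative H' y) (at y)"
  and H': "!!y. y \<in> W ==> H' y = Hilbert_Choice.inv (blinfun_apply (?f (H y)))"
  and bij: "!!y. y \<in> W ==> bij (blinfun_apply (?f (H y)))"
  by metis
 have HV: "H y \<in> V" if "y \<in> W" for y using hom that by (auto simp: homeomorphism_def)
 then have HU: "H y \<in> U" if "y \<in> W" for y using V that by blast
 have JH: "jacobian G (H y) *v H' y v = v" if "y \<in> W" for y v
  using jacobian_works[OF G HU[OF that]] f[OF HU[OF that]] bij[OF that] H'[OF that] by (metis bij_inv_eq_iff)
 have det: "det (jacobian G (H y)) \<noteq> 0" if "y \<in> W" for y
 proof -
  have "inj ((*v) (jacobian G (H y)))"
   using bij[OF that] f[OF HU[OF that]] jacobian_works[OF G HU[OF that]] by (simp add: bij_def fun_eq_iff[symmetric] inj_def)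
  then show ?thesis
   by (metis invertible_left_inverse invertible_det_nz matrix_left_invertible_injective)
 qed
 define Q where "Q v i x = det (\<chi> k l. if l = i then v $ k else jacobian G x $ k $ l) / det (jacobian G x)" for v i x
 define U0 where "U0 = {x \<in> U. det (jacobian G x) \<noteq> 0}"
 have kd: "kreg_on U (\<lambda>x. det (jacobian G x))"
  by (rule kreg_on_det[OF kmap_on_open[OF G] kreg_on_jacobian[OF G]])
 have oU0: "open U0"
 proof -
  have "open (U \<inter> (\<lambda>x. det (jacobian G x)) -` (- {0}))"
   by (rule continuous_open_preimage[OF kreg_on_continuous[OF kd] kmap_on_open[OF G] open_Compl[OF closed_singleton]])
  moreover have "U0 = U \<inter> (\<lambda>x. det (jacobian G x)) -` (- {0})" by (auto simp: U0_def)
  ultimately show ?thesis by simp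
 qed
 have sub: "U0 \<subseteq> U" by (auto simp: U0_def)
 have Q: "kreg_on U0 (Q v i)" for v i
 proof -
  have e: "kreg_on U (\<lambda>x. if l = i then v $ k else jacobian G x $ k $ l)" for k l
   using kreg_on_const[OF kmap_on_open[OF G]] kreg_on_jacobian[OF G] by (cases "l = i") auto
  have n: "kreg_on U (\<lambda>x. det (\<chi> k l. if l = i then v $ k else jacobian G x $ k $ l))"
   by (rule kreg_on_det[OF kmap_on_open[OF G]]) (simp add: e)
  show ?thesis unfolding Q_def
   by (rule kreg_on_divide[OF kreg_on_subset[OF n oU0 sub] kreg_on_subset[OF kd oU0 sub]]) (simp add: U0_def)
 qed
 have HU0: "H y \<in> U0" if "y \<in> W" for y using HU det that by (simp add: U0_def)
 have QH: "H' y v = (\<chi> i. Q v i (H y))" if "y \<in> W" for y v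
  using cramer[OF det[OF that]] JH[OF that, of v] by (simp add: Q_def)
 have DH: "fd H y = H' y" if "y \<in> W" for y
  using frechet_derivative_at[OF dH[OF that]] by simp
 have TH: "Tk k W (\<lambda>s. H)" for k
 proof (induction k)
  case 0
  have "continuous_on W H" using hom by (simp add: homeomorphism_def)
  then have "Ck_on 0 W H" by simp
  then show ?case unfolding Ck_on_eq_Tk .
 next
  case (Suc k)
  show ?case
  proof (rule Tk_SucI[OF V(4) Tk_continuous[OF Suc] dH])
   fix v
   have "Tk k W (\<lambda>s y. (\<chi> i. Q v i (H y)))"
    by (rule Tk_vec[OF V(4)]) (simp add: Tk_compose[OF V(4) oU0 kreg_on_Tk[OF Q] Suc HU0])
   then show "Tk k W (\<lambda>s y. H' y v)"
    by (subst Tk_cong[OF V(4), of _ "\<lambda>s y. (\<chi> i. Q v i (H y))"]) (simp_all add: QH)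
  qed
 qed
 have "kmap_on W H"
  unfolding kmap_on_def
 proof (intro allI kreg_onI[where f' = "\<lambda>y v. H' y v $ _"])
  show "open W" by fact
  show "Ck_on k W (\<lambda>y. H y $ i)" for k i
   unfolding Ck_on_eq_Tk by (rule Tk_bounded_linear[OF bounded_linear_nth V(4) TH])
  show "((\<lambda>y. H y $ i) has_derivative (\<lambda>v. H' y v $ i)) (at y)" if "y \<in> W" for y i
   by (rule bounded_linear.has_derivative[OF bounded_linear_nth dH[OF that]])
  \<comment> \<open>Both vectors are sent to \<open>c *s v\<close> by the Jacobian of
    \<open>G\<close> at \<open>H y\<close>, which is injective.\<close>
  show "H' y (c *s v) $ i = c * H' y v $ i" if "y \<in> W" for y c v i
  proof -
   have "jacobian G (H y) *v (c *s H' y v) = c *s v"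
    using JH[OF that, of v] by (simp add: vector_scalar_commute)
   then have "jacobian G (H y) *v (c *s H' y v) = jacobian G (H y) *v H' y (c *s v)"
    using JH[OF that, of "c *s v"] by simp
   then have "c *s H' y v = H' y (c *s v)"
    by (metis det[OF that] invertible_det_nz invertible_left_inverse matrix_left_invertible_injective injD)
   then show ?thesis by (metis vector_smult_component)
  qed
 qed
 then show thesis using that V hom by blast
qed

subsection \<open>Flows of time-dependent vector fields\<close>

text \<open>Time becomes the coordinate \<open>None\<close>, so that a time-dependent field is a map
  germ on one vector space over the scalar field, regular in time as well as in space.\<close>

definition scons :: "'k => 'k^'m => 'k^('m::finite option)" where
 "scons s x = (\<chi> i. case i of None => s | Some j => x $ j)"

lemma scons_nth [simp]: "scons s x $ None = s" "scons s x $ Some j = x $ j"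
 by (simp_all add: scons_def)

lemma scons_0 [simp]: "scons 0 0 = (0 :: 'k::zero^('m::finite option))"
 by (simp add: vec_eq_iff scons_def zero_vec_def split: option.split)

lemma scons_add: "scons (s + t) (x + y) = scons s x + scons t (y :: 'k::semigroup_add^'m)"
 by (simp add: vec_eq_iff scons_def split: option.split)

lemma linear_scons: "linear (\<lambda>z. scons (fst z) (snd z) :: 'k::real_normed_field^('m::finite option))"
 by (rule linearI) (auto simp: vec_eq_iff scons_def split: option.split)

lemma bounded_linear_scons:
 "bounded_linear (\<lambda>z. scons (fst z) (snd z) :: 'k::{real_normed_field,euclidean_space}^('m::finite option))"
 using linear_scons linear_conv_bounded_linear by blast

lemma bounded_linear_scons_space:
 "bounded_linear (\<lambda>y. scons 0 y :: 'k::{real_normed_field,euclidean_space}^('m::finite option))"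
 using bounded_linear_compose[OF bounded_linear_scons bounded_linear_Pair[OF bounded_linear_zero bounded_linear_ident]] by simp

lemma scons_has_derivative:
 assumes "(f has_derivative f') (at x within S)" "(g has_derivative g') (at x within S)"
 shows "((\<lambda>x. scons (f x) (g x) :: 'k::{real_normed_field,euclidean_space}^('m::finite option)) has_derivative (\<lambda>v. scons (f' v) (g' v))) (at x within S)"
 using bounded_linear.has_derivative[OF bounded_linear_scons has_derivative_Pair[OF assms]] by simp

lemma continuous_on_scons:
 fixes g :: "'a::topological_space => 'k::{real_normed_field,euclidean_space}^'m"
 assumes "continuous_on A f" "continuous_on A g"
 shows "continuous_on A (\<lambda>x. scons (f x) (g x))"
 using bounded_linear.continuous_on[OF bounded_linear_scons continuous_on_Pair[OF assms]] by simp

lemma norm_time_le: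
 assumes "\<bar>a\<bar> \<le> r" "t \<in> {0..1}"
 shows "norm (of_real (t * a) :: 'k::real_normed_field) \<le> r"
proof -
 have "\<bar>t\<bar> * \<bar>a\<bar> \<le> \<bar>a\<bar>" using assms(2) by (intro mult_left_le_one_le) auto
 then show ?thesis using assms(1) unfolding norm_of_real abs_mult by linarith
qed

text \<open>A single bound for the size and for the Lipschitz constant keeps the notion stable under
  shrinking \<open>r\<close> and enlarging \<open>L\<close>, so that a field and its holomorphic
  extension can share both constants.\<close>

definition tame :: "('k::{real_normed_field,euclidean_space}^('m::finite option)) set => ('k^('m::finite option) => 'k^'m) => real => real => bool" where
 "tame U X r L \<longleftrightarrow> r > 0 \<and> L > 0 \<and> kmap_on U X \<and>
   (\<forall>s y. norm s \<le> r \<and> norm y \<le> r --> scons s y \<in> U \<and> norm (X (scons s y)) \<le> L \<and>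
    (\<forall>y'. norm y' \<le> r --> norm (X (scons s y) - X (scons s y')) \<le> L * norm (y - y')))"

lemma tame_mono:
 assumes "tame U X r L" "0 < r'" "r' \<le> r" "L \<le> L'"
 shows "tame U X r' L'"
proof -
 have "L * norm z \<le> L' * norm z" for z :: "'a^'b" using assms(4) by (simp add: mult_right_mono)
 then show ?thesis using assms unfolding tame_def by (smt (verit, best) order_trans)
qed

lemma tame_exists:
 fixes X :: "'k::{real_normed_field,euclidean_space}^('m::finite option) => 'k^'m"
 assumes X: "kmap_on U X" and U0: "0 \<in> U"
 shows "\<exists>r L. tame U X r L"
proof -
 obtain R where R: "R > 0" "cball 0 R \<subseteq> U" using kmap_on_open[OF X] U0 open_contains_cball by blast
 obtain K where K: "K > 0" "!!z. norm (scons (fst z) (snd z) :: 'k^('m::finite option)) \<le> norm z * K"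
  using bounded_linear.pos_bounded[OF bounded_linear_scons] by blast
 \<comment> \<open>A pair with both entries bounded by \<open>r\<close> has norm at most 2r, and
   \<open>scons\<close> enlarges norms by at most \<open>K\<close>, so its value stays in the closed
   ball of radius \<open>R\<close>.\<close>
 define r where "r = R / (2 * K)"
 have r: "r > 0" using R K by (simp add: r_def)
 have inR: "scons s y \<in> cball 0 R" if "norm s \<le> r" "norm y \<le> r" for s :: 'k and y :: "'k^'m"
 proof -
  have "norm (scons s y) \<le> norm (s, y) * K" using K(2)[of "(s, y)"] by simp
  also have "... \<le> (r + r) * K"
   using norm_Pair_le[of s y] that K(1) by (intro mult_right_mono) auto
  also have "... = R" using K by (simp add: r_def)
  finally show ?thesis by simp
 qed
 have "\<exists>M. \<forall>x\<in>cball 0 R. norm (fd X x b) \<le> M" for b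
 proof -
  have "continuous_on (cball 0 R) (\<lambda>x. fd X x b)"
   by (rule continuous_on_subset[OF _ R(2)]) (use kmap_on_Ck[OF X, of "Suc 0"] in simp)
  then have "compact ((\<lambda>x. fd X x b) ` cball 0 R)"
   by (rule compact_continuous_image) simp
  then show ?thesis using compact_imp_bounded by (fastforce simp: bounded_iff)
 qed
 then have "\<exists>M. \<forall>b. \<forall>x\<in>cball 0 R. norm (fd X x b) \<le> M b" by (intro choice) blast
 then obtain M where M: "!!b x. x \<in> cball 0 R ==> norm (fd X x b) \<le> M b" by blast
 define L1 where "L1 = (\<Sum>b\<in>Basis. \<bar>M b\<bar>)"
 have L1: "norm (fd X x v) \<le> L1 * norm v" if x: "x \<in> cball 0 R" for x v
 proof -
  have l: "linear (fd X x)"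
   using has_derivative_linear[OF kmap_on_deriv[OF X]] R(2) x by blast
  show ?thesis unfolding L1_def by (rule linear_Basis_bound[OF l order_trans[OF M[OF x] abs_ge_self]])
 qed
 have L10: "L1 \<ge> 0" by (auto simp: L1_def intro: sum_nonneg)
 have lip: "norm (X a - X b) \<le> L1 * norm (a - b)" if "a \<in> cball 0 R" "b \<in> cball 0 R" for a b
 proof (rule differentiable_bound[OF convex_cball _ _ that(1,2)])
  show "(X has_derivative fd X x) (at x within cball 0 R)" if "x \<in> cball 0 R" for x
   using kmap_on_deriv[OF X] that R(2) by (blast intro: has_derivative_at_withinI)
  show "onorm (fd X x) \<le> L1" if "x \<in> cball 0 R" for x
   by (rule onorm_le) (rule L1[OF that])
 qed
 \<comment> \<open>The first summand dominates the Lipschitz constant in space, the bracket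
   dominates the size of the field, and 1 makes the sum positive.\<close>
 define L where "L = L1 * K + (norm (X 0) + L1 * R) + 1"
 show ?thesis
 proof (rule exI[of _ r], rule exI[of _ L])
  have Lpos: "L > 0" using L10 K(1) R(1) by (simp add: L_def add_nonneg_pos)
  have U: "scons s y \<in> U" if sy: "norm s \<le> r" "norm y \<le> r" for s :: 'k and y :: "'k^'m"
   using inR[OF sy] R(2) by blast
  have bd: "norm (X (scons s y)) \<le> L" if sy: "norm s \<le> r" "norm y \<le> r" for s :: 'k and y :: "'k^'m"
  proof -
   have "norm (X (scons s y)) \<le> norm (X 0) + norm (X (scons s y) - X 0)"
    by (metis norm_triangle_sub)
   also have "norm (X (scons s y) - X 0) \<le> L1 * norm (scons s y - 0)"
    using inR[OF sy] R(1) by (intro lip) auto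
   also have "... \<le> L1 * R" using inR[OF sy] L10 by (intro mult_left_mono) auto
   finally show ?thesis using mult_nonneg_nonneg[OF L10 less_imp_le[OF K(1)]] by (simp add: L_def)
  qed
  have lp: "norm (X (scons s y) - X (scons s y')) \<le> L * norm (y - y')"
   if sy: "norm s \<le> r" "norm y \<le> r" and y': "norm y' \<le> r" for s :: 'k and y y' :: "'k^'m"
  proof -
   have "norm (X (scons s y) - X (scons s y')) \<le> L1 * norm (scons s y - scons s y')"
    by (rule lip[OF inR[OF sy] inR[OF sy(1) y']])
   also have "scons s y - scons s y' = scons 0 (y - y')"
    by (simp add: vec_eq_iff scons_def split: option.split)
   also have "norm (scons 0 (y - y')) \<le> norm (y - y') * K"
    using K(2)[of "(0, y - y')"] by (simp add: norm_Pair)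
   then have "L1 * norm (scons 0 (y - y')) \<le> L1 * (norm (y - y') * K)" using L10 by (intro mult_left_mono) auto
   also have "... \<le> L * norm (y - y')"
   proof -
    have "L1 * K \<le> L" using L10 R(1) by (simp add: L_def)
    from mult_right_mono[OF this norm_ge_zero, of "y - y'"] show ?thesis by (simp add: mult_ac)
   qed
   finally show ?thesis .
  qed
  show "tame U X r L" unfolding tame_def using r X Lpos U bd lp by blast
 qed
qed

text \<open>The flow up to time \<open>a\<close> is rescaled to the unit interval; the factor
  \<open>a\<close> then provides the small contraction constant.\<close>

abbreviation (input) vf where "vf X a t y \<equiv> a *\<^sub>R X (scons (of_real (t * a)) y)"

definition flow_on :: "('k::{real_normed_field,euclidean_space}^('m::finite option) => 'k^'m) => real => real => (real => 'k^'m) => 'k^'m => bool" where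
 "flow_on X a r y x \<longleftrightarrow> continuous_on {0..1} y \<and>
   (\<forall>s\<in>{0..1}. norm (y s) < r \<and> y s = x + integral {0..s} (\<lambda>t. vf X a t (y t)))"

lemma flow_onD:
 assumes "flow_on X a r y x"
 shows "continuous_on {0..1} y"
  and "s \<in> {0..1} ==> norm (y s) < r" "s \<in> {0..1} ==> norm (y s) \<le> r"
  and "s \<in> {0..1} ==> y s = x + integral {0..s} (\<lambda>t. vf X a t (y t))"
 using assms unfolding flow_on_def by (blast intro: less_imp_le)+

lemma flow_field_continuous:
 assumes "tame U X r L" "\<bar>a\<bar> \<le> r" "continuous_on {0..1} y" "!!s. s \<in> {0..1} ==> norm (y s) \<le> r"
 shows "continuous_on {0..1} (\<lambda>t. vf X a t (y t))"
proof -
 have c: "continuous_on {0..1} (\<lambda>t. scons (of_real (t * a)) (y t))"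
  by (intro continuous_on_scons continuous_intros assms(3))
 have "(\<lambda>t. scons (of_real (t * a)) (y t)) ` {0..1} \<subseteq> U"
 proof (rule image_subsetI)
  fix t :: real assume "t \<in> {0..1}"
  then show "scons (of_real (t * a)) (y t) \<in> U"
   using assms(1) norm_time_le[OF assms(2)] assms(4) unfolding tame_def by blast
 qed
 from continuous_on_compose2[OF kmap_on_continuous c this] assms(1)
 show ?thesis by (intro continuous_intros) (auto simp: tame_def)
qed

lemma flow_unique:
 assumes t: "tame U X r L" and a: "\<bar>a\<bar> \<le> r" "\<bar>a\<bar> * L \<le> 1/4"
  and y: "flow_on X a r y x" and z: "flow_on X a r z x" and s: "s \<in> {0..1}"
 shows "y s = z s"
proof -
 have cy: "continuous_on {0..1} (\<lambda>t. vf X a t (y t))"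
  by (rule flow_field_continuous[OF t a(1) flow_onD(1,3)[OF y]])
 have cz: "continuous_on {0..1} (\<lambda>t. vf X a t (z t))"
  by (rule flow_field_continuous[OF t a(1) flow_onD(1,3)[OF z]])
 have "norm (y s - z s) \<le> 0 / (1 - 1/4)"
 proof (rule contraction_bound[OF _ _ _ s])
  show "continuous_on {0..1} (\<lambda>s. y s - z s)" by (intro continuous_intros flow_onD(1)[OF y] flow_onD(1)[OF z])
  fix M and s :: real assume M: "!!t. t \<in> {0..1} ==> norm (y t - z t) \<le> M" and s: "s \<in> {0..1}"
  have "y s - z s = integral {0..s} (\<lambda>t. vf X a t (y t) - vf X a t (z t))"
   unfolding flow_onD(4)[OF y s] flow_onD(4)[OF z s] using integral_unit_diff[OF cy cz s] by simp
  also have "norm ... \<le> M / 4"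
  proof (rule integral_unit_bound[OF continuous_on_diff[OF cy cz] _ s])
   fix t :: real assume t1: "t \<in> {0..1}"
   have "norm (of_real (t * a) :: 'a) \<le> r" by (rule norm_time_le[OF a(1) t1])
   moreover have "norm (y t) \<le> r" "norm (z t) \<le> r" using flow_onD(3)[OF y t1] flow_onD(3)[OF z t1] .
   ultimately have "norm (X (scons (of_real (t * a)) (y t)) - X (scons (of_real (t * a)) (z t))) \<le> L * norm (y t - z t)"
    using t unfolding tame_def by blast
   then have "\<bar>a\<bar> * norm (X (scons (of_real (t * a)) (y t)) - X (scons (of_real (t * a)) (z t))) \<le> \<bar>a\<bar> * (L * norm (y t - z t))"
    by (rule mult_left_mono) simp
   also have "... \<le> 1/4 * norm (y t - z t)"
    using mult_right_mono[OF a(2) norm_ge_zero[of "y t - z t"]] by (simp add: mult.assoc)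
   also have "... \<le> M / 4" using M[OF t1] by simp
   finally show "norm (vf X a t (y t) - vf X a t (z t)) \<le> M / 4"
    by (simp add: scaleR_diff_right[symmetric])
  qed
  finally show "norm (y s - z s) \<le> 0 + 1/4 * M" by simp
 qed simp
 then show ?thesis by simp
qed

text \<open>The closest-point projection to the ball extends the field to the whole space without
  increasing its Lipschitz constant. A solution starting within r/2 moves by at most r/4, so it
  stays in the ball, where the projection is the identity.\<close>

lemma flow_exists:
 fixes X :: "'k::{real_normed_field,euclidean_space}^('m::finite option) => 'k^'m"
 assumes t: "tame U X r L" and a: "\<bar>a\<bar> \<le> r" "\<bar>a\<bar> * L \<le> 1/4" "\<bar>a\<bar> * L \<le> r/4" and x: "norm x < r / 2"
 shows "\<exists>y. flow_on X a r y x"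
proof -
 have X: "kmap_on U X" and r: "r > 0" using t by (auto simp: tame_def)
 let ?p = "closest_point (cball 0 r) :: 'k^'m => 'k^'m"
 have ne: "cball 0 r \<noteq> ({} :: ('k^'m) set)" using r by simp
 have pr: "norm (?p y) \<le> r" for y using closest_point_in_set[OF closed_cball ne, of y] by simp
 have pl: "norm (?p y - ?p y') \<le> norm (y - y')" for y y'
  using closest_point_lipschitz[OF convex_cball closed_cball ne, of y y'] by (simp add: dist_norm)
 have nt: "norm (of_real (t * a) :: 'k) \<le> r" if "t \<in> {0..1}" for t
  by (rule norm_time_le[OF a(1) that])
 define G where "G t y = vf X a t (?p y)" for t y
 have "\<exists>w. continuous_on {0..1} w \<and> (\<forall>s\<in>{0..1}. w s = x + integral {0..s} (\<lambda>t. G t (w t)))"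
 proof (rule integral_equation_exists)
  have c: "continuous_on ({0..1} \<times> UNIV) (\<lambda>z::real \<times> ('k^'m). scons (of_real (fst z * a)) (?p (snd z)))"
   by (intro continuous_on_scons continuous_intros
     continuous_on_compose2[OF continuous_on_closest_point[OF convex_cball closed_cball ne]]) auto
  have "(\<lambda>z::real \<times> ('k^'m). scons (of_real (fst z * a)) (?p (snd z))) ` ({0..1} \<times> UNIV) \<subseteq> U"
   using t nt pr unfolding tame_def by auto
  from continuous_on_compose2[OF kmap_on_continuous[OF X] c this]
  show "continuous_on ({0..1} \<times> UNIV) (\<lambda>z. G (fst z) (snd z))"
   unfolding G_def by (intro continuous_intros)
  fix s y y' assume s: "s \<in> {0..1::real}"
  have "norm (X (scons (of_real (s * a)) (?p y)) - X (scons (of_real (s * a)) (?p y'))) \<le> L * norm (?p y - ?p y')"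
   using t nt[OF s] pr unfolding tame_def by blast
  also have "... \<le> L * norm (y - y')" using pl t by (intro mult_left_mono) (auto simp: tame_def)
  finally have "\<bar>a\<bar> * norm (X (scons (of_real (s * a)) (?p y)) - X (scons (of_real (s * a)) (?p y'))) \<le> \<bar>a\<bar> * (L * norm (y - y'))"
   by (rule mult_left_mono) simp
  also have "... \<le> 1/4 * norm (y - y')"
   using mult_right_mono[OF a(2) norm_ge_zero[of "y - y'"]] by (simp add: mult.assoc)
  finally have "norm (G s y - G s y') \<le> 1/4 * norm (y - y')"
   by (simp add: G_def scaleR_diff_right[symmetric])
  then show "norm (G s y - G s y') \<le> norm (y - y') / 2" using norm_ge_zero[of "y - y'"] by linarith
 qed
 then obtain w where w: "continuous_on {0..1} w" "!!s. s \<in> {0..1} ==> w s = x + integral {0..s} (\<lambda>t. G t (w t))" by blast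
 have "continuous_on {0..1} (\<lambda>t. ?p (w t))"
  by (rule continuous_on_compose2[OF continuous_on_closest_point[OF convex_cball closed_cball ne] w(1) subset_UNIV])
 from flow_field_continuous[OF t a(1) this pr]
 have cG: "continuous_on {0..1} (\<lambda>t. G t (w t))" by (simp add: G_def)
 have wr: "norm (w s) < r" if s: "s \<in> {0..1}" for s
 proof -
  have "norm (integral {0..s} (\<lambda>t. G t (w t))) \<le> r / 4"
  proof (rule integral_unit_bound[OF cG _ s])
   fix u :: real assume u: "u \<in> {0..1}"
   have "norm (X (scons (of_real (u * a)) (?p (w u)))) \<le> L"
    using t nt[OF u] pr unfolding tame_def by blast
   from mult_left_mono[OF this, of "\<bar>a\<bar>"] a(3) show "norm (G u (w u)) \<le> r / 4" by (simp add: G_def)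
  qed
  then show ?thesis using w(2)[OF s] x r norm_triangle_ineq[of x "integral {0..s} (\<lambda>t. G t (w t))"] by simp
 qed
 have "flow_on X a r w x" unfolding flow_on_def
 proof (intro conjI ballI w(1) wr)
  fix s :: real assume s: "s \<in> {0..1}"
  have "integral {0..s} (\<lambda>t. G t (w t)) = integral {0..s} (\<lambda>t. vf X a t (w t))"
  proof (rule integral_cong)
   fix t assume "t \<in> {0..s}"
   then have "w t \<in> cball 0 r" using wr[of t] s by auto
   then show "G t (w t) = vf X a t (w t)" by (simp add: G_def closest_point_self)
  qed
  then show "w s = x + integral {0..s} (\<lambda>t. vf X a t (w t))" using w(2)[OF s] by simp
 qed
 then show ?thesis by blast
qed

text \<open>An instance of \<open>integral_equation\<close> with the initial value as parameter. The
  bound 1/4 is sharper than the 1/2 demanded there; the argument for injectivity uses the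
  difference.\<close>

theorem flow_regular:
 fixes X :: "'k::{real_normed_field,euclidean_space}^('m::finite option) => 'k^'m"
 assumes t: "tame U X r L" and a: "\<bar>a\<bar> \<le> r" "\<bar>a\<bar> * L \<le> 1/4"
  and y: "!!x. norm x < r / 2 ==> flow_on X a r (\<lambda>s. y s x) x"
 shows "s \<in> {0..1} ==> kmap_on (ball 0 (r/2)) (y s)"
  and "norm x < r/2 ==> continuous_on {0..1} (\<lambda>s. fd (y s) x v)"
  and "norm x < r/2 ==> s \<in> {0..1} ==> fd (y s) x v = v + integral {0..s}
    (\<lambda>t. a *\<^sub>R fd X (scons (of_real (t * a)) (y t x)) (scons 0 (fd (y t) x v)))"
  and "norm x < r/2 ==> s \<in> {0..1} ==> inj (fd (y s) x)"
proof -
 let ?V = "ball 0 (r/2) :: ('k^'m) set" and ?B = "ball 0 r :: ('k^'m) set"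
 define F where "F t z = vf X a t (snd z)" for t and z :: "('k^'m) \<times> ('k^'m)"
 have X: "kmap_on U X" and r: "r > 0" using t by (auto simp: tame_def)
 have nt: "norm (of_real (t * a) :: 'k) \<le> r" if "t \<in> {0..1}" for t
  by (rule norm_time_le[OF a(1) that])
 have inU: "scons (of_real (s * a)) y \<in> U" if "s \<in> {0..1}" "norm y \<le> r" for s and y :: "'k^'m"
  using t nt[OF that(1)] that(2) unfolding tame_def by blast
 have oVB: "open (?V \<times> ?B)" by (auto intro: open_Times)
 have TF: "Tk k (?V \<times> ?B) F" for k
 proof -
  have "Tk k (?V \<times> ?B) (\<lambda>s z. scons (of_real (s * a)) 0 + (scons 0 (snd z) :: 'k^('m::finite option)))"
  proof (intro Tk_add[OF oVB] Tk_time[OF _ oVB] Tk_space_linear[OF _ oVB])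
   show "continuous_on {0..1} (\<lambda>s. scons (of_real (s * a)) 0 :: 'k^('m::finite option))"
    by (intro continuous_on_scons continuous_intros)
   show "bounded_linear (\<lambda>z :: ('k^'m) \<times> ('k^'m). scons 0 (snd z) :: 'k^('m::finite option))"
    by (rule bounded_linear_compose[OF bounded_linear_scons_space bounded_linear_snd])
  qed
  then have "Tk k (?V \<times> ?B) (\<lambda>s z. (scons (of_real (s * a)) (snd z) :: 'k^('m::finite option)))"
   by (simp add: scons_add[symmetric])
  then have "Tk k (?V \<times> ?B) (\<lambda>s z. X (scons (of_real (s * a)) (snd z)))"
   by (rule Tk_compose[OF oVB kmap_on_open[OF X] kmap_on_Tk[OF X]]) (rule inU, auto)
  then show ?thesis unfolding F_def
   by (rule Tk_bounded_linear[OF bounded_linear_scaleR_right oVB])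
 qed
 have c: "Ck_on k ?V (\<lambda>x. x)" for k by (simp add: Ck_on_eq_Tk Tk_space_linear[OF bounded_linear_ident open_ball])
 interpret integral_equation ?V ?B F "\<lambda>x. x" y
 proof
  show "continuous_on ({0..1} \<times> ?V \<times> ?B) (\<lambda>z. F (fst z) (snd z))" using Tk_continuous[OF TF[of 0]] .
  fix s :: real and x u u' assume s: "s \<in> {0..1}" and u: "u \<in> ?B" "u' \<in> ?B"
  have "norm (X (scons (of_real (s * a)) u) - X (scons (of_real (s * a)) u')) \<le> L * norm (u - u')"
   using t nt[OF s] u unfolding tame_def by auto
  then have "\<bar>a\<bar> * norm (X (scons (of_real (s * a)) u) - X (scons (of_real (s * a)) u')) \<le> \<bar>a\<bar> * (L * norm (u - u'))"
   by (rule mult_left_mono) simp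
  also have "... \<le> 1/4 * norm (u - u')"
   using mult_right_mono[OF a(2) norm_ge_zero[of "u - u'"]] by (simp add: mult.assoc)
  also have "... \<le> norm (u - u') / 2" by simp
  finally show "norm (F s (x, u) - F s (x, u')) \<le> norm (u - u') / 2"
   by (simp add: F_def scaleR_diff_right[symmetric])
 next
  show "!!s x. s \<in> {0..1} ==> x \<in> ?V ==> y s x \<in> ?B" using flow_onD(2)[OF y] by simp
  show "!!x. x \<in> ?V ==> continuous_on {0..1} (\<lambda>s. y s x)" using flow_onD(1)[OF y] by simp
  show "!!s x. s \<in> {0..1} ==> x \<in> ?V ==> y s x = x + integral {0..s} (\<lambda>t. F t (x, y t x))"
   using flow_onD(4)[OF y] unfolding F_def snd_conv mem_ball_0 by blast
 qed (auto intro!: continuous_intros)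
 have T: "Tk k ?V y" for k by (rule Tk_integral_equation[OF integral_equation_axioms TF c])
 have dF: "fd (F s) (x, u) (v, w) = a *\<^sub>R fd X (scons (of_real (s * a)) u) (scons 0 w)"
  if "s \<in> {0..1}" "u \<in> ?B" for s x u v w
 proof -
  have "((\<lambda>z :: ('k^'m) \<times> ('k^'m). scons (of_real (s * a)) (snd z) :: 'k^('m::finite option)) has_derivative (\<lambda>z. scons 0 (snd z))) (at (x, u))"
   by (intro scons_has_derivative has_derivative_const has_derivative_snd has_derivative_ident)
  from has_derivative_compose[OF this, of X] kmap_on_deriv[OF X inU[OF that(1), of u]] that(2)
  have "((\<lambda>z. X (scons (of_real (s * a)) (snd z))) has_derivative (\<lambda>z. fd X (scons (of_real (s * a)) u) (scons 0 (snd z)))) (at (x, u))"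
   by simp
  from frechet_derivative_at[OF has_derivative_scaleR_right[OF this, of a]]
  show ?thesis unfolding F_def by (metis snd_conv)
 qed
 have D1: "fd (\<lambda>x::'k^'m. x) x v = v" for x v
  using frechet_derivative_at[OF has_derivative_ident[of "at x"]] by metis
 show cD: "norm x < r/2 ==> continuous_on {0..1} (\<lambda>s. fd (y s) x v)" for x v
  using y_derivative_eq(1)[OF TF c] by simp
 have yF: "fd (y s) x v = v + integral {0..s} (\<lambda>t. fd (F t) (x, y t x) (v, fd (y t) x v))"
  if "norm x < r/2" "s \<in> {0..1}" for s x v
  using y_derivative_eq(2)[OF TF c _ that(2), of x v] that(1) D1 by simp
 show yD: "fd (y s) x v = v + integral {0..s}
    (\<lambda>t. a *\<^sub>R fd X (scons (of_real (t * a)) (y t x)) (scons 0 (fd (y t) x v)))"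
  if x: "norm x < r/2" and s: "s \<in> {0..1}" for s x v
 proof -
  have "integral {0..s} (\<lambda>t. fd (F t) (x, y t x) (v, fd (y t) x v)) = integral {0..s}
    (\<lambda>t. a *\<^sub>R fd X (scons (of_real (t * a)) (y t x)) (scons 0 (fd (y t) x v)))"
   by (rule integral_cong, rule dF) (use y_B x s in auto)
  then show ?thesis using yF[OF x s] by simp
 qed
 have cDF: "continuous_on {0..1} (\<lambda>t. fd (F t) (x, y t x) (v, fd (y t) x v))"
  if "norm x < r/2" for x v
  using DF_along[OF TF c _ cD] that by auto
 have dyx: "(y s has_derivative fd (y s) x) (at x)" if "norm x < r/2" "s \<in> {0..1}" for s x
  using Tk_Suc_has_derivative[OF T that(2), of x] that(1) by simp
 have FD: "norm (fd (F t) (x, y t x) (v, w)) \<le> norm w / 4" if "norm x < r/2" "t \<in> {0..1}" for t x v w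
 proof -
  have yr: "y t x \<in> ?B" using y_B[OF that(2)] that(1) by simp
  have "((\<lambda>u'. vf X a t u') has_derivative (\<lambda>w. a *\<^sub>R fd X (scons (of_real (t * a)) (y t x)) (scons 0 w))) (at (y t x))"
  proof -
   have 1: "((\<lambda>u'. scons (of_real (t * a)) u' :: 'k^('m::finite option)) has_derivative scons 0) (at (y t x))"
    by (intro scons_has_derivative has_derivative_const has_derivative_ident)
   have 2: "(X has_derivative fd X (scons (of_real (t * a)) (y t x))) (at (scons (of_real (t * a)) (y t x)))"
    using kmap_on_deriv[OF X inU[OF that(2)]] yr by simp
   show ?thesis by (rule has_derivative_scaleR_right[OF has_derivative_compose[OF 1 2]])
  qed
  moreover
  have "norm (vf X a t u - vf X a t (y t x)) \<le> 1/4 * norm (u - y t x)" if u: "u \<in> ?B" for u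
  proof -
   have "norm (X (scons (of_real (t * a)) u) - X (scons (of_real (t * a)) (y t x))) \<le> L * norm (u - y t x)"
    using \<open>tame U X r L\<close> nt[OF \<open>t \<in> {0..1}\<close>] u yr unfolding tame_def by auto
   then have "\<bar>a\<bar> * norm (X (scons (of_real (t * a)) u) - X (scons (of_real (t * a)) (y t x))) \<le> \<bar>a\<bar> * (L * norm (u - y t x))"
    by (rule mult_left_mono) simp
   also have "... \<le> 1/4 * norm (u - y t x)"
    using mult_right_mono[OF a(2) norm_ge_zero[of "u - y t x"]] by (simp add: mult.assoc)
   finally show ?thesis by (simp add: scaleR_diff_right[symmetric])
  qed
  ultimately have "norm (a *\<^sub>R fd X (scons (of_real (t * a)) (y t x)) (scons 0 w)) \<le> 1/4 * norm w"
   by (rule lipschitz_derivative_bound[OF _ open_ball yr])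
  then show ?thesis using dF[OF that(2) yr] by simp
 qed
 show "inj (fd (y s) x)" if x: "norm x < r/2" and s: "s \<in> {0..1}" for s x
 proof -
  \<comment> \<open>Absorption with factor 1/4 bounds the derivative along the trajectory by 4/3 of
    the norm of \<open>v\<close>, hence the integral by 1/3 of it. But the integral equals
    \<open>- v\<close> if the derivative at time \<open>s\<close> kills \<open>v\<close>.\<close>
  have "v = 0" if v0: "fd (y s) x v = 0" for v
  proof -
   have b: "norm (fd (y u) x v) \<le> norm v / (1 - 1/4)" if u: "u \<in> {0..1}" for u
   proof (rule contraction_bound[OF cD[OF x] _ _ u])
    fix M and u :: real assume M: "!!t. t \<in> {0..1} ==> norm (fd (y t) x v) \<le> M" and u: "u \<in> {0..1}"
    have "norm (integral {0..u} (\<lambda>t. fd (F t) (x, y t x) (v, fd (y t) x v))) \<le> M / 4"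
    proof (rule integral_unit_bound[OF cDF[OF x] _ u])
     fix t :: real assume t1: "t \<in> {0..1}"
     show "norm (fd (F t) (x, y t x) (v, fd (y t) x v)) \<le> M / 4"
      using FD[OF x t1, of v "fd (y t) x v"] M[OF t1] by linarith
    qed
    then show "norm (fd (y u) x v) \<le> norm v + 1/4 * M"
     unfolding yF[OF x u, of v] by (intro norm_triangle_le) simp
   qed simp
   have "norm (integral {0..s} (\<lambda>t. fd (F t) (x, y t x) (v, fd (y t) x v))) \<le> norm v / 3"
   proof (rule integral_unit_bound[OF cDF[OF x] _ s])
    fix t :: real assume t1: "t \<in> {0..1}"
    show "norm (fd (F t) (x, y t x) (v, fd (y t) x v)) \<le> norm v / 3"
     using FD[OF x t1, of v "fd (y t) x v"] b[OF t1] by simp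
   qed
   moreover have "integral {0..s} (\<lambda>t. fd (F t) (x, y t x) (v, fd (y t) x v)) = - v"
    using yF[OF x s, of v] v0 by (simp add: eq_neg_iff_add_eq_0 add.commute)
   ultimately show "v = 0" by simp
  qed
  then show ?thesis using linear_injective_0[OF has_derivative_linear[OF dyx[OF x s]]] by blast
 qed
 show "kmap_on ?V (y s)" if s: "s \<in> {0..1}" for s
  unfolding kmap_on_def
 proof (intro allI kreg_onI[OF open_ball])
  show "Ck_on k ?V (\<lambda>x. y s x $ i)" for k i
   unfolding Ck_on_eq_Tk
   by (rule Tk_bounded_linear[OF bounded_linear_nth open_ball]) (use Ck_on_Tk[OF T s] in \<open>simp add: Ck_on_eq_Tk\<close>)
  show "((\<lambda>x. y s x $ i) has_derivative (\<lambda>v. fd (y s) x v $ i)) (at x)" if "x \<in> ?V" for i x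
   using bounded_linear.has_derivative[OF bounded_linear_nth dyx[OF _ s]] that by simp
  fix x c v i assume "x \<in> ?V"
  then have x: "norm x < r/2" by simp
  \<comment> \<open>The defect of scalar-linearity solves the homogeneous linearised equation, so it
    vanishes by uniqueness.\<close>
  let ?e = "\<lambda>u. fd (y u) x (c *s v) - c *s fd (y u) x v"
  have blc: "bounded_linear (\<lambda>v :: 'k^'m. c *s v)"
   unfolding linear_conv_bounded_linear[symmetric] by (rule linearI) (auto simp: vec_eq_iff algebra_simps)
  have ce: "continuous_on {0..1} ?e" by (intro continuous_intros cD[OF x] bounded_linear.continuous_on[OF blc])
  have "?e s = 0"
  proof (rule linearised_unique[OF TF c _ ce _ _ s])
   show "x \<in> ?V" using x by simp
   show "continuous_on {0..1} (\<lambda>t. fd (F t) (x, y t x) (0, ?e t))"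
    using DF_along[OF TF c _ ce] x by simp
   fix u :: real assume u: "u \<in> {0..1}"
   have "integral {0..u} (\<lambda>t. fd (F t) (x, y t x) (0, ?e t)) =
     integral {0..u} (\<lambda>t. fd (F t) (x, y t x) (c *s v, fd (y t) x (c *s v))
      - c *s fd (F t) (x, y t x) (v, fd (y t) x v))"
   proof (rule integral_cong)
    fix t assume "t \<in> {0..u}"
    then have t1: "t \<in> {0..1}" using u by auto
    have yr: "y t x \<in> ?B" using y_B[OF t1] x by simp
    have XU: "scons (of_real (t * a)) (y t x) \<in> U" using inU[OF t1] yr by simp
    note l = has_derivative_linear[OF kmap_on_deriv[OF X XU]]
    have sd: "(scons 0 (p - c *s q) :: 'k^('m::finite option)) = scons 0 p - c *s scons 0 q" for p q
     by (simp add: vec_eq_iff scons_def split: option.split)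
    show "fd (F t) (x, y t x) (0, ?e t) =
      fd (F t) (x, y t x) (c *s v, fd (y t) x (c *s v))
      - c *s fd (F t) (x, y t x) (v, fd (y t) x v)"
     unfolding dF[OF t1 yr] sd linear_diff[OF l] kmap_on_scale[OF X XU]
     by (simp add: vec_eq_iff algebra_simps)
   qed
   also have "... = integral {0..u} (\<lambda>t. fd (F t) (x, y t x) (c *s v, fd (y t) x (c *s v)))
      - c *s integral {0..u} (\<lambda>t. fd (F t) (x, y t x) (v, fd (y t) x v))"
   proof -
    have i: "(\<lambda>t. fd (F t) (x, y t x) (v, fd (y t) x v)) integrable_on {0..u}" for v
     by (rule integrable_continuous_real, rule continuous_on_subset[OF cDF[OF x]]) (use u in auto)
    have ic: "(\<lambda>t. c *s fd (F t) (x, y t x) (v, fd (y t) x v)) integrable_on {0..u}"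
     using integrable_linear[OF i blc] by (simp add: o_def)
    show ?thesis
     using integral_diff[OF i ic, of "c *s v"] integral_linear[OF i blc, of v] by (simp add: o_def)
   qed
   also have "... = ?e u" unfolding yF[OF x u, of v] yF[OF x u, of "c *s v"]
    by (simp add: vec_eq_iff algebra_simps)
   finally show "?e u = integral {0..u} (\<lambda>t. fd (F t) (x, y t x) (0, ?e t))" ..
  qed
  then show "fd (y s) x (c *s v) $ i = c * fd (y s) x v $ i" by simp
 qed
qed

subsection \<open>Holomorphic functions of several variables\<close>

lemma kreg_on_line_derivative:
 fixes f :: "complex^'m => complex"
 assumes "kreg_on U f" "x + z *s v \<in> U"
 shows "((\<lambda>z. f (x + z *s v)) has_field_derivative fd f (x + z *s v) v) (at z within S)"
proof -
 have 1: "((\<lambda>z. x + z *s v) has_derivative (\<lambda>h. h *s v)) (at z within S)"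
 proof (rule vec_has_derivative[where G' = "\<lambda>i h. h * v $ i", folded vector_scalar_mult_def])
  fix i show "((\<lambda>z. (x + z *s v) $ i) has_derivative (\<lambda>h. h * v $ i)) (at z within S)"
   by (auto intro!: derivative_eq_intros)
 qed
 have "(\<lambda>h. fd f (x + z *s v) (h *s v)) = (*) (fd f (x + z *s v) v)"
  by (auto simp: fun_eq_iff kreg_on_scale[OF assms] mult.commute)
 then show ?thesis
  using has_derivative_compose[OF 1 kreg_on_deriv[OF assms]] by (simp only: has_field_derivative_def)
qed

text \<open>The one-variable Cauchy inequality on the complex line through \<open>x\<close> in
  direction \<open>v\<close>.\<close>

lemma cauchy_estimate:
 fixes f :: "complex^'m => complex"
 assumes f: "kreg_on U f" and d: "D > 0" and sub: "!!z. cmod z \<le> D ==> x + z *s v \<in> U"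
  and M: "!!z. cmod z \<le> D ==> cmod (f (x + z *s v)) \<le> M"
 shows "cmod (fd f x v) \<le> M / D"
proof -
 let ?g = "\<lambda>z. f (x + z *s v)"
 have g: "(?g has_field_derivative fd f (x + z *s v) v) (at z within S)" if "cmod z \<le> D" for z S
  by (rule kreg_on_line_derivative[OF f sub[OF that]])
 have "cmod ((deriv ^^ 1) ?g 0) \<le> fact 1 * M / D ^ 1"
 proof (rule Cauchy_inequality[OF _ _ d])
  show "?g holomorphic_on ball 0 D" unfolding holomorphic_on_def field_differentiable_def
   by (intro ballI exI) (rule g, simp)
  show "continuous_on (cball 0 D) ?g"
   unfolding continuous_on_eq_continuous_within by (intro ballI DERIV_continuous) (rule g, simp)
 qed (use M in auto)
 moreover have "deriv ?g 0 = fd f x v"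
  using DERIV_imp_deriv[OF g[of 0]] d by simp
 ultimately show ?thesis by simp
qed

lemma kreg_on_diff: "kreg_on U f ==> kreg_on U g ==> kreg_on U (\<lambda>x. f x - g x)"
 using kreg_on_add[of U f "\<lambda>x. (-1) * g x"] kreg_on_mult[of U "\<lambda>x. -1" g] kreg_on_const[OF kreg_on_open[of U g], of "-1"] by simp

lemma norm_smult_vec: "norm (c *s v :: complex^'m) = cmod c * norm v"
 unfolding norm_vec_def by (simp add: norm_mult L2_set_right_distrib)

text \<open>Cauchy's estimate turns uniform closeness of two members of the sequence into closeness
  of their derivatives on a smaller ball, uniformly relative to the norm of the direction. The
  limits of the derivatives are then the derivative of the limit.\<close>

lemma uniform_limit_derivative:
 fixes F :: "nat => complex^'m => complex"
 assumes F: "!!N. kreg_on (ball 0 R) (F N)" and lim: "uniform_limit (ball 0 R) F f sequentially" and r: "0 < r" "r < R"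
 shows "\<exists>f'. (\<forall>x\<in>ball 0 r. (f has_derivative f' x) (at x)) \<and>
   (\<forall>x\<in>ball 0 r. \<forall>c v. f' x (c *s v) = c * f' x v) \<and>
   (\<forall>v. uniform_limit (ball 0 r) (\<lambda>N x. fd (F N) x v) (\<lambda>x. f' x v) sequentially)"
proof -
 \<comment> \<open>Half of the gap between the radii, so that discs of radius \<open>D\<close>
   around points of the smaller ball stay inside the larger one.\<close>
 define D where "D = (R - r) / 2"
 have D: "D > 0" "r + D < R" using r by (auto simp: D_def field_simps)
 have close: "cmod (fd (F m) x h - fd (F n) x h) \<le> e / D * norm h"
  if e: "!!x. x \<in> ball 0 R ==> cmod (F m x - F n x) \<le> e" and x: "x \<in> ball 0 r" for m n e x h
 proof (cases "h = 0")
  case True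
  have "linear (fd (F k) x)" for k
   using has_derivative_linear[OF kreg_on_deriv[OF F]] x r by auto
  then show ?thesis using True by (simp add: linear_0)
 next
  case False
  have xR: "x \<in> ball 0 R" using x r by simp
  have "fd (\<lambda>x. F m x - F n x) x h = fd (F m) x h - fd (F n) x h"
   using frechet_derivative_at[OF has_derivative_diff[OF kreg_on_deriv[OF F xR, of m] kreg_on_deriv[OF F xR, of n]]] by metis
  moreover have "cmod (fd (\<lambda>x. F m x - F n x) x h) \<le> e / (D / norm h)"
  proof (rule cauchy_estimate[OF kreg_on_diff[OF F F]])
   show in_ball: "x + z *s h \<in> ball 0 R" if "cmod z \<le> D / norm h" for z
   proof -
    have "cmod z * norm h \<le> D" using that False by (simp add: pos_le_divide_eq)
    then have "norm (x + z *s h) < R"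
     using norm_triangle_ineq[of x "z *s h"] x D(2) by (simp add: norm_smult_vec)
    then show ?thesis by simp
   qed
   show "cmod (F m (x + z *s h) - F n (x + z *s h)) \<le> e" if "cmod z \<le> D / norm h" for z
    using e[OF in_ball[OF that]] .
  qed (use D False in auto)
  ultimately show ?thesis by simp
 qed
 have cauchyD: "\<exists>N. \<forall>m\<ge>N. \<forall>n\<ge>N. \<forall>x\<in>ball 0 r. \<forall>h. cmod (fd (F m) x h - fd (F n) x h) \<le> e * norm h"
  if "e > 0" for e
 proof -
  have "uniformly_Cauchy_on (ball 0 R) F" using lim by (intro uniformly_convergent_Cauchy uniformly_convergentI)
  moreover have "e * D > 0" using that D by simp
  ultimately obtain N where N: "\<forall>x\<in>ball 0 R. \<forall>m\<ge>N. \<forall>n\<ge>N. dist (F m x) (F n x) < e * D"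
   unfolding uniformly_Cauchy_on_def by blast
  have "cmod (fd (F m) x h - fd (F n) x h) \<le> e * norm h"
   if "m \<ge> N" "n \<ge> N" "x \<in> ball 0 r" for m n x h
   using close[of m n "e * D" x h] N that D by (simp add: dist_norm less_imp_le)
  then show ?thesis by blast
 qed
 define f' where "f' x h = lim (\<lambda>N. fd (F N) x h)" for x h
 have u: "uniform_limit (ball 0 r) (\<lambda>N x. fd (F N) x v) (\<lambda>x. f' x v) sequentially" for v
  unfolding f'_def uniformly_convergent_uniform_limit_iff[symmetric]
 proof (intro Cauchy_uniformly_convergent uniformly_Cauchy_onI)
  fix e :: real assume e: "e > 0"
  have pos: "norm v + 1 > 0" by (simp add: add_nonneg_pos)
  then have "e / (norm v + 1) > 0" using e by simp
  from cauchyD[OF this] obtain N where N: "\<forall>m\<ge>N. \<forall>n\<ge>N. \<forall>x\<in>ball 0 r. \<forall>h. cmod (fd (F m) x h - fd (F n) x h) \<le> e / (norm v + 1) * norm h" by blast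
  have "e / (norm v + 1) * norm v < e" using e pos by (simp add: field_simps)
  then show "\<exists>N. \<forall>x\<in>ball 0 r. \<forall>m\<ge>N. \<forall>n\<ge>N. dist (fd (F m) x v) (fd (F n) x v) < e"
   using N unfolding dist_norm by (intro exI[of _ N] allI impI ballI) (meson le_less_trans)
 qed
 note f' = tendsto_uniform_limitI[OF u]
 have unif: "\<exists>N. \<forall>n\<ge>N. \<forall>x\<in>ball 0 r. \<forall>h. cmod (fd (F n) x h - f' x h) \<le> e * norm h" if e: "e > 0" for e
 proof -
  obtain N where N: "\<forall>m\<ge>N. \<forall>n\<ge>N. \<forall>x\<in>ball 0 r. \<forall>h. cmod (fd (F m) x h - fd (F n) x h) \<le> e * norm h"
   using cauchyD[OF e] by blast
  have "cmod (fd (F n) x h - f' x h) \<le> e * norm h" if n: "n \<ge> N" and x: "x \<in> ball 0 r" for n x h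
  proof (rule tendsto_upperbound)
   show "((\<lambda>m. cmod (fd (F n) x h - fd (F m) x h)) \<longlongrightarrow> cmod (fd (F n) x h - f' x h)) sequentially"
    by (intro tendsto_intros f' x)
   show "\<forall>\<^sub>F m in sequentially. cmod (fd (F n) x h - fd (F m) x h) \<le> e * norm h"
    using eventually_ge_at_top[of N] by eventually_elim (use N n x in blast)
  qed simp
  then show ?thesis by blast
 qed
 have "\<exists>g. \<forall>x\<in>ball 0 r. (\<lambda>n. F n x) \<longlonglongrightarrow> g x \<and> (g has_derivative f' x) (at x within ball 0 r)"
 proof (rule has_derivative_sequence[where f' = "\<lambda>n x. fd (F n) x"])
  show "(F n has_derivative fd (F n) x) (at x within ball 0 r)" if "x \<in> ball 0 r" for n x
   using kreg_on_deriv[OF F] that r by (auto intro: has_derivative_at_withinI)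
  show "\<forall>\<^sub>F n in sequentially. \<forall>x\<in>ball 0 r. \<forall>h. norm (fd (F n) x h - f' x h) \<le> e * norm h" if "e > 0" for e
   using unif[OF that] unfolding eventually_sequentially .
  show "0 \<in> ball (0 :: complex^'m) r" using r by simp
  show "(\<lambda>n. F n 0) \<longlonglongrightarrow> f 0" using tendsto_uniform_limitI[OF lim] r by simp
 qed simp
 then obtain g where g: "!!x. x \<in> ball 0 r ==> (\<lambda>n. F n x) \<longlonglongrightarrow> g x" "!!x. x \<in> ball 0 r ==> (g has_derivative f' x) (at x within ball 0 r)" by blast
 have gf: "g x = f x" if "x \<in> ball 0 r" for x
  using LIMSEQ_unique[OF g(1)[OF that]] tendsto_uniform_limitI[OF lim] that r by auto
 have d: "(f has_derivative f' x) (at x)" if x: "x \<in> ball 0 r" for x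
  using g(2)[OF x] has_derivative_transform_within_open[of g "f' x" x UNIV "ball 0 r" f] gf x
  by (simp add: at_within_open[OF x open_ball])
 have s: "f' x (c *s v) = c * f' x v" if x: "x \<in> ball 0 r" for x c v
 proof (rule LIMSEQ_unique[OF f'[OF x]])
  have "(\<lambda>N. c * fd (F N) x v) \<longlonglongrightarrow> c * f' x v" by (intro tendsto_intros f' x)
  then show "(\<lambda>N. fd (F N) x (c *s v)) \<longlonglongrightarrow> c * f' x v"
   using kreg_on_scale[OF F] x r by simp
 qed
 show ?thesis using d s u by blast
qed

text \<open>Weierstrass' theorem. The order is raised by applying the induction hypothesis to the
  directional derivatives, which converge uniformly on a ball of intermediate radius.\<close>

theorem kreg_on_uniform_limit:
 fixes F :: "nat => complex^'m => complex"
 assumes F: "!!N. kreg_on (ball 0 R) (F N)" and lim: "uniform_limit (ball 0 R) F f sequentially" and r: "0 < r" "r < R"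
 shows "kreg_on (ball 0 r) f"
proof -
 have C: "Ck_on k (ball 0 r) f" for k
  using F lim r
 proof (induction k arbitrary: F f r R)
  case 0
  obtain f' where f': "!!x. x \<in> ball 0 r ==> (f has_derivative f' x) (at x)"
   using uniform_limit_derivative[OF 0] by blast
  show ?case
   using has_derivative_continuous[OF f'] by (auto intro!: continuous_at_imp_continuous_on)
 next
  case (Suc k)
  obtain r' where r': "r < r'" "r' < R" using dense Suc.prems(4) by blast
  then have r'0: "0 < r'" using Suc.prems(3) by linarith
  obtain f' where f': "!!x. x \<in> ball 0 r' ==> (f has_derivative f' x) (at x)"
   "!!v. uniform_limit (ball 0 r') (\<lambda>N x. fd (F N) x v) (\<lambda>x. f' x v) sequentially"
   using uniform_limit_derivative[OF Suc.prems(1,2) r'0 r'(2)] by blast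
  have K: "kreg_on (ball 0 r') (\<lambda>x. fd (F N) x v)" for N v
   by (rule kreg_on_subset[OF kreg_on_frechet[OF Suc.prems(1)]]) (use r' in auto)
  have IH: "Ck_on k (ball 0 r) (\<lambda>x. f' x v)" for v
   by (rule Suc.IH[OF K f'(2) Suc.prems(3) r'(1)])
  have fr: "(f has_derivative f' x) (at x)" if "x \<in> ball 0 r" for x using f'(1) that r' by simp
  have "Tk (Suc k) (ball 0 r) (\<lambda>s. f)"
  proof (rule Tk_SucI[OF open_ball _ fr])
   show "Tk k (ball 0 r) (\<lambda>s x. f' x v)" for v using IH by (simp add: Ck_on_eq_Tk)
   have "Ck_on 0 (ball 0 r) f"
    using has_derivative_continuous[OF fr] by (auto intro!: continuous_at_imp_continuous_on)
   then show "continuous_on ({0..1::real} \<times> ball 0 r) (\<lambda>z. f (snd z))" unfolding Ck_on_eq_Tk by simp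
  qed
  then show ?case by (simp only: Ck_on_eq_Tk)
 qed
 obtain f' where "!!x. x \<in> ball 0 r ==> (f has_derivative f' x) (at x)" "!!x c v. x \<in> ball 0 r ==> f' x (c *s v) = c * f' x v"
  using uniform_limit_derivative[OF F lim r] by blast
 then show ?thesis by (intro kreg_onI[OF open_ball C])
qed

subsection \<open>Power series\<close>

definition kgerm :: "('k::real_normed_field^'m => 'k) => bool" where
 "kgerm f \<longleftrightarrow> (\<exists>U. 0 \<in> U \<and> kreg_on U f)"

lemma norm_prod_power_le:
 fixes x :: "'k::real_normed_field^'m"
 assumes "norm x \<le> r"
 shows "norm (\<Prod>i\<in>UNIV. x $ i ^ a i) \<le> (\<Prod>i\<in>(UNIV::'m set). r ^ a i)"
 unfolding prod_norm[symmetric] norm_power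
 by (intro prod_mono) (use assms order_trans[OF Finite_Cartesian_Product.norm_nth_le] in \<open>auto intro!: power_mono\<close>)

text \<open>Unordered sums over the real or complex numbers converge absolutely, which
  \<open>abs\<close> records. A diagonal point (r, ..., r) inside the domain of convergence then
  dominates all points of norm less than \<open>r\<close>.\<close>

lemma power_series_abs_summable:
 fixes c :: "('m::finite => nat) => 'k::{real_normed_field,euclidean_space}"
 assumes "near0 x. (\<lambda>a. c a * (\<Prod>i\<in>UNIV. x $ i ^ a i)) summable_on UNIV"
  and abs: "!!f :: ('m => nat) => 'k. f summable_on UNIV ==> (\<lambda>a. norm (f a)) summable_on UNIV"
 obtains r where "r > 0" "(\<lambda>a. norm (c a) * (\<Prod>i\<in>UNIV. r ^ a i)) summable_on UNIV"
proof -
 obtain S where S: "open S" "0 \<in> S" "!!x. x \<in> S ==> (\<lambda>a. c a * (\<Prod>i\<in>UNIV. x $ i ^ a i)) summable_on UNIV"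
  using assms(1) unfolding eventually_nhds by blast
 have "((\<lambda>t. \<chi> i. of_real t) \<longlongrightarrow> (\<chi> i. of_real 0 :: 'k^'m)) (at_right 0)"
  by (intro tendsto_intros)
 moreover have "(\<chi> i. of_real 0) = (0 :: 'k^'m)" by (simp add: vec_eq_iff)
 ultimately have "\<forall>\<^sub>F t in at_right 0. (\<chi> i. of_real t) \<in> S"
  using S(1,2) by (auto simp: tendsto_def)
 then obtain r where r: "r > 0" "(\<chi> i. of_real r) \<in> S"
  unfolding eventually_at_right_field using field_lbound_gt_zero[of _ 1] by (metis dense)
 show thesis
 proof (rule that[OF r(1)])
  have "(\<lambda>a. norm (c a * (\<Prod>i\<in>UNIV. (\<chi> i. of_real r) $ i ^ a i))) summable_on UNIV"
   by (rule abs[OF S(3)[OF r(2)]])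
  then show "(\<lambda>a. norm (c a) * (\<Prod>i\<in>UNIV. r ^ a i)) summable_on UNIV"
   using r(1) by (simp add: norm_mult prod_norm[symmetric] norm_power)
 qed
qed

lemma finite_box: "finite {a :: 'm::finite => nat. \<forall>i. a i \<le> N}"
proof -
 have "{a :: 'm => nat. \<forall>i. a i \<le> N} = PiE UNIV (\<lambda>_. {..N})" by (auto simp: PiE_UNIV_domain)
 then show ?thesis by (simp add: finite_PiE)
qed

text \<open>Boxes of multi-indices exhaust all finite sets, so unordered limits can be taken along a
  sequence, as \<open>kreg_on_uniform_limit\<close> demands.\<close>

lemma filterlim_box: "filterlim (\<lambda>N. {a :: 'm::finite => nat. \<forall>i. a i \<le> N}) (finite_subsets_at_top UNIV) sequentially"
 unfolding filterlim_iff eventually_finite_subsets_at_top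
proof (intro allI impI)
 fix P :: "('m => nat) set => bool"
 assume "\<exists>X. finite X \<and> X \<subseteq> UNIV \<and> (\<forall>Y. finite Y \<and> X \<subseteq> Y \<and> Y \<subseteq> UNIV --> P Y)"
 then obtain X where X: "finite X" "\<forall>Y. finite Y \<and> X \<subseteq> Y \<and> Y \<subseteq> UNIV --> P Y"
  by (elim exE conjE) (rule that)
 have "finite ((\<lambda>(a :: 'm => nat, i). a i) ` (X \<times> UNIV))" using X(1) by simp
 then obtain n where n: "\<forall>k\<in>(\<lambda>(a :: 'm => nat, i). a i) ` (X \<times> UNIV). k \<le> n"
  unfolding finite_nat_set_iff_bounded_le by blast
 have "P {a. \<forall>i. a i \<le> N}" if N: "N \<ge> n" for N
 proof (rule X(2)[rule_format], intro conjI finite_box subset_UNIV subsetI CollectI allI)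
  fix a i assume "a \<in> X"
  then have "a i \<le> n" using n by force
  then show "a i \<le> N" using N by simp
 qed
 then show "\<forall>\<^sub>F N in sequentially. P {a. \<forall>i. a i \<le> N}" unfolding eventually_sequentially by blast
qed

lemma kreg_on_power: "kreg_on U f ==> kreg_on U (\<lambda>x. f x ^ n)"
 by (induction n) (auto intro!: kreg_on_mult kreg_on_const kreg_on_open[of U f])

text \<open>Partial sums over boxes are polynomials and converge uniformly by the Weierstrass test,
  with the terms at radius \<open>r\<close> as majorants.\<close>

lemma power_series_kreg:
 fixes c :: "('m::finite => nat) => complex"
 assumes rho: "r > 0" and sm: "(\<lambda>a. norm (c a) * (\<Prod>i\<in>UNIV. r ^ a i)) summable_on UNIV"
 shows "kreg_on (ball 0 (r/2)) (\<lambda>x. infsum (\<lambda>a. c a * (\<Prod>i\<in>UNIV. x $ i ^ a i)) UNIV)" (is ?A)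
  and "norm x < r ==> (\<lambda>a. c a * (\<Prod>i\<in>UNIV. x $ i ^ a i)) summable_on UNIV" (is "_ ==> ?B")
proof -
 let ?t = "\<lambda>a (x::complex^'m). c a * (\<Prod>i\<in>UNIV. x $ i ^ a i)"
 have bd: "norm (?t a x) \<le> norm (c a) * (\<Prod>i\<in>UNIV. r ^ a i)" if "norm x < r" for a x
  using norm_prod_power_le[of x r a] that by (simp add: norm_mult mult_left_mono)
 show ?B if "norm x < r"
 proof -
  have "(\<lambda>a. norm (?t a x)) summable_on UNIV"
   by (rule Infinite_Sum.abs_summable_on_comparison_test'[OF sm]) (rule bd[OF that])
  then show ?thesis by (rule abs_summable_summable)
 qed
 have "uniform_limit (ball 0 r) (\<lambda>X x. \<Sum>a\<in>X. ?t a x) (\<lambda>x. infsum (\<lambda>a. ?t a x) UNIV) (finite_subsets_at_top UNIV)"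
  by (rule Weierstrass_m_test_general[OF _ sm]) (use bd in auto)
 then have lim: "uniform_limit (ball 0 r) (\<lambda>N x. \<Sum>a\<in>{a. \<forall>i. a i \<le> N}. ?t a x) (\<lambda>x. infsum (\<lambda>a. ?t a x) UNIV) sequentially"
  unfolding uniform_limit_iff using filterlim_box unfolding filterlim_iff by blast
 have k: "kreg_on (ball 0 r) (\<lambda>x. \<Sum>a\<in>{a. \<forall>i. a i \<le> N}. ?t a x)" for N
  by (intro kreg_on_sum kreg_on_mult kreg_on_const kreg_on_prod kreg_on_power kreg_on_nth open_ball)
 show ?A by (rule kreg_on_uniform_limit[OF k lim]) (use rho in auto)
qed

section \<open>Taylor expansion of holomorphic functions of several variables\<close>

text \<open>Iterated partial derivatives are indexed by words instead of multi-indices: one more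
  derivative is one more letter, and Taylor's formula carries only factorials of lengths.\<close>

primrec Dw :: "'m list => (complex^'m => complex) => complex^'m => complex" where
 "Dw [] f = f"
| "Dw (i # w) f = (\<lambda>x. fd (Dw w f) x (axis i 1))"

lemma kreg_on_Dw: "kreg_on U f ==> kreg_on U (Dw w f)"
 by (induction w) (auto intro: kreg_on_frechet)

text \<open>Each letter takes one Cauchy estimate on a disc of radius \<open>D\<close> and uses up
  \<open>D\<close> of the distance to the boundary.\<close>

lemma Dw_bound:
 fixes f :: "complex^'m => complex"
 assumes f: "kreg_on (ball 0 R) f" and M: "!!x. x \<in> ball 0 R ==> cmod (f x) \<le> M" and d: "D > 0"
 shows "norm x + real (length w) * D < R ==> cmod (Dw w f x) \<le> M / D ^ length w"
proof (induction w arbitrary: x)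
 case Nil
 then show ?case using M by simp
next
 case (Cons i w)
 have near: "norm (x + Z *s axis i 1) \<le> norm x + D" if "cmod Z \<le> D" for Z :: complex
  using norm_triangle_ineq[of x "Z *s axis i 1"] that by (simp add: norm_smult_vec)
 have l: "norm x + D + real (length w) * D < R" using Cons.prems by (simp add: algebra_simps)
 have "cmod (Dw (i # w) f x) \<le> (M / D ^ length w) / D"
  unfolding Dw.simps
 proof (rule cauchy_estimate[OF kreg_on_Dw[OF f] d])
  fix Z :: complex assume z: "cmod Z \<le> D"
  have "real (length w) * D \<ge> 0" using d by simp
  then show "x + Z *s axis i 1 \<in> ball 0 R" using near[OF z] l by simp
  show "cmod (Dw w f (x + Z *s axis i 1)) \<le> M / D ^ length w"
   by (rule Cons.IH) (use near[OF z] l in linarith)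
 qed
 then show ?case by (simp add: mult.commute)
qed

definition words :: "nat => 'm list set" where
 "words k = {w. length w = k}"

lemma words_0: "words 0 = {[]}" by (auto simp: words_def)

lemma finite_words: "finite (words k :: 'm::finite list set)"
 using finite_lists_length_eq[of "UNIV :: 'm set" k] by (simp add: words_def)

lemma sum_words_Suc:
 "(\<Sum>w\<in>words (Suc k). g w) = (\<Sum>w\<in>words k. \<Sum>i\<in>(UNIV::'m::finite set). g (i # w))"
proof -
 have eq: "words (Suc k) = (\<lambda>(w, i). i # w) ` (words k \<times> (UNIV :: 'm set))"
  by (force simp: words_def length_Suc_conv)
 have inj: "inj_on (\<lambda>(w, i). i # w) (words k \<times> (UNIV :: 'm set))" by (auto simp: inj_on_def)
 show ?thesis
  unfolding eq sum.reindex[OF inj] by (simp add: sum.cartesian_product o_def case_prod_beta)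
qed

definition wmon :: "complex^'m => 'm list => complex" where
 "wmon z w = prod_list (map (\<lambda>i. z $ i) w)"

lemma norm_wmon: "cmod (wmon z w) \<le> norm z ^ length w"
proof (induction w)
 case (Cons i w)
 have "cmod (z $ i) * cmod (wmon z w) \<le> norm z * norm z ^ length w"
  using Cons Finite_Cartesian_Product.norm_nth_le[of z i] by (intro mult_mono) auto
 then show ?case by (simp add: wmon_def norm_mult)
qed (simp add: wmon_def)

lemma card_words: "card (words k :: 'm::finite list set) = CARD('m) ^ k"
 using card_lists_length_eq[of "UNIV :: 'm set" k] by (simp add: words_def)

text \<open>The quotient of k^k by k! is a single term of the exponential series at k. It
  compensates the k^k that arises from discs of radius proportional to 1/k.\<close>

lemma power_self_le: "real k ^ k \<le> fact k * exp (real k)"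
proof -
 have s: "(\<lambda>n. real k ^ n /\<^sub>R fact n) sums exp (real k)" by (rule exp_converges)
 have "(\<Sum>n\<in>{k}. real k ^ n /\<^sub>R fact n) \<le> (\<Sum>n. real k ^ n /\<^sub>R fact n)"
  by (rule sum_le_suminf[OF sums_summable[OF s]]) auto
 also have "... = exp (real k)" using s by (rule sums_unique[symmetric])
 finally show ?thesis by (simp add: field_simps)
qed

text \<open>There are \<open>CARD('m) ^ k\<close> words of length k. The bound on \<open>z\<close>
  makes \<open>CARD('m) * norm z / D\<close> at most k / (4 e), and \<open>power_self_le\<close>
  turns the k-th power of this into k! / 4^k.\<close>

lemma taylor_terms_bound:
 fixes f :: "complex^'m => complex"
 assumes f: "kreg_on (ball 0 R) f" and M: "!!x. x \<in> ball 0 R ==> cmod (f x) \<le> M" and R: "R > 0"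
  and x: "norm x \<le> R / 4" and z: "norm z \<le> R / (16 * exp 1 * CARD('m))"
 shows "(\<Sum>w\<in>words k. cmod (wmon z w * Dw w f x)) \<le> M * fact k * (1/4) ^ k"
proof (cases "k = 0")
 case True
 then show ?thesis using M[of x] x R by (simp add: words_0 wmon_def)
next
 case False
 \<comment> \<open>All k Cauchy estimates together use R/4, which with
   \<open>norm x \<le> R / 4\<close> stays inside the ball of radius \<open>R\<close>.\<close>
 define D where "D = R / (4 * k)"
 have M0: "M \<ge> 0" using order_trans[OF norm_ge_zero M[of 0]] R by simp
 have d: "D > 0" using R False by (simp add: D_def)
 define m where "m = real CARD('m)"
 have m: "m > 0" by (simp add: m_def)
 have "cmod (wmon z w * Dw w f x) \<le> norm z ^ k * (M / D ^ k)" if "w \<in> words k" for w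
 proof -
  have lw: "length w = k" using that by (simp add: words_def)
  have "norm x + real (length w) * D < R" using x R False lw by (simp add: D_def)
  from Dw_bound[OF f M d this] norm_wmon[of z w] show ?thesis
   unfolding norm_mult lw by (intro mult_mono) auto
 qed
 then have "(\<Sum>w\<in>words k. cmod (wmon z w * Dw w f x)) \<le> of_nat (card (words k :: 'm list set)) * (norm z ^ k * (M / D ^ k))"
  by (intro sum_bounded_above) auto
 also have "... = M * (m * norm z / D) ^ k"
  by (simp add: card_words m_def power_mult_distrib power_divide)
 also have "... \<le> M * (real k * (1 / (4 * exp 1))) ^ k"
 proof (intro mult_left_mono M0 power_mono)
  have "m * norm z \<le> R / (16 * exp 1)" using z m by (simp add: m_def field_simps)
  then have "m * norm z / D \<le> (R / (16 * exp 1)) / D" by (rule divide_right_mono) (use d in simp)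
  also have "... = real k * (1 / (4 * exp 1))" using R False by (simp add: D_def field_simps)
  finally show "m * norm z / D \<le> real k * (1 / (4 * exp 1))" .
 qed (use m d in auto)
 also have "... = M * (real k ^ k * (1 / (4 ^ k * exp (real k))))"
  by (simp add: power_mult_distrib power_divide exp_of_nat_mult[symmetric])
 also have "... \<le> M * ((fact k * exp (real k)) * (1 / (4 ^ k * exp (real k))))"
  by (intro mult_left_mono M0 mult_right_mono power_self_le) auto
 also have "... = M * fact k * (1/4) ^ k" by (simp add: power_divide)
 finally show ?thesis .
qed

definition taylor_term :: "(complex^'m => complex) => complex^'m => 'm list => complex" where
 "taylor_term f z w = wmon z w * Dw w f 0 / fact (length w)"

text \<open>Taylor's formula in one variable for the function Z -> f (Z z) on the closed unit
  disc.\<close>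

lemma taylor_sums:
 fixes f :: "complex^'m => complex"
 assumes f: "kreg_on (ball 0 R) f" and M: "!!x. x \<in> ball 0 R ==> cmod (f x) \<le> M" and R: "R > 0"
  and z: "norm z \<le> R / (16 * exp 1 * CARD('m))"
 shows "(\<lambda>k. \<Sum>w\<in>words k. taylor_term f z w) sums f z"
proof -
 \<comment> \<open>The k-th derivative of f (Z z) with respect to Z, expanded over words.\<close>
 define G where "G k Z = (\<Sum>w\<in>words k. wmon z w * Dw w f (Z *s z))" for k and Z :: complex
 have M0: "M \<ge> 0" using order_trans[OF norm_ge_zero M[of 0]] R by simp
 have z4: "norm z \<le> R / 4"
 proof -
  have "4 * 1 \<le> 16 * exp 1 * real CARD('m)"
   using exp_ge_add_one_self[of 1] by (intro mult_mono) (auto simp: Suc_le_eq intro: order_trans[of _ "2::real"])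
  then have "R / (16 * exp 1 * real CARD('m)) \<le> R / 4" using R by (intro divide_left_mono) auto
  then show ?thesis using z by simp
 qed
 have in4: "norm (Z *s z) \<le> R / 4" if "cmod Z \<le> 1" for Z
  using mult_mono[OF that z4] by (simp add: norm_smult_vec)
 then have inR: "Z *s z \<in> ball 0 R" if "cmod Z \<le> 1" for Z using R that by fastforce
 have dG: "(G k has_field_derivative G (Suc k) Z) (at Z within S)" if "cmod Z \<le> 1" for k Z S
 proof -
  have "((\<lambda>Z. Dw w f (Z *s z)) has_field_derivative (\<Sum>i\<in>UNIV. z $ i * Dw (i # w) f (Z *s z))) (at Z within S)" for w
  proof -
   note K = kreg_on_Dw[OF f, of w]
   have e: "fd (Dw w f) (Z *s z) z = (\<Sum>i\<in>UNIV. z $ i * Dw (i # w) f (Z *s z))"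
   proof -
    have l: "linear (fd (Dw w f) (Z *s z))"
     by (rule has_derivative_linear[OF kreg_on_deriv[OF K inR[OF that]]])
    have "z = (\<Sum>i\<in>UNIV. z $ i *s axis i 1)"
     by (simp add: vec_eq_iff axis_def if_distrib cong: if_cong)
    then have "fd (Dw w f) (Z *s z) z = fd (Dw w f) (Z *s z) (\<Sum>i\<in>UNIV. z $ i *s axis i 1)" by simp
    also have "... = (\<Sum>i\<in>UNIV. z $ i * Dw (i # w) f (Z *s z))"
     by (simp add: linear_sum[OF l] kreg_on_scale[OF K inR[OF that]])
    finally show ?thesis .
   qed
   show ?thesis using kreg_on_line_derivative[OF K, of 0 Z z S] inR[OF that] e by simp
  qed
  then have "(G k has_field_derivative (\<Sum>w\<in>words k. wmon z w * (\<Sum>i\<in>UNIV. z $ i * Dw (i # w) f (Z *s z)))) (at Z within S)"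
   unfolding G_def by (intro DERIV_sum DERIV_cmult)
  moreover have "G (Suc k) Z = (\<Sum>w\<in>words k. wmon z w * (\<Sum>i\<in>UNIV. z $ i * Dw (i # w) f (Z *s z)))"
   unfolding G_def sum_words_Suc by (simp add: wmon_def sum_distrib_left mult_ac)
  ultimately show ?thesis by simp
 qed
 have bG: "cmod (G k Z) \<le> M * fact k * (1/4) ^ k" if "cmod Z \<le> 1" for k Z
  unfolding G_def using taylor_terms_bound[OF f M R in4[OF that] z, of k] by (rule order_trans[OF norm_sum])
 \<comment> \<open>The bound M (n + 1)! / 4^(n + 1) for the derivative of order n + 1 is divided by
   n! in the remainder, which leaves the factor n + 1.\<close>
 have rem: "cmod (f z - (\<Sum>i\<le>n. \<Sum>w\<in>words i. taylor_term f z w)) \<le> M * (real (Suc n) * (1/4) ^ Suc n)" for n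
 proof -
  have "cmod (G 0 1 - (\<Sum>i\<le>n. G i 0 * (1 - 0) ^ i / fact i)) \<le> (M * fact (Suc n) * (1/4) ^ Suc n) * cmod (1 - 0) ^ Suc n / fact n"
  proof (rule complex_Taylor[of "cball 0 1"])
   show "(G i has_field_derivative G (Suc i) Z) (at Z within cball 0 1)" if "Z \<in> cball 0 1" for i Z using dG that by simp
   show "cmod (G (Suc n) Z) \<le> M * fact (Suc n) * (1/4) ^ Suc n" if "Z \<in> cball 0 1" for Z by (rule bG) (use that in simp)
  qed auto
  moreover have "G 0 1 = f z" by (simp add: G_def words_0 wmon_def)
  moreover have "G i 0 * (1 - 0) ^ i / fact i = (\<Sum>w\<in>words i. taylor_term f z w)" for i
   unfolding G_def taylor_term_def by (auto simp: sum_divide_distrib words_def intro!: sum.cong)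
  ultimately show ?thesis by (simp add: mult_ac)
 qed
 have "(\<lambda>n. M * (real (Suc n) * (1/4) ^ Suc n)) \<longlonglongrightarrow> M * 0"
 proof (intro tendsto_intros)
  have "(\<lambda>n. real n * (1/4::real) ^ n) \<longlonglongrightarrow> 0" by (rule powser_times_n_limit_0) simp
  then show "(\<lambda>n. real (Suc n) * (1/4::real) ^ Suc n) \<longlonglongrightarrow> 0" by (rule LIMSEQ_Suc)
 qed
 then have "(\<lambda>n. M * (real (Suc n) * (1/4) ^ Suc n)) \<longlonglongrightarrow> 0" by (simp only: mult_zero_right)
 from Lim_null_comparison[OF always_eventually[OF allI[OF rem]] this]
 have "(\<lambda>n. f z - (\<Sum>i\<le>n. \<Sum>w\<in>words i. taylor_term f z w)) \<longlonglongrightarrow> 0" .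
 from tendsto_diff[OF tendsto_const[of "f z"] this]
 have "(\<lambda>n. \<Sum>i\<le>n. \<Sum>w\<in>words i. taylor_term f z w) \<longlonglongrightarrow> f z" by simp
 then show ?thesis by (simp add: sums_def_le)
qed

text \<open>The terms of degree k add up to at most M / 4^k in absolute value, so the family over
  all words is absolutely summable. Its sum, grouped by length, is the series of
  \<open>taylor_sums\<close>.\<close>

lemma taylor_has_sum:
 fixes f :: "complex^'m => complex"
 assumes f: "kreg_on (ball 0 R) f" and M: "!!x. x \<in> ball 0 R ==> cmod (f x) \<le> M" and R: "R > 0"
  and z: "norm z \<le> R / (16 * exp 1 * CARD('m))"
 shows "(taylor_term f z has_sum f z) UNIV"
proof -
 have M0: "M \<ge> 0" using order_trans[OF norm_ge_zero M[of 0]] R by simp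
 have tb: "(\<Sum>w\<in>words k. cmod (taylor_term f z w)) \<le> M * (1/4) ^ k" for k
 proof -
  have "(\<Sum>w\<in>words k. cmod (taylor_term f z w)) = (\<Sum>w\<in>words k. cmod (wmon z w * Dw w f 0)) / fact k"
   by (auto simp: taylor_term_def words_def norm_divide sum_divide_distrib intro!: sum.cong)
  also have "... \<le> (M * fact k * (1/4) ^ k) / fact k"
   by (intro divide_right_mono taylor_terms_bound[OF f M R _ z]) (use R in auto)
  finally show ?thesis by simp
 qed
 have "(\<lambda>w. cmod (taylor_term f z w)) summable_on UNIV"
 proof (rule nonneg_bdd_above_summable_on)
  show "bdd_above (sum (\<lambda>w. cmod (taylor_term f z w)) ` {F. F \<subseteq> UNIV \<and> finite F})"
  proof (rule bdd_aboveI2)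
   fix F :: "'m list set" assume "F \<in> {F. F \<subseteq> UNIV \<and> finite F}"
   then have F: "finite F" by simp
   then obtain N where N: "\<forall>k\<in>length ` F. k < N" using finite_nat_set_iff_bounded by blast
   have "(\<Sum>w\<in>F. cmod (taylor_term f z w)) \<le> (\<Sum>w\<in>(\<Union>k<N. words k). cmod (taylor_term f z w))"
   proof (rule sum_mono2)
    show "finite (\<Union>k<N. words k :: 'm list set)" by (auto intro: finite_words)
    show "F \<subseteq> (\<Union>k<N. words k)" using N by (auto simp: words_def)
   qed simp
   also have "... = (\<Sum>k<N. \<Sum>w\<in>words k. cmod (taylor_term f z w))"
    by (rule sum.UNION_disjoint) (auto simp: finite_words, auto simp: words_def)
   also have "... \<le> (\<Sum>k<N. M * (1/4) ^ k)" by (intro sum_mono tb)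
   also have "... = M * (\<Sum>k<N. (1/4) ^ k)" by (simp add: sum_distrib_left)
   also have "... \<le> M * 2"
   proof (rule mult_left_mono[OF _ M0])
    show "(\<Sum>k<N. (1/4::real) ^ k) \<le> 2" unfolding sum_gp_strict by (simp add: field_simps)
   qed
   finally show "(\<Sum>w\<in>F. cmod (taylor_term f z w)) \<le> M * 2" .
  qed
 qed simp
 then have "taylor_term f z summable_on UNIV" by (rule abs_summable_summable)
 then obtain S where S: "(taylor_term f z has_sum S) UNIV" by (auto simp: summable_on_def)
 have "((\<lambda>(k, w). taylor_term f z w) has_sum S) (Sigma UNIV words)"
 proof -
  have "bij_betw (\<lambda>w. (length w, w)) UNIV (Sigma UNIV words :: (nat \<times> 'm list) set)"
   by (rule bij_betw_byWitness[where f' = snd]) (auto simp: words_def)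
  from has_sum_reindex_bij_betw[OF this, of "\<lambda>(k, w). taylor_term f z w" S] S show ?thesis by simp
 qed
 then have "((\<lambda>k. \<Sum>w\<in>words k. taylor_term f z w) has_sum S) UNIV"
  by (rule has_sum_SigmaD) (auto intro!: has_sum_finiteI finite_words)
 then have "(\<lambda>k. \<Sum>w\<in>words k. taylor_term f z w) sums S" by (rule has_sum_imp_sums)
 then have "S = f z" using taylor_sums[OF f M R z] sums_unique2 by blast
 then show ?thesis using S by simp
qed

definition wcount :: "'m list => 'm => nat" where
 "wcount w = count_list w"

lemma wmon_wcount: "wmon z w = (\<Prod>i\<in>UNIV. z $ i ^ wcount w i)"
proof (induction w)
 case (Cons j w)
 have "(\<Prod>i\<in>UNIV. z $ i ^ wcount (j # w) i) = (\<Prod>i\<in>UNIV. (if i = j then z $ i else 1) * z $ i ^ wcount w i)"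
  by (intro prod.cong) (auto simp: wcount_def)
 also have "... = z $ j * wmon z w" by (simp add: prod.distrib Cons)
 finally show ?case by (simp add: wmon_def)
qed (simp add: wmon_def wcount_def)

lemma length_wcount: "length w = (\<Sum>i\<in>(UNIV :: 'm::finite set). wcount w i)"
proof (induction w)
 case (Cons a w)
 have "(\<Sum>i\<in>UNIV. wcount (a # w) i) = (\<Sum>i\<in>UNIV. (if i = a then 1 else 0) + wcount w i)"
  by (rule sum.cong) (auto simp: wcount_def)
 then show ?case using Cons by (simp add: sum.distrib)
qed (simp add: wcount_def)

theorem kgerm_imp_analytic:
 fixes f :: "complex^'m => complex"
 assumes "kgerm f"
 shows "analytic_germ f"
proof -
 obtain U where U: "0 \<in> U" "kreg_on U f" using assms by (auto simp: kgerm_def)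
 obtain R where R: "R > 0" "cball 0 R \<subseteq> U" using kreg_on_open[OF U(2)] U(1) open_contains_cball by blast
 have f: "kreg_on (ball 0 R) f" by (rule kreg_on_subset[OF U(2)]) (use R in auto)
 have "compact (f ` cball 0 R)"
  by (intro compact_continuous_image continuous_on_subset[OF kreg_on_continuous[OF U(2)] R(2)]) simp
 then have "bounded (f ` cball 0 R)" by (rule compact_imp_bounded)
 then obtain M where "\<forall>y\<in>f ` cball 0 R. norm y \<le> M" unfolding bounded_iff by blast
 then have M: "cmod (f x) \<le> M" if "x \<in> ball 0 R" for x using that by auto
 define r where "r = R / (16 * exp 1 * CARD('m))"
 have r: "r > 0" using R(1) by (simp add: r_def)
 \<comment> \<open>All words with the same letter counts share a monomial. Adding their terms takes
   the place of dividing the partial derivative by the factorial of the multi-index.\<close>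
 define c where "c a = (\<Sum>w\<in>{w. wcount w = a}. Dw w f 0 / fact (length w))" for a
 have fin: "finite {w :: 'm list. wcount w = a}" for a
 proof (rule finite_subset[OF _ finite_words])
  show "{w. wcount w = a} \<subseteq> words (\<Sum>i\<in>UNIV. a i)" using length_wcount by (auto simp: words_def)
 qed
 have "((\<lambda>a. c a * (\<Prod>i\<in>UNIV. z $ i ^ a i)) has_sum f z) UNIV" if z: "norm z \<le> r" for z
 proof -
  have "((\<lambda>(a, w). taylor_term f z w) has_sum f z) (Sigma UNIV (\<lambda>a. {w. wcount w = a}))"
  proof -
   have "bij_betw (\<lambda>w. (wcount w, w)) UNIV (Sigma UNIV (\<lambda>a. {w :: 'm list. wcount w = a}))"
    by (rule bij_betw_byWitness[where f' = snd]) auto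
   from has_sum_reindex_bij_betw[OF this, of "\<lambda>(k, w). taylor_term f z w"] taylor_has_sum[OF f M R(1) z[unfolded r_def]]
   show ?thesis by simp
  qed
  then have "((\<lambda>a. \<Sum>w\<in>{w. wcount w = a}. taylor_term f z w) has_sum f z) UNIV"
   by (rule has_sum_SigmaD) (auto intro!: has_sum_finiteI fin)
  moreover have "(\<Sum>w\<in>{w. wcount w = a}. taylor_term f z w) = c a * (\<Prod>i\<in>UNIV. z $ i ^ a i)" for a
   unfolding c_def sum_distrib_right by (rule sum.cong) (auto simp: taylor_term_def wmon_wcount)
  ultimately show ?thesis by simp
 qed
 moreover have "near0 z. norm (z :: complex^'m) \<le> r"
 proof -
  have "near0 z. z \<in> ball (0 :: complex^'m) r" using r by (intro eventually_nhds_in_open) auto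
  then show ?thesis by eventually_elim simp
 qed
 ultimately show ?thesis unfolding analytic_germ_def
  by (intro exI[of _ c]) (auto elim: eventually_mono)
qed

theorem analytic_imp_kgerm:
 fixes f :: "complex^'m => complex"
 assumes "analytic_germ f"
 shows "kgerm f"
proof -
 obtain c where c: "near0 x. ((\<lambda>a. c a * (\<Prod>i\<in>UNIV. x $ i ^ a i)) has_sum f x) UNIV"
  using assms by (auto simp: analytic_germ_def)
 have "near0 x. (\<lambda>a. c a * (\<Prod>i\<in>UNIV. x $ i ^ a i)) summable_on UNIV"
  using c by eventually_elim (auto simp: summable_on_def)
 then obtain R where r: "R > 0" "(\<lambda>a. norm (c a) * (\<Prod>i\<in>UNIV. R ^ a i)) summable_on UNIV"
  by (rule power_series_abs_summable[OF _ summable_on_iff_abs_summable_on_complex[THEN iffD1]]) (assumption, rule that)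
 obtain S where S: "open S" "0 \<in> S" "!!x. x \<in> S ==> ((\<lambda>a. c a * (\<Prod>i\<in>UNIV. x $ i ^ a i)) has_sum f x) UNIV"
  using c unfolding eventually_nhds by blast
 have "kreg_on (ball 0 (R/2) \<inter> S) (\<lambda>x. infsum (\<lambda>a. c a * (\<Prod>i\<in>UNIV. x $ i ^ a i)) UNIV)"
  by (rule kreg_on_subset[OF power_series_kreg(1)[OF r]]) (use S in auto)
 then have "kreg_on (ball 0 (R/2) \<inter> S) f"
  by (rule kreg_on_cong) (use S(3) infsumI in blast)
 then show ?thesis unfolding kgerm_def using r(1) S(2) by (intro exI[of _ "ball 0 (R/2) \<inter> S"]) auto
qed

section \<open>Real analytic germs as restrictions of holomorphic germs\<close>

definition of_real_vec :: "real^'m => complex^'m" where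
 "of_real_vec x = (\<chi> i. of_real (x $ i))"

text \<open>In one direction the same coefficients define a holomorphic series; in the other the
  real parts of the coefficients of the holomorphic series represent \<open>f\<close>, since
  monomials are real at real points.\<close>

theorem real_analytic_iff:
 fixes f :: "real^'m => real"
 shows "analytic_germ f \<longleftrightarrow> (\<exists>F. kgerm F \<and> (near0 x. F (of_real_vec x) = of_real (f x)))"
proof
 assume "analytic_germ f"
 then obtain c where c: "near0 x. ((\<lambda>a. c a * (\<Prod>i\<in>UNIV. x $ i ^ a i)) has_sum f x) UNIV"
  by (auto simp: analytic_germ_def)
 have "near0 x. (\<lambda>a. c a * (\<Prod>i\<in>UNIV. x $ i ^ a i)) summable_on UNIV"
  using c by eventually_elim (auto simp: summable_on_def)
 then obtain R where r: "R > 0" "(\<lambda>a. norm (c a) * (\<Prod>i\<in>UNIV. R ^ a i)) summable_on UNIV"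
  by (rule power_series_abs_summable[OF _ summable_on_iff_abs_summable_on_real[THEN iffD1]]) (assumption, rule that)
 define F where "F z = infsum (\<lambda>a. complex_of_real (c a) * (\<Prod>i\<in>UNIV. z $ i ^ a i)) UNIV" for z :: "complex^'m"
 have "kreg_on (ball 0 (R/2)) F"
  unfolding F_def[abs_def] by (rule power_series_kreg(1)[OF r(1)]) (use r(2) in simp)
 then have "kgerm F" unfolding kgerm_def using r(1) by (intro exI[of _ "ball 0 (R/2)"]) auto
 moreover have "near0 x. F (of_real_vec x) = of_real (f x)"
  using c
 proof eventually_elim
  case (elim x)
  from has_sum_of_real[OF elim, where 'a = complex]
  have "((\<lambda>a. complex_of_real (c a) * (\<Prod>i\<in>UNIV. of_real_vec x $ i ^ a i)) has_sum of_real (f x)) UNIV"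
   by (simp add: of_real_vec_def)
  then show ?case unfolding F_def by (rule infsumI)
 qed
 ultimately show "\<exists>F. kgerm F \<and> (near0 x. F (of_real_vec x) = of_real (f x))" by blast
next
 assume "\<exists>F. kgerm F \<and> (near0 x. F (of_real_vec x) = of_real (f x))"
 then obtain F where F: "kgerm F" "near0 x. F (of_real_vec x) = of_real (f x)" by blast
 obtain c where c: "near0 z. ((\<lambda>a. c a * (\<Prod>i\<in>UNIV. z $ i ^ a i)) has_sum F z) UNIV"
  using kgerm_imp_analytic[OF F(1)] by (auto simp: analytic_germ_def)
 have "filterlim (of_real_vec :: real^'m => _) (nhds (of_real_vec 0)) (nhds 0)"
  unfolding of_real_vec_def by (intro tendsto_intros filterlim_ident)
 moreover have "of_real_vec 0 = (0 :: complex^'m)" by (simp add: of_real_vec_def vec_eq_iff)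
 ultimately have "filterlim (of_real_vec :: real^'m => _) (nhds 0) (nhds 0)" by (simp only:)
 from eventually_compose_filterlim[OF c this]
 have "near0 x. ((\<lambda>a. Re (c a) * (\<Prod>i\<in>UNIV. x $ i ^ a i)) has_sum f x) UNIV"
  using F(2)
 proof eventually_elim
  case (elim x)
  have e: "(\<Prod>i\<in>UNIV. of_real_vec x $ i ^ a i) = complex_of_real (\<Prod>i\<in>UNIV. x $ i ^ a i)" for a
   by (simp add: of_real_vec_def)
  have r: "Re (c a * complex_of_real p) = Re (c a) * p" for a p by simp
  from has_sum_Re[OF elim(1)] show ?case unfolding elim(2) e r Re_complex_of_real .
 qed
 then show "analytic_germ f" unfolding analytic_germ_def by (rule exI[of _ "\<lambda>a. Re (c a)"])
qed

subsection \<open>Germs of scalar-regular functions\<close>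

lemma kgerm_cong:
 assumes "kgerm f" "near0 x. f x = g x"
 shows "kgerm g"
proof -
 obtain U where U: "0 \<in> U" "kreg_on U f" using assms(1) by (auto simp: kgerm_def)
 obtain S where S: "open S" "0 \<in> S" "!!x. x \<in> S ==> f x = g x" using assms(2) unfolding eventually_nhds by blast
 have "kreg_on (U \<inter> S) f" by (rule kreg_on_subset[OF U(2)]) (use S kreg_on_open[OF U(2)] in auto)
 then have "kreg_on (U \<inter> S) g" by (rule kreg_on_cong) (use S in auto)
 then show ?thesis unfolding kgerm_def using U S by blast
qed

lemma kgerm_map:
 fixes G :: "'k::real_normed_field^'m => 'k^'l"
 assumes "!!i. kgerm (\<lambda>x. G x $ i)"
 obtains U where "0 \<in> U" "kmap_on U G"
proof -
 have "\<forall>i. \<exists>U. 0 \<in> U \<and> kreg_on U (\<lambda>x. G x $ i)" using assms by (auto simp: kgerm_def)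
 from choice[OF this] obtain U where U: "\<forall>i. 0 \<in> U i \<and> kreg_on (U i) (\<lambda>x. G x $ i)" ..
 have "open (\<Inter>i. U i)" using U kreg_on_open by (intro open_INT) auto
 then have "kmap_on (\<Inter>i. U i) G" unfolding kmap_on_def
  using U by (auto intro: kreg_on_subset)
 then show thesis using U by (intro that[of "\<Inter>i. U i"]) auto
qed

lemma kgerm_const: "kgerm (\<lambda>x. c)" unfolding kgerm_def by (rule exI[of _ UNIV]) (simp add: kreg_on_const)
lemma kgerm_nth: "kgerm (\<lambda>x. x $ i)" unfolding kgerm_def by (rule exI[of _ UNIV]) (simp add: kreg_on_nth)

lemma kgerm2:
 assumes "kgerm f" "kgerm g"
 obtains U where "0 \<in> U" "kreg_on U f" "kreg_on U g"
proof -
 obtain U V where "0 \<in> U" "kreg_on U f" "0 \<in> V" "kreg_on V g" using assms by (auto simp: kgerm_def)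
 then show thesis using kreg_on_open by (intro that[of "U \<inter> V"]) (auto intro: kreg_on_subset)
qed

lemma kgerm_add: "kgerm f ==> kgerm g ==> kgerm (\<lambda>x. f x + g x)"
 using kgerm2[of f g thesis] kreg_on_add unfolding kgerm_def by (metis kgerm2 kgerm_def)
lemma kgerm_mult: "kgerm f ==> kgerm g ==> kgerm (\<lambda>x. f x * g x)"
 using kreg_on_mult unfolding kgerm_def by (metis kgerm2 kgerm_def)

lemma kgerm_inverse:
 assumes "kgerm f" "f 0 \<noteq> 0"
 shows "kgerm (\<lambda>x. inverse (f x))"
proof -
 obtain U where U: "0 \<in> U" "kreg_on U f" using assms(1) by (auto simp: kgerm_def)
 let ?V = "U \<inter> f -` (- {0})"
 have "open ?V"
  by (rule continuous_open_preimage[OF kreg_on_continuous[OF U(2)] kreg_on_open[OF U(2)] open_Compl[OF closed_singleton]])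
 then have "kreg_on ?V f" by (rule kreg_on_subset[OF U(2)]) auto
 then have "kreg_on ?V (\<lambda>x. inverse (f x))" by (rule kreg_on_inverse) auto
 then show ?thesis unfolding kgerm_def using U assms(2) by (intro exI[of _ ?V]) auto
qed

lemma kgerm_frechet:
 fixes f :: "'k::{real_normed_field,euclidean_space}^'m => 'k"
 shows "kgerm f ==> kgerm (\<lambda>x. fd f x v)"
 unfolding kgerm_def using kreg_on_frechet by blast

lemma kgerm_compose:
 fixes f :: "'k::{real_normed_field,euclidean_space}^'m => 'k" and G :: "'k^'l => 'k^'m"
 assumes "kgerm f" "!!i. kgerm (\<lambda>x. G x $ i)" "G 0 = 0"
 shows "kgerm (\<lambda>x. f (G x))"
proof -
 obtain V where V: "0 \<in> V" "kreg_on V f" using assms(1) by (auto simp: kgerm_def)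
 obtain U where U: "0 \<in> U" "kmap_on U G" using kgerm_map[OF assms(2)] by blast
 let ?W = "U \<inter> G -` V"
 have "open ?W"
  by (rule continuous_open_preimage[OF kmap_on_continuous[OF U(2)] kmap_on_open[OF U(2)] kreg_on_open[OF V(2)]])
 then have "kmap_on ?W G" by (rule kmap_on_subset[OF U(2)]) auto
 then have "kreg_on ?W (\<lambda>x. f (G x))" by (rule kreg_on_compose[OF V(2)]) auto
 then show ?thesis unfolding kgerm_def using U V assms(3) by (intro exI[of _ ?W]) auto
qed

lemma kgerm_ball:
 assumes "kgerm f" obtains R where "R > 0" "kreg_on (ball 0 R) f"
proof -
 obtain U where U: "0 \<in> U" "kreg_on U f" using assms(1) by (auto simp: kgerm_def)
 obtain R where "R > 0" "ball 0 R \<subseteq> U" using kreg_on_open[OF U(2)] U(1) open_contains_ball by blast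
 then show thesis using that kreg_on_subset[OF U(2)] by blast
qed

lemma kgerm_average:
 fixes f :: "'k::{real_normed_field,euclidean_space}^'m => 'k"
 assumes "kgerm f" shows "kgerm (average t f)"
proof -
 obtain R where "R > 0" "kreg_on (ball 0 R) f" using kgerm_ball[OF assms] .
 then show ?thesis unfolding kgerm_def by (intro exI[of _ "ball 0 R"]) (auto intro: kreg_on_average(1))
qed

subsection \<open>Regular germs, with complexification in the analytic case\<close>

text \<open>The real-analytic germs are the restrictions of holomorphic germs that are real on real points.
 Every construction below is carried out on the holomorphic extension as well, along the embedding
 \<open>cx\<close> of the scalars into \<open>complex\<close>; the flag \<open>an\<close> says whether such extensions are required.\<close>

locale regular_class =
 fixes an :: bool and cx :: "'k::{real_normed_field,euclidean_space} => complex"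
 assumes cx_bl: "bounded_linear cx" and cx_mult: "cx (x * y) = cx x * cx y" and cx_1: "cx 1 = 1"
  and norm_cx: "cmod (cx x) = norm x"
begin

lemma cx_add: "cx (x + y) = cx x + cx y" by (rule linear_add[OF bounded_linear.linear[OF cx_bl]])
lemma cx_0: "cx 0 = 0" by (rule linear_0[OF bounded_linear.linear[OF cx_bl]])
lemma cx_sum: "cx (sum f A) = (\<Sum>i\<in>A. cx (f i))" by (rule linear_sum[OF bounded_linear.linear[OF cx_bl]])
lemma cx_scaleR: "cx (r *\<^sub>R x) = r *\<^sub>R cx x" by (rule linear_scale[OF bounded_linear.linear[OF cx_bl]])
lemma cx_prod: "cx (prod f A) = (\<Prod>i\<in>A. cx (f i))"
 by (induction A rule: infinite_finite_induct) (auto simp: cx_1 cx_mult)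
lemma cx_eq_0: "cx x = 0 \<longleftrightarrow> x = 0" using norm_cx[of x] by (metis norm_eq_zero cx_0)
lemma cx_inverse: "cx (inverse x) = inverse (cx x)"
proof (cases "x = 0")
 case False
 then have "cx (inverse x) * cx x = 1" by (simp add: cx_mult[symmetric] cx_1)
 then show ?thesis by (metis inverse_unique mult.commute)
qed (simp add: cx_0)
lemma cx_of_real: "cx (of_real r) = of_real r"
 using cx_scaleR[of r 1] by (simp add: cx_1 of_real_def)
lemma cx_of_int: "cx (of_int r) = of_int r"
 using cx_of_real[of "of_int r"] by simp

definition cxv :: "'k^'m => complex^'m" where "cxv x = (\<chi> i. cx (x $ i))"

lemma cxv_nth [simp]: "cxv x $ i = cx (x $ i)" by (simp add: cxv_def)
lemma cxv_0 [simp]: "cxv 0 = 0" by (simp add: vec_eq_iff cx_0)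
lemma norm_cxv: "norm (cxv x) = norm x" by (simp add: norm_vec_def norm_cx)
lemma cxv_bl: "bounded_linear (cxv :: 'k^'m => _)"
 by (rule bounded_linear_intro[of _ 1]) (auto simp: vec_eq_iff cx_add cx_scaleR norm_cxv)
lemma cxv_axis: "cxv (axis i 1) = axis i 1" by (simp add: vec_eq_iff axis_def cx_0 cx_1)
lemma filterlim_cxv: "filterlim cxv (nhds 0) (nhds (0 :: 'k^'m))"
 using bounded_linear.tendsto[OF cxv_bl, of "\<lambda>x. x" "0 :: 'k^'m" "nhds 0"] by (simp add: filterlim_ident)

definition extends :: "(complex^'m => complex) => ('k^'m => 'k) => bool" where
 "extends F f \<longleftrightarrow> kgerm F \<and> (near0 x. F (cxv x) = cx (f x))"

definition rg :: "('k^'m => 'k) => bool" where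
 "rg f \<longleftrightarrow> kgerm f \<and> (an --> (\<exists>F. extends F f))"

definition rmap :: "('k^'m => 'k^'l) => bool" where
 "rmap G \<longleftrightarrow> (\<forall>i. rg (\<lambda>x. G x $ i))"

lemma rg_kgerm: "rg f ==> kgerm f" by (simp add: rg_def)
lemma rmap_rg: "rmap G ==> rg (\<lambda>x. G x $ i)" by (simp add: rmap_def)

lemma rg_cong:
 assumes "rg f" "near0 x. f x = g x" shows "rg g"
proof -
 have "extends F g" if "extends F f" for F
 proof -
  have "near0 x. F (cxv x) = cx (g x)"
   using that[unfolded extends_def, THEN conjunct2] assms(2) by eventually_elim simp
  then show ?thesis using that by (simp add: extends_def)
 qed
 then show ?thesis using assms kgerm_cong unfolding rg_def by blast
qed

lemma rg_const: "rg (\<lambda>x. c)"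
 unfolding rg_def extends_def using kgerm_const[of c] kgerm_const[of "cx c"] by auto

lemma rg_nth: "rg (\<lambda>x. x $ i)"
 unfolding rg_def extends_def using kgerm_nth[of i, where 'a = 'k] kgerm_nth[of i, where 'a = complex] by auto

lemma rg_lift2:
 assumes "rg f" "rg g" "kgerm f ==> kgerm g ==> kgerm h"
  and "!!F G. extends F f ==> extends G g ==> \<exists>H. extends H h"
 shows "rg h"
 using assms unfolding rg_def by blast

lemma rg_add: "rg f ==> rg g ==> rg (\<lambda>x. f x + g x)"
proof (rule rg_lift2, assumption, assumption, rule kgerm_add, assumption, assumption)
 fix F G assume "extends F f" "extends G g"
 then have F: "kgerm F" "near0 x. F (cxv x) = cx (f x)" and G: "kgerm G" "near0 x. G (cxv x) = cx (g x)"
  by (auto simp: extends_def)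
 have "near0 x. F (cxv x) + G (cxv x) = cx (f x + g x)"
  using F(2) G(2) by eventually_elim (simp add: cx_add)
 then have "extends (\<lambda>z. F z + G z) (\<lambda>x. f x + g x)" using kgerm_add[OF F(1) G(1)] by (simp add: extends_def)
 then show "\<exists>H. extends H (\<lambda>x. f x + g x)" by (intro exI)
qed

lemma rg_mult: "rg f ==> rg g ==> rg (\<lambda>x. f x * g x)"
proof (rule rg_lift2, assumption, assumption, rule kgerm_mult, assumption, assumption)
 fix F G assume "extends F f" "extends G g"
 then have F: "kgerm F" "near0 x. F (cxv x) = cx (f x)" and G: "kgerm G" "near0 x. G (cxv x) = cx (g x)"
  by (auto simp: extends_def)
 have "near0 x. F (cxv x) * G (cxv x) = cx (f x * g x)"
  using F(2) G(2) by eventually_elim (simp add: cx_mult)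
 then have "extends (\<lambda>z. F z * G z) (\<lambda>x. f x * g x)" using kgerm_mult[OF F(1) G(1)] by (simp add: extends_def)
 then show "\<exists>H. extends H (\<lambda>x. f x * g x)" by (intro exI)
qed

lemma rg_minus: "rg f ==> rg (\<lambda>x. - f x)"
 using rg_mult[OF rg_const[of "-1"], of f] by simp
lemma rg_diff: "rg f ==> rg g ==> rg (\<lambda>x. f x - g x)"
 using rg_add[OF _ rg_minus, of f g] by simp
lemma rg_sum: "(!!i. i \<in> I ==> rg (f i)) ==> rg (\<lambda>x. \<Sum>i\<in>I. f i x)"
 by (induction I rule: infinite_finite_induct) (auto intro!: rg_add rg_const)
lemma rg_prod: "(!!i. i \<in> I ==> rg (f i)) ==> rg (\<lambda>x. \<Prod>i\<in>I. f i x)"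
 by (induction I rule: infinite_finite_induct) (auto intro!: rg_mult rg_const)
lemma rg_if: "(b ==> rg f) ==> (\<not> b ==> rg g) ==> rg (\<lambda>x. if b then f x else g x)"
 by (cases b) auto

lemma rg_inverse:
 assumes "rg f" "f 0 \<noteq> 0" shows "rg (\<lambda>x. inverse (f x))"
proof -
 have "\<exists>H. extends H (\<lambda>x. inverse (f x))" if "extends F f" for F
 proof -
  have F: "kgerm F" "near0 x. F (cxv x) = cx (f x)" using that by (auto simp: extends_def)
  have "F 0 \<noteq> 0" using near0D[OF F(2)] assms(2) by (simp add: cx_eq_0)
  moreover have "near0 x. inverse (F (cxv x)) = cx (inverse (f x))"
   using F(2) by eventually_elim (simp add: cx_inverse)
  ultimately have "extends (\<lambda>z. inverse (F z)) (\<lambda>x. inverse (f x))" using kgerm_inverse[OF F(1)] by (simp add: extends_def)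
  then show ?thesis by (intro exI)
 qed
 then show ?thesis using assms kgerm_inverse[of f] unfolding rg_def by blast
qed

lemma rg_divide: "rg f ==> rg g ==> g 0 \<noteq> 0 ==> rg (\<lambda>x. f x / g x)"
 unfolding divide_inverse by (intro rg_mult rg_inverse)

lemma rg_det: "(!!i j. rg (\<lambda>x. M x $ i $ j)) ==> rg (\<lambda>x. det (M x))"
 unfolding det_def by (intro rg_sum rg_mult rg_const rg_prod)

text \<open>Both sides are derivatives of one map, written as \<open>F (cxv x)\<close> and as
  \<open>cx (f x)\<close>.\<close>

lemma extends_derivative:
 assumes F: "extends F f" and f: "kgerm f"
 shows "near0 x. \<forall>v. fd F (cxv x) (cxv v) = cx (fd f x v)"
proof -
 obtain U where U: "0 \<in> U" "kreg_on U F" using F by (auto simp: extends_def kgerm_def)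
 obtain V where V: "0 \<in> V" "kreg_on V f" using f by (auto simp: kgerm_def)
 obtain S where S: "open S" "0 \<in> S" "!!x. x \<in> S ==> F (cxv x) = cx (f x)"
  using F unfolding extends_def eventually_nhds by blast
 have "near0 x. cxv x \<in> U"
  using eventually_compose_filterlim[OF eventually_nhds_in_open[OF kreg_on_open[OF U(2)] U(1)] filterlim_cxv] .
 moreover have "near0 x. x \<in> V" by (rule eventually_nhds_in_open[OF kreg_on_open[OF V(2)] V(1)])
 moreover have "near0 x. x \<in> S" by (rule eventually_nhds_in_open[OF S(1,2)])
 ultimately show ?thesis
 proof eventually_elim
  case (elim x)
  have 1: "((\<lambda>x. F (cxv x)) has_derivative (\<lambda>v. fd F (cxv x) (cxv v))) (at x)"
   by (rule has_derivative_compose[OF bounded_linear_imp_has_derivative[OF cxv_bl] kreg_on_deriv[OF U(2) elim(1)]])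
  have "((\<lambda>x. cx (f x)) has_derivative (\<lambda>v. cx (fd f x v))) (at x)"
   by (rule bounded_linear.has_derivative[OF cx_bl kreg_on_deriv[OF V(2) elim(2)]])
  then have "((\<lambda>x. F (cxv x)) has_derivative (\<lambda>v. cx (fd f x v))) (at x)"
   by (rule has_derivative_transform_within_open[OF _ S(1) elim(3)]) (simp add: S(3))
  from has_derivative_unique[OF 1 this] show ?case by metis
 qed
qed

lemma rg_frechet:
 assumes "rg f" shows "rg (\<lambda>x. fd f x v)"
proof -
 have "extends (\<lambda>z. fd F z (cxv v)) (\<lambda>x. fd f x v)" if "extends F f" for F
  using extends_derivative[OF that rg_kgerm[OF assms]] kgerm_frechet[of F "cxv v"] that
  by (auto simp: extends_def elim: eventually_mono)
 then show ?thesis using assms kgerm_frechet[of f v] unfolding rg_def by blast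
qed

lemma rmap_extends:
 assumes "rmap G" an
 obtains H where "!!i. kgerm (\<lambda>z. H z $ i)" "near0 x. H (cxv x) = cxv (G x)"
proof -
 have "\<forall>i. \<exists>F. extends F (\<lambda>x. G x $ i)" using assms unfolding rmap_def rg_def by blast
 from choice[OF this] obtain F where F: "\<forall>i. extends (F i) (\<lambda>x. G x $ i)" ..
 define H where "H z = (\<chi> i. F i z)" for z
 have "near0 x. \<forall>i. F i (cxv x) = cx (G x $ i)"
  using F by (intro eventually_all_finite) (auto simp: extends_def)
 then have "near0 x. H (cxv x) = cxv (G x)"
  by eventually_elim (simp add: H_def vec_eq_iff)
 moreover have "kgerm (\<lambda>z. H z $ i)" for i using F by (simp add: H_def extends_def)
 ultimately show thesis using that by blast
qed

lemma rmapI_extends: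
 assumes "!!i. kgerm (\<lambda>x. G x $ i)" "an ==> \<exists>H. (\<forall>i. kgerm (\<lambda>z. H z $ i)) \<and> (near0 x. H (cxv x) = cxv (G x))"
 shows "rmap G"
 unfolding rmap_def rg_def
proof (intro allI conjI impI assms(1))
 fix i assume an
 then obtain H where H: "\<forall>i. kgerm (\<lambda>z. H z $ i)" "near0 x. H (cxv x) = cxv (G x)" using assms(2) by blast
 have "extends (\<lambda>z. H z $ i) (\<lambda>x. G x $ i)" unfolding extends_def
  using H(1) eventually_mono[OF H(2), of "\<lambda>x. H (cxv x) $ i = cx (G x $ i)"] by simp
 then show "\<exists>F. extends F (\<lambda>x. G x $ i)" by (intro exI)
qed

lemma rmap_kmap:
 assumes "rmap G" obtains U where "0 \<in> U" "kmap_on U G"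
 using kgerm_map[of G] assms rg_kgerm unfolding rmap_def by blast

lemma rmap_tendsto:
 assumes "rmap G" "G 0 = 0" shows "filterlim G (nhds 0) (nhds 0)"
proof -
 obtain U where U: "0 \<in> U" "kmap_on U G" using rmap_kmap[OF assms(1)] .
 have "isCont G 0" using kmap_on_continuous[OF U(2)] kmap_on_open[OF U(2)] U(1) continuous_on_eq_continuous_at by blast
 then show ?thesis using assms(2) tendsto_at_iff_tendsto_nhds[of G 0] by (simp add: isCont_def)
qed

lemma rg_compose:
 assumes f: "rg f" and G: "rmap G" and 0: "G 0 = 0"
 shows "rg (\<lambda>x. f (G x))"
proof -
 have "\<exists>H. extends H (\<lambda>x. f (G x))" if F: "extends F f" and an for F
 proof -
  obtain H where H: "!!i. kgerm (\<lambda>z. H z $ i)" "near0 x. H (cxv x) = cxv (G x)"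
   using rmap_extends[OF G \<open>an\<close>] by blast
  have H0: "H 0 = 0" using near0D[OF H(2)] 0 by simp
  have "kgerm (\<lambda>z. F (H z))" by (rule kgerm_compose[OF _ H(1) H0]) (use F in \<open>simp add: extends_def\<close>)
  moreover have "near0 x. F (cxv (G x)) = cx (f (G x))"
   using F by (intro eventually_compose_filterlim[OF _ rmap_tendsto[OF G 0]]) (simp add: extends_def)
  then have "near0 x. F (H (cxv x)) = cx (f (G x))" using H(2) by eventually_elim simp
  ultimately show ?thesis unfolding extends_def by blast
 qed
 moreover have "kgerm (\<lambda>x. f (G x))"
  by (rule kgerm_compose[OF rg_kgerm[OF f] rg_kgerm[OF rmap_rg[OF G]] 0])
 ultimately show ?thesis using f unfolding rg_def by blast
qed

lemma rmap_compose:
 assumes "rmap F" "rmap G" "G 0 = 0" shows "rmap (\<lambda>x. F (G x))"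
 using rg_compose[OF rmap_rg[OF assms(1)] assms(2,3)] by (simp add: rmap_def)

lemma cxv_shrink: "cxv (shrink t s x) = shrink t s (cxv x)"
 by (simp add: vec_eq_iff shrink_def cx_scaleR)

lemma shrink_average_integrable:
 fixes f :: "'k^'m => 'k"
 assumes "kreg_on (ball 0 R) f" "x \<in> ball 0 R"
 shows "(\<lambda>s. f (shrink t s x)) integrable_on {0..1}"
proof (rule integrable_continuous_real)
 have "continuous_on {0..1} (\<lambda>s. shrink t s x)" unfolding shrink_eq by (intro continuous_intros)
 then show "continuous_on {0..1} (\<lambda>s. f (shrink t s x))"
  by (rule continuous_on_compose2[OF kreg_on_continuous[OF assms(1)]]) (use shrink_in_ball assms(2) in blast)
qed

lemma rg_average:
 assumes "rg f" shows "rg (average t f)"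
proof -
 have "\<exists>H. extends H (average t f)" if F: "extends F f" for F
 proof -
  obtain S where S: "open S" "0 \<in> S" "!!x. x \<in> S ==> F (cxv x) = cx (f x)"
   using F unfolding extends_def eventually_nhds by blast
  obtain r where r: "r > 0" "ball 0 r \<subseteq> S" using S open_contains_ball by blast
  obtain R where R: "R > 0" "kreg_on (ball 0 R) f" using kgerm_ball[OF rg_kgerm[OF assms]] .
  have eq: "average t F (cxv x) = cx (average t f x)" if x: "x \<in> ball 0 (min r R)" for x
  proof -
   have "average t F (cxv x) = integral {0..1} (\<lambda>s. cx (f (shrink t s x)))"
    unfolding average_def
   proof (rule integral_cong)
    fix s :: real assume s: "s \<in> {0..1}"
    have "shrink t s x \<in> ball 0 r" by (rule shrink_in_ball[OF s]) (use x in simp)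
    then show "F (shrink t s (cxv x)) = cx (f (shrink t s x))"
     using S(3) r(2) unfolding cxv_shrink[symmetric] by blast
   qed
   also have "... = cx (average t f x)"
    using integral_linear[OF shrink_average_integrable[OF R(2), of x t] cx_bl] x
    by (simp add: average_def o_def)
   finally show ?thesis .
  qed
  have "near0 x. x \<in> ball (0::'k^'a) (min r R)"
   using r R by (intro eventually_nhds_in_open) auto
  then have "near0 x. average t F (cxv x) = cx (average t f x)"
   by eventually_elim (rule eq)
  then have "extends (average t F) (average t f)"
   using kgerm_average[of F t] F by (simp add: extends_def)
  then show ?thesis by (intro exI)
 qed
 then show ?thesis using assms kgerm_average[of f t] unfolding rg_def by blast
qed

lemma det_cx: "det (\<chi> i j. cx (A $ i $ j)) = cx (det A)"
 by (simp add: det_def cx_sum cx_mult cx_prod cx_of_int)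

text \<open>The holomorphic extension \<open>E\<close> of \<open>G\<close> is inverted separately,
  which is possible because its Jacobian at 0 is the image of that of \<open>G\<close>. Applying the
  inverse \<open>K\<close> of \<open>E\<close> to \<open>E (cxv (H y)) = cxv y\<close> shows that
  \<open>K\<close> extends \<open>H\<close>.\<close>

lemma rmap_inverse:
 fixes G :: "'k^'m => 'k^'m"
 assumes G: "rmap G" and 0: "G 0 = 0" and inj: "inj (fd G 0)"
 obtains H where "rmap H" "H 0 = 0" "near0 x. H (G x) = x" "near0 y. G (H y) = y"
proof -
 have inv: "\<exists>H V W. open V \<and> 0 \<in> V \<and> open W \<and> 0 \<in> W \<and> homeomorphism V W G' H \<and> kmap_on W H"
  if "kmap_on U G'" "0 \<in> U" "inj (fd G' 0)" "G' 0 = 0"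
  for U and G' :: "'j::{real_normed_field,euclidean_space}^'m => 'j^'m"
  using kmap_on_inverse[OF that(1-3)] that(4) by metis
 obtain U where U: "0 \<in> U" "kmap_on U G" using rmap_kmap[OF G] .
 obtain H V W where H: "open V" "0 \<in> V" "open W" "0 \<in> W" "homeomorphism V W G H" "kmap_on W H"
  using inv[OF U(2,1) inj 0] by blast
 have HG: "H (G x) = x" if "x \<in> V" for x using H(5) that by (simp add: homeomorphism_def)
 have GH: "G (H y) = y" if "y \<in> W" for y using H(5) that by (simp add: homeomorphism_def)
 have H0: "H 0 = 0" using HG[OF H(2)] 0 by simp
 have kH: "kgerm (\<lambda>x. H x $ i)" for i unfolding kgerm_def using H(4) kmap_on_nth[OF H(6)] by blast
 have eGH: "near0 y. G (H y) = y" using eventually_nhds_in_open[OF H(3,4)] by eventually_elim (rule GH)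
 have "rmap H"
 proof (rule rmapI_extends[OF kH])
  assume an
  obtain E where E: "!!i. kgerm (\<lambda>z. E z $ i)" "near0 x. E (cxv x) = cxv (G x)"
   using rmap_extends[OF G \<open>an\<close>] by blast
  have E0: "E 0 = 0" using near0D[OF E(2)] 0 by simp
  obtain UE where UE: "0 \<in> UE" "kmap_on UE E" using kgerm_map[OF E(1)] by blast
  have ex: "extends (\<lambda>z. E z $ i) (\<lambda>x. G x $ i)" for i unfolding extends_def
   using E(1) eventually_mono[OF E(2), of "\<lambda>x. E (cxv x) $ i = cx (G x $ i)"] by simp
  have "jacobian E 0 $ i $ j = cx (jacobian G 0 $ i $ j)" for i j
   using near0D[OF extends_derivative[OF ex rg_kgerm[OF rmap_rg[OF G]], of i], THEN spec, of "axis j 1"]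
   by (simp add: cxv_axis jacobian_def kmap_on_deriv_nth[OF U(2,1)] kmap_on_deriv_nth[OF UE(2,1)])
  then have "jacobian E 0 = (\<chi> i j. cx (jacobian G 0 $ i $ j))" by (simp add: vec_eq_iff)
  then have "det (jacobian E 0) = cx (det (jacobian G 0))" by (simp add: det_cx)
  moreover have "inj ((*v) (jacobian G 0))"
   using inj jacobian_works[OF U(2,1)] by (simp add: inj_def)
  then have "det (jacobian G 0) \<noteq> 0"
   by (metis invertible_left_inverse invertible_det_nz matrix_left_invertible_injective)
  ultimately have "det (jacobian E 0) \<noteq> 0" by (simp add: cx_eq_0)
  then have "inj ((*v) (jacobian E 0))"
   by (metis invertible_left_inverse invertible_det_nz matrix_left_invertible_injective)
  then have injE: "inj (fd E 0)"
   using jacobian_works[OF UE(2,1)] by (simp add: inj_def)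
  obtain K VE WE where K: "open VE" "0 \<in> VE" "open WE" "0 \<in> WE" "homeomorphism VE WE E K" "kmap_on WE K"
   using inv[OF UE(2,1) injE E0] by blast
  have KE: "K (E x) = x" if "x \<in> VE" for x using K(5) that by (simp add: homeomorphism_def)
  have kK: "kgerm (\<lambda>x. K x $ i)" for i unfolding kgerm_def using K(4) kmap_on_nth[OF K(6)] by blast
  have tH: "filterlim H (nhds 0) (nhds 0)"
  proof -
   have "isCont H 0" using kmap_on_continuous[OF H(6)] H(3,4) continuous_on_eq_continuous_at by blast
   then show ?thesis using H0 tendsto_at_iff_tendsto_nhds[of H 0] by (simp add: isCont_def)
  qed
  have "near0 y. E (cxv (H y)) = cxv (G (H y))" by (rule eventually_compose_filterlim[OF E(2) tH])
  moreover have "near0 y. cxv (H y) \<in> VE"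
   by (rule eventually_compose_filterlim[OF eventually_nhds_in_open[OF K(1,2)] filterlim_compose[OF filterlim_cxv tH]])
  ultimately have "near0 y. K (cxv y) = cxv (H y)"
   using eGH by eventually_elim (metis KE)
  then show "\<exists>K. (\<forall>i. kgerm (\<lambda>z. K z $ i)) \<and> (near0 x. K (cxv x) = cxv (H x))" using kK by blast
 qed
 moreover have "near0 x. H (G x) = x" using eventually_nhds_in_open[OF H(1,2)] by eventually_elim (rule HG)
 ultimately show thesis using that H0 eGH by blast
qed

end

section \<open>Hadamard's lemma and division by coordinate functions\<close>

lemma shrink_path_derivative:
 fixes f :: "'k::{real_normed_field,euclidean_space}^'m => 'k"
 assumes f: "kreg_on (ball 0 R) f" and x: "x \<in> ball 0 R" and s: "s \<in> {0..1}"
 shows "((\<lambda>s. f (shrink t s x)) has_vector_derivative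
   x $ t * fd f (shrink t s x) (axis t 1)) (at s within S)"
proof -
 have in_ball: "shrink t s x \<in> ball 0 R" by (rule shrink_in_ball[OF s x])
 have "(f has_derivative fd f (shrink t s x)) (at ((x - axis t (x $ t)) + s *\<^sub>R axis t (x $ t)))"
  using kreg_on_deriv[OF f in_ball] by (simp add: shrink_eq algebra_simps)
 from line_has_derivative[OF this, of S]
 have "((\<lambda>s. f (shrink t s x)) has_vector_derivative fd f (shrink t s x) (axis t (x $ t))) (at s within S)"
  by (simp add: shrink_eq[abs_def] algebra_simps)
 moreover have "axis t (x $ t) = x $ t *s axis t 1" by (simp add: vec_eq_iff axis_def)
 ultimately show ?thesis using kreg_on_scale[OF f in_ball] by simp
qed

lemma hadamard_formula:
 fixes f :: "'k::{real_normed_field,euclidean_space}^'m => 'k"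
 assumes f: "kreg_on (ball 0 R) f" and x: "x \<in> ball 0 R"
 shows "f x = f (shrink t 0 x) + x $ t * average t (\<lambda>x. fd f x (axis t 1)) x"
proof -
 have "((\<lambda>s. x $ t * fd f (shrink t s x) (axis t 1)) has_integral
   f (shrink t 1 x) - f (shrink t 0 x)) {0..1}"
  by (rule fundamental_theorem_of_calculus) (use shrink_path_derivative[OF f x] in auto)
 then have "integral {0..1} (\<lambda>s. x $ t * fd f (shrink t s x) (axis t 1)) = f (shrink t 1 x) - f (shrink t 0 x)"
  by (rule integral_unique)
 moreover have "shrink t 1 x = x" by (simp add: shrink_eq)
 ultimately show ?thesis by (simp add: average_def)
qed

text \<open>Integrates the derivative of \<open>s *\<^sub>R f (shrink t s x)\<close> over the unit
  interval; the boundary term at 0 vanishes.\<close>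

lemma average_antiderivative:
 fixes f :: "'k::{real_normed_field,euclidean_space}^'m => 'k"
 assumes f: "kreg_on (ball 0 R) f" and x: "x \<in> ball 0 R"
 shows "average t f x + x $ t * fd (average t f) x (axis t 1) = f x"
proof -
 let ?D = "\<lambda>s. fd f (shrink t s x) (shrink t s (axis t 1))"
 have e: "?D s = s *\<^sub>R fd f (shrink t s x) (axis t 1)" if "s \<in> {0..1}" for s
 proof -
  have "shrink t s (axis t 1) = s *\<^sub>R axis t (1::'k)" by (simp add: vec_eq_iff shrink_def axis_def)
  then show ?thesis
   using linear_scale[OF has_derivative_linear[OF kreg_on_deriv[OF f shrink_in_ball[OF that x]]]] by simp
 qed
 have "((\<lambda>s. f (shrink t s x) + x $ t * ?D s) has_integral 1 *\<^sub>R f (shrink t 1 x) - 0 *\<^sub>R f (shrink t 0 x)) {0..1}"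
 proof (rule fundamental_theorem_of_calculus)
  fix s :: real assume s: "s \<in> {0..1}"
  have "((\<lambda>s. s *\<^sub>R f (shrink t s x)) has_vector_derivative
    s *\<^sub>R (x $ t * fd f (shrink t s x) (axis t 1)) + 1 *\<^sub>R f (shrink t s x)) (at s within {0..1})"
   by (rule has_vector_derivative_scaleR[OF _ shrink_path_derivative[OF f x s]]) (auto intro!: derivative_eq_intros)
  then show "((\<lambda>s. s *\<^sub>R f (shrink t s x)) has_vector_derivative f (shrink t s x) + x $ t * ?D s) (at s within {0..1})"
   by (simp add: e[OF s] add.commute)
 qed simp
 then have 1: "integral {0..1} (\<lambda>s. f (shrink t s x) + x $ t * ?D s) = f x"
  by (auto simp: shrink_eq dest: integral_unique)
 have i: "(\<lambda>s. f (shrink t s x)) integrable_on {0..1}"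
 proof (rule integrable_continuous_real)
  have "continuous_on {0..1} (\<lambda>s. shrink t s x)" unfolding shrink_eq by (intro continuous_intros)
  then show "continuous_on {0..1} (\<lambda>s. f (shrink t s x))"
   by (rule continuous_on_compose2[OF kreg_on_continuous[OF f]]) (use shrink_in_ball x in blast)
 qed
 have j: "?D integrable_on {0..1}" by (rule kreg_on_average(3)[OF f x])
 have "integral {0..1} (\<lambda>s. f (shrink t s x) + x $ t * ?D s) = average t f x + x $ t * integral {0..1} ?D"
  using integral_add[OF i integrable_linear[OF j bounded_linear_mult_right[of "x $ t"]]]
   integral_linear[OF j bounded_linear_mult_right[of "x $ t"]] by (simp add: average_def o_def)
 then show ?thesis using 1 kreg_on_average(2)[OF f x, of t "axis t 1"] by simp
qed

context regular_class
begin

lemma rg_deriv: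
 assumes "rg f"
 shows "near0 x. (f has_derivative fd f x) (at x) \<and>
   (\<forall>c v. fd f x (c *s v) = c * fd f x v)"
proof -
 obtain U where U: "0 \<in> U" "kreg_on U f" using rg_kgerm[OF assms] by (auto simp: kgerm_def)
 show ?thesis
  using eventually_nhds_in_open[OF kreg_on_open[OF U(2)] U(1)]
  by eventually_elim (use kreg_on_deriv[OF U(2)] kreg_on_scale[OF U(2)] in blast)
qed

lemma rmap_deriv:
 assumes "rmap G"
 shows "near0 x. (G has_derivative fd G x) (at x) \<and>
   (\<forall>v. fd G x v = jacobian G x *v v) \<and>
   (\<forall>v i. fd (\<lambda>x. G x $ i) x v = fd G x v $ i)"
proof -
 obtain U where U: "0 \<in> U" "kmap_on U G" using rmap_kmap[OF assms] .
 show ?thesis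
  using eventually_nhds_in_open[OF kmap_on_open[OF U(2)] U(1)]
  by eventually_elim (intro conjI allI kmap_on_deriv[OF U(2)] jacobian_works[OF U(2)] kmap_on_deriv_nth[OF U(2), symmetric])
qed

lemma rg_isCont: "rg f ==> isCont f 0"
 by (rule has_derivative_continuous[OF conjunct1[OF near0D[OF rg_deriv]]])

lemma rg_tendsto: "rg f ==> (f \<longlongrightarrow> f 0) (nhds 0)"
 using rg_isCont[of f] unfolding isCont_def tendsto_at_iff_tendsto_nhds

.

lemma rg_eventually_nonzero: "rg f ==> f 0 \<noteq> 0 ==> near0 x. f x \<noteq> 0"
 by (rule tendsto_imp_eventually_ne[OF rg_tendsto])

lemma rg_symmetric:
 assumes "rg f"
 shows "near0 x. fd (\<lambda>x. fd f x u) x v =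
     fd (\<lambda>x. fd f x v) x u"
proof -
 obtain U where U: "0 \<in> U" "kreg_on U f" using rg_kgerm[OF assms] by (auto simp: kgerm_def)
 show ?thesis
  using eventually_nhds_in_open[OF kreg_on_open[OF U(2)] U(1)]
  by eventually_elim (rule symmetric_second_derivative[OF kreg_on_Ck[OF U(2)] kreg_on_open[OF U(2)]])
qed

lemma rmap_shrink: "rmap (shrink t s :: 'k^'m => _)"
 unfolding rmap_def shrink_def
proof
 fix i :: 'm
 show "rg (\<lambda>x :: 'k^'m. (\<chi> i. if i = t then s *\<^sub>R x $ i else x $ i) $ i)"
  by (cases "i = t") (auto simp: scaleR_conv_of_real intro!: rg_mult rg_const rg_nth)
qed

lemma shrink_0 [simp]: "shrink t s 0 = (0 :: 'k^'m)"
 by (simp add: shrink_def vec_eq_iff)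

lemma shrink_tendsto: "filterlim (shrink t s) (nhds 0) (nhds (0 :: 'k^'m))"
 by (rule rmap_tendsto[OF rmap_shrink shrink_0])

lemma hadamard:
 assumes "rg f" "near0 x. x $ t = 0 --> f x = 0"
 shows "\<exists>g. rg g \<and> (near0 x. f x = x $ t * g x)"
proof (intro exI conjI)
 show "rg (average t (\<lambda>x. fd f x (axis t 1)))"
  by (rule rg_average[OF rg_frechet[OF assms(1)]])
 obtain R where R: "R > 0" "kreg_on (ball 0 R) f" using kgerm_ball[OF rg_kgerm[OF assms(1)]] .
 have "near0 x. x \<in> ball (0::'k^'a) R" by (rule eventually_nhds_in_open) (use R in auto)
 moreover have "near0 x. shrink t 0 x $ t = 0 --> f (shrink t 0 x) = 0"
  by (rule eventually_compose_filterlim[OF assms(2) shrink_tendsto])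
 ultimately show "near0 x. f x = x $ t * average t (\<lambda>x. fd f x (axis t 1)) x"
 proof eventually_elim
  case (elim x)
  have "f (shrink t 0 x) = 0" using elim(2) by (simp add: shrink_def)
  then show ?case using hadamard_formula[OF R(2) elim(1), of t] by simp
 qed
qed

lemma zero_from_hyperplane:
 assumes "rg f" "near0 x. x $ t = 0 --> f x = 0"
  and "near0 x. fd f x (axis t 1) = 0"
 shows "near0 x. f x = 0"
proof -
 obtain R where R: "R > 0" "kreg_on (ball 0 R) f" using kgerm_ball[OF rg_kgerm[OF assms(1)]] .
 obtain S where S: "open S" "0 \<in> S" "!!x. x \<in> S ==> fd f x (axis t 1) = 0"
  using assms(3) unfolding eventually_nhds by blast
 obtain r where r: "r > 0" "ball 0 r \<subseteq> S" using S open_contains_ball by blast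
 have "near0 x. x \<in> ball (0::'k^'a) (min R r)" by (rule eventually_nhds_in_open) (use R r in auto)
 moreover have "near0 x. shrink t 0 x $ t = 0 --> f (shrink t 0 x) = 0"
  by (rule eventually_compose_filterlim[OF assms(2) shrink_tendsto])
 ultimately show ?thesis
 proof eventually_elim
  case (elim x)
  have "f (shrink t 0 x) = 0" using elim(2) by (simp add: shrink_def)
  moreover have "average t (\<lambda>x. fd f x (axis t 1)) x = integral {0..1::real} (\<lambda>s. 0)"
   unfolding average_def
  proof (rule integral_cong)
   fix s :: real assume s: "s \<in> {0..1}"
   have "shrink t s x \<in> ball 0 r" by (rule shrink_in_ball[OF s]) (use elim in simp)
   then show "fd f (shrink t s x) (axis t 1) = 0" using S(3) r(2) by blast
  qed
  ultimately show ?case using hadamard_formula[OF R(2), of x t] elim(1) by simp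
 qed
qed

lemma antiderivative:
 assumes "rg f"
 shows "\<exists>g. rg g \<and> (near0 x. fd (\<lambda>x. x $ t * g x) x (axis t 1) = f x)"
proof (intro exI conjI)
 show "rg (average t f)" by (rule rg_average[OF assms])
 obtain R where R: "R > 0" "kreg_on (ball 0 R) f" using kgerm_ball[OF rg_kgerm[OF assms]] .
 have "near0 x. x \<in> ball (0::'k^'a) R" by (rule eventually_nhds_in_open) (use R in auto)
 then show "near0 x. fd (\<lambda>x. x $ t * average t f x) x (axis t 1) = f x"
 proof eventually_elim
  case (elim x)
  have 1: "((\<lambda>x. x $ t) has_derivative (\<lambda>v. v $ t)) (at x)"
   by (rule nth_has_derivative)
  have 2: "((\<lambda>x. x $ t * average t f x) has_derivative (\<lambda>v. x $ t * fd (average t f) x v + v $ t * average t f x)) (at x)"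
   by (rule has_derivative_mult[OF 1 kreg_on_deriv[OF kreg_on_average(1)[OF R(2)] elim]])
  have "fd (\<lambda>x. x $ t * average t f x) x (axis t 1) = x $ t * fd (average t f) x (axis t 1) + axis t 1 $ t * average t f x"
   unfolding fd_eq[OF 2] ..
  then show ?case using average_antiderivative[OF R(2) elim, of t] by (simp add: axis_def add.commute)
 qed
qed

text \<open>Off the hyperplane one divides; on it the value is a limit of zeros along e_t.\<close>

lemma cancel_coordinate:
 assumes "rg f" "near0 x. x $ t * f x = 0"
 shows "near0 x. f x = 0"
proof -
 obtain U where U: "0 \<in> U" "kreg_on U f" using rg_kgerm[OF assms(1)] by (auto simp: kgerm_def)
 obtain S where S: "open S" "0 \<in> S" "!!x. x \<in> S ==> x $ t * f x = 0"
  using assms(2) unfolding eventually_nhds by blast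
 have oUS: "open (U \<inter> S)" using kreg_on_open[OF U(2)] S(1) by auto
 have "near0 x. x \<in> U \<inter> S" by (rule eventually_nhds_in_open[OF oUS]) (use U S in auto)
 then show ?thesis
 proof eventually_elim
  case (elim x)
  show "f x = 0"
  proof (cases "x $ t = 0")
   case True
   have l: "((\<lambda>s. x + s *\<^sub>R axis t (1::'k)) \<longlongrightarrow> x) (at_right 0)"
    by (rule tendsto_eq_intros refl | simp)+
   have "isCont f x" by (rule has_derivative_continuous[OF kreg_on_deriv[OF U(2)]]) (use elim in simp)
   from isCont_tendsto_compose[OF this l]
   have "((\<lambda>s. f (x + s *\<^sub>R axis t 1)) \<longlongrightarrow> f x) (at_right 0)" .
   moreover have "\<forall>\<^sub>F s in at_right 0. x + s *\<^sub>R axis t (1::'k) \<in> U \<inter> S"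
    using l oUS elim by (rule topological_tendstoD)
   then have "\<forall>\<^sub>F s in at_right 0. f (x + s *\<^sub>R axis t 1) = 0"
    using eventually_at_right_less[of 0]
   proof eventually_elim
    case (elim s)
    have "(x + s *\<^sub>R axis t 1) $ t * f (x + s *\<^sub>R axis t 1) = 0" using S(3) elim by blast
    then show ?case using True elim by (simp add: axis_def)
   qed
   then have "((\<lambda>s. f (x + s *\<^sub>R axis t 1)) \<longlongrightarrow> 0) (at_right 0)" by (rule tendsto_eventually)
   ultimately show ?thesis by (rule tendsto_unique[OF trivial_limit_at_right_real])
  qed (use S(3) elim in force)
 qed
qed

text \<open>Exactness of the Koszul complex of a regular sequence. Independence of the differentials
  lets \<open>h1\<close> and \<open>h2\<close> become the coordinates y_i and y_j, where the syzygy
  reads y_j k1 = y_i k2.\<close>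

lemma koszul:
 fixes f1 f2 h1 h2 :: "'k^'m => 'k"
 assumes rg: "rg f1" "rg f2" "rg h1" "rg h2" and h0: "h1 0 = 0" "h2 0 = 0"
  and indep: "fd h1 0 (axis i 1) * fd h2 0 (axis j 1)
    \<noteq> fd h1 0 (axis j 1) * fd h2 0 (axis i 1)"
  and syz: "near0 x. h2 x * f1 x = h1 x * f2 x"
 shows "\<exists>c. rg c \<and> (near0 x. f1 x = c x * h1 x \<and> f2 x = c x * h2 x)"
proof -
 have ij: "i \<noteq> j" using indep by auto
 define H where "H x = (\<chi> l. if l = i then h1 x else if l = j then h2 x else x $ l)" for x
 have rH: "rmap H" unfolding rmap_def H_def by (auto intro!: rg_if rg rg_nth)
 have H0: "H 0 = 0" by (simp add: H_def h0 vec_eq_iff)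
 note dH = near0D[OF rmap_deriv[OF rH]]
 note d1 = near0D[OF rg_deriv[OF rg(3)]] and d2 = near0D[OF rg_deriv[OF rg(4)]]
 have "inj (fd H 0)"
 proof (subst linear_injective_0[OF has_derivative_linear[OF conjunct1[OF dH]]], intro allI impI)
  fix v assume v: "fd H 0 v = 0"
  have c: "fd (\<lambda>x. H x $ l) 0 v = 0" for l
   using conjunct2[OF conjunct2[OF dH], rule_format, of l v] unfolding v by simp
  have vl: "v $ l = 0" if "l \<noteq> i" "l \<noteq> j" for l
  proof -
   have d: "((\<lambda>x::'k^'m. x $ l) has_derivative (\<lambda>v. v $ l)) (at 0)"
    by (rule nth_has_derivative)
   have "fd (\<lambda>x::'k^'m. x $ l) 0 v = v $ l"
    unfolding fd_eq[OF d] ..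
   then show ?thesis using c[of l] that by (simp add: H_def)
  qed
  have vv: "v = v $ i *s axis i 1 + v $ j *s axis j 1"
   using vl ij by (auto simp: vec_eq_iff axis_def)
  have lin: "fd h 0 v = v $ i * fd h 0 (axis i 1) + v $ j * fd h 0 (axis j 1)"
   if "(h has_derivative fd h 0) (at 0) \<and> (\<forall>c v. fd h 0 (c *s v) = c * fd h 0 v)" for h
   using linear_add[OF has_derivative_linear[OF conjunct1[OF that]]] that by (subst vv) simp
  have "v $ i * fd h1 0 (axis i 1) + v $ j * fd h1 0 (axis j 1) = 0"
     "v $ i * fd h2 0 (axis i 1) + v $ j * fd h2 0 (axis j 1) = 0"
   using lin[OF d1] lin[OF d2] c[of i] c[of j] ij by (auto simp: H_def)
  then have "v $ i = 0 \<and> v $ j = 0" using indep by algebra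
  then show "v = 0" using vl by (metis vec_eq_iff zero_index)
 qed
 from rmap_inverse[OF rH H0 this] obtain G where G: "rmap G" "G 0 = 0" "near0 x. G (H x) = x" "near0 y. H (G y) = y" .
 have gi: "near0 y. h1 (G y) = y $ i \<and> h2 (G y) = y $ j"
  using G(4)
 proof eventually_elim
  case (elim y)
  show ?case using arg_cong[OF elim, of "\<lambda>z. z $ i"] arg_cong[OF elim, of "\<lambda>z. z $ j"] ij by (simp add: H_def)
 qed
 define k1 where "k1 y = f1 (G y)" for y
 define k2 where "k2 y = f2 (G y)" for y
 have rk: "rg k1" "rg k2" unfolding k1_def k2_def by (rule rg_compose[OF rg(1) G(1,2)], rule rg_compose[OF rg(2) G(1,2)])
 have "near0 y. h2 (G y) * f1 (G y) = h1 (G y) * f2 (G y)"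
  by (rule eventually_compose_filterlim[OF syz rmap_tendsto[OF G(1,2)]])
 then have k: "near0 y. y $ j * k1 y = y $ i * k2 y"
  using gi by eventually_elim (simp add: k1_def k2_def)
 \<comment> \<open>Restricting the syzygy to y_i = 0 gives y_j k1 = 0 there, so \<open>k1\<close>
   vanishes on this hyperplane and is divisible by y_i.\<close>
 have "near0 y. shrink i 0 y $ j * k1 (shrink i 0 y) = shrink i 0 y $ i * k2 (shrink i 0 y)"
  by (rule eventually_compose_filterlim[OF k shrink_tendsto])
 then have "near0 y. y $ j * k1 (shrink i 0 y) = 0"
  by eventually_elim (use ij in \<open>simp add: shrink_def\<close>)
 then have "near0 y. k1 (shrink i 0 y) = 0"
  by (rule cancel_coordinate[OF rg_compose[OF rk(1) rmap_shrink shrink_0]])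
 then have "near0 y. y $ i = 0 --> k1 y = 0"
 proof eventually_elim
  case (elim y)
  have "y $ i = 0 ==> shrink i 0 y = y" by (simp add: vec_eq_iff shrink_def)
  then show ?case using elim by auto
 qed
 from hadamard[OF rk(1) this] obtain c where c: "rg c" "near0 y. k1 y = y $ i * c y" by blast
 have "near0 y. y $ i * (k2 y - y $ j * c y) = 0"
  using k c(2) by eventually_elim (auto simp: algebra_simps)
 then have "near0 y. k2 y - y $ j * c y = 0"
  by (rule cancel_coordinate[OF rg_diff[OF rk(2) rg_mult[OF rg_nth c(1)]]])
 then have "near0 y. k1 y = y $ i * c y \<and> k2 y = y $ j * c y"
  using c(2) by eventually_elim simp
 from eventually_compose_filterlim[OF this rmap_tendsto[OF rH H0]]
 have "near0 x. f1 x = c (H x) * h1 x \<and> f2 x = c (H x) * h2 x"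
  using G(3) by eventually_elim (use ij in \<open>simp add: k1_def k2_def, simp add: H_def mult.commute\<close>)
 moreover have "rg (\<lambda>x. c (H x))" by (rule rg_compose[OF c(1) rH H0])
 ultimately show ?thesis by blast
qed

section \<open>Short-time flows of regular fields\<close>

lemma cxv_scons: "cxv (scons s x) = scons (cx s) (cxv x)"
 by (simp add: vec_eq_iff scons_def split: option.split)

lemma eventually_scons:
 assumes "\<forall>\<^sub>F z in nhds (0 :: 'k^('m::finite option)). P z"
 obtains r where "r > 0" "!!s y. norm s \<le> r ==> norm y \<le> r ==> P (scons s y)"
proof -
 obtain S where S: "open S" "0 \<in> S" "!!x. x \<in> S ==> P x"
  using assms unfolding eventually_nhds by blast
 have "isCont (\<lambda>z :: 'k \<times> ('k^'m). scons (fst z) (snd z)) 0"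
  by (rule linear_continuous_at[OF bounded_linear_scons])
 then have "\<forall>\<^sub>F z in nhds (0 :: 'k \<times> ('k^'m)). scons (fst z) (snd z) \<in> S"
  using S(1,2) by (auto simp: continuous_at_open eventually_nhds)
 then obtain d where d: "d > 0" "!!z :: 'k \<times> ('k^'m). dist z 0 < d ==> scons (fst z) (snd z) \<in> S"
  unfolding eventually_nhds_metric by blast
 show thesis
 proof (rule that[of "d/3"])
  fix s :: 'k and y :: "'k^'m" assume "norm s \<le> d/3" "norm y \<le> d/3"
  then have "norm (s, y) < d" using norm_Pair_le[of s y] d(1) by simp
  then show "P (scons s y)" using d(2)[of "(s, y)"] S(3) by simp
 qed (use d in simp)
qed

text \<open>What Moser's argument needs along one trajectory: the flow equation, the variational
  equation for the space derivative, and a property \<open>P\<close> that holds near 0 and is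
  therefore available at all points passed.\<close>

definition flow_eqs :: "('k^('m option) => bool) => ('k^('m::finite option) => 'k^'m) => real => (real => 'k^'m => 'k^'m) => 'k^'m => bool" where
 "flow_eqs P X a y x \<longleftrightarrow> y 0 x = x \<and> (\<forall>v. fd (y 0) x v = v) \<and>
    (\<forall>s\<in>{0..1}. P (scons (of_real (s * a)) (y s x)) \<and>
     ((\<lambda>s. y s x) has_vector_derivative vf X a s (y s x)) (at s within {0..1}) \<and>
     (\<forall>v. ((\<lambda>s. fd (y s) x v) has_vector_derivative
      a *\<^sub>R fd X (scons (of_real (s * a)) (y s x)) (scons 0 (fd (y s) x v))) (at s within {0..1})))"

text \<open>Existence is run twice, for \<open>X\<close> and for its holomorphic extension
  \<open>E\<close>. The image under \<open>cxv\<close> of a trajectory of \<open>X\<close> solves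
  the integral equation of \<open>E\<close>, so by \<open>flow_unique\<close> the end map of the
  flow of \<open>E\<close> extends \<open>y 1\<close>.\<close>

theorem regular_flow:
 fixes X :: "'k^('m::finite option) => 'k^'m"
 assumes X: "rmap X" and P: "near0 z. P z"
  and X0: "near0 z. (\<forall>j. z $ Some j = 0) --> X z = 0"
 shows "\<exists>e>0. \<forall>a. \<bar>a\<bar> < e --> (\<exists>y. rmap (y 1) \<and> y 1 0 = 0 \<and> inj (fd (y 1) 0) \<and> (near0 x. flow_eqs P X a y x))"
proof -
 obtain U where U: "0 \<in> U" "kmap_on U X" using rmap_kmap[OF X] .
 obtain r0 L0 where t0: "tame U X r0 L0" using tame_exists[OF U(2,1)] by blast
 obtain r1 where r1: "r1 > 0" "!!s y. norm s \<le> r1 ==> norm y \<le> r1 ==> P (scons s y) \<and> ((\<forall>j. scons s y $ Some j = 0) --> X (scons s y) = 0)"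
  using eventually_scons[OF eventually_conj[OF P X0]] by blast
 have "\<exists>E UE r2 L2. an --> (\<forall>i. kgerm (\<lambda>z. E z $ i)) \<and> tame UE E r2 L2 \<and>
   (\<forall>s y. norm s \<le> r2 --> norm y \<le> r2 --> E (cxv (scons s y)) = cxv (X (scons s y)))"
 proof (cases an)
  case True
  obtain E where E: "!!i. kgerm (\<lambda>z. E z $ i)" "near0 x. E (cxv x) = cxv (X x)"
   using rmap_extends[OF X True] by blast
  obtain UE where UE: "0 \<in> UE" "kmap_on UE E" using kgerm_map[OF E(1)] by blast
  obtain r L where t: "tame UE E r L" using tame_exists[OF UE(2,1)] by blast
  obtain r' where r': "r' > 0" "!!s y. norm s \<le> r' ==> norm y \<le> r' ==> E (cxv (scons s y)) = cxv (X (scons s y))"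
   using eventually_scons[OF E(2)] by blast
  have "tame UE E (min r r') L" by (rule tame_mono[OF t]) (use r' t in \<open>auto simp: tame_def\<close>)
  then show ?thesis using E(1) r'(2) by (intro exI[of _ E] exI[of _ UE] exI[of _ "min r r'"] exI[of _ L]) simp
 qed auto
 then obtain E UE r2 L2 where E: "an ==> kgerm (\<lambda>z. E z $ i)" "an ==> tame UE E r2 L2"
   "an ==> norm s \<le> r2 ==> norm y \<le> r2 ==> E (cxv (scons s y)) = cxv (X (scons s y))" for i s y by blast
 \<comment> \<open>A common radius and a common bound, so that the same \<open>a\<close> is
   admissible for the field and for its extension.\<close>
 define r where "r = (if an then min (min r0 r1) r2 else min r0 r1)"
 define L where "L = (if an then max L0 L2 else L0)"
 have r: "r > 0" "r \<le> r0" "r \<le> r1" "an ==> r \<le> r2" using t0 r1 E(2) by (auto simp: r_def tame_def)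
 have t: "tame U X r L" by (rule tame_mono[OF t0 r(1,2)]) (simp add: L_def)
 have tE: "tame UE E r L" if an by (rule tame_mono[OF E(2)[OF that] r(1) r(4)[OF that]]) (use that in \<open>simp add: L_def\<close>)
 have L: "L > 0" using t by (simp add: tame_def)
 \<comment> \<open>Ensures \<open>\<bar>a\<bar> \<le> r\<close>,
   \<open>\<bar>a\<bar> * L \<le> 1/4\<close> and \<open>\<bar>a\<bar> * L \<le> r/4\<close>, the
   three conditions in \<open>flow_exists\<close>.\<close>
 define e where "e = min r (min (1/4) (r/4) / L)"
 show ?thesis
 proof (intro exI[of _ e] conjI allI impI)
  show "e > 0" using r L by (simp add: e_def)
  fix a :: real assume a: "\<bar>a\<bar> < e"
  have ar: "\<bar>a\<bar> \<le> r" using a by (simp add: e_def)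
  have "\<bar>a\<bar> * L \<le> min (1/4) (r/4)" using a L by (simp add: e_def pos_less_divide_eq less_imp_le)
  then have aL: "\<bar>a\<bar> * L \<le> 1/4" "\<bar>a\<bar> * L \<le> r/4" by auto
  have "\<forall>x. \<exists>y. norm x < r/2 --> flow_on X a r y x" using flow_exists[OF t ar aL] by blast
  from choice[OF this] obtain w where w: "\<forall>x. norm x < r/2 --> flow_on X a r (w x) x" ..
  define y where "y s x = w x s" for s x
  have y: "flow_on X a r (\<lambda>s. y s x) x" if "norm x < r/2" for x using w that by (simp add: y_def)
  note reg = flow_regular[OF t ar aL(1) y]
  have i1: "1 \<in> {0..1::real}" and i0: "0 \<in> {0..1::real}" by auto
  have ntime: "norm (of_real (s * a) :: 'k) \<le> r" if "s \<in> {0..1}" for s by (rule norm_time_le[OF ar that])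
  have cX: "continuous_on {0..1} (\<lambda>t. vf X a t (y t x))" if "norm x < r/2" for x
   by (rule flow_field_continuous[OF t ar flow_onD(1,3)[OF y[OF that]]])
  have inU: "scons (of_real (s * a)) (y s x) \<in> U" if "norm x < r/2" "s \<in> {0..1}" for s x
   using t ntime[OF that(2)] flow_onD(3)[OF y[OF that(1)] that(2)] unfolding tame_def by blast
  have cD: "continuous_on {0..1} (\<lambda>s. a *\<^sub>R fd X (scons (of_real (s * a)) (y s x)) (scons 0 (fd (y s) x v)))"
   if x: "norm x < r/2" for x v
  proof -
   have c1: "continuous_on {0..1} (\<lambda>s. scons (of_real (s * a)) (y s x))"
    by (intro continuous_on_scons continuous_intros flow_onD(1)[OF y[OF x]])
   have c2: "continuous_on {0..1} (\<lambda>s. scons 0 (fd (y s) x v) :: 'k^('m option))"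
    by (intro continuous_on_scons continuous_intros reg(2)[OF _ x])
   \<comment> \<open>The direction of differentiation moves with \<open>s\<close>; the Jacobian
     matrix separates it from the base point.\<close>
   have "continuous_on {0..1} (\<lambda>s. jacobian X (scons (of_real (s * a)) (y s x)) *v scons 0 (fd (y s) x v))"
    unfolding matrix_vector_mult_def
   proof (rule continuous_on_vec_lambda, rule continuous_on_sum, rule continuous_on_mult)
    fix i j
    show "continuous_on {0..1} (\<lambda>s. jacobian X (scons (of_real (s * a)) (y s x)) $ i $ j)"
     by (rule continuous_on_compose2[OF kreg_on_continuous[OF kreg_on_jacobian[OF U(2)]] c1]) (use inU[OF x] in blast)
    show "continuous_on {0..1} (\<lambda>s. scons 0 (fd (y s) x v) $ j)"
     by (rule bounded_linear.continuous_on[OF bounded_linear_nth c2])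
   qed
   then have "continuous_on {0..1} (\<lambda>s. a *\<^sub>R (jacobian X (scons (of_real (s * a)) (y s x)) *v scons 0 (fd (y s) x v)))"
    by (intro continuous_intros)
   then show ?thesis
    by (rule continuous_on_eq) (rule arg_cong[where f = "scaleR a"], rule jacobian_works[OF U(2) inU[OF x], symmetric])
  qed
  have "rmap (y 1)"
  proof (rule rmapI_extends)
   show "kgerm (\<lambda>x. y 1 x $ i)" for i
    unfolding kgerm_def using kmap_on_nth[OF reg(1)[OF _ i1]] r(1) by (intro exI[of _ "ball 0 (r/2)"]) auto
   assume an
   have "\<forall>x. \<exists>y. norm x < r/2 --> flow_on E a r y x" using flow_exists[OF tE[OF \<open>an\<close>] ar aL] by blast
   from choice[OF this] obtain w' where w': "\<forall>x. norm x < r/2 --> flow_on E a r (w' x) x" ..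
   define z where "z s x = w' x s" for s x
   have z: "flow_on E a r (\<lambda>s. z s x) x" if "norm x < r/2" for x using w' that by (simp add: z_def)
   have "kgerm (\<lambda>x. z 1 x $ i)" for i
    unfolding kgerm_def using kmap_on_nth[OF flow_regular(1)[OF tE[OF \<open>an\<close>] ar aL(1) z i1]] r(1)
    by (intro exI[of _ "ball 0 (r/2)"]) auto
   moreover have "z 1 (cxv x) = cxv (y 1 x)" if x: "norm x < r/2" for x
   proof (rule flow_unique[OF tE[OF \<open>an\<close>] ar aL(1) z _ i1])
    show "norm (cxv x) < r/2" using x by (simp add: norm_cxv)
    show "flow_on E a r (\<lambda>s. cxv (y s x)) (cxv x)" unfolding flow_on_def
    proof (intro conjI ballI)
     show "continuous_on {0..1} (\<lambda>s. cxv (y s x))"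
      by (rule bounded_linear.continuous_on[OF cxv_bl flow_onD(1)[OF y[OF x]]])
     fix s :: real assume s: "s \<in> {0..1}"
     show "norm (cxv (y s x)) < r" using flow_onD(2)[OF y[OF x] s] by (simp add: norm_cxv)
     have int: "(\<lambda>t. vf X a t (y t x)) integrable_on {0..s}"
      by (rule integrable_continuous_real, rule continuous_on_subset[OF cX[OF x]]) (use s in auto)
     have "cxv (y s x) = cxv x + cxv (integral {0..s} (\<lambda>t. vf X a t (y t x)))"
      using flow_onD(4)[OF y[OF x] s] linear_add[OF bounded_linear.linear[OF cxv_bl]] by metis
     also have "cxv (integral {0..s} (\<lambda>t. vf X a t (y t x))) =
       integral {0..s} (\<lambda>t. cxv (vf X a t (y t x)))"
      using integral_linear[OF int cxv_bl] by (simp add: o_def)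
     also have "... = integral {0..s} (\<lambda>t. vf E a t (cxv (y t x)))"
     proof (rule integral_cong)
      fix t assume "t \<in> {0..s}"
      then have t1: "t \<in> {0..1}" using s by auto
      have "cxv (X (scons (of_real (t * a)) (y t x))) = E (cxv (scons (of_real (t * a)) (y t x)))"
       using E(3)[OF \<open>an\<close>] ntime[OF t1] flow_onD(3)[OF y[OF x] t1] r(4)[OF \<open>an\<close>] by (metis order_trans)
      then show "cxv (vf X a t (y t x)) = vf E a t (cxv (y t x))"
       unfolding cxv_scons cx_of_real linear_scale[OF bounded_linear.linear[OF cxv_bl]] by simp
     qed
     finally show "cxv (y s x) = cxv x + integral {0..s} (\<lambda>t. vf E a t (cxv (y t x)))" .
    qed
   qed
   then have "near0 x. z 1 (cxv x) = cxv (y 1 x)"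
    using eventually_nhds_in_open[of "ball 0 (r/2)" "0::'k^'m"] r(1) by (auto elim!: eventually_mono)
   ultimately show "\<exists>H. (\<forall>i. kgerm (\<lambda>z. H z $ i)) \<and> (near0 x. H (cxv x) = cxv (y 1 x))" by blast
  qed
  moreover have "y 1 0 = 0"
  proof (rule flow_unique[OF t ar aL(1) y _ i1])
   show "flow_on X a r (\<lambda>s. 0) 0" unfolding flow_on_def
   proof (intro conjI ballI)
    fix s :: real assume s: "s \<in> {0..1}"
    have "integral {0..s} (\<lambda>t. a *\<^sub>R X (scons (of_real (t * a)) 0)) = integral {0..s} (\<lambda>t. 0)"
    proof (rule integral_cong)
     fix t assume "t \<in> {0..s}"
     then have "t \<in> {0..1}" using s by auto
     then have "norm (of_real (t * a) :: 'k) \<le> r1" using ntime r(3) by (metis order_trans)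
     then show "a *\<^sub>R X (scons (of_real (t * a)) 0) = 0" using r1(2)[of "of_real (t * a)" 0] r1(1) by simp
    qed
    then show "0 = 0 + integral {0..s} (\<lambda>t. a *\<^sub>R X (scons (of_real (t * a)) 0))" by simp
   qed (use r in auto)
  qed (use r in simp)
  moreover have "inj (fd (y 1) 0)" by (rule reg(4)[OF _ _ i1]) (use r in auto)
  moreover have "near0 x. x \<in> ball (0::'k^'m) (r/2)" by (rule eventually_nhds_in_open) (use r in auto)
  then have "near0 x. flow_eqs P X a y x"
  proof eventually_elim
   case (elim x)
   then have x: "norm x < r/2" by simp
   show ?case unfolding flow_eqs_def
   proof (intro conjI ballI allI)
    show "y 0 x = x" using flow_onD(4)[OF y[OF x] i0] by simp
    show "fd (y 0) x v = v" for v using reg(3)[OF _ x i0, of v] by simp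
    fix s :: real assume s: "s \<in> {0..1}"
    have "norm (of_real (s * a) :: 'k) \<le> r1" "norm (y s x) \<le> r1"
     using ntime[OF s] flow_onD(3)[OF y[OF x] s] r(3) by (metis order_trans)+
    then show "P (scons (of_real (s * a)) (y s x))" using r1(2) by blast
    have "((\<lambda>s. x + integral {0..s} (\<lambda>t. vf X a t (y t x))) has_vector_derivative
      0 + vf X a s (y s x)) (at s within {0..1})"
     by (intro has_vector_derivative_add has_vector_derivative_const integral_has_vector_derivative[OF cX[OF x] s])
    from this[unfolded add_0_left] show "((\<lambda>s. y s x) has_vector_derivative vf X a s (y s x)) (at s within {0..1})"
     by (rule has_vector_derivative_transform[OF s, rotated]) (use flow_onD(4)[OF y[OF x]] in auto)
    fix v
    have "((\<lambda>s. v + integral {0..s} (\<lambda>t. a *\<^sub>R fd X (scons (of_real (t * a)) (y t x)) (scons 0 (fd (y t) x v)))) has_vector_derivative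
      0 + a *\<^sub>R fd X (scons (of_real (s * a)) (y s x)) (scons 0 (fd (y s) x v))) (at s within {0..1})"
     by (intro has_vector_derivative_add has_vector_derivative_const integral_has_vector_derivative[OF cD[OF x] s])
    from this[unfolded add_0_left] show "((\<lambda>s. fd (y s) x v) has_vector_derivative
      a *\<^sub>R fd X (scons (of_real (s * a)) (y s x)) (scons 0 (fd (y s) x v))) (at s within {0..1})"
     by (rule has_vector_derivative_transform[OF s, rotated]) (use reg(3)[OF _ x] in auto)
   qed
  qed
  ultimately show "\<exists>y. rmap (y 1) \<and> y 1 0 = 0 \<and> inj (fd (y 1) 0) \<and> (near0 x. flow_eqs P X a y x)"
   by blast
 qed
qed

end

subsection \<open>Alternating multilinear forms\<close>

lemma scalar_linear_iff:
 fixes f :: "'k::field^'m => 'k"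
 shows "Vector_Spaces.linear (*s) (*) f \<longleftrightarrow> (\<forall>x y. f (x + y) = f x + f y) \<and> (\<forall>c x. f (c *s x) = c * f x)"
 unfolding Vector_Spaces.linear_iff
 using vec.vector_space_axioms vector_space_over_itself.vector_space_axioms by auto

definition multilinear :: "nat => ('k::field, 'm::finite) covector => bool" where
 "multilinear k a \<longleftrightarrow> (\<forall>vs i x y c. length vs = k \<and> i < k -->
   a (vs[i := x + y]) = a (vs[i := x]) + a (vs[i := y]) \<and> a (vs[i := c *s x]) = c * a (vs[i := x]))"

definition alternating :: "nat => ('k::field, 'm::finite) covector => bool" where
 "alternating k a \<longleftrightarrow> (\<forall>vs i j. length vs = k \<and> i < j \<and> j < k \<and> vs ! i = vs ! j --> a vs = 0)"

lemma alternating_multilinear_iff: "alternating_multilinear k a \<longleftrightarrow> multilinear k a \<and> alternating k a"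
 unfolding alternating_multilinear_def multilinear_def alternating_def scalar_linear_iff by blast

lemma multilinear_add: "multilinear k a ==> length vs = k ==> i < k ==> a (vs[i := x + y]) = a (vs[i := x]) + a (vs[i := y])"
 and multilinear_scale: "multilinear k a ==> length vs = k ==> i < k ==> a (vs[i := c *s x]) = c * a (vs[i := x])"
 unfolding multilinear_def by blast+

lemma multilinear_zero_on_span:
 assumes ml: "multilinear k a" and z: "!!us. length us = k ==> set us \<subseteq> S ==> a us = 0"
  and vs: "length vs = k" "set vs \<subseteq> vec.span S"
 shows "a vs = 0"
proof -
 \<comment> \<open>Slots from \<open>j\<close> on already lie in \<open>S\<close>. The induction
   releases one slot at a time into the span, because the vectors that give the value 0 in that slot
   form a subspace.\<close>
 have "j \<le> k ==> length vs = k ==> set vs \<subseteq> vec.span S ==> (\<forall>i. j \<le> i \<and> i < k --> vs ! i \<in> S) ==> a vs = 0" for j vs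
 proof (induction j arbitrary: vs)
  case 0
  then show ?case by (intro z) (auto simp: set_conv_nth)
 next
  case (Suc j)
  then have j: "j < k" "j < length vs" by auto
  let ?Z = "{x. x \<in> vec.span S \<and> a (vs[j := x]) = 0}"
  have "vec.subspace ?Z"
   unfolding vec.subspace_def
   using multilinear_add[OF ml Suc.prems(2) j(1)] multilinear_scale[OF ml Suc.prems(2) j(1)]
    multilinear_scale[OF ml Suc.prems(2) j(1), of 0 0]
   by (auto simp: vec.span_zero vec.span_add vec.span_scale)
  moreover have "S \<subseteq> ?Z"
  proof
   fix x assume x: "x \<in> S"
   have "a (vs[j := x]) = 0"
   proof (rule Suc.IH)
    show "set (vs[j := x]) \<subseteq> vec.span S"
     using Suc.prems(3) x vec.span_base set_update_subset_insert[of vs j x] by auto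
    show "\<forall>i. j \<le> i \<and> i < k --> vs[j := x] ! i \<in> S"
    proof (intro allI impI)
     fix i assume i: "j \<le> i \<and> i < k"
     show "vs[j := x] ! i \<in> S"
     proof (cases "i = j")
      case False
      then have "Suc j \<le> i" using i by simp
      then show ?thesis using Suc.prems(4) i False by simp
     qed (use x j in simp)
    qed
   qed (use Suc.prems in auto)
   then show "x \<in> ?Z" using x vec.span_base by auto
  qed
  ultimately have "vec.span S \<subseteq> ?Z" by (rule vec.span_minimal[rotated])
  moreover have "vs ! j \<in> vec.span S" using Suc.prems(3) j(2) nth_mem by blast
  ultimately have "a (vs[j := vs ! j]) = 0" by blast
  then show ?case by simp
 qed
 note this[of k vs, OF order_refl vs]
 moreover have "\<forall>i. k \<le> i \<and> i < k --> vs ! i \<in> S" by auto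
 ultimately show ?thesis by blast
qed

lemma not_distinct_obtain:
 assumes "\<not> distinct us" "length us = k"
 obtains i j where "i < j" "j < k" "us ! i = us ! j"
proof -
 obtain i j where ij: "i < length us" "j < length us" "i \<noteq> j" "us ! i = us ! j"
  using assms(1) unfolding distinct_conv_nth by blast
 show thesis
 proof (cases "i < j")
  case True
  then show ?thesis using that[of i j] ij assms(2) by simp
 next
  case False
  then show ?thesis using that[of j i] ij assms(2) by simp
 qed
qed

lemma alternating_swap:
 assumes ml: "multilinear k a" and al: "alternating k a" and vs: "length vs = k" and ij: "i < j" "j < k"
 shows "a (vs[i := vs ! j, j := vs ! i]) = - a vs"
proof -
 let ?x = "vs ! i" and ?y = "vs ! j"
 define b where "b u v = a (vs[i := u, j := v])" for u v
 have d: "b u u = 0" for u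
 proof -
  have "length (vs[i := u, j := u]) = k \<and> i < j \<and> j < k \<and> vs[i := u, j := u] ! i = vs[i := u, j := u] ! j"
   using vs ij by simp
  then show ?thesis using al unfolding alternating_def b_def by blast
 qed
 have a2: "b u (v + w) = b u v + b u w" for u v w
  unfolding b_def using multilinear_add[OF ml, of "vs[i := u]" j v w] vs ij by simp
 have a1: "b (u + v) w = b u w + b v w" for u v w
  unfolding b_def using multilinear_add[OF ml, of "vs[j := w]" i u v] vs ij by (simp add: list_update_swap)
 have "b (?x + ?y) (?x + ?y) = b ?x ?y + b ?y ?x" unfolding a1 a2 by (simp add: d)
 then have "b ?x ?y + b ?y ?x = 0" using d[of "?x + ?y"] by simp
 then have "b ?y ?x = - b ?x ?y" by (rule minus_unique[symmetric])
 moreover have "vs[i := ?x, j := ?y] = vs" by simp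
 ultimately show ?thesis by (simp add: b_def)
qed

lemma alternating_zero_permute:
 assumes ml: "multilinear k A" and al: "alternating k A" and es: "length es = k" and z: "A es = 0"
  and p: "p permutes {..<k}"
 shows "A (permute_list p es) = 0"
 using finite_lessThan p
proof (induction rule: permutes_rev_induct)
 case id
 then show ?case using z by simp
next
 case (swap a b p)
 let ?q = "permute_list p es"
 have "permute_list (p \<circ> Transposition.transpose a b) es = permute_list (Transposition.transpose a b) ?q"
  by (rule permute_list_compose) (use swap es permutes_swap_id[of a "{..<k}" b] in auto)
 moreover have "permute_list (Transposition.transpose a b) ?q = ?q[a := ?q ! b, b := ?q ! a]"
  using swap es by (auto simp: list_eq_iff_nth_eq permute_list_def Transposition.transpose_def nth_list_update)
 moreover have "?q[a := ?q ! b, b := ?q ! a] = ?q[b := ?q ! a, a := ?q ! b]"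
  using swap by (simp add: list_update_swap)
 moreover have "A (?q[a := ?q ! b, b := ?q ! a]) = 0 \<or> A (?q[b := ?q ! a, a := ?q ! b]) = 0"
  using alternating_swap[OF ml al, of ?q a b] alternating_swap[OF ml al, of ?q b a] swap es by (cases a b rule: linorder_cases) auto
 ultimately show ?case by argo
qed

text \<open>After reduction to arguments from \<open>es\<close>, a list either repeats a vector or
  is a permutation of \<open>es\<close>.\<close>

lemma alternating_zero_top:
 fixes a :: "('k::field, 'm::finite) covector"
 assumes ml: "multilinear k a" and al: "alternating k a" and es: "length es = k" "vec.span (set es) = UNIV"
  and z: "a es = 0" and vs: "length vs = k"
 shows "a vs = 0"
proof (rule multilinear_zero_on_span[OF ml _ vs])
 show "set vs \<subseteq> vec.span (set es)" using es by simp
 fix us assume us: "length us = k" "set us \<subseteq> set es"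
 show "a us = 0"
 proof (cases "distinct us")
  case False
  then obtain i j where "i < j" "j < k" "us ! i = us ! j"
   using us(1) by (rule not_distinct_obtain)
  then show ?thesis using al us(1) unfolding alternating_def by blast
 next
  case True
  have "card (set us) \<ge> card (set es)" using True distinct_card us(1) es(1) card_length[of es] by metis
  then have "set us = set es" using us(2) by (intro card_seteq) auto
  moreover have "distinct es"
   using True calculation us(1) es(1) by (metis card_distinct distinct_card)
  ultimately have "mset us = mset es" using True by (simp add: set_eq_iff_mset_eq_distinct)
  then obtain p where "p permutes {..<length es}" "permute_list p es = us" by (rule mset_eq_permutation)
  then show ?thesis using alternating_zero_permute[OF ml al es(1) z] es(1) by auto
 qed
qed

lemma span_axes: "distinct es ==> set es = UNIV ==> vec.span (set (map (\<lambda>i. axis i (1::'k::field)) es) :: ('k^'m) set) = UNIV"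
 unfolding set_map
proof -
 assume "set es = UNIV"
 moreover have "range (\<lambda>i. axis i (1::'k)) = (cart_basis :: ('k^'m) set)" by (auto simp: cart_basis_def)
 ultimately show "vec.span ((\<lambda>i. axis i (1::'k)) ` set es :: ('k^'m) set) = UNIV" using vec.span_Basis by metis
qed

text \<open>Both sides are alternating and multilinear in the list of arguments and agree on the
  standard basis in the order \<open>es\<close>, so their difference \<open>g\<close> vanishes by
  \<open>alternating_zero_top\<close>.\<close>

theorem alternating_top_form:
 fixes A :: "('k::field_char_0, 'm::finite) covector"
 assumes ml: "multilinear CARD('m) A" and al: "alternating CARD('m) A"
  and es: "distinct es" "set es = (UNIV :: 'm set)"
 shows "A (map f es) = det (\<chi> i. f i) * A (map (\<lambda>i. axis i 1) es)"
proof -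
 let ?k = "CARD('m)" and ?E = "map (\<lambda>i. axis i (1::'k)) es :: ('k^'m) list"
 have len: "length es = ?k" using es distinct_card by fastforce
 define pos where "pos i = (THE j. j < ?k \<and> es ! j = i)" for i
 have pos: "pos i < ?k \<and> es ! pos i = i" for i
 proof -
  have "\<exists>!j. j < ?k \<and> es ! j = i"
   using es len by (metis UNIV_I distinct_Ex1)
  from theI'[OF this] show ?thesis by (simp add: pos_def)
 qed
 have pos_nth: "pos (es ! j) = j" if "j < ?k" for j
 proof -
  have "pos (es ! j) < ?k" "es ! pos (es ! j) = es ! j" using pos[of "es ! j"] by simp_all
  then show ?thesis using nth_eq_iff_index_eq[OF es(1), of "pos (es ! j)" j] that len by simp
 qed
 define d where "d vs = det (\<chi> i. vs ! pos i)" for vs :: "('k^'m) list"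
 have upd: "(\<chi> i. vs[j := x] ! pos i) = (\<chi> i. if i = es ! j then x else vs ! pos i)"
  if "length vs = ?k" "j < ?k" for vs :: "('k^'m) list" and j x
  using that pos pos_nth by (auto simp: vec_eq_iff nth_list_update)
 have mld: "multilinear ?k d"
  unfolding multilinear_def d_def
 proof (intro allI impI conjI)
  fix vs :: "('k^'m) list" and i x y c assume a: "length vs = ?k \<and> i < ?k"
  then have l: "length vs = ?k" "i < ?k" by auto
  show "det (\<chi> j. vs[i := x + y] ! pos j) = det (\<chi> j. vs[i := x] ! pos j) + det (\<chi> j. vs[i := y] ! pos j)"
   unfolding upd[OF l] by (rule det_row_add)
  show "det (\<chi> j. vs[i := c *s x] ! pos j) = c * det (\<chi> j. vs[i := x] ! pos j)"
   unfolding upd[OF l] by (rule det_row_mul)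
 qed
 have ald: "alternating ?k d"
  unfolding alternating_def d_def
 proof (intro allI impI, elim conjE)
  fix vs :: "('k^'m) list" and i j assume a: "length vs = ?k" "i < j" "j < ?k" "vs ! i = vs ! j"
  show "det (\<chi> i. vs ! pos i) = 0"
  proof (rule det_identical_rows)
   show "es ! i \<noteq> es ! j" using a es(1) len by (simp add: nth_eq_iff_index_eq)
   show "row (es ! i) (\<chi> i. vs ! pos i) = row (es ! j) (\<chi> i. vs ! pos i)"
    using a pos_nth by (simp add: row_def)
  qed
 qed
 have dE: "d ?E = 1"
 proof -
  have "(\<chi> i. ?E ! pos i) = mat 1" using pos len by (simp add: vec_eq_iff mat_def axis_def)
  then show ?thesis by (simp add: d_def)
 qed
 define g where "g vs = A vs - A ?E * d vs" for vs
 have "g (map f es) = 0"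
 proof (rule alternating_zero_top[of ?k])
  show "multilinear ?k g"
   unfolding multilinear_def g_def using ml mld unfolding multilinear_def by (simp add: algebra_simps)
  show "alternating ?k g"
   unfolding alternating_def g_def using al ald unfolding alternating_def by simp
  show "vec.span (set ?E) = UNIV" by (rule span_axes[OF es])
  show "g ?E = 0" by (simp add: g_def dE)
 qed (simp_all add: len)
 moreover have "(\<chi> i. map f es ! pos i) = (\<chi> i. f i)" using pos len by (simp add: vec_eq_iff)
 ultimately show ?thesis by (simp add: g_def d_def)
qed

subsection \<open>Wedge products\<close>

lemma wedge_cong:
 assumes "!!us. length us = k ==> a us = a' us" "!!us. length us = l ==> b us = b' us"
 shows "wedge k l a b vs = wedge k l a' b' vs"
 unfolding wedge_def using assms by simp

lemma wedge_power_cong: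
 assumes "!!us. length us = 2 ==> a us = a' us"
 shows "wedge_power a n vs = wedge_power a' n vs"
proof (induction n arbitrary: vs)
 case (Suc n)
 show ?case unfolding wedge_power.simps by (rule wedge_cong[OF assms Suc])
qed simp

lemma wedge_map:
 assumes "length vs = k + l"
 shows "wedge k l (\<lambda>us. a (map f us)) (\<lambda>us. b (map f us)) vs = wedge k l a b (map f vs)"
proof -
 have "map f (map (\<lambda>i. vs ! p i) [0..<k]) = map (\<lambda>i. map f vs ! p i) [0..<k] \<and>
  map f (map (\<lambda>i. vs ! p i) [k..<k + l]) = map (\<lambda>i. map f vs ! p i) [k..<k + l]"
  if "p \<in> {p. p permutes {..<k + l}}" for p
  using permutes_in_image[of p "{..<k + l}"] that assms by auto
 then show ?thesis unfolding wedge_def by (intro arg_cong2[where f = "(/)"] sum.cong refl) (simp del: map_map map_eq_conv)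
qed

lemma wedge_power_map:
 "length vs = 2 * n ==> wedge_power (\<lambda>us. a (map f us)) n vs = wedge_power a n (map f vs)"
proof (induction n arbitrary: vs)
 case (Suc n)
 have "wedge 2 (2 * n) (\<lambda>us. a (map f us)) (wedge_power (\<lambda>us. a (map f us)) n) vs =
   wedge 2 (2 * n) (\<lambda>us. a (map f us)) (\<lambda>us. wedge_power a n (map f us)) vs"
  by (rule wedge_cong[OF refl Suc.IH])
 also have "... = wedge 2 (2 * n) a (wedge_power a n) (map f vs)"
  by (rule wedge_map) (use Suc.prems in simp)
 finally show ?case by simp
qed simp

lemma multilinear_wedge:
 fixes A B :: "('k::real_normed_field, 'm::finite) covector"
 assumes a: "multilinear k A" and b: "multilinear l B"
 shows "multilinear (k + l) (wedge k l A B)"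
proof -
 have slot: "(map (\<lambda>j. vs[i := x] ! P j) [p..<q]) = (if j0 \<in> {p..<q} then (map (\<lambda>j. vs ! P j) [p..<q])[j0 - p := x] else map (\<lambda>j. vs ! P j) [p..<q])"
  if "inj P" "P j0 = i" "i < length vs" for vs i and x :: "'k^'m" and P :: "nat => nat" and p q j0
 proof (rule nth_equalityI)
  show "length (map (\<lambda>j. vs[i := x] ! P j) [p..<q]) = length (if j0 \<in> {p..<q} then (map (\<lambda>j. vs ! P j) [p..<q])[j0 - p := x] else map (\<lambda>j. vs ! P j) [p..<q])"
   by simp
  fix j assume "j < length (map (\<lambda>j. vs[i := x] ! P j) [p..<q])"
  then have j: "p + j < q" by simp
  have e: "P (p + j) = i \<longleftrightarrow> p + j = j0" using that(1,2) by (metis injD)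
  show "map (\<lambda>j. vs[i := x] ! P j) [p..<q] ! j = (if j0 \<in> {p..<q} then (map (\<lambda>j. vs ! P j) [p..<q])[j0 - p := x] else map (\<lambda>j. vs ! P j) [p..<q]) ! j"
   using j e that(3) by (auto simp: nth_list_update)
 qed
 have "\<exists>g. \<forall>x. A (map (\<lambda>j. vs[i := x] ! P j) [0..<k]) * B (map (\<lambda>j. vs[i := x] ! P j) [k..<k + l]) = g x \<and>
   (\<forall>x y c. g (x + y) = g x + g y \<and> g (c *s x) = c * g x)"
  if vs: "length vs = k + l" "i < k + l" and p: "P permutes {..<k + l}" for vs i P
 proof -
  \<comment> \<open>Slot \<open>i\<close> appears in exactly one of the two factors, at position
    \<open>j0\<close> of the permuted list; the other factor is constant in it.\<close>
  define j0 where "j0 = inv P i"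
  have j0: "P j0 = i" "j0 < k + l"
   using permutes_inverses(1)[OF p] permutes_in_image[OF permutes_inv[OF p], of i] vs(2) by (auto simp: j0_def)
  note sl = slot[OF permutes_inj[OF p] j0(1)]
  show ?thesis
  proof (cases "j0 < k")
   case True
   let ?u = "map (\<lambda>j. vs ! P j) [0..<k]"
   have "\<forall>x y c. A (?u[j0 := x + y]) = A (?u[j0 := x]) + A (?u[j0 := y]) \<and> A (?u[j0 := c *s x]) = c * A (?u[j0 := x])"
    using multilinear_add[OF a, of ?u j0] multilinear_scale[OF a, of ?u j0] True by simp
   then show ?thesis using True sl[of vs _ 0 k] sl[of vs _ k "k + l"] vs
    by (intro exI[of _ "\<lambda>x. A (?u[j0 := x]) * B (map (\<lambda>j. vs ! P j) [k..<k + l])"]) (simp add: algebra_simps del: map_eq_conv)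
  next
   case False
   let ?u = "map (\<lambda>j. vs ! P j) [k..<k + l]"
   have "\<forall>x y c. B (?u[j0 - k := x + y]) = B (?u[j0 - k := x]) + B (?u[j0 - k := y]) \<and> B (?u[j0 - k := c *s x]) = c * B (?u[j0 - k := x])"
    using multilinear_add[OF b, of ?u "j0 - k"] multilinear_scale[OF b, of ?u "j0 - k"] False j0(2) by simp
   then show ?thesis using False j0(2) sl[of vs _ 0 k] sl[of vs _ k "k + l"] vs
    by (intro exI[of _ "\<lambda>x. A (map (\<lambda>j. vs ! P j) [0..<k]) * B (?u[j0 - k := x])"]) (simp add: algebra_simps del: map_eq_conv)
  qed
 qed
 then have lin: "A (map (\<lambda>j. vs[i := x + y] ! P j) [0..<k]) * B (map (\<lambda>j. vs[i := x + y] ! P j) [k..<k + l]) =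
   A (map (\<lambda>j. vs[i := x] ! P j) [0..<k]) * B (map (\<lambda>j. vs[i := x] ! P j) [k..<k + l]) +
   A (map (\<lambda>j. vs[i := y] ! P j) [0..<k]) * B (map (\<lambda>j. vs[i := y] ! P j) [k..<k + l])"
  "A (map (\<lambda>j. vs[i := c *s x] ! P j) [0..<k]) * B (map (\<lambda>j. vs[i := c *s x] ! P j) [k..<k + l]) =
   c * (A (map (\<lambda>j. vs[i := x] ! P j) [0..<k]) * B (map (\<lambda>j. vs[i := x] ! P j) [k..<k + l]))"
  if "length vs = k + l" "i < k + l" "P permutes {..<k + l}" for vs i P x y c
  using that by metis+
 show ?thesis
  unfolding multilinear_def wedge_def mult.assoc
 proof (intro allI impI conjI, elim conjE)
  fix vs :: "('k^'m) list" and i x y assume v: "length vs = k + l" "i < k + l"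
  show "(\<Sum>P | P permutes {..<k + l}. of_int (sign P) * (A (map (\<lambda>j. vs[i := x + y] ! P j) [0..<k]) * B (map (\<lambda>j. vs[i := x + y] ! P j) [k..<k + l]))) / (fact k * fact l) =
    (\<Sum>P | P permutes {..<k + l}. of_int (sign P) * (A (map (\<lambda>j. vs[i := x] ! P j) [0..<k]) * B (map (\<lambda>j. vs[i := x] ! P j) [k..<k + l]))) / (fact k * fact l) +
    (\<Sum>P | P permutes {..<k + l}. of_int (sign P) * (A (map (\<lambda>j. vs[i := y] ! P j) [0..<k]) * B (map (\<lambda>j. vs[i := y] ! P j) [k..<k + l]))) / (fact k * fact l)"
   unfolding add_divide_distrib[symmetric] sum.distrib[symmetric] distrib_left[symmetric]
   by (intro arg_cong2[where f = "(/)"] sum.cong refl arg_cong2[where f = "(*)"]) (use lin(1)[OF v] in simp)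
 next
  fix vs :: "('k^'m) list" and i x c assume v: "length vs = k + l \<and> i < k + l"
  show "(\<Sum>P | P permutes {..<k + l}. of_int (sign P) * (A (map (\<lambda>j. vs[i := c *s x] ! P j) [0..<k]) * B (map (\<lambda>j. vs[i := c *s x] ! P j) [k..<k + l]))) / (fact k * fact l) =
    c * ((\<Sum>P | P permutes {..<k + l}. of_int (sign P) * (A (map (\<lambda>j. vs[i := x] ! P j) [0..<k]) * B (map (\<lambda>j. vs[i := x] ! P j) [k..<k + l]))) / (fact k * fact l))"
   unfolding times_divide_eq_right sum_distrib_left
   by (intro arg_cong2[where f = "(/)"] sum.cong refl) (use lin(2)[OF conjunct1[OF v] conjunct2[OF v]] in \<open>simp add: mult.left_commute\<close>)
 qed
qed

text \<open>Composing the permutations with the transposition of two slots with equal entries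
  changes only the sign, so the sum equals its negative.\<close>

lemma alternating_wedge:
 fixes a b :: "('k::real_normed_field, 'm::finite) covector"
 shows "alternating (k + l) (wedge k l a b)"
 unfolding alternating_def
proof (intro allI impI, elim conjE)
 fix vs :: "('k^'m) list" and i j assume v: "length vs = k + l" "i < j" "j < k + l" "vs ! i = vs ! j"
 let ?S = "{p. p permutes {..<k + l}}" and ?T = "Transposition.transpose i j"
 define g where "g p = of_int (sign p) * a (map (\<lambda>i. vs ! p i) [0..<k]) * b (map (\<lambda>i. vs ! p i) [k..<k + l])" for p
 have t: "?T permutes {..<k + l}" by (rule permutes_swap_id) (use v in auto)
 have same: "vs ! (?T m) = vs ! m" for m using v(4) by (simp add: Transposition.transpose_def)
 have neg: "g (?T \<circ> p) = - g p" if "p \<in> ?S" for p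
 proof -
  have "permutation p" "permutation ?T" using that permutation_permutes by (auto intro: permutation_swap_id)
  then have "sign (?T \<circ> p) = - sign p" using v(2) by (simp add: sign_compose sign_swap_id)
  then show ?thesis by (simp add: g_def same)
 qed
 have "sum g ?S = (\<Sum>p\<in>?S. g (?T \<circ> p))"
  by (rule setum_permutations_compose_left[OF t])
 also have "... = (\<Sum>p\<in>?S. - g p)" by (rule sum.cong[OF refl neg])
 finally have "sum g ?S = - sum g ?S" by (simp add: sum_negf)
 then have "2 * sum g ?S = 0" by (metis add.right_inverse mult_2)
 then have "sum g ?S = 0" by simp
 then show "wedge k l a b vs = 0" unfolding wedge_def g_def by simp
qed

lemma wedge_power_alternating_multilinear:
 fixes a :: "('k::real_normed_field, 'm::finite) covector"
 assumes "multilinear 2 a"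
 shows "multilinear (2 * n) (wedge_power a n) \<and> alternating (2 * n) (wedge_power a n)"
proof (induction n)
 case 0
 then show ?case by (simp add: multilinear_def alternating_def)
next
 case (Suc n)
 then show ?case using multilinear_wedge[OF assms, of "2 * n" "wedge_power a n"] alternating_wedge[of 2 "2 * n" a "wedge_power a n"]
  by simp
qed

text \<open>Serves to count how many vectors of a given set fall to each of the two factors.\<close>

lemma wedge_arguments:
 assumes "p permutes {..<k + l}" "length vs = k + l"
 shows "mset (map (\<lambda>i. vs ! p i) [0..<k]) + mset (map (\<lambda>i. vs ! p i) [k..<k + l]) = mset vs"
proof -
 have "permute_list p vs = map (\<lambda>i. vs ! p i) [0..<k] @ map (\<lambda>i. vs ! p i) [k..<k + l]"
  by (simp only: permute_list_def assms(2) upt_add_eq_append[OF le0] map_append)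
 then show ?thesis using mset_permute_list[of p vs] assms by (metis mset_append)
qed

lemma wedge_power_vanishes:
 fixes A :: "('k::real_normed_field, 'm::finite) covector"
 assumes K: "!!us. length us = 2 ==> set us \<inter> K \<noteq> {} ==> A us = 0"
 shows "length vs = 2 * n ==> set vs \<inter> K \<noteq> {} ==> wedge_power A n vs = 0"
proof (induction n arbitrary: vs)
 case (Suc n)
 have len: "length vs = 2 + 2 * n" using Suc.prems(1) by simp
 have "of_int (sign p) * A (map (\<lambda>i. vs ! p i) [0..<2]) * wedge_power A n (map (\<lambda>i. vs ! p i) [2..<2 + 2 * n]) = 0"
  if p: "p \<in> {p. p permutes {..<2 + 2 * n}}" for p
 proof -
  define a b where "a = map (\<lambda>i. vs ! p i) [0..<2]" and "b = map (\<lambda>i. vs ! p i) [2..<2 + 2 * n]"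
  have l: "length a = 2" "length b = 2 * n" by (simp_all only: a_def b_def length_map length_upt diff_add_inverse diff_zero)
  have "mset a + mset b = mset vs" unfolding a_def b_def using p len by (intro wedge_arguments) auto
  then have "set vs = set a \<union> set b" by (metis set_mset_mset set_mset_union)
  then have "A a = 0 \<or> wedge_power A n b = 0" using Suc.prems(2) K[OF l(1)] Suc.IH[OF l(2)] by blast
  then show ?thesis unfolding a_def[symmetric] b_def[symmetric] by auto
 qed
 then have "(\<Sum>p | p permutes {..<2 + 2 * n}. of_int (sign p) * A (map (\<lambda>i. vs ! p i) [0..<2]) *
   wedge_power A n (map (\<lambda>i. vs ! p i) [2..<2 + 2 * n])) = 0" by (intro sum.neutral ballI)
 then show ?case unfolding wedge_power.simps wedge_def by (simp only: div_0)
qed simp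

text \<open>If a kernel vector of the form at \<open>0\<close> occurs in each of two factors, their product vanishes to second order.\<close>

lemma wedge_power_jet:
 fixes A :: "'a::real_normed_vector => ('k::real_normed_field, 'm::finite) covector"
 assumes D: "!!us. length us = 2 ==> ((\<lambda>x. A x us) has_derivative a' us) (at 0)"
  and K: "!!us. length us = 2 ==> set us \<inter> K \<noteq> {} ==> A 0 us = 0"
  and N: "N = 3 \<or> N = 2 \<and> (\<forall>us. length us = 2 --> set us \<subseteq> K --> a' us u = 0)"
 shows "length vs = 2 * n ==> \<exists>G. ((\<lambda>x. wedge_power (A x) n vs) has_derivative G) (at 0) \<and>
  (N \<le> length (filter (\<lambda>v. v \<in> K) vs) --> G u = 0)"
proof (induction n arbitrary: vs)
 case 0
 show ?case by (intro exI[of _ "\<lambda>_. 0"]) (use N 0 in auto)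
next
 case (Suc n)
 define a b where "a p = map (\<lambda>i. vs ! p i) [0..<2]" and "b p = map (\<lambda>i. vs ! p i) [2..<2 + 2 * n]" for p
 have l: "length (a p) = 2" "length (b p) = 2 * n" for p
  by (simp_all only: a_def b_def length_map length_upt diff_add_inverse diff_zero)
 let ?S = "{p. p permutes {..<2 + 2 * n}}" and ?c = "\<lambda>vs. length (filter (\<lambda>v. v \<in> K) vs)"
 have "\<forall>p. \<exists>G. ((\<lambda>x. wedge_power (A x) n (b p)) has_derivative G) (at 0) \<and> (N \<le> ?c (b p) --> G u = 0)"
  by (intro allI Suc.IH l)
 from choice[OF this] obtain G where G: "\<forall>p. ((\<lambda>x. wedge_power (A x) n (b p)) has_derivative G p) (at 0) \<and> (N \<le> ?c (b p) --> G p u = 0)" ..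
 let ?T = "\<lambda>p h. of_int (sign p) * A 0 (a p) * G p h + of_int (sign p) * a' (a p) h * wedge_power (A 0) n (b p)"
 have d: "((\<lambda>x. wedge_power (A x) (Suc n) vs) has_derivative (\<lambda>h. (\<Sum>p\<in>?S. ?T p h) * inverse (fact 2 * fact (2 * n)))) (at 0)"
  unfolding wedge_power.simps wedge_def divide_inverse a_def[symmetric] b_def[symmetric]
  by (intro has_derivative_mult_left has_derivative_sum has_derivative_mult has_derivative_mult_right D l G[rule_format, THEN conjunct1])
 have "?T p u = 0" if c: "N \<le> ?c vs" and p: "p \<in> ?S" for p
 proof -
  have "mset (a p) + mset (b p) = mset vs" unfolding a_def b_def using p Suc.prems by (intro wedge_arguments) auto
  then have "mset (filter (\<lambda>v. v \<in> K) vs) = mset (filter (\<lambda>v. v \<in> K) (a p)) + mset (filter (\<lambda>v. v \<in> K) (b p))"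
   by (metis filter_union_mset mset_filter)
  then have "?c vs = ?c (a p) + ?c (b p)" by (metis size_mset size_union)
  then have sum: "N \<le> ?c (a p) + ?c (b p)" using c by simp
  have W0: "wedge_power (A 0) n (b p) = 0" if "?c (b p) \<noteq> 0"
   using that l by (intro wedge_power_vanishes[OF K]) (auto simp: filter_empty_conv)
  \<comment> \<open>If kernel vectors meet both factors, both values at 0 vanish. If all lie in the
    first factor, there are at most two of them, so \<open>N = 2\<close> and the assumption on
    \<open>a'\<close> applies; if all lie in the second, the induction hypothesis does.\<close>
  show ?thesis
  proof (cases "?c (a p) = 0")
   case True
   then have "N \<le> ?c (b p)" "?c (b p) \<noteq> 0" using sum N by auto
   then show ?thesis using W0 G by simp
  next
   case False
   then have a0: "A 0 (a p) = 0" using l by (intro K) (auto simp: filter_empty_conv)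
   show ?thesis
   proof (cases "?c (b p) = 0")
    case b: True
    have "?c (a p) \<le> 2" using length_filter_le[of "\<lambda>v. v \<in> K" "a p"] l by simp
    then have N2: "N = 2" "?c (a p) = length (a p)" using N sum b l by auto
    then have "set (a p) \<subseteq> K" using length_filter_less[of _ "a p" "\<lambda>v. v \<in> K"] by (metis less_irrefl subsetI)
    then show ?thesis using a0 N N2(1) l by simp
   qed (simp add: a0 W0)
  qed
 qed
 then have z: "(\<Sum>p\<in>?S. ?T p u) = 0" if "N \<le> ?c vs" using that by (intro sum.neutral ballI)
 show ?case
 proof (intro exI conjI impI, rule d)
  assume "N \<le> ?c vs"
  then show "(\<Sum>p\<in>?S. ?T p u) * inverse (fact 2 * fact (2 * n)) = 0" using z by simp
 qed
qed

context regular_class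
begin

lemma rg_wedge_power:
 fixes a :: "'k^'l => ('k, 'm::finite) covector"
 assumes "!!us. length us = 2 ==> rg (\<lambda>x. a x us)"
 shows "rg (\<lambda>x. wedge_power (a x) n vs)"
proof (induction n arbitrary: vs)
 case 0
 then show ?case by (simp add: rg_const)
next
 case (Suc n)
 show ?case unfolding wedge_power.simps wedge_def divide_inverse
  by (intro rg_mult rg_sum rg_const Suc assms) simp
qed

end

subsection \<open>Skew-symmetric matrices\<close>

definition bl :: "'k::comm_ring_1^'m^'m => 'k^'m => 'k^'m => 'k" where
 "bl A v w = (\<Sum>i\<in>UNIV. v $ i * (A *v w) $ i)"

definition skew :: "'k::comm_ring_1^'m^'m => bool" where
 "skew A \<longleftrightarrow> (\<forall>i j. A $ i $ j = - A $ j $ i)"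

lemma skewD: "skew A ==> A $ i $ j = - A $ j $ i"
 unfolding skew_def by blast

lemma bl_sum: "bl A v w = (\<Sum>i\<in>UNIV. \<Sum>j\<in>UNIV. v $ i * A $ i $ j * w $ j)"
 by (simp add: bl_def matrix_vector_mult_def sum_distrib_left mult.assoc)

lemma bl_add_left: "bl A (u + v) w = bl A u w + bl A v w"
 and bl_diff_left: "bl A (u - v) w = bl A u w - bl A v w"
 and bl_scale_left: "bl A (c *s v) w = c * bl A v w"
 and bl_minus_left: "bl A (- v) w = - bl A v w"
 and bl_zero_left [simp]: "bl A 0 w = 0"
 by (simp_all add: bl_def sum.distrib distrib_right sum_subtractf left_diff_distrib sum_distrib_left mult.assoc sum_negf)

lemma bl_add_right: "bl A u (v + w) = bl A u v + bl A u w"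
 and bl_scale_right: "bl A v (c *s w) = c * bl A v w"
 and bl_zero_right [simp]: "bl A v 0 = 0"
 by (simp_all add: bl_def matrix_vector_mult_def sum.distrib distrib_left sum_distrib_left algebra_simps)

lemma bl_diff_right: "bl A u (v - w) = bl A u v - bl A u w"
 by (simp add: bl_def matrix_vector_mult_def sum_subtractf right_diff_distrib)

lemma bl_matrix_add: "bl (A + B) v w = bl A v w + bl B v w"
 and bl_matrix_diff: "bl (A - B) v w = bl A v w - bl B v w"
 by (simp_all add: bl_sum sum.distrib sum_subtractf algebra_simps)

lemma bl_axis_left: "bl A (axis i 1) w = (A *v w) $ i"
proof -
 have "bl A (axis i 1) w = (\<Sum>l\<in>UNIV. if l = i then (A *v w) $ l else 0)"
  unfolding bl_def by (rule sum.cong) (auto simp: axis_def)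
 then show ?thesis by simp
qed

lemma matrix_axis: "(A *v axis j (1::'k::comm_ring_1)) $ i = A $ i $ j"
proof -
 have "(A *v axis j 1) $ i = (\<Sum>l\<in>UNIV. if l = j then A $ i $ l else 0)"
  unfolding matrix_vector_mult_def vec_lambda_beta by (rule sum.cong) (auto simp: axis_def)
 then show ?thesis by simp
qed

lemma sum_times_axis: "(\<Sum>i\<in>UNIV. u $ i * axis j (1::'k::comm_ring_1) $ i) = u $ (j::'m::finite)"
proof -
 have "(\<Sum>i\<in>UNIV. u $ i * axis j (1::'k::comm_ring_1) $ i) = (\<Sum>i\<in>UNIV. if i = j then u $ i else 0)"
  by (rule sum.cong) (auto simp: axis_def)
 then show ?thesis by simp
qed

lemma bl_axes: "bl A (axis i 1) (axis j (1::'k::comm_ring_1)) = A $ i $ j"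
 by (simp add: bl_axis_left matrix_axis)

lemma bl_skew: assumes "skew A" shows "bl A w v = - bl A v w"
proof -
 have "bl A w v = (\<Sum>j\<in>UNIV. \<Sum>i\<in>UNIV. w $ i * A $ i $ j * v $ j)" unfolding bl_sum by (rule sum.swap)
 also have "... = (\<Sum>j\<in>UNIV. \<Sum>i\<in>UNIV. - (v $ j * A $ j $ i * w $ i))"
 proof (intro sum.cong refl)
  fix i j show "w $ i * A $ i $ j * v $ j = - (v $ j * A $ j $ i * w $ i)"
   unfolding skewD[OF assms, of i j] by (simp add: algebra_simps)
 qed
 finally show ?thesis by (simp add: bl_sum sum_negf)
qed

lemma bl_self: "skew A ==> bl A v v = (0::'k::{idom, ring_char_0})"
 using bl_skew[of A v v] by (simp add: eq_neg_iff_add_eq_0)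

lemma bl_kernel: "A *v w = 0 ==> bl A v w = 0"
 by (simp add: bl_def)

lemma bl_eq: "A *v w = c *s axis i 1 ==> bl A v w = c * v $ (i :: 'm::finite)"
proof -
 assume "A *v w = c *s axis i 1"
 then have "bl A v w = (\<Sum>l\<in>UNIV. if l = i then c * v $ l else 0)"
  unfolding bl_def by (intro sum.cong) (auto simp: axis_def)
 then show ?thesis by simp
qed

lemma bl_has_derivative:
 fixes A :: "'a::real_normed_vector => 'k::real_normed_field^'m^'m"
 assumes A: "(A has_derivative A') (at x within S)" and V: "(V has_derivative V') (at x within S)"
  and W: "(W has_derivative W') (at x within S)"
 shows "((\<lambda>x. bl (A x) (V x) (W x)) has_derivative
  (\<lambda>h. bl (A' h) (V x) (W x) + bl (A x) (V' h) (W x) + bl (A x) (V x) (W' h))) (at x within S)"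
proof -
 note nth = bounded_linear.has_derivative[OF bounded_linear_nth]
 have "((\<lambda>x. bl (A x) (V x) (W x)) has_derivative
  (\<lambda>h. \<Sum>i\<in>UNIV. \<Sum>j\<in>UNIV. V x $ i * A x $ i $ j * W' h $ j + (V x $ i * A' h $ i $ j + V' h $ i * A x $ i $ j) * W x $ j)) (at x within S)"
  unfolding bl_sum by (intro has_derivative_sum has_derivative_mult nth A V W)
 moreover have "(\<Sum>i\<in>UNIV. \<Sum>j\<in>UNIV. V x $ i * A x $ i $ j * W' h $ j + (V x $ i * A' h $ i $ j + V' h $ i * A x $ i $ j) * W x $ j) =
   bl (A' h) (V x) (W x) + bl (A x) (V' h) (W x) + bl (A x) (V x) (W' h)" for h
  unfolding bl_sum by (simp add: sum.distrib algebra_simps)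
 ultimately show ?thesis by simp
qed

text \<open>The matrix of the two-form dx_a \<and> dx_b. Adding it restores full rank when the
  kernel of a corank two skew matrix projects isomorphically to the coordinates \<open>a\<close> and
  \<open>b\<close>; this is \<open>completion_exists\<close>.\<close>

definition swap_matrix :: "'m => 'm => 'k::comm_ring_1^'m^'m" where
 "swap_matrix a b = (\<chi> i j. (if i = a \<and> j = b then 1 else 0) - (if i = b \<and> j = a then 1 else 0))"

lemma skew_swap_matrix: "skew (swap_matrix a b)"
 unfolding skew_def swap_matrix_def by (intro allI) (simp only: vec_lambda_beta minus_diff_eq conj_commute)

lemma swap_matrix_mult:
 "swap_matrix a b *v v = v $ b *s axis a 1 - v $ a *s axis (b::'m::finite) (1::'k::comm_ring_1)"
proof -
 have "(swap_matrix a b *v v) $ i = (\<Sum>j\<in>UNIV. (if j = b then (if i = a then v $ b else 0) else 0) - (if j = a then (if i = b then v $ a else 0) else 0))" for i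
  unfolding matrix_vector_mult_def vec_lambda_beta swap_matrix_def by (rule sum.cong) auto
 then show ?thesis by (simp add: vec_eq_iff sum_subtractf axis_def)
qed

text \<open>A skew-symmetric matrix \<open>A\<close> of corank at most two becomes invertible after adding a rank two matrix;
 its kernel is then described by two vectors and one scalar that depend regularly on \<open>A\<close>.\<close>

definition completed_inverse :: "'m => 'm => 'k::field^'m^'m => 'k^'m^'m" where
 "completed_inverse a b A = matrix_inv (A + swap_matrix a b)"

definition kernel1 :: "'m => 'm => 'k::field^'m^'m => 'k^'m" where
 "kernel1 a b A = completed_inverse a b A *v axis a 1"

definition kernel2 :: "'m => 'm => 'k::field^'m^'m => 'k^'m" where
 "kernel2 a b A = completed_inverse a b A *v axis b 1"

text \<open>For skew \<open>A\<close> with invertible completion this is the top power of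
  \<open>A\<close> divided by that of the completion, see \<open>pf_factor\<close>; it vanishes
  exactly if \<open>A\<close> is degenerate.\<close>

definition pfaffian_factor :: "'m => 'm => 'k::field^'m^'m => 'k" where
 "pfaffian_factor a b A = 1 - kernel1 a b A $ b"

context
 fixes A :: "'k::field_char_0^'m^'m" and a b :: 'm
 assumes sk: "skew A" and d: "det (A + swap_matrix a b) \<noteq> 0"
begin

lemma completed_inverse_mult: "(A + swap_matrix a b) *v (completed_inverse a b A *v v) = v"
 "completed_inverse a b A *v ((A + swap_matrix a b) *v v) = v"
proof -
 have "invertible (A + swap_matrix a b)" using d by (simp add: invertible_det_nz)
 from someI_ex[OF this[unfolded invertible_def]]
 have "(A + swap_matrix a b) ** completed_inverse a b A = mat 1 \<and> completed_inverse a b A ** (A + swap_matrix a b) = mat 1"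
  unfolding completed_inverse_def matrix_inv_def .
 then show "(A + swap_matrix a b) *v (completed_inverse a b A *v v) = v"
  "completed_inverse a b A *v ((A + swap_matrix a b) *v v) = v"
  by (simp_all add: matrix_vector_mul_assoc)
qed

lemma completed_mult: "A *v v = (A + swap_matrix a b) *v v - v $ b *s axis a 1 + v $ a *s axis b 1"
 by (simp add: matrix_vector_mult_add_rdistrib swap_matrix_mult)

lemma skew_completed: "skew (A + swap_matrix a b)"
 unfolding skew_def
proof (intro allI)
 fix i j
 show "(A + swap_matrix a b) $ i $ j = - (A + swap_matrix a b) $ j $ i"
  using skewD[OF sk, of i j] skewD[OF skew_swap_matrix[of a b], of i j] by simp
qed

lemma completed_kernel: "(A + swap_matrix a b) *v kernel1 a b A = axis a 1" "(A + swap_matrix a b) *v kernel2 a b A = axis b 1"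
 by (simp_all add: kernel1_def kernel2_def completed_inverse_mult)

text \<open>The completed matrix sends \<open>kernel1\<close> to e_a and \<open>kernel2\<close> to
  e_b, so pairing with these images reads off the two coordinates; skewness moves the matrix to the
  other argument.\<close>

lemma completed_inverse_nth:
 "(completed_inverse a b A *v v) $ a = - (\<Sum>i\<in>UNIV. kernel1 a b A $ i * v $ i)"
 "(completed_inverse a b A *v v) $ b = - (\<Sum>i\<in>UNIV. kernel2 a b A $ i * v $ i)"
proof -
 let ?B = "A + swap_matrix a b" and ?x = "completed_inverse a b A *v v"
 have x: "?B *v ?x = v" by (rule completed_inverse_mult)
 have "bl ?B ?x (kernel1 a b A) = 1 * ?x $ a" by (rule bl_eq) (simp add: completed_kernel)
 moreover have "bl ?B ?x (kernel1 a b A) = - bl ?B (kernel1 a b A) ?x" by (rule bl_skew[OF skew_completed])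
 moreover have "bl ?B ?x (kernel2 a b A) = 1 * ?x $ b" by (rule bl_eq) (simp add: completed_kernel)
 moreover have "bl ?B ?x (kernel2 a b A) = - bl ?B (kernel2 a b A) ?x" by (rule bl_skew[OF skew_completed])
 ultimately show "?x $ a = - (\<Sum>i\<in>UNIV. kernel1 a b A $ i * v $ i)" "?x $ b = - (\<Sum>i\<in>UNIV. kernel2 a b A $ i * v $ i)"
  by (simp_all add: bl_def x)
qed

lemma kernel_coordinates:
 "kernel1 a b A $ a = 0" "kernel2 a b A $ b = 0"
 "kernel1 a b A $ b = 1 - pfaffian_factor a b A" "kernel2 a b A $ a = pfaffian_factor a b A - 1"
proof -
 have "kernel1 a b A $ a = - kernel1 a b A $ a" "kernel2 a b A $ b = - kernel2 a b A $ b" "kernel2 a b A $ a = - kernel1 a b A $ b"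
  using completed_inverse_nth[of "axis a 1"] completed_inverse_nth[of "axis b 1"]
  unfolding sum_times_axis kernel1_def[symmetric] kernel2_def[symmetric] by simp_all
 then show "kernel1 a b A $ a = 0" "kernel2 a b A $ b = 0"
  "kernel1 a b A $ b = 1 - pfaffian_factor a b A" "kernel2 a b A $ a = pfaffian_factor a b A - 1"
  by (simp_all add: pfaffian_factor_def eq_neg_iff_add_eq_0 flip: mult_2)
qed

lemma mult_kernel: "A *v kernel1 a b A = pfaffian_factor a b A *s axis a 1" "A *v kernel2 a b A = pfaffian_factor a b A *s axis b 1"
 unfolding completed_mult completed_kernel kernel_coordinates by (simp_all add: vec_eq_iff algebra_simps)

text \<open>On the kernel of \<open>A\<close> the completed matrix acts through the added matrix
  alone and sees only the coordinates \<open>a\<close> and \<open>b\<close>; applying its inverse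
  gives the expansion.\<close>

lemma kernel_expansion:
 assumes "A *v v = 0" shows "v = v $ b *s kernel1 a b A - v $ a *s kernel2 a b A"
proof -
 have "(A + swap_matrix a b) *v v = A *v v + (v $ b *s axis a 1 - v $ a *s axis b 1)"
  unfolding completed_mult[of v] by simp
 then have "(A + swap_matrix a b) *v v = v $ b *s axis a 1 - v $ a *s axis b 1"
  unfolding assms by simp
 then have "v = completed_inverse a b A *v (v $ b *s axis a 1 - v $ a *s axis b 1)"
  using completed_inverse_mult(2)[of v] by simp
 then show ?thesis
  by (simp add: kernel1_def kernel2_def matrix_vector_mult_diff_distrib vector_scalar_commute)
qed

end

section \<open>The Pfaffian as a top wedge power\<close>

definition bpow :: "'k::real_normed_field^'m^'m => nat => ('k, 'm) covector" where
 "bpow A n = wedge_power (\<lambda>vs. bl A (vs ! 0) (vs ! 1)) n"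

text \<open>For \<open>CARD('m) = 2 * n\<close> and an enumeration \<open>es\<close> of the
  coordinates this is n! times the Pfaffian, up to the sign of the order.\<close>

definition pf :: "'m list => nat => 'k::real_normed_field^'m^'m => 'k" where
 "pf es n A = bpow A n (map (\<lambda>i. axis i 1) es)"

lemma multilinear_bl: "multilinear 2 (\<lambda>vs. bl A (vs ! 0) (vs ! 1))"
 unfolding multilinear_def
 by (auto simp: less_2_cases_iff bl_add_left bl_add_right bl_scale_left bl_scale_right)

lemma multilinear_two_matrix:
 fixes a :: "('k::field, 'm::finite) covector"
 assumes a: "alternating_multilinear 2 a"
 shows "a [v, w] = bl (\<chi> i j. a [axis i 1, axis j 1]) v w"
proof -
 have ml: "multilinear 2 a" using a by (simp add: alternating_multilinear_iff)
 define g where "g vs = a [vs ! 0, vs ! 1] - bl (\<chi> i j. a [axis i 1, axis j 1]) (vs ! 0) (vs ! 1)" for vs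
 have l: "a [x + y, w] = a [x, w] + a [y, w]" "a [c *s x, w] = c * a [x, w]"
  "a [w, x + y] = a [w, x] + a [w, y]" "a [w, c *s x] = c * a [w, x]" for x y w c
  using multilinear_add[OF ml, of "[x, w]" 0 x y] multilinear_scale[OF ml, of "[x, w]" 0 c x]
   multilinear_add[OF ml, of "[w, x]" 1 x y] multilinear_scale[OF ml, of "[w, x]" 1 c x] by simp_all
 have "g [v, w] = 0"
 proof (rule multilinear_zero_on_span[where k = 2 and S = "range (\<lambda>i. axis i 1)"])
  show "multilinear 2 g" unfolding multilinear_def g_def
   by (auto simp: less_2_cases_iff bl_add_left bl_add_right bl_scale_left bl_scale_right l algebra_simps)
  have "range (\<lambda>i. axis i (1::'k)) = (cart_basis :: ('k^'m) set)" by (auto simp: cart_basis_def)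
  then show "set [v, w] \<subseteq> vec.span (range (\<lambda>i. axis i 1))" using vec.span_Basis by simp
  fix us :: "('k^'m) list" assume us: "length us = 2" "set us \<subseteq> range (\<lambda>i. axis i 1)"
  then have "us ! 0 \<in> range (\<lambda>i. axis i 1)" "us ! 1 \<in> range (\<lambda>i. axis i 1)" by (auto simp: subset_iff)
  then show "g us = 0" by (auto simp: g_def bl_axes)
 qed simp
 then show ?thesis by (simp add: g_def)
qed

lemma skew_two_matrix:
 fixes a :: "('k::field, 'm::finite) covector"
 assumes a: "alternating_multilinear 2 a"
 shows "skew (\<chi> i j. a [axis i 1, axis j 1])"
proof -
 have "multilinear 2 a" "alternating 2 a" using a by (simp_all add: alternating_multilinear_iff)
 from alternating_swap[OF this, of _ 0 1] show ?thesis by (simp add: skew_def minus_equation_iff)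
   (metis length_Cons list.size(3) list_update_code(2,3) nth_Cons_0 nth_Cons_Suc numeral_2_eq_2 One_nat_def)
qed

text \<open>The Pfaffian of a congruent matrix picks up the determinant: the wedge power of the
  transformed form is the wedge power of \<open>B\<close> on the transformed basis, and
  \<open>alternating_top_form\<close> extracts the determinant.\<close>

lemma pf_congruence:
 fixes A B :: "'k::real_normed_field^'m^'m"
 assumes card: "CARD('m) = 2 * n" and es: "distinct es" "set es = (UNIV :: 'm set)"
  and AB: "!!i j. A $ i $ j = bl B (f i) (f j)"
 shows "pf es n A = det (\<chi> i. f i) * pf es n B"
proof -
 let ?L = "\<lambda>v. \<Sum>i\<in>UNIV. v $ i *s f i"
 let ?b = "\<lambda>vs. bl B (vs ! 0) (vs ! 1)"
 have len: "length es = 2 * n" using es card distinct_card by fastforce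
 have Lax: "?L (axis i 1) = f i" for i
 proof -
  have "?L (axis i 1) = (\<Sum>l\<in>UNIV. if l = i then f l else 0)" by (rule sum.cong) (auto simp: axis_def)
  then show ?thesis by simp
 qed
 have bl_sums: "bl B (sum g I) w = (\<Sum>i\<in>I. bl B (g i) w)" "bl B w (sum g I) = (\<Sum>i\<in>I. bl B w (g i))" for g and I :: "'m set" and w
  by (induction I rule: infinite_finite_induct) (simp_all add: bl_add_left bl_add_right)
 have e: "bl A v w = bl B (?L v) (?L w)" for v w
 proof -
  have "bl B (?L v) (?L w) = (\<Sum>i\<in>UNIV. \<Sum>j\<in>UNIV. v $ i * (w $ j * bl B (f i) (f j)))"
   unfolding bl_sums(1) bl_scale_left by (simp add: bl_sums(2) bl_scale_right sum_distrib_left)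
  then show ?thesis unfolding bl_sum[of A] AB by (simp add: algebra_simps)
 qed
 have "pf es n A = wedge_power (\<lambda>us. ?b (map ?L us)) n (map (\<lambda>i. axis i 1) es)"
  unfolding pf_def bpow_def by (rule wedge_power_cong) (simp add: e)
 also have "... = wedge_power ?b n (map ?L (map (\<lambda>i. axis i 1) es))"
  by (rule wedge_power_map) (simp add: len)
 also have "map ?L (map (\<lambda>i. axis i 1) es) = map f es"
  using Lax by simp
 also have "wedge_power ?b n (map f es) = det (\<chi> i. f i) * pf es n B"
  unfolding pf_def bpow_def
  using wedge_power_alternating_multilinear[OF multilinear_bl[of B], of n]
  by (intro alternating_top_form es) (simp_all add: card)
 finally show ?thesis .
qed

text \<open>Replacing e_b by e_b - p in the standard basis turns the completed matrix back into
  \<open>A\<close>, since the completed matrix sends p to e_a. The determinant of this change of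
  basis is 1 - p_b.\<close>

lemma pf_factor:
 fixes A :: "'k::real_normed_field^'m^'m"
 assumes card: "CARD('m) = 2 * n" and es: "distinct es" "set es = (UNIV :: 'm set)"
  and sk: "skew A" and d: "det (A + swap_matrix a b) \<noteq> 0"
 shows "pf es n A = pfaffian_factor a b A * pf es n (A + swap_matrix a b)"
proof -
 let ?B = "A + swap_matrix a b" and ?p = "kernel1 a b A"
 define f where "f i = axis i 1 - (if i = b then ?p else 0)" for i
 have skB: "skew ?B" by (rule skew_completed[OF sk d])
 have p1: "bl ?B v ?p = v $ a" for v using bl_eq[of ?B ?p 1 a v] completed_kernel[OF sk d] by simp
 have p2: "bl ?B ?p v = - v $ a" for v using bl_skew[OF skB, of ?p v] p1 by simp
 have pa: "?p $ a = 0" by (rule kernel_coordinates[OF sk d])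
 have "A $ i $ j = bl ?B (f i) (f j)" for i j
 proof -
  have S: "?B $ i $ j = A $ i $ j + ((if i = a \<and> j = b then 1 else 0) - (if i = b \<and> j = a then 1 else 0))" for i j
   by (simp add: swap_matrix_def)
  have ax: "axis l 1 $ a = (if l = a then 1 else (0::'k))" for l by (auto simp: axis_def)
  show ?thesis
   unfolding f_def
   by (cases "i = b"; cases "j = b") (simp_all only: bl_diff_left bl_diff_right bl_axes p1 p2 pa S ax if_True if_False simp_thms bl_zero_left bl_zero_right, auto)
 qed
 from pf_congruence[OF card es this]
 have "pf es n A = det (\<chi> i. f i) * pf es n ?B" .
 moreover have "det (\<chi> i. f i) = pfaffian_factor a b A"
 proof -
  have 1: "(\<chi> i. f i) = (\<chi> i. if i = b then f b else row i (mat 1))"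
   by (auto simp: f_def vec_eq_iff row_def mat_def axis_def)
  have 2: "f b = (\<Sum>i\<in>UNIV. f b $ i *s row i (mat 1))"
  proof -
   have "(\<Sum>i\<in>UNIV. f b $ i *s row i (mat 1)) $ j = (\<Sum>i\<in>UNIV. if i = j then f b $ i else 0)" for j
    unfolding sum_component by (rule sum.cong) (auto simp: row_def mat_def)
   then show ?thesis by (simp add: vec_eq_iff)
  qed
  have "det (\<chi> i. f i) = f b $ b * det (mat 1 :: 'k^'m^'m)"
   unfolding 1 by (subst 2) (rule cramer_lemma_transpose)
  then show ?thesis by (simp add: f_def pfaffian_factor_def axis_def)
 qed
 ultimately show ?thesis by simp
qed

subsection \<open>Kernels of skew-symmetric matrices\<close>

definition indep3 :: "'k::field^'m => 'k^'m => 'k^'m => bool" where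
 "indep3 x y z \<longleftrightarrow> (\<forall>a b c. a *s x + b *s y + c *s z = 0 --> a = 0 \<and> b = 0 \<and> c = 0)"

lemma extend_to_invertible:
 fixes B :: "('k::field^'m) set"
 assumes "vec.independent B"
 obtains f :: "'m => 'k^'m" where "inj f" "B \<subseteq> range f" "det (\<chi> i. f i) \<noteq> 0" "vec.span (range f) = UNIV"
proof -
 let ?E = "vec.extend_basis B"
 have E: "B \<subseteq> ?E" "vec.independent ?E" "vec.span ?E = UNIV"
  using vec.extend_basis_superset[OF assms] vec.independent_extend_basis[OF assms] vec.span_extend_basis[OF assms] by auto
 have "card ?E = vec.dim (UNIV :: ('k^'m) set)"
  using vec.dim_eq_card[OF _ E(2), of UNIV] E(3) by simp
 then have c: "card ?E = CARD('m)" by (simp add: vec_dim_card card_cart_basis)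
 then have "finite ?E" by (metis card.infinite card_eq_0_iff finite_class.finite_UNIV UNIV_not_empty)
 then obtain f where f: "bij_betw f (UNIV :: 'm set) ?E"
  using finite_same_card_bij[of "UNIV :: 'm set" ?E] c by auto
 have "rows (\<chi> i. f i) = ?E" using f by (auto simp: rows_def row_def bij_betw_def)
 then obtain R where "R ** (\<chi> i. f i) = mat 1"
  using E(3) matrix_left_invertible_span_rows_gen[of "\<chi> i. f i"] by auto
 then have "det (\<chi> i. f i) \<noteq> 0" by (metis det_I det_mul mult_zero_right zero_neq_one)
 moreover have "inj f" "B \<subseteq> range f" "vec.span (range f) = UNIV" using f E(1,3) by (auto simp: bij_betw_def)
 ultimately show thesis using that by blast
qed

lemma indep3_independent:
 fixes x y z :: "'k::field^'m"
 assumes "indep3 x y z"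
 shows "x \<noteq> y" "x \<noteq> z" "y \<noteq> z" "vec.independent {x, y, z}"
proof -
 note i3 = assms[unfolded indep3_def, rule_format]
 show neq: "x \<noteq> y" "x \<noteq> z" "y \<noteq> z"
  using i3[of 1 "-1" 0] i3[of 1 0 "-1"] i3[of 0 1 "-1"] by (auto simp: vec_eq_iff)
 show "vec.independent {x, y, z}"
 proof
  assume "vec.dependent {x, y, z}"
  then obtain u where u: "\<exists>v\<in>{x, y, z}. u v \<noteq> 0" "(\<Sum>v\<in>{x, y, z}. u v *s v) = 0"
   using vec.dependent_finite[of "{x, y, z}"] by auto
  then have "u x *s x + u y *s y + u z *s z = 0" using neq by (simp add: add.assoc)
  then have "u x = 0 \<and> u y = 0 \<and> u z = 0" using assms unfolding indep3_def by blast
  then show False using u(1) by auto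
 qed
qed

lemma indep3_extend:
 fixes x y z :: "'k::field^'m"
 assumes "indep3 x y z"
 obtains f :: "'m => 'k^'m" and i j k where "det (\<chi> i. f i) \<noteq> 0" "distinct [i, j, k]" "f i = x" "f j = y" "f k = z"
proof -
 note ind = indep3_independent[OF assms]
 obtain f :: "'m => 'k^'m" where f: "inj f" "{x, y, z} \<subseteq> range f" "det (\<chi> i. f i) \<noteq> 0" using extend_to_invertible[OF ind(4)] .
 then obtain i j k where "f i = x" "f j = y" "f k = z" by auto
 then show thesis using that[of f i j k] ind f(3) by auto
qed

text \<open>Rank-nullity with explicit vectors: a basis of the row space is extended to a basis
  \<open>f\<close>, and those members \<open>c l\<close> of the dual basis that belong to added
  vectors are annihilated by all rows.\<close>

lemma rank_kernel3:
 fixes S :: "'k::field^'p^'p"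
 assumes "rank S + 3 = CARD('p)"
 obtains x y z where "indep3 x y z" "S *v x = 0" "S *v y = 0" "S *v z = 0"
proof -
 obtain B where B: "B \<subseteq> rows S" "vec.independent B" "rows S \<subseteq> vec.span B" "card B = vec.dim (rows S)"
  by (rule vec.basis_exists)
 obtain f :: "'p => 'k^'p" where f: "inj f" "B \<subseteq> range f" "det (\<chi> i. f i) \<noteq> 0"
  using extend_to_invertible[OF B(2)] .
 let ?R = "\<chi> i. f i"
 obtain Q where Q: "?R ** Q = mat 1"
  using f(3) invertible_det_nz[of ?R] unfolding invertible_def by blast
 define c where "c l = Q *v axis l 1" for l
 have Rc: "?R *v c l = axis l 1" for l by (simp add: c_def matrix_vector_mul_assoc Q)
 have ker: "S *v c l = 0" if "f l \<notin> B" for l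
 proof -
  have "v \<in> B ==> (\<Sum>j\<in>UNIV. v $ j * c l $ j) = 0" for v
  proof -
   assume "v \<in> B"
   then obtain i where i: "f i = v" "i \<noteq> l" using f(2) \<open>f l \<notin> B\<close> by auto
   have "(?R *v c l) $ i = 0" using i(2) by (simp add: Rc axis_def)
   then show ?thesis by (simp add: matrix_vector_mult_def i(1))
  qed
  moreover have "vec.subspace {v. (\<Sum>j\<in>UNIV. v $ j * c l $ j) = 0}"
   unfolding vec.subspace_def by (simp add: distrib_right sum.distrib mult.assoc flip: sum_distrib_left)
  ultimately have "vec.span B \<subseteq> {v. (\<Sum>j\<in>UNIV. v $ j * c l $ j) = 0}" by (intro vec.span_minimal) auto
  then have "!!v. v \<in> rows S ==> (\<Sum>j\<in>UNIV. v $ j * c l $ j) = 0" using B(3) by blast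
  then show ?thesis by (simp add: vec_eq_iff matrix_vector_mult_def rows_def row_def) (metis vec_lambda_eta)
 qed
 have "card {l. f l \<in> B} = card B"
 proof -
  have "f ` {l. f l \<in> B} = B" using f(2) by auto
  then show ?thesis using card_image[of f "{l. f l \<in> B}"] f(1) by (metis inj_on_subset subset_UNIV)
 qed
 moreover have "card {l. f l \<notin> B} = CARD('p) - card {l. f l \<in> B}"
  unfolding Collect_neg_eq Compl_eq_Diff_UNIV by (rule card_Diff_subset) auto
 ultimately have "card {l. f l \<notin> B} = 3" using assms B(4) by (simp add: row_rank_def_gen)
 then obtain i j k where ijk: "{l. f l \<notin> B} = {i, j, k}" "i \<noteq> j" "i \<noteq> k" "j \<noteq> k" unfolding card_3_iff by auto
 have "indep3 (c i) (c j) (c k)"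
  unfolding indep3_def
 proof (intro allI impI)
  fix a b g assume "a *s c i + b *s c j + g *s c k = 0"
  then have "?R *v (a *s c i + b *s c j + g *s c k) = 0" by simp
  then have "a *s axis i 1 + b *s axis j 1 + g *s axis k (1::'k) = 0"
   by (simp add: matrix_vector_right_distrib vector_scalar_commute Rc)
  then have "a * axis i 1 $ l + b * axis j 1 $ l + g * axis k (1::'k) $ l = 0" for l
   by (simp add: vec_eq_iff)
  from this[of i] this[of j] this[of k] show "a = 0 \<and> b = 0 \<and> g = 0" using ijk(2-4) by (simp add: axis_def)
 qed
 then show thesis using that ker ijk(1) by blast
qed

lemma minor_exists:
 fixes x y :: "'k::field^'m"
 assumes "!!A B. A *s x + B *s y = 0 ==> A = 0 \<and> B = 0"
 obtains a b where "x $ a * y $ b - x $ b * y $ a \<noteq> 0"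
proof -
 have "x \<noteq> 0" using assms[of 1 0] by auto
 then obtain a where a: "x $ a \<noteq> 0" by (auto simp: vec_eq_iff)
 have "\<exists>b. x $ a * y $ b - x $ b * y $ a \<noteq> 0"
 proof (rule ccontr)
  assume "\<not> ?thesis"
  then have "(- y $ a) *s x + x $ a *s y = 0" by (simp add: vec_eq_iff algebra_simps)
  then show False using assms a by blast
 qed
 then show thesis using that by blast
qed

text \<open>If the completed matrix kills \<open>v\<close>, then \<open>A *v v\<close> is a
  combination of e_a and e_b. Pairing it with the kernel vectors \<open>x\<close>, \<open>y\<close>
  forces v_a = v_b = 0 by the minor; so \<open>v\<close> lies in the kernel, depends on
  \<open>x\<close>, \<open>y\<close> by \<open>no3\<close>, and is zero.\<close>

lemma completion_exists:
 fixes A :: "'k::field_char_0^'m^'m"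
 assumes sk: "skew A" and n: "A *v x = 0" "A *v y = 0" "x $ a * y $ b - x $ b * y $ a \<noteq> 0"
  and no3: "!!u v w. A *v u = 0 ==> A *v v = 0 ==> A *v w = 0 ==> \<not> indep3 u v w"
 shows "det (A + swap_matrix a b) \<noteq> 0"
proof -
 have "v = 0" if "(A + swap_matrix a b) *v v = 0" for v
 proof -
  have Av: "A *v v = v $ a *s axis b 1 - v $ b *s axis a 1"
   using that by (simp add: matrix_vector_mult_add_rdistrib swap_matrix_mult add_eq_0_iff2)
  have pair: "(\<Sum>i\<in>UNIV. u $ i * (A *v v) $ i) = v $ a * u $ b - v $ b * u $ a" for u
  proof -
   have "(\<Sum>i\<in>UNIV. u $ i * (A *v v) $ i) = (\<Sum>i\<in>UNIV. (if i = b then v $ a * u $ i else 0) - (if i = a then v $ b * u $ i else 0))"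
    unfolding Av by (rule sum.cong) (auto simp: axis_def algebra_simps)
   then show ?thesis by (simp add: sum_subtractf)
  qed
  have z: "v $ a * u $ b - v $ b * u $ a = 0" if "A *v u = 0" for u
   using bl_skew[OF sk, of u v] bl_kernel[OF that, of v] pair[of u] by (simp add: bl_def)
  have e: "v $ a * x $ b = v $ b * x $ a" "v $ a * y $ b = v $ b * y $ a" using z[OF n(1)] z[OF n(2)] by simp_all
  have "v $ a * (x $ a * y $ b - x $ b * y $ a) = 0" "v $ b * (x $ a * y $ b - x $ b * y $ a) = 0"
   using e by algebra+
  then have ab: "v $ a = 0" "v $ b = 0" using n(3) by auto
  then have "A *v v = 0" by (simp add: Av)
  have "\<not> indep3 x y v" by (rule no3[OF n(1,2) \<open>A *v v = 0\<close>])
  then obtain c B g where abc: "c *s x + B *s y + g *s v = 0" "\<not> (c = 0 \<and> B = 0 \<and> g = 0)"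
   unfolding indep3_def by blast
  have "c * x $ l + B * y $ l + g * v $ l = 0" for l using abc(1) by (simp add: vec_eq_iff)
  from this[of a] this[of b] have "c * x $ a + B * y $ a = 0" "c * x $ b + B * y $ b = 0" by (simp_all add: ab)
  then have "c * (x $ a * y $ b - x $ b * y $ a) = 0" "B * (x $ a * y $ b - x $ b * y $ a) = 0" by algebra+
  then have "c = 0" "B = 0" using n(3) by auto
  then show "v = 0" using abc by (simp add: vec_eq_iff)
 qed
 then have "\<forall>v. (A + swap_matrix a b) *v v = 0 --> v = 0" by simp
 with matrix_left_invertible_ker[of "A + swap_matrix a b", symmetric]
 have "\<exists>R. R ** (A + swap_matrix a b) = mat 1" by (rule iffD1)
 then obtain R where "R ** (A + swap_matrix a b) = mat 1" ..
 then show ?thesis by (metis det_I det_mul mult_zero_right zero_neq_one)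
qed

text \<open>On the span of \<open>x\<close>, \<open>y\<close>, \<open>z\<close> the matrix takes
  values in the line of e_t, so it kills a plane in this span. Subtracting multiples of one of the
  three vectors from the other two exhibits the plane.\<close>

lemma tangential_kernel:
 fixes A :: "'k::field^'m^'m"
 assumes i3: "indep3 x y z" and tan: "x $ t = 0" "y $ t = 0" "z $ t = 0"
  and ker: "!!j. j \<noteq> t ==> (A *v x) $ j = 0 \<and> (A *v y) $ j = 0 \<and> (A *v z) $ j = 0"
 obtains u v a b where "A *v u = 0" "A *v v = 0" "u $ t = 0" "v $ t = 0" "u $ a * v $ b - u $ b * v $ a \<noteq> 0"
proof -
 have zero: "A *v w = 0" if "(A *v w) $ t = 0" "!!j. j \<noteq> t ==> (A *v w) $ j = 0" for w
 proof -
  have "(A *v w) $ j = 0" for j using that by (cases "j = t") auto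
  then show ?thesis by (simp add: vec_eq_iff)
 qed
 have main: thesis if i3: "indep3 x y z" and tan: "x $ t = 0" "y $ t = 0" "z $ t = 0"
  and ker: "!!j. j \<noteq> t ==> (A *v x) $ j = 0 \<and> (A *v y) $ j = 0 \<and> (A *v z) $ j = 0"
  and nz: "(A *v z) $ t = 0 --> (A *v x) $ t = 0 \<and> (A *v y) $ t = 0" for x y z
 proof -
  \<comment> \<open>Division by zero gives 0, the right multiple in the case that all three images
    vanish.\<close>
  define c d where "c = (A *v x) $ t / (A *v z) $ t" and "d = (A *v y) $ t / (A *v z) $ t"
  let ?u = "x - c *s z" and ?v = "y - d *s z"
  have comb: "(A *v (w - e *s z)) $ j = (A *v w) $ j - e * (A *v z) $ j" for w e j
   by (simp add: matrix_vector_mult_diff_distrib vector_scalar_commute)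
  have 1: "A *v ?u = 0" by (rule zero) (use ker nz in \<open>auto simp: comb c_def\<close>)
  have 2: "A *v ?v = 0" by (rule zero) (use ker nz in \<open>auto simp: comb d_def\<close>)
  have "f = 0 \<and> B = 0" if "f *s ?u + B *s ?v = 0" for f B
  proof -
   have "f *s x + B *s y + (- f * c - B * d) *s z = 0"
    using that by (simp add: vec_eq_iff algebra_simps)
   then show ?thesis using i3 unfolding indep3_def by blast
  qed
  then obtain a b where "?u $ a * ?v $ b - ?u $ b * ?v $ a \<noteq> 0" by (rule minor_exists)
  then show thesis using \<open>!!u v a b. [|A *v u = 0; A *v v = 0; u $ t = 0; v $ t = 0; u $ a * v $ b - u $ b * v $ a \<noteq> 0|] ==> thesis\<close>
    1 2 tan by simp
 qed
 have perm: "indep3 z y x" "indep3 x z y"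
  unfolding indep3_def
 proof (safe)
  fix f B g
  { assume "f *s z + B *s y + g *s x = 0"
   then have "g *s x + B *s y + f *s z = 0" by (simp add: algebra_simps)
   then have "g = 0 \<and> B = 0 \<and> f = 0" using i3 unfolding indep3_def by blast
   then show "f = 0" "B = 0" "g = 0" by auto }
  { assume "f *s x + B *s z + g *s y = 0"
   then have "f *s x + g *s y + B *s z = 0" by (simp add: algebra_simps)
   then have "f = 0 \<and> g = 0 \<and> B = 0" using i3 unfolding indep3_def by blast
   then show "f = 0" "B = 0" "g = 0" by auto }
 qed
 \<comment> \<open>The vector used for elimination must have a nonzero image whenever one of the
   three has.\<close>
 consider "(A *v z) $ t = 0 --> (A *v x) $ t = 0 \<and> (A *v y) $ t = 0" | "(A *v x) $ t \<noteq> 0" | "(A *v y) $ t \<noteq> 0" by blast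
 then show thesis
 proof cases
  case 1
  then show ?thesis using main[OF i3 tan ker] by blast
 next
  case 2
  then show ?thesis using main[OF perm(1) tan(3,2,1)] ker by blast
 next
  case 3
  then show ?thesis using main[OF perm(2) tan(1,3,2)] ker by blast
 qed
qed

text \<open>Three kernel vectors among the arguments cannot all fall to one factor of the wedge
  power, so two factors vanish at 0 and the power vanishes to second order. This will bound the
  corank at a structurally smooth point by two.\<close>

lemma pf_derivative_corank3:
 fixes M :: "'a::real_normed_vector => 'k::real_normed_field^'m^'m"
 assumes card: "CARD('m) = 2 * n" and es: "distinct es" "set es = (UNIV :: 'm set)"
  and M: "(M has_derivative D) (at 0)" and sk: "skew (M 0)"
  and i3: "indep3 x y z" and ker: "M 0 *v x = 0" "M 0 *v y = 0" "M 0 *v z = 0"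
  and G: "((\<lambda>y. pf es n (M y)) has_derivative G) (at 0)"
 shows "G v = 0"
proof -
 obtain f :: "'m => 'k^'m" and i j k where f: "det (\<chi> i. f i) \<noteq> 0" "distinct [i, j, k]" "f i = x" "f j = y" "f k = z"
  using indep3_extend[OF i3] .
 have len: "length es = 2 * n" using es card distinct_card by fastforce
 have "\<exists>G'. ((\<lambda>y. bpow (M y) n (map f es)) has_derivative G') (at 0) \<and>
   (3 \<le> length (filter (\<lambda>v. v \<in> {x, y, z}) (map f es)) --> G' v = 0)"
  unfolding bpow_def
 proof (rule wedge_power_jet)
  show "((\<lambda>x. bl (M x) (us ! 0) (us ! 1)) has_derivative (\<lambda>h. bl (D h) (us ! 0) (us ! 1))) (at 0)" for us
   using bl_has_derivative[OF M has_derivative_const has_derivative_const, of "us ! 0" "us ! 1"] by simp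
  fix us :: "('k^'m) list" assume us: "length us = 2" "set us \<inter> {x, y, z} \<noteq> {}"
  have "bl (M 0) v w = 0" "bl (M 0) w v = 0" if "w \<in> {x, y, z}" for v w
   using that ker bl_kernel[of "M 0" w v] bl_skew[OF sk, of w v] by auto
  moreover have "us ! 0 \<in> {x, y, z} \<or> us ! 1 \<in> {x, y, z}"
   using us by (auto simp: in_set_conv_nth less_2_cases_iff)
  ultimately show "bl (M 0) (us ! 0) (us ! 1) = 0" by blast
 qed (simp_all add: len)
 then obtain G' where G': "((\<lambda>y. bpow (M y) n (map f es)) has_derivative G') (at 0)"
  "3 \<le> length (filter (\<lambda>v. v \<in> {x, y, z}) (map f es)) --> G' v = 0" by blast
 have "card {i, j, k} \<le> card (set (filter (\<lambda>l. f l \<in> {x, y, z}) es))" using f es(2) by (intro card_mono) auto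
 also have "... = length (filter (\<lambda>v. v \<in> {x, y, z}) (map f es))"
  unfolding filter_map length_map comp_def using es(1) by (intro distinct_card distinct_filter)
 finally have "G' v = 0" using f(2) G'(2) by simp
 moreover have "bpow (M y) n (map f es) = det (\<chi> i. f i) * pf es n (M y)" for y
  unfolding pf_def bpow_def using wedge_power_alternating_multilinear[OF multilinear_bl[of "M y"], of n]
  by (intro alternating_top_form es) (simp_all add: card)
 then have "G' = (\<lambda>h. det (\<chi> i. f i) * G h)"
  using has_derivative_unique[OF G'(1)] has_derivative_mult_right[OF G] by simp
 ultimately show ?thesis using f(1) by simp
qed

subsection \<open>Germs of two-forms\<close>

lemma mult_has_derivative:
 fixes A :: "'a::real_normed_vector => 'k::real_normed_field^'m^'m"
 assumes A: "(A has_derivative A') (at x within S)" and V: "(V has_derivative V') (at x within S)"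
 shows "((\<lambda>x. A x *v V x) has_derivative (\<lambda>h. A' h *v V x + A x *v V' h)) (at x within S)"
proof -
 have "((\<lambda>x. bl (A x) (axis i 1) (V x)) has_derivative
  (\<lambda>h. bl (A' h) (axis i 1) (V x) + bl (A x) 0 (V x) + bl (A x) (axis i 1) (V' h))) (at x within S)" for i
  by (rule bl_has_derivative[OF A has_derivative_const V])
 from vec_has_derivative[OF this[unfolded bl_axis_left]]
 have "((\<lambda>x. \<chi> i. (A x *v V x) $ i) has_derivative (\<lambda>h. \<chi> i. (A' h *v V x) $ i + bl (A x) 0 (V x) + (A x *v V' h) $ i)) (at x within S)"
  by simp
 moreover have "(\<chi> i. (A' h *v V x) $ i + bl (A x) 0 (V x) + (A x *v V' h) $ i) = A' h *v V x + A x *v V' h" for h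
  by (simp add: vec_eq_iff)
 ultimately show ?thesis by simp
qed

text \<open>The exterior derivative evaluated on constant vector fields, for which the bracket terms
  are absent.\<close>

definition closed2 :: "('k::real_normed_field^'m => 'k^'m^'m) => 'k^'m => bool" where
 "closed2 M x \<longleftrightarrow> (\<forall>u v w. bl (fd M x u) v w + bl (fd M x v) w u +
   bl (fd M x w) u v = 0)"

definition pull :: "('k::real_normed_field^'m => 'k^'l) => ('k^'l => 'k^'l^'l) => 'k^'m => 'k^'m^'m" where
 "pull F M x = (\<chi> i j. bl (M (F x)) (fd F x (axis i 1)) (fd F x (axis j 1)))"

lemma closed2_axes:
 fixes M :: "'k::real_normed_field^'m => 'k^'m^'m"
 assumes lin: "!!u j k. fd M x u $ j $ k = (\<Sum>i\<in>UNIV. u $ i * fd M x (axis i 1) $ j $ k)"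
  and cyc: "!!i j k. fd M x (axis i 1) $ j $ k + fd M x (axis j 1) $ k $ i +
   fd M x (axis k 1) $ i $ j = 0"
 shows "closed2 M x"
 unfolding closed2_def
proof (intro allI)
 fix u v w
 define T where "T i j k = fd M x (axis i 1) $ j $ k" for i j k
 have e: "bl (fd M x u) v w = (\<Sum>i\<in>UNIV. \<Sum>j\<in>UNIV. \<Sum>k\<in>UNIV. u $ i * v $ j * w $ k * T i j k)" for u v w
 proof -
  have "bl (fd M x u) v w = (\<Sum>j\<in>UNIV. \<Sum>k\<in>UNIV. \<Sum>i\<in>UNIV. u $ i * v $ j * w $ k * T i j k)"
   unfolding bl_sum lin[of u] T_def by (simp add: sum_distrib_left sum_distrib_right algebra_simps)
  also have "... = (\<Sum>j\<in>UNIV. \<Sum>i\<in>UNIV. \<Sum>k\<in>UNIV. u $ i * v $ j * w $ k * T i j k)"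
   by (intro sum.cong refl sum.swap)
  finally show ?thesis by (subst sum.swap)
 qed
 have e1: "bl (fd M x v) w u = (\<Sum>i\<in>UNIV. \<Sum>j\<in>UNIV. \<Sum>k\<in>UNIV. u $ i * v $ j * w $ k * T j k i)"
 proof -
  have "bl (fd M x v) w u = (\<Sum>j\<in>UNIV. \<Sum>i\<in>UNIV. \<Sum>k\<in>UNIV. v $ j * w $ k * u $ i * T j k i)"
   unfolding e by (intro sum.cong refl sum.swap)
  then show ?thesis by (subst sum.swap) (simp add: algebra_simps)
 qed
 have e2: "bl (fd M x w) u v = (\<Sum>i\<in>UNIV. \<Sum>j\<in>UNIV. \<Sum>k\<in>UNIV. u $ i * v $ j * w $ k * T k i j)"
 proof -
  have "bl (fd M x w) u v = (\<Sum>i\<in>UNIV. \<Sum>k\<in>UNIV. \<Sum>j\<in>UNIV. w $ k * u $ i * v $ j * T k i j)"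
   unfolding e by (rule sum.swap)
  also have "... = (\<Sum>i\<in>UNIV. \<Sum>j\<in>UNIV. \<Sum>k\<in>UNIV. w $ k * u $ i * v $ j * T k i j)"
   by (intro sum.cong refl sum.swap)
  finally show ?thesis by (simp add: algebra_simps)
 qed
 show "bl (fd M x u) v w + bl (fd M x v) w u + bl (fd M x w) u v = 0"
  unfolding e[of u v w] e1 e2 sum.distrib[symmetric] distrib_left[symmetric] cyc[folded T_def] by simp
qed

context regular_class
begin

definition rmat :: "('k^'l => 'k^'m^'m) => bool" where
 "rmat M \<longleftrightarrow> (\<forall>i j. rg (\<lambda>x. M x $ i $ j))"

lemma rmat_rg: "rmat M ==> rg (\<lambda>x. M x $ i $ j)" by (simp add: rmat_def)

lemma rmat_deriv:
 assumes "rmat M"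
 shows "near0 x. (M has_derivative fd M x) (at x) \<and>
   (\<forall>u i j. fd (\<lambda>x. M x $ i $ j) x u = fd M x u $ i $ j)"
proof -
 have "near0 x. \<forall>i j. ((\<lambda>x. M x $ i $ j) has_derivative fd (\<lambda>x. M x $ i $ j) x) (at x)"
  proof (intro eventually_all_finite)
  fix i j
  show "near0 x. ((\<lambda>x. M x $ i $ j) has_derivative fd (\<lambda>x. M x $ i $ j) x) (at x)"
   using rg_deriv[OF rmat_rg[OF assms]] by (rule eventually_mono) blast
 qed
 then show ?thesis
 proof eventually_elim
  case (elim x)
  have d: "(M has_derivative (\<lambda>u. \<chi> i j. fd (\<lambda>x. M x $ i $ j) x u)) (at x)"
  proof -
   have "((\<lambda>x. M x $ i) has_derivative (\<lambda>u. \<chi> j. fd (\<lambda>x. M x $ i $ j) x u)) (at x)" for i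
    by (rule vec_has_derivative) (use elim in blast)
   from vec_has_derivative[OF this] show ?thesis .
  qed
  show ?case using d unfolding fd_eq[OF d] by simp
 qed
qed

lemma rmat_linear:
 assumes "rmat M"
 shows "near0 x. \<forall>u j k. fd M x u $ j $ k = (\<Sum>i\<in>UNIV. u $ i * fd M x (axis i 1) $ j $ k)"
proof -
 have "near0 x. \<forall>j k. (\<forall>c v. fd (\<lambda>x. M x $ j $ k) x (c *s v) = c * fd (\<lambda>x. M x $ j $ k) x v)"
 proof (intro eventually_all_finite)
  fix j k
  show "near0 x. \<forall>c v. fd (\<lambda>x. M x $ j $ k) x (c *s v) = c * fd (\<lambda>x. M x $ j $ k) x v"
   using rg_deriv[OF rmat_rg[OF assms]] by (rule eventually_mono) blast
 qed
 with rmat_deriv[OF assms] show ?thesis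
 proof eventually_elim
  case (elim x)
  let ?D = "fd M x"
  have add: "?D (v + w) = ?D v + ?D w" for v w
   by (rule linear_add[OF has_derivative_linear[OF conjunct1[OF elim(1)]]])
  have sc: "?D (c *s v) $ j $ k = c * ?D v $ j $ k" for c v j k using elim by metis
  have D0: "?D 0 = 0" by (rule linear_0[OF has_derivative_linear[OF conjunct1[OF elim(1)]]])
  have sums: "?D (sum g I) $ j $ k = (\<Sum>i\<in>I. ?D (g i) $ j $ k)" for g and I :: "'a set" and j k
   by (induction I rule: infinite_finite_induct) (simp_all add: D0 add)
  show ?case
  proof (intro allI)
   fix u j k
   have "?D u $ j $ k = ?D (\<Sum>i\<in>UNIV. u $ i *s axis i 1) $ j $ k" by (simp add: basis_expansion)
   then show "?D u $ j $ k = (\<Sum>i\<in>UNIV. u $ i * ?D (axis i 1) $ j $ k)" unfolding sums sc .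
  qed
 qed
qed

lemma rmap_mv: "rmat A ==> rmap V ==> rmap (\<lambda>x. A x *v V x)"
 unfolding rmap_def rmat_def matrix_vector_mult_def by (simp add: rg_sum rg_mult)

lemma rg_bl: "rmat A ==> rmap V ==> rmap W ==> rg (\<lambda>x. bl (A x) (V x) (W x))"
 unfolding bl_sum rmap_def rmat_def by (intro rg_sum rg_mult) blast+

lemma rmap_const: "rmap (\<lambda>x. c)" unfolding rmap_def by (simp add: rg_const)
lemma rmap_add: "rmap F ==> rmap G ==> rmap (\<lambda>x. F x + G x)" unfolding rmap_def by (simp add: rg_add)
lemma rmap_diff: "rmap F ==> rmap G ==> rmap (\<lambda>x. F x - G x)" unfolding rmap_def by (simp add: rg_diff)
lemma rmap_scale: "rg f ==> rmap G ==> rmap (\<lambda>x. f x *s G x)" unfolding rmap_def by (simp add: rg_mult)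
lemma rmat_add: "rmat F ==> rmat G ==> rmat (\<lambda>x. F x + G x)" unfolding rmat_def by (simp add: rg_add)
lemma rmat_diff: "rmat F ==> rmat G ==> rmat (\<lambda>x. F x - G x)" unfolding rmat_def by (simp add: rg_diff)
lemma rmat_compose: "rmat M ==> rmap G ==> G 0 = 0 ==> rmat (\<lambda>x. M (G x))"
 unfolding rmat_def using rg_compose[of "\<lambda>x. M x $ _ $ _" G] by blast
lemma rmap_frechet:
 assumes "rmap G" shows "rmap (\<lambda>x. fd G x v)"
 unfolding rmap_def
proof
 fix i
 show "rg (\<lambda>x. fd G x v $ i)"
  by (rule rg_cong[OF rg_frechet[OF rmap_rg[OF assms, of i], of v]])
    (use rmap_deriv[OF assms] in \<open>rule eventually_mono, blast\<close>)
qed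

lemma eventually_rmap: "near0 y. P y ==> rmap G ==> G 0 = 0 ==> near0 x. P (G x)"
 by (rule eventually_compose_filterlim[OF _ rmap_tendsto])

lemma frechet_compose:
 assumes F: "rmap F" and G: "rmap G" "G 0 = 0"
 shows "near0 x. \<forall>v. fd (\<lambda>x. F (G x)) x v = fd F (G x) (fd G x v)"
 using rmap_deriv[OF G(1)] eventually_rmap[OF rmap_deriv[OF F] G]
proof eventually_elim
 case (elim x)
 then have "((\<lambda>x. F (G x)) has_derivative (\<lambda>v. fd F (G x) (fd G x v))) (at x)"
  using has_derivative_compose[OF conjunct1[OF elim(1)] conjunct1[OF elim(2)]] by simp
 then show ?case by (metis frechet_derivative_at)
qed

section \<open>Equivalence and pullback of germs of two-forms\<close>

text \<open>\<open>M\<close> is the pullback of \<open>N\<close> by a diffeomorphism-germ;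
  injectivity of the differential at 0 stands for the regular inverse, which
  \<open>rmap_inverse\<close> supplies.\<close>

definition mequiv :: "('k^'m => 'k^'m^'m) => ('k^'m => 'k^'m^'m) => bool" where
 "mequiv M N \<longleftrightarrow> (\<exists>H. rmap H \<and> H 0 = 0 \<and> inj (fd H 0) \<and>
   (near0 x. \<forall>v w. bl (N (H x)) (fd H x v) (fd H x w) = bl (M x) v w))"

lemma mequiv_trans:
 assumes "mequiv L M" "mequiv M N" shows "mequiv L N"
proof -
 obtain F where F: "rmap F" "F 0 = 0" "inj (fd F 0)"
   "near0 x. \<forall>v w. bl (M (F x)) (fd F x v) (fd F x w) = bl (L x) v w"
  using assms(1) unfolding mequiv_def by blast
 obtain G where G: "rmap G" "G 0 = 0" "inj (fd G 0)"
   "near0 x. \<forall>v w. bl (N (G x)) (fd G x v) (fd G x w) = bl (M x) v w"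
  using assms(2) unfolding mequiv_def by blast
 note c = frechet_compose[OF G(1) F(1,2)]
 show ?thesis unfolding mequiv_def
 proof (intro exI[of _ "\<lambda>x. G (F x)"] conjI)
  show "rmap (\<lambda>x. G (F x))" by (rule rmap_compose[OF G(1) F(1,2)])
  show "G (F 0) = 0" using F G by simp
  have "fd (\<lambda>x. G (F x)) 0 = fd G 0 \<circ> fd F 0"
   using near0D[OF c] F(2) by (auto simp: fun_eq_iff)
  then show "inj (fd (\<lambda>x. G (F x)) 0)" using inj_compose[OF G(3) F(3)] by simp
  show "near0 x. \<forall>v w. bl (N (G (F x))) (fd (\<lambda>x. G (F x)) x v) (fd (\<lambda>x. G (F x)) x w) = bl (L x) v w"
   using c F(4) eventually_rmap[OF G(4) F(1,2)]
  proof eventually_elim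
   case (elim x)
   show ?case
   proof (intro allI)
    fix v w
    show "bl (N (G (F x))) (fd (\<lambda>x. G (F x)) x v) (fd (\<lambda>x. G (F x)) x w) = bl (L x) v w"
     unfolding elim(1)[rule_format] elim(3)[rule_format] elim(2)[rule_format] ..
   qed
  qed
 qed
qed

lemma frechet_inverse:
 assumes G: "rmap G" and H: "rmap H" "H 0 = 0" and GH: "near0 y. G (H y) = y"
 shows "near0 y. \<forall>v. fd G (H y) (fd H y v) = v"
proof -
 have "near0 y. \<forall>\<^sub>F z in nhds y. G (H z) = z" using GH by (simp add: eventually_eventually)
 with frechet_compose[OF G H] show ?thesis
 proof eventually_elim
  case (elim y)
  obtain S where "open S" "y \<in> S" "!!z. z \<in> S ==> G (H z) = z" using elim(2) unfolding eventually_nhds by blast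
  then have "fd (\<lambda>y. G (H y)) y = fd (\<lambda>z. z) y"
   by (intro fd_cong_open)
  also have "... = (\<lambda>v. v)" using frechet_derivative_at[OF has_derivative_ident, of y] by (simp add: id_def)
  finally show ?case using elim(1) by simp
 qed
qed

lemma mequiv_sym:
 assumes "mequiv M N" shows "mequiv N M"
proof -
 obtain G where G: "rmap G" "G 0 = 0" "inj (fd G 0)"
   "near0 x. \<forall>v w. bl (N (G x)) (fd G x v) (fd G x w) = bl (M x) v w"
  using assms unfolding mequiv_def by blast
 obtain H where H: "rmap H" "H 0 = 0" "near0 x. H (G x) = x" "near0 y. G (H y) = y"
  using rmap_inverse[OF G(1-3)] .
 note c = frechet_inverse[OF G(1) H(1,2,4)]
 show ?thesis unfolding mequiv_def
 proof (intro exI[of _ H] conjI H)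
  show "inj (fd H 0)"
   using near0D[OF c] by (metis injI)
  show "near0 x. \<forall>v w. bl (M (H x)) (fd H x v) (fd H x w) = bl (N x) v w"
   using c H(4) eventually_rmap[OF G(4) H(1,2)]
  proof eventually_elim
   case (elim x)
   show ?case
   proof (intro allI)
    fix v w
    show "bl (M (H x)) (fd H x v) (fd H x w) = bl (N x) v w"
     unfolding elim(3)[rule_format, symmetric] elim(1)[rule_format] elim(2) ..
   qed
  qed
 qed
qed

definition two_form :: "('k^'m => 'k^'m^'m) => bool" where
 "two_form M \<longleftrightarrow> rmat M \<and> (near0 x. skew (M x) \<and> closed2 M x)"

lemma two_formD: "two_form M ==> rmat M" "two_form M ==> near0 x. skew (M x)" "two_form M ==> near0 x. closed2 M x"
 unfolding two_form_def by (auto elim: eventually_mono)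

lemma linear_axis_sum:
 fixes L :: "'k^'m => 'k^'l"
 assumes "!!v w. L (v + w) = L v + L w" "!!c v. L (c *s v) = c *s L v"
 shows "L v = (\<Sum>i\<in>UNIV. v $ i *s L (axis i (1::'k)))"
proof -
 have L0: "L 0 = 0" using assms(2)[of 0 0] by simp
 have Ls: "L (sum g I) = (\<Sum>i\<in>I. L (g i))" for g and I :: "'m set"
  by (induction I rule: infinite_finite_induct) (simp_all add: L0 assms(1))
 have "v = (\<Sum>i\<in>UNIV. v $ i *s axis i 1)" by (simp add: basis_expansion)
 then have "L v = L (\<Sum>i\<in>UNIV. v $ i *s axis i 1)" by simp
 then show ?thesis unfolding Ls assms(2) .
qed

lemma bl_pull:
 assumes "rmap F"
 shows "near0 x. \<forall>v w. bl (pull F M x) v w = bl (M (F x)) (fd F x v) (fd F x w)"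
 using rmap_deriv[OF assms]
proof eventually_elim
 case (elim x)
 let ?D = "fd F x" and ?B = "M (F x)"
 have D: "?D v = jacobian F x *v v" for v using elim by blast
 have e: "?D v = (\<Sum>i\<in>UNIV. v $ i *s ?D (axis i 1))" for v
  by (rule linear_axis_sum) (simp_all add: D matrix_vector_right_distrib vector_scalar_commute)
 have bl_sums: "bl B (sum g I) w = (\<Sum>i\<in>I. bl B (g i) w)" "bl B w (sum g I) = (\<Sum>i\<in>I. bl B w (g i))"
  for B :: "'k^'b^'b" and g and I :: "'a set" and w
  by (induction I rule: infinite_finite_induct) (simp_all add: bl_add_left bl_add_right)
 show ?case
 proof (intro allI)
  fix v w
  have "bl ?B (?D v) (?D w) = (\<Sum>i\<in>UNIV. \<Sum>j\<in>UNIV. v $ i * (w $ j * bl ?B (?D (axis i 1)) (?D (axis j 1))))"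
   unfolding e[of v] e[of w] bl_sums(1) bl_scale_left by (simp add: bl_sums(2) bl_scale_right sum_distrib_left)
  then show "bl (pull F M x) v w = bl ?B (?D v) (?D w)"
   unfolding bl_sum[of "pull F M x"] by (simp add: pull_def algebra_simps)
 qed
qed

lemma rmat_pull:
 assumes M: "rmat M" and F: "rmap F" "F 0 = 0"
 shows "rmat (pull F M)"
 unfolding rmat_def pull_def
 using rg_bl[OF rmat_compose[OF M F] rmap_frechet[OF F(1)] rmap_frechet[OF F(1)]] by simp

text \<open>Closedness is inherited because the second derivatives of \<open>P\<close> occur in
  pairs that cancel: they are symmetric, while the form is skew.\<close>

lemma two_form_pull:
 assumes M: "two_form M" and P: "rmap P" "P 0 = 0"
 shows "two_form (pull P M)"
proof -
 have reg: "rmat (pull P M)" by (rule rmat_pull[OF two_formD(1)[OF M] P])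
 have "near0 x. \<forall>i. fd (\<lambda>x. P x $ i) x = (\<lambda>v. fd P x v $ i)"
  using rmap_deriv[OF P(1)] by (rule eventually_mono) auto
 then have near: "near0 x. \<forall>\<^sub>F z in nhds x. \<forall>i. fd (\<lambda>x. P x $ i) z = (\<lambda>v. fd P z v $ i)"
  by (simp add: eventually_eventually)
 have sym0: "near0 x. fd (\<lambda>x. fd P x u) x v = fd (\<lambda>x. fd P x v) x u" for u v
 proof -
  have "near0 x. \<forall>i. fd (\<lambda>x. fd (\<lambda>x. P x $ i) x u) x v =
     fd (\<lambda>x. fd (\<lambda>x. P x $ i) x v) x u"
   by (intro eventually_all_finite rg_symmetric rmap_rg[OF P(1)])
  with near rmap_deriv[OF rmap_frechet[OF P(1), of u]] rmap_deriv[OF rmap_frechet[OF P(1), of v]]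
  show ?thesis
  proof eventually_elim
   case (elim x)
   obtain S where S: "open S" "x \<in> S" "!!z i. z \<in> S ==> fd (\<lambda>x. P x $ i) z = (\<lambda>v. fd P z v $ i)"
    using elim(1) unfolding eventually_nhds by blast
   have e: "fd (\<lambda>x. fd (\<lambda>x. P x $ i) x w) x = fd (\<lambda>x. fd P x w $ i) x" for i w
    by (rule fd_cong_open[OF S(1,2)]) (simp add: S(3))
   show ?case
    using elim(4) elim(2,3) unfolding e vec_eq_iff by metis
  qed
 qed
 have lin: "near0 x. \<forall>u. fd P x u = (\<Sum>i\<in>UNIV. u $ i *s fd P x (axis i 1))"
  using rmap_deriv[OF P(1)]
 proof eventually_elim
  case (elim x)
  have D: "fd P x v = jacobian P x *v v" for v using elim by blast
  show ?case by (intro allI linear_axis_sum) (simp_all add: D matrix_vector_right_distrib vector_scalar_commute)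
 qed
 have cl: "near0 x. bl (fd (pull P M) x (axis i 1)) (axis j 1) (axis k 1) +
   bl (fd (pull P M) x (axis j 1)) (axis k 1) (axis i 1) +
   bl (fd (pull P M) x (axis k 1)) (axis i 1) (axis j 1) = 0" for i j k
 proof -
  note d = rmap_deriv[OF rmap_frechet[OF P(1)]]
  show ?thesis
   using d[of "axis i 1"] d[of "axis j 1"] d[of "axis k 1"] rmap_deriv[OF P(1)] sym0[of "axis i 1" "axis j 1"] sym0[of "axis j 1" "axis k 1"] sym0[of "axis k 1" "axis i 1"]
    eventually_rmap[OF rmat_deriv[OF two_formD(1)[OF M]] P] eventually_rmap[OF two_formD(3)[OF M] P] eventually_rmap[OF two_formD(2)[OF M] P]
    rmat_deriv[OF reg]
  proof eventually_elim
   case (elim x)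
   let ?D = "\<lambda>l. fd P x (axis l 1)" and ?M = "M (P x)"
   let ?D2 = "\<lambda>l u. fd (\<lambda>x. fd P x (axis l 1)) x u"
   let ?DM = "\<lambda>u. fd M (P x) u"
   have dM: "((\<lambda>x. M (P x)) has_derivative (\<lambda>u. ?DM (fd P x u))) (at x)"
    using has_derivative_compose[OF conjunct1[OF elim(4)] conjunct1[OF elim(8)]] .
   have main: "fd (pull P M) x (axis p 1) $ q $ r =
     bl (?DM (?D p)) (?D q) (?D r) + bl ?M (?D2 q (axis p 1)) (?D r) + bl ?M (?D q) (?D2 r (axis p 1))"
    if q: "((\<lambda>x. fd P x (axis q 1)) has_derivative ?D2 q) (at x)"
    and r: "((\<lambda>x. fd P x (axis r 1)) has_derivative ?D2 r) (at x)" for p q r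
   proof -
    have "fd (pull P M) x (axis p 1) $ q $ r = fd (\<lambda>x. pull P M x $ q $ r) x (axis p 1)"
     using elim(11) by simp
    then show ?thesis using fd_eq[OF bl_has_derivative[OF dM q r]] by (simp add: pull_def)
   qed
   have closed: "bl (?DM u) v w + bl (?DM v) w u + bl (?DM w) u v = 0" for u v w
    using elim(9) unfolding closed2_def by blast
   have sk: "bl ?M v w = - bl ?M w v" for v w by (rule bl_skew[OF elim(10)])
   have di: "((\<lambda>x. fd P x (axis i 1)) has_derivative ?D2 i) (at x)"
    and dj: "((\<lambda>x. fd P x (axis j 1)) has_derivative ?D2 j) (at x)"
    and dk: "((\<lambda>x. fd P x (axis k 1)) has_derivative ?D2 k) (at x)"
    using elim(1-3) by blast+
   show ?case
    unfolding bl_axes main[OF dj dk] main[OF dk di] main[OF di dj]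
    using closed[of "?D i" "?D j" "?D k"] elim(5-7)
     sk[of "?D i" "?D2 k (axis j 1)"] sk[of "?D j" "?D2 i (axis k 1)"] sk[of "?D k" "?D2 j (axis i 1)"] by (simp add: add.assoc)
  qed
 qed
 have "near0 x. \<forall>i j k. bl (fd (pull P M) x (axis i 1)) (axis j 1) (axis k 1) +
   bl (fd (pull P M) x (axis j 1)) (axis k 1) (axis i 1) +
   bl (fd (pull P M) x (axis k 1)) (axis i 1) (axis j 1) = 0"
  by (intro eventually_all_finite cl)
 with rmat_linear[OF reg] have "near0 x. closed2 (pull P M) x"
 proof eventually_elim
  case (elim x)
  show ?case
  proof (rule closed2_axes)
   show "fd (pull P M) x u $ j $ k = (\<Sum>i\<in>UNIV. u $ i * fd (pull P M) x (axis i 1) $ j $ k)" for u j k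
    using elim(1) by blast
   show "fd (pull P M) x (axis i 1) $ j $ k + fd (pull P M) x (axis j 1) $ k $ i +
     fd (pull P M) x (axis k 1) $ i $ j = 0" for i j k
    using elim(2)[rule_format, of i j k] unfolding bl_axes .
  qed
 qed
 moreover have "near0 x. skew (pull P M x)"
  using eventually_rmap[OF two_formD(2)[OF M] P]
 proof eventually_elim
  case (elim x)
  show ?case unfolding skew_def pull_def vec_lambda_beta by (intro allI bl_skew[OF elim])
 qed
 ultimately show ?thesis unfolding two_form_def using reg by (simp add: eventually_conj_iff)
qed

end

subsection \<open>Deformation of two-forms that agree on a hyperplane\<close>

definition msc :: "'k::comm_ring_1 => 'k^'m^'m => 'k^'m^'m" where
 "msc c A = (\<chi> i j. c * A $ i $ j)"

lemma msc_nth [simp]: "msc c A $ i $ j = c * A $ i $ j" by (simp add: msc_def)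
lemma bl_msc: "bl (msc c A) v w = c * bl A v w" by (simp add: bl_sum sum_distrib_left algebra_simps)

lemma msc_has_derivative:
 fixes A :: "'a::real_normed_vector => 'k::real_normed_field^'m^'m"
 assumes f: "(f has_derivative f') (at x within S)" and A: "(A has_derivative A') (at x within S)"
 shows "((\<lambda>x. msc (f x) (A x)) has_derivative (\<lambda>h. msc (f x) (A' h) + msc (f' h) (A x))) (at x within S)"
proof -
 note nth = bounded_linear.has_derivative[OF bounded_linear_nth]
 have "((\<lambda>x. msc (f x) (A x) $ i) has_derivative (\<lambda>h. \<chi> j. f x * A' h $ i $ j + f' h * A x $ i $ j)) (at x within S)" for i
  by (rule vec_has_derivative) (simp, intro has_derivative_mult f nth A)
 from vec_has_derivative[OF this]
 have "((\<lambda>x. msc (f x) (A x)) has_derivative (\<lambda>h. \<chi> i j. f x * A' h $ i $ j + f' h * A x $ i $ j)) (at x within S)" .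
 moreover have "(\<chi> i j. f x * A' h $ i $ j + f' h * A x $ i $ j) = msc (f x) (A' h) + msc (f' h) (A x)" for h
  by (simp add: vec_eq_iff)
 ultimately show ?thesis by simp
qed

definition stail :: "'k^('m::finite option) => 'k^'m" where "stail z = (\<chi> j. z $ Some j)"

lemma stail_nth [simp]: "stail z $ j = z $ Some j" by (simp add: stail_def)
lemma stail_scons [simp]: "stail (scons s y) = y" by (simp add: stail_def scons_def vec_eq_iff)
lemma stail_0 [simp]: "stail (0 :: 'k::zero^('m::finite option)) = 0" by (simp add: vec_eq_iff)

lemma stail_has_derivative: "(stail has_derivative stail) (at (z :: 'k::real_normed_field^('m::finite option)) within S)"
proof -
 have "((\<lambda>z :: 'k^('m option). stail z $ j) has_derivative (\<lambda>h. h $ Some j)) (at z within S)" for j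
  by (simp add: bounded_linear_imp_has_derivative bounded_linear_nth)
 from vec_has_derivative[OF this] show ?thesis by (simp add: stail_def[abs_def])
qed

context regular_class
begin

lemma rmap_stail: "rmap (stail :: 'k^('m::finite option) => _)"
 unfolding rmap_def by (simp add: rg_nth)

lemma rmat_const: "rmat (\<lambda>x. C)" unfolding rmat_def by (simp add: rg_const)

lemma rmat_msc: "rg f ==> rmat A ==> rmat (\<lambda>x. msc (f x) (A x))"
 unfolding rmat_def by (simp add: rg_mult)

section \<open>Regularity and derivatives of the completed kernel data\<close>

lemma completed_det_nonzero:
 assumes A: "rmat A" and d: "det (A 0 + swap_matrix a b) \<noteq> 0"
 shows "near0 x. det (A x + swap_matrix a b) \<noteq> 0"
 by (rule rg_eventually_nonzero[OF rg_det[OF rmat_rg[OF rmat_add[OF A rmat_const]]] d])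

text \<open>Cramer's rule exhibits the entries as quotients of determinants, so the choice hidden in
  \<open>matrix_inv\<close> does no harm to regularity.\<close>

lemma rmat_completed_inverse:
 assumes A: "rmat A" and d: "det (A 0 + swap_matrix a b) \<noteq> 0"
 shows "rmat (\<lambda>x. completed_inverse a b (A x))"
 unfolding rmat_def
proof (intro allI)
 fix k j
 let ?B = "\<lambda>x. A x + swap_matrix a b"
 let ?N = "\<lambda>x. \<chi> i l. if l = k then axis j 1 $ i else ?B x $ i $ l"
 have reg: "rmat ?B" by (rule rmat_add[OF A rmat_const])
 have "rg (\<lambda>x. ?N x $ i $ l)" for i l
  using rg_const rmat_rg[OF reg, of i l] by (cases "l = k") simp_all
 then have "rg (\<lambda>x. det (?N x) / det (?B x))"
  by (intro rg_divide rg_det d rmat_rg[OF reg])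
 then show "rg (\<lambda>x. completed_inverse a b (A x) $ k $ j)"
 proof (rule rg_cong)
  show "near0 x. det (?N x) / det (?B x) = completed_inverse a b (A x) $ k $ j"
   using completed_det_nonzero[OF assms]
  proof eventually_elim
   case (elim x)
   have "invertible (?B x)" using elim by (simp add: invertible_det_nz)
   from someI_ex[OF this[unfolded invertible_def]] have "?B x ** completed_inverse a b (A x) = mat 1"
    unfolding completed_inverse_def matrix_inv_def by blast
   then have "?B x *v (completed_inverse a b (A x) *v axis j 1) = axis j 1"
    by (simp add: matrix_vector_mul_assoc)
   then have "(completed_inverse a b (A x) *v axis j 1) $ k = det (?N x) / det (?B x)"
    unfolding cramer[OF elim] by simp
   then show ?case by (simp add: matrix_axis)
  qed
 qed
qed

lemma kernel_germs:
 assumes A: "rmat A" and d: "det (A 0 + swap_matrix a b) \<noteq> 0"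
 shows rmap_kernel1: "rmap (\<lambda>x. kernel1 a b (A x))" and rmap_kernel2: "rmap (\<lambda>x. kernel2 a b (A x))"
  and rg_pfaffian_factor: "rg (\<lambda>x. pfaffian_factor a b (A x))"
proof -
 show p: "rmap (\<lambda>x. kernel1 a b (A x))" and "rmap (\<lambda>x. kernel2 a b (A x))"
  unfolding kernel1_def kernel2_def by (intro rmap_mv rmat_completed_inverse assms rmap_const)+
 show "rg (\<lambda>x. pfaffian_factor a b (A x))"
  unfolding pfaffian_factor_def by (intro rg_diff rg_const rmap_rg[OF p])
qed

text \<open>Differentiates the identity r A p = k r_a with r frozen at its value at 0. There r_a =
  -1 and r A = 0, so the derivative of p drops out.\<close>

lemma pfaffian_factor_derivative:
 assumes A: "rmat A" and d: "det (A 0 + swap_matrix a b) \<noteq> 0" and sk: "near0 x. skew (A x)"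
  and k0: "pfaffian_factor a b (A 0) = 0"
 shows "fd (\<lambda>x. pfaffian_factor a b (A x)) 0 u =
  - bl (fd A 0 u) (kernel2 a b (A 0)) (kernel1 a b (A 0))"
proof -
 let ?p = "\<lambda>x. kernel1 a b (A x)" and ?r = "kernel2 a b (A 0)" and ?k = "\<lambda>x. pfaffian_factor a b (A x)"
 have sk0: "skew (A 0)" by (rule near0D[OF sk])
 have dA: "(A has_derivative fd A 0) (at 0)" using near0D[OF rmat_deriv[OF A]] by blast
 have dp: "(?p has_derivative fd ?p 0) (at 0)"
  using near0D[OF rmap_deriv[OF rmap_kernel1[OF A d]]] by blast
 have dk: "(?k has_derivative fd ?k 0) (at 0)"
  using near0D[OF rg_deriv[OF rg_pfaffian_factor[OF A d]]] by blast
 have d1: "((\<lambda>x. bl (A x) ?r (?p x)) has_derivative (\<lambda>h. bl (fd A 0 h) ?r (?p 0) + bl (A 0) 0 (?p 0) +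
   bl (A 0) ?r (fd ?p 0 h))) (at 0)"
  by (rule bl_has_derivative[OF dA has_derivative_const dp])
 have d2: "((\<lambda>x. ?k x * ?r $ a) has_derivative (\<lambda>h. fd ?k 0 h * ?r $ a)) (at 0)"
  by (rule has_derivative_mult_left[OF dk])
 have "near0 x. bl (A x) ?r (?p x) = ?k x * ?r $ a"
  using sk completed_det_nonzero[OF A d]
  by eventually_elim (rule bl_eq, rule mult_kernel)
 then obtain S where "open S" "0 \<in> S" "!!x. x \<in> S ==> bl (A x) ?r (?p x) = ?k x * ?r $ a" unfolding eventually_nhds by blast
 then have "fd (\<lambda>x. bl (A x) ?r (?p x)) 0 = fd (\<lambda>x. ?k x * ?r $ a) 0"
  by (intro fd_cong_open)
 then have "bl (fd A 0 u) ?r (?p 0) + bl (A 0) 0 (?p 0) + bl (A 0) ?r (fd ?p 0 u) =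
   fd ?k 0 u * ?r $ a"
  unfolding fd_eq[OF d1] fd_eq[OF d2] by (rule fun_cong)
 moreover have "?r $ a = - 1" using kernel_coordinates(4)[OF sk0 d] k0 by simp
 moreover have "bl (A 0) ?r w = 0" for w
  using bl_skew[OF sk0, of ?r w] bl_kernel[of "A 0" ?r w] mult_kernel(2)[OF sk0 d] k0 by simp
 ultimately show ?thesis by simp
qed

lemma hyperplane_derivative:
 assumes f: "rg f" "near0 x. x $ t = 0 --> f x = 0" and v: "v $ t = 0"
 shows "near0 x. x $ t = 0 --> fd f x v = 0"
proof -
 obtain g where g: "rg g" "near0 x. f x = x $ t * g x" using hadamard[OF f] by blast
 have "near0 x. \<forall>\<^sub>F z in nhds x. f z = z $ t * g z" using g(2) by (simp add: eventually_eventually)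
 with rg_deriv[OF g(1)] show ?thesis
 proof eventually_elim
  case (elim x)
  have d: "((\<lambda>x. x $ t * g x) has_derivative (\<lambda>h. x $ t * fd g x h + h $ t * g x)) (at x)"
   using elim(1) by (intro has_derivative_mult nth_has_derivative) auto
  have e: "fd (\<lambda>x. x $ t * g x) x v = x $ t * fd g x v"
   unfolding fd_eq[OF d] using v by simp
  obtain S where "open S" "x \<in> S" "!!z. z \<in> S ==> f z = z $ t * g z" using elim(2) unfolding eventually_nhds by blast
  then have "fd f x = fd (\<lambda>x. x $ t * g x) x" by (intro fd_cong_open)
  then show ?case using e by simp
 qed
qed

lemma fd_cong:
 assumes "near0 x. f x = g x"
 shows "near0 x. fd f x = fd g x"
proof -
 have "near0 x. \<forall>\<^sub>F z in nhds x. f z = g z" using assms by (simp add: eventually_eventually)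
 then show ?thesis
 proof eventually_elim
  case (elim x)
  then obtain S where "open S" "x \<in> S" "!!z. z \<in> S ==> f z = g z" unfolding eventually_nhds by blast
  then show ?case by (intro fd_cong_open)
 qed
qed

lemma skew_derivative:
 assumes "rmat M" "near0 x. skew (M x)"
 shows "near0 x. \<forall>u. skew (fd M x u)"
proof -
 have "near0 x. \<forall>i j. fd (\<lambda>x. M x $ i $ j) x = fd (\<lambda>x. - M x $ j $ i) x"
 proof (intro eventually_all_finite fd_cong)
  fix i j
  show "near0 x. M x $ i $ j = - M x $ j $ i"
   using assms(2) by eventually_elim (rule skewD)
 qed
 with rmat_deriv[OF assms(1)] show ?thesis
 proof eventually_elim
  case (elim x)
  have "((\<lambda>x. - M x $ j $ i) has_derivative (\<lambda>u. - fd M x u $ j $ i)) (at x)" for i j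
   using elim(1) by (intro has_derivative_minus bounded_linear.has_derivative[OF bounded_linear_nth]) blast
  note e = fd_eq[OF this]
  show ?case unfolding skew_def
  proof (intro allI)
   fix u i j
   show "fd M x u $ i $ j = - fd M x u $ j $ i"
    using conjunct2[OF elim(1), rule_format, of i j u] elim(2)[rule_format, of i j] e[of j i] by simp
  qed
 qed
qed

end

lemma bl_one: "bl (mat 1) v w = (\<Sum>i\<in>UNIV. v $ i * w $ i)"
 by (simp add: bl_def matrix_vector_mul_lid)

lemma skew_add: "skew A ==> skew B ==> skew (A + B)"
 and skew_diff: "skew A ==> skew B ==> skew (A - B)"
 and skew_msc: "skew A ==> skew (msc c A)"
proof -
 assume A: "skew A"
 { assume B: "skew B"
  show "skew (A + B)" unfolding skew_def
  proof (intro allI)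
   fix i j show "(A + B) $ i $ j = - (A + B) $ j $ i" using skewD[OF A, of i j] skewD[OF B, of i j] by simp
  qed }
 { assume B: "skew B"
  show "skew (A - B)" unfolding skew_def
  proof (intro allI)
   fix i j show "(A - B) $ i $ j = - (A - B) $ j $ i" using skewD[OF A, of i j] skewD[OF B, of i j] by simp
  qed }
 show "skew (msc c A)" unfolding skew_def
 proof (intro allI)
  fix i j show "msc c A $ i $ j = - msc c A $ j $ i" using skewD[OF A, of i j] by simp
 qed
qed

section \<open>A relative Poincare lemma and Moser's deformation\<close>

context regular_class
begin

lemma two_form_diff:
 assumes M: "two_form M" and N: "two_form N" shows "two_form (\<lambda>x. M x - N x)"
proof -
 have "near0 x. skew (M x - N x) \<and> closed2 (\<lambda>x. M x - N x) x"
  using rmat_deriv[OF two_formD(1)[OF M]] rmat_deriv[OF two_formD(1)[OF N]] two_formD(2)[OF M] two_formD(2)[OF N] two_formD(3)[OF M] two_formD(3)[OF N]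
 proof eventually_elim
  case (elim x)
  have d: "((\<lambda>x. M x - N x) has_derivative (\<lambda>u. fd M x u - fd N x u)) (at x)"
   using elim by (intro has_derivative_diff) blast+
  have "closed2 (\<lambda>x. M x - N x) x" unfolding closed2_def fd_eq[OF d] bl_matrix_diff
  proof (intro allI)
   fix u v w
   have e: "(m1 - n1) + (m2 - n2) + (m3 - n3) = 0" if "m1 + m2 + m3 = 0" "n1 + n2 + n3 = 0" for m1 m2 m3 n1 n2 n3 :: 'k
   proof -
    have "(m1 - n1) + (m2 - n2) + (m3 - n3) = (m1 + m2 + m3) - (n1 + n2 + n3)" by simp
    then show ?thesis using that by simp
   qed
   show "bl (fd M x u) v w - bl (fd N x u) v w +
     (bl (fd M x v) w u - bl (fd N x v) w u) +
     (bl (fd M x w) u v - bl (fd N x w) u v) = 0"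
    by (rule e) (use elim(5,6) in \<open>unfold closed2_def, blast\<close>)+
  qed
  then show ?case using skew_diff[OF elim(3,4)] by blast
 qed
 then show ?thesis unfolding two_form_def using rmat_diff two_formD(1)[OF M] two_formD(1)[OF N] by blast
qed

text \<open>The primitive has components b_j with b_t = 0 and, for j \<noteq> t, b_j the integral of
  m_tj along e_t from the hyperplane. As m_tj vanishes there, b_j vanishes to second order. For i, j
  \<noteq> t the defect \<open>n\<close> of the remaining equation vanishes on the hyperplane, and
  by closedness its derivative along e_t is zero.\<close>

lemma relative_poincare:
 assumes m: "two_form m" and z: "near0 x. x $ t = 0 --> m x = 0"
 shows "\<exists>G. rmap G \<and> (near0 x. \<forall>u w. bl (m x) u w =
  bl (mat 1) w (fd (\<lambda>x. (x $ t * x $ t) *s G x) x u) -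
  bl (mat 1) u (fd (\<lambda>x. (x $ t * x $ t) *s G x) x w))"
proof -
 note rm = two_formD(1)[OF m]
 have ze: "near0 x. x $ t = 0 --> m x $ i $ j = 0" for i j
  using z by (rule eventually_mono) simp
 have "\<forall>j. \<exists>g. rg g \<and> (near0 x. fd (\<lambda>x. x $ t * g x) x (axis t 1) = m x $ t $ j)"
  using antiderivative[OF rmat_rg[OF rm], of t t] by blast
 from choice[OF this] obtain g where g: "\<forall>j. rg (g j) \<and> (near0 x. fd (\<lambda>x. x $ t * g j x) x (axis t 1) = m x $ t $ j)" ..
 have g0: "near0 x. x $ t = 0 --> g j x = 0" for j
  using g[rule_format, of j, THEN conjunct2] rg_deriv[OF g[rule_format, of j, THEN conjunct1]] ze[of t j]
 proof eventually_elim
  case (elim x)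
  have d: "((\<lambda>x. x $ t * g j x) has_derivative (\<lambda>h. x $ t * fd (g j) x h + h $ t * g j x)) (at x)"
   using elim(2) by (intro has_derivative_mult nth_has_derivative) auto
  show ?case using elim(1,3) unfolding fd_eq[OF d] by (auto simp: axis_def)
 qed
 have "\<forall>j. \<exists>h. rg h \<and> (near0 x. g j x = x $ t * h x)"
  using hadamard[OF g[rule_format, THEN conjunct1] g0] by blast
 from choice[OF this] obtain h where h: "\<forall>j. rg (h j) \<and> (near0 x. g j x = x $ t * h j x)" ..
 define G where "G x = (\<chi> j. if j = t then 0 else h j x)" for x
 have rG: "rmap G" unfolding rmap_def G_def using h by (auto intro!: rg_if rg_const)
 define b where "b j x = (x $ t * x $ t) * G x $ j" for j x
 have rb: "rg (b j)" for j unfolding b_def by (intro rg_mult rg_nth rmap_rg[OF rG])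
 have bt: "b t = (\<lambda>x. 0)" by (simp add: b_def[abs_def] G_def)
 have Dbt: "fd (b t) x v = 0" for x v
  unfolding bt using frechet_derivative_at[OF has_derivative_const, of "0::'k" x] by (metis)
 have Db: "near0 x. fd (b j) x (axis t 1) = m x $ t $ j" if "j \<noteq> t" for j
 proof -
  have "near0 x. b j x = x $ t * g j x"
   using h[rule_format, of j, THEN conjunct2] by eventually_elim (simp add: b_def G_def that)
  from fd_cong[OF this] g[rule_format, of j, THEN conjunct2]
  show ?thesis by eventually_elim simp
 qed
 have bz: "near0 x. x $ t = 0 --> b j x = 0" for j by (simp add: b_def)
 have Dbz: "near0 x. x $ t = 0 --> fd (b j) x (axis i 1) = 0" if "i \<noteq> t" for i j
  by (rule hyperplane_derivative[OF rb bz]) (use that in \<open>simp add: axis_def\<close>)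
 have main: "near0 x. m x $ i $ j = fd (b j) x (axis i 1) - fd (b i) x (axis j 1)" for i j
 proof -
  consider "i = t" "j = t" | "i = t" "j \<noteq> t" | "i \<noteq> t" "j = t" | "i \<noteq> t" "j \<noteq> t" by blast
  then show ?thesis
  proof cases
   case 1
   show ?thesis using two_formD(2)[OF m]
   proof eventually_elim
    case (elim x)
    show ?case using skewD[OF elim, of t t] 1 by (simp add: eq_neg_iff_add_eq_0)
   qed
  next
   case 2
   show ?thesis using Db[OF 2(2)] by eventually_elim (simp add: 2 Dbt)
  next
   case 3
   show ?thesis using Db[OF 3(1)] two_formD(2)[OF m]
   proof eventually_elim
    case (elim x)
    show ?case using skewD[OF elim(2), of i t] elim(1) 3 by (simp add: Dbt)
   qed
  next
   case 4
   define n where "n x = m x $ i $ j - (fd (b j) x (axis i 1) - fd (b i) x (axis j 1))" for x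
   have "near0 x. n x = 0"
   proof (rule zero_from_hyperplane)
    show "rg n" unfolding n_def by (intro rg_diff rmat_rg[OF rm] rg_frechet rb)
    show "near0 x. x $ t = 0 --> n x = 0"
     using ze[of i j] Dbz[OF 4(1), of j] Dbz[OF 4(2), of i] by eventually_elim (simp add: n_def)
    note D1 = fd_cong[OF Db[OF 4(2)]] and D2 = fd_cong[OF Db[OF 4(1)]]
    show "near0 x. fd n x (axis t 1) = 0"
     using D1 D2 rg_symmetric[OF rb[of j], of "axis i 1" "axis t 1"] rg_symmetric[OF rb[of i], of "axis j 1" "axis t 1"]
      rg_deriv[OF rg_frechet[OF rb[of j], of "axis i 1"]] rg_deriv[OF rg_frechet[OF rb[of i], of "axis j 1"]]
      rg_deriv[OF rmat_rg[OF rm, of i j]] rmat_deriv[OF rm] skew_derivative[OF rm two_formD(2)[OF m]] two_formD(3)[OF m]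
    proof eventually_elim
     case (elim x)
     have d: "(n has_derivative (\<lambda>v. fd (\<lambda>x. m x $ i $ j) x v -
       (fd (\<lambda>x. fd (b j) x (axis i 1)) x v -
       fd (\<lambda>x. fd (b i) x (axis j 1)) x v))) (at x)"
      unfolding n_def[abs_def] using elim(5,6,7) by (intro has_derivative_diff) blast+
     let ?D = "fd m x"
     have e: "fd (\<lambda>x. m x $ p $ q) x v = ?D v $ p $ q" for p q v using elim(8) by blast
     have sk: "?D v $ p $ q = - ?D v $ q $ p" for v p q using elim(9) skewD by blast
     have "bl (?D (axis t 1)) (axis i 1) (axis j 1) + bl (?D (axis i 1)) (axis j 1) (axis t 1) + bl (?D (axis j 1)) (axis t 1) (axis i 1) = 0"
      using elim(10) unfolding closed2_def by blast
     then show ?case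
      unfolding fd_eq[OF d] elim(3) elim(4) elim(1) elim(2) e bl_axes
      using sk[of "axis i 1" j t] by algebra
    qed
   qed
   then show ?thesis by eventually_elim (simp add: n_def)
  qed
 qed
 have all: "near0 x. \<forall>i j. m x $ i $ j = fd (b j) x (axis i 1) - fd (b i) x (axis j 1)"
  by (intro eventually_all_finite main)
 define B where "B x = (x $ t * x $ t) *s G x" for x
 have rB: "rmap B" unfolding B_def by (intro rmap_scale rg_mult rg_nth rG)
 have bb: "(\<lambda>x. B x $ j) = b j" for j by (simp add: B_def b_def fun_eq_iff)
 have "near0 x. \<forall>u w. bl (m x) u w = bl (mat 1) w (fd B x u) - bl (mat 1) u (fd B x w)"
  using all rmap_deriv[OF rB]
 proof eventually_elim
  case (elim x)
  let ?D = "fd B x"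
  have J: "?D v = jacobian B x *v v" for v using elim(2) by blast
  have lin: "?D u = (\<Sum>i\<in>UNIV. u $ i *s ?D (axis i 1))" for u
   by (rule linear_axis_sum) (simp_all add: J matrix_vector_right_distrib vector_scalar_commute)
  have nth: "?D v $ j = fd (b j) x v" for v j using elim(2) bb by metis
  have lin': "?D u $ j = (\<Sum>i\<in>UNIV. u $ i * fd (b j) x (axis i 1))" for u j
   by (subst lin) (simp add: nth)
  show ?case
  proof (intro allI)
   fix u w
   have "bl (m x) u w = (\<Sum>i\<in>UNIV. \<Sum>j\<in>UNIV. w $ j * (u $ i * fd (b j) x (axis i 1))) -
     (\<Sum>i\<in>UNIV. \<Sum>j\<in>UNIV. u $ i * (w $ j * fd (b i) x (axis j 1)))"
    unfolding bl_sum elim(1)[rule_format] sum_subtractf[symmetric] by (simp add: algebra_simps)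
   also have "(\<Sum>i\<in>UNIV. \<Sum>j\<in>UNIV. w $ j * (u $ i * fd (b j) x (axis i 1))) = bl (mat 1) w (?D u)"
    unfolding bl_one lin' sum_distrib_left by (rule sum.swap)
   also have "(\<Sum>i\<in>UNIV. \<Sum>j\<in>UNIV. u $ i * (w $ j * fd (b i) x (axis j 1))) = bl (mat 1) u (?D w)"
    unfolding bl_one lin' sum_distrib_left ..
   finally show "bl (m x) u w = bl (mat 1) w (?D u) - bl (mat 1) u (?D w)" .
  qed
 qed
 then show ?thesis using rG unfolding B_def by blast
qed

end

context regular_class
begin

text \<open>Time is a germ coordinate at 0, so the path is restarted at every \<open>s0\<close> and
  only small increments \<open>l\<close> are reached. Since \<open>f\<close> vanishes on the
  hyperplane, the family \<open>N\<close> coincides there with \<open>M\<close> at all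
  times.\<close>

lemma moser_step:
 fixes M f :: "'k^'m => 'k^'m^'m" and s0 :: real
 assumes M: "two_form M" and f: "two_form f" and z: "near0 y. y $ t = 0 --> f y = 0"
  and d: "det (M 0 + swap_matrix a b) \<noteq> 0"
  and tan: "kernel1 a b (M 0) $ t = 0" "kernel2 a b (M 0) $ t = 0"
  and kz: "near0 y. y $ t = 0 --> pfaffian_factor a b (M y) = 0"
  and dk: "fd (\<lambda>y. pfaffian_factor a b (M y)) 0 (axis t 1) \<noteq> 0"
 shows "\<exists>n>0. \<forall>l. \<bar>l\<bar> < n --> mequiv (\<lambda>y. M y + msc (of_real s0) (f y)) (\<lambda>y. M y + msc (of_real (s0 + l)) (f y))"
proof -
 note rM = two_formD(1)[OF M] and rm = two_formD(1)[OF f]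
 obtain G where G: "rmap G" and poin: "near0 x. \<forall>u w. bl (f x) u w =
  bl (mat 1) w (fd (\<lambda>x. (x $ t * x $ t) *s G x) x u) -
  bl (mat 1) u (fd (\<lambda>x. (x $ t * x $ t) *s G x) x w)"
  using relative_poincare[OF f z] by (elim exE conjE) (rule that)
 define B where "B x = (x $ t * x $ t) *s G x" for x
 note poin = poin[folded B_def[abs_def]]
 have rb: "rmap B" unfolding B_def by (intro rmap_scale rg_mult rg_nth G)
 define c where "c z = of_real s0 + z $ None" for z :: "'k^('m option)"
 have rc: "rg c" unfolding c_def by (intro rg_add rg_const rg_nth)
 define N where "N z = M (stail z) + msc (c z) (f (stail z))" for z
 note st = rmap_stail stail_0
 have rN: "rmat N" unfolding N_def by (rule rmat_add[OF rmat_compose[OF rM st] rmat_msc[OF rc rmat_compose[OF rm st]]])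
 have m0: "f 0 = 0" using near0D[OF z] by simp
 have N0: "N 0 = M 0" by (simp add: N_def m0 vec_eq_iff)
 have skN: "near0 z. skew (N z)"
  using eventually_rmap[OF two_formD(2)[OF M] st] eventually_rmap[OF two_formD(2)[OF f] st]
  by eventually_elim (simp add: N_def skew_add skew_msc)
 have dN: "det (N 0 + swap_matrix a b) \<noteq> 0" using d N0 by simp
 let ?p = "\<lambda>z. kernel1 a b (N z)" and ?r = "\<lambda>z. kernel2 a b (N z)" and ?k = "\<lambda>z. pfaffian_factor a b (N z)"
 note rp = rmap_kernel1[OF rN dN] and rr = rmap_kernel2[OF rN dN] and rk = rg_pfaffian_factor[OF rN dN]
 have k0: "near0 z. z $ Some t = 0 --> ?k z = 0"
  using eventually_rmap[OF kz st] eventually_rmap[OF z st]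
 proof eventually_elim
  case (elim z)
  have "N z = M (stail z)" if "z $ Some t = 0" using elim(2) that by (simp add: N_def vec_eq_iff)
  then show ?case using elim(1) by simp
 qed
 obtain k' where k': "rg k'" "near0 z. ?k z = z $ Some t * k' z" using hadamard[OF rk k0] by blast
 have k'0: "k' 0 \<noteq> 0"
 proof -
  have "((\<lambda>z. z $ Some t * k' z) has_derivative (\<lambda>h. 0 $ Some t * fd k' 0 h + h $ Some t * k' 0)) (at 0)"
   using near0D[OF rg_deriv[OF k'(1)]]
   by (intro has_derivative_mult nth_has_derivative) auto
  note e = fd_eq[OF this]
  have 1: "fd ?k 0 (axis (Some t) 1) = k' 0"
   unfolding near0D[OF fd_cong[OF k'(2)]] e by (simp add: axis_def)
  have sk0: "skew (M 0)" by (rule near0D[OF two_formD(2)[OF M]])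
  have "?k 0 = 0" "pfaffian_factor a b (M 0) = 0" using near0D[OF k0] near0D[OF kz] by simp_all
  note pd = pfaffian_factor_derivative[OF rN dN skN this(1)] pfaffian_factor_derivative[OF rM d two_formD(2)[OF M] this(2)]
  let ?Dm = "fd f 0" and ?DM = "fd M 0"
  note dM = near0D[OF rmat_deriv[OF rM], THEN conjunct1]
  note dm = near0D[OF rmat_deriv[OF rm], THEN conjunct1]
  have "(N has_derivative (\<lambda>h. ?DM (stail h) + (msc (c 0) (?Dm (stail h)) + msc (h $ None) (f (stail 0))))) (at 0)"
   unfolding N_def[abs_def]
  proof (intro has_derivative_add msc_has_derivative)
   show "((\<lambda>z. M (stail z)) has_derivative (\<lambda>h. ?DM (stail h))) (at 0)"
    by (rule has_derivative_compose[OF stail_has_derivative]) (simp add: dM)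
   show "((\<lambda>z. f (stail z)) has_derivative (\<lambda>h. ?Dm (stail h))) (at 0)"
    by (rule has_derivative_compose[OF stail_has_derivative]) (simp add: dm)
   show "(c has_derivative (\<lambda>h. h $ None)) (at 0)"
    unfolding c_def[abs_def] using has_derivative_add[OF has_derivative_const bounded_linear_imp_has_derivative[OF bounded_linear_nth[of None]]] by simp
  qed
  note DN = fd_eq[OF this]
  have ax: "stail (axis (Some t) 1) = axis t (1::'k)" "axis (Some t) (1::'k) $ None = 0"
   by (simp_all add: vec_eq_iff axis_def)
  \<comment> \<open>By closedness this is minus the sum of two terms that differentiate
    \<open>f\<close> along the kernel vectors; these are tangent to the hyperplane, where
    \<open>f\<close> is zero. So the deformation does not affect the transversal derivative of the
    Pfaffian factor.\<close>
  have "bl (?Dm (axis t 1)) (kernel2 a b (M 0)) (kernel1 a b (M 0)) = 0"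
  proof -
   have "?Dm v = 0" if "v $ t = 0" for v
   proof -
    have "?Dm v $ i $ j = 0" for i j
    proof -
     have "near0 x. x $ t = 0 --> f x $ i $ j = 0" using z by (rule eventually_mono) simp
     from near0D[OF hyperplane_derivative[OF rmat_rg[OF rm] this that]]
     show ?thesis using near0D[OF rmat_deriv[OF rm]] by simp
    qed
    then show ?thesis by (simp add: vec_eq_iff)
   qed
   then have "?Dm (kernel2 a b (M 0)) = 0" "?Dm (kernel1 a b (M 0)) = 0" using tan by auto
   moreover have "bl (?Dm (axis t 1)) (kernel2 a b (M 0)) (kernel1 a b (M 0)) +
     bl (?Dm (kernel2 a b (M 0))) (kernel1 a b (M 0)) (axis t 1) + bl (?Dm (kernel1 a b (M 0))) (axis t 1) (kernel2 a b (M 0)) = 0"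
    using near0D[OF two_formD(3)[OF f]] unfolding closed2_def by blast
   ultimately show ?thesis by (simp add: bl_sum)
  qed
  then have "fd ?k 0 (axis (Some t) 1) = fd (\<lambda>y. pfaffian_factor a b (M y)) 0 (axis t 1)"
   unfolding pd DN N0 ax by (simp add: bl_matrix_add bl_msc)
  then show ?thesis using 1 dk by simp
 qed
 define g where "g z = completed_inverse a b (N z) *v G (stail z)" for z
 have rz: "rmap g" unfolding g_def by (rule rmap_mv[OF rmat_completed_inverse[OF rN dN] rmap_compose[OF G st]])
 \<comment> \<open>Built to satisfy N X = x_t^2 G: the completed inverse gives N g = G - g_b e_a +
   g_a e_b, and the kernel vectors correct the error because N p = k e_a, N r = k e_b and k = x_t k'
   with a unit k'.\<close>
 define X where "X z = (z $ Some t * z $ Some t) *s g z + (z $ Some t / k' z) *s (g z $ b *s ?p z - g z $ a *s ?r z)" for z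
 have rX: "rmap X" unfolding X_def
  by (intro rmap_add rmap_scale rmap_diff rg_mult rg_nth rg_divide k' k'0 rz rmap_rg[OF rz] rp rr)
 have X0: "near0 z. (\<forall>j. z $ Some j = 0) --> X z = 0"
  by (simp add: X_def vec_eq_iff)
 have NX: "near0 z. N z *v X z = B (stail z)"
  using skN completed_det_nonzero[OF rN dN] k'(2) rg_eventually_nonzero[OF k'(1) k'0]
 proof eventually_elim
  case (elim z)
  note sd = elim(1,2)
  have 1: "N z *v g z = G (stail z) - g z $ b *s axis a 1 + g z $ a *s axis b 1"
   using completed_mult[OF sd, of "g z"] completed_inverse_mult(1)[OF sd, of "G (stail z)"] by (simp add: g_def)
  show ?case
   using elim(4)
   unfolding X_def matrix_vector_right_distrib vector_scalar_commute matrix_vector_mult_diff_distrib 1 mult_kernel[OF sd] elim(3)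
   by (simp add: vec_eq_iff B_def axis_def algebra_simps)
 qed
 \<comment> \<open>Infinitesimal invariance: up to the factor \<open>l\<close>, the left-hand side
   is the derivative in time of the form pulled back by the flow.\<close>
 define P where "P z \<longleftrightarrow> (N has_derivative fd N z) (at z) \<and>
  (\<forall>V W. bl (fd N z (scons 1 (X z))) V W +
    bl (N z) (fd X z (scons 0 V)) W + bl (N z) V (fd X z (scons 0 W)) = 0)" for z
 have P: "near0 z. P z"
  using eventually_rmap[OF rmat_deriv[OF rM] st] eventually_rmap[OF rmat_deriv[OF rm] st]
   eventually_rmap[OF two_formD(3)[OF M] st] eventually_rmap[OF two_formD(3)[OF f] st]
   eventually_rmap[OF skew_derivative[OF rM two_formD(2)[OF M]] st] eventually_rmap[OF skew_derivative[OF rm two_formD(2)[OF f]] st]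
   fd_cong[OF NX] rmap_deriv[OF rX] eventually_rmap[OF rmap_deriv[OF rb] st] eventually_rmap[OF poin st] skN
 proof eventually_elim
  case (elim z)
  let ?Dm = "fd f (stail z)" and ?DM = "fd M (stail z)"
  let ?DX = "fd X z" and ?Db = "fd B (stail z)"
  define D where "D u = ?DM u + msc (c z) (?Dm u)" for u
  have dN: "(N has_derivative (\<lambda>h. ?DM (stail h) + (msc (c z) (?Dm (stail h)) + msc (h $ None) (f (stail z))))) (at z)"
   unfolding N_def[abs_def]
  proof (intro has_derivative_add msc_has_derivative)
   show "((\<lambda>z. M (stail z)) has_derivative (\<lambda>h. ?DM (stail h))) (at z)"
    by (rule has_derivative_compose[OF stail_has_derivative conjunct1[OF elim(1)]])
   show "((\<lambda>z. f (stail z)) has_derivative (\<lambda>h. ?Dm (stail h))) (at z)"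
    by (rule has_derivative_compose[OF stail_has_derivative conjunct1[OF elim(2)]])
   show "(c has_derivative (\<lambda>h. h $ None)) (at z)"
    unfolding c_def[abs_def] using has_derivative_add[OF has_derivative_const bounded_linear_imp_has_derivative[OF bounded_linear_nth[of None]]] by simp
  qed
  then have DN: "fd N z h = D (stail h) + msc (h $ None) (f (stail z))" for h
   unfolding fd_eq[OF dN] D_def by simp
  have dX: "(X has_derivative ?DX) (at z)" using elim(8) by blast
  have db: "((\<lambda>z. B (stail z)) has_derivative (\<lambda>h. ?Db (stail h))) (at z)"
   by (rule has_derivative_compose[OF stail_has_derivative conjunct1[OF elim(9)]])
  note dNX = mult_has_derivative[OF dN dX]
  \<comment> \<open>Differentiating N X = B in a space direction trades the derivative of X for
    those of B and N, to which the primitive and closedness apply.\<close>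
  have NDX: "N z *v ?DX (scons 0 W) = ?Db W - D W *v X z" for W
  proof -
   have "fd (\<lambda>z. N z *v X z) z (scons 0 W) = fd (\<lambda>z. B (stail z)) z (scons 0 W)"
    using elim(7) by simp
   then have "(?DM W + (msc (c z) (?Dm W) + msc 0 (f (stail z)))) *v X z + N z *v ?DX (scons 0 W) = ?Db W"
    unfolding fd_eq[OF dNX] fd_eq[OF db] by simp
   moreover have "?DM W + (msc (c z) (?Dm W) + msc 0 (f (stail z))) = D W" by (simp add: D_def vec_eq_iff)
   ultimately show ?thesis by (simp add: eq_diff_eq add.commute)
  qed
  have skD: "skew (D u)" for u unfolding D_def using elim(5,6) by (intro skew_add skew_msc) auto
  have cyc: "bl (D u) v w + bl (D v) w u + bl (D w) u v = 0" for u v w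
  proof -
   have 1: "bl (?DM u) v w + bl (?DM v) w u + bl (?DM w) u v = 0" "bl (?Dm u) v w + bl (?Dm v) w u + bl (?Dm w) u v = 0"
    using elim(3,4) unfolding closed2_def by blast+
   have "bl (D u) v w + bl (D v) w u + bl (D w) u v = (bl (?DM u) v w + bl (?DM v) w u + bl (?DM w) u v) +
     c z * (bl (?Dm u) v w + bl (?Dm v) w u + bl (?Dm w) u v)"
    unfolding D_def bl_matrix_add bl_msc by (simp add: algebra_simps)
   then show ?thesis by (simp add: 1)
  qed
  have r: "bl (N z) V (?DX (scons 0 W)) = bl (mat 1) V (?Db W) - bl (D W) V (X z)" for V W
   unfolding bl_def[of "N z"] NDX by (simp add: bl_one bl_def right_diff_distrib sum_subtractf)
  have "bl (fd N z (scons 1 (X z))) V W + bl (N z) (?DX (scons 0 V)) W + bl (N z) V (?DX (scons 0 W)) = 0" for V W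
  proof -
   have "bl (fd N z (scons 1 (X z))) V W = bl (D (X z)) V W + bl (f (stail z)) V W"
    unfolding DN by (simp add: bl_matrix_add bl_msc)
   moreover have "bl (N z) (?DX (scons 0 V)) W = - bl (N z) W (?DX (scons 0 V))" by (rule bl_skew[OF elim(11)])
   moreover have "bl (f (stail z)) V W = bl (mat 1) W (?Db V) - bl (mat 1) V (?Db W)" using elim(10) by blast
   ultimately show ?thesis using r[of V W] r[of W V] cyc[of "X z" V W] bl_skew[OF skD, of W V "X z"] by algebra
  qed
  then show ?case unfolding P_def using dN frechet_derivative_at[OF dN] by auto
 qed
 obtain n where n: "n > 0" and flow: "\<forall>l. \<bar>l\<bar> < n --> (\<exists>y. rmap (y 1) \<and> y 1 0 = 0 \<and> inj (fd (y 1) 0) \<and> (near0 x. flow_eqs P X l y x))"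
  using regular_flow[OF rX P X0] by (elim exE conjE) (rule that)
 show ?thesis
 proof (intro exI[of _ n] conjI n allI impI)
  fix l :: real assume "\<bar>l\<bar> < n"
  from flow[rule_format, OF this] obtain y where y: "rmap (y 1)" "y 1 0 = 0" "inj (fd (y 1) 0)"
   and yf: "near0 x. flow_eqs P X l y x"
   by (elim exE conjE) (rule that)
  show "mequiv (\<lambda>y. M y + msc (of_real s0) (f y)) (\<lambda>y. M y + msc (of_real (s0 + l)) (f y))"
   unfolding mequiv_def
  proof (intro exI[of _ "y 1"] conjI y)
   show "near0 x. \<forall>v w. bl (M (y 1 x) + msc (of_real (s0 + l)) (f (y 1 x))) (fd (y 1) x v)
     (fd (y 1) x w) = bl (M x + msc (of_real s0) (f x)) v w"
    using yf
   proof eventually_elim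
    case (elim x)
    note elim = elim[unfolded flow_eqs_def]
    define Z where "Z s = scons (of_real (s * l)) (y s x)" for s
    define V where "V v s = fd (y s) x v" for v s
    have NZ: "N (Z s) = M (y s x) + msc (of_real (s0 + s * l)) (f (y s x))" for s
     by (simp add: N_def Z_def c_def)
    show ?case
    proof (intro allI)
     fix v w
     \<comment> \<open>The pulled-back form on two fixed vectors along one trajectory;
       \<open>P\<close> makes it constant.\<close>
     define E where "E s = bl (N (Z s)) (V v s) (V w s)" for s
     have "(E has_derivative (\<lambda>h. 0)) (at s within {0..1})" if s: "s \<in> {0..1}" for s
     proof -
      let ?DX = "fd X (Z s)" and ?DN = "fd N (Z s)"
      have h: "P (Z s)" "((\<lambda>s. y s x) has_derivative (\<lambda>h. h *\<^sub>R (l *\<^sub>R X (Z s)))) (at s within {0..1})"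
       "(V v has_derivative (\<lambda>h. h *\<^sub>R (l *\<^sub>R ?DX (scons 0 (V v s))))) (at s within {0..1})" for v
       using elim s unfolding Z_def V_def has_vector_derivative_def by auto
      have dN: "(N has_derivative ?DN) (at (Z s))" using h(1) unfolding P_def by blast
      have "((\<lambda>s. of_real (s * l) :: 'k) has_derivative (\<lambda>h. of_real (h * l))) (at s within {0..1})"
       by (intro bounded_linear.has_derivative[OF bounded_linear_of_real] has_derivative_mult_left has_derivative_ident)
      from scons_has_derivative[OF this h(2)]
      have dZ: "(Z has_derivative (\<lambda>h. scons (of_real (h * l)) (h *\<^sub>R (l *\<^sub>R X (Z s))))) (at s within {0..1})"
       unfolding Z_def .
      have e: "scons (of_real (h * l)) (h *\<^sub>R (l *\<^sub>R X (Z s))) = (h * l) *\<^sub>R scons 1 (X (Z s))" for h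
       by (simp add: vec_eq_iff scons_def scaleR_conv_of_real[where 'a='k] split: option.split)
      have "((\<lambda>s. N (Z s)) has_derivative (\<lambda>h. ?DN ((h * l) *\<^sub>R scons 1 (X (Z s))))) (at s within {0..1})"
       using has_derivative_compose[OF dZ dN] unfolding e .
      moreover have "?DN ((h * l) *\<^sub>R scons 1 (X (Z s))) = (h * l) *\<^sub>R ?DN (scons 1 (X (Z s)))" for h
       by (rule linear_scale[OF has_derivative_linear[OF dN]])
      ultimately have dNZ: "((\<lambda>s. N (Z s)) has_derivative (\<lambda>h. (h * l) *\<^sub>R ?DN (scons 1 (X (Z s))))) (at s within {0..1})" by simp
      have sc: "bl (c *\<^sub>R A) p q = of_real c * bl A p q" "bl A (c *\<^sub>R p) q = of_real c * bl A p q" "bl A p (c *\<^sub>R q) = of_real c * bl A p q"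
       for A :: "'k^'m^'m" and p q and c :: real
       by (simp_all add: bl_sum scaleR_conv_of_real[where 'a='k] sum_distrib_left algebra_simps)
      have "(E has_derivative (\<lambda>h. bl ((h * l) *\<^sub>R ?DN (scons 1 (X (Z s)))) (V v s) (V w s) +
        bl (N (Z s)) (h *\<^sub>R (l *\<^sub>R ?DX (scons 0 (V v s)))) (V w s) + bl (N (Z s)) (V v s) (h *\<^sub>R (l *\<^sub>R ?DX (scons 0 (V w s)))))) (at s within {0..1})"
       unfolding E_def[abs_def] by (rule bl_has_derivative[OF dNZ h(3) h(3)])
      moreover have "bl ((h * l) *\<^sub>R ?DN (scons 1 (X (Z s)))) (V v s) (V w s) +
        bl (N (Z s)) (h *\<^sub>R (l *\<^sub>R ?DX (scons 0 (V v s)))) (V w s) + bl (N (Z s)) (V v s) (h *\<^sub>R (l *\<^sub>R ?DX (scons 0 (V w s)))) = 0" for h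
      proof -
       have "bl (?DN (scons 1 (X (Z s)))) (V v s) (V w s) + bl (N (Z s)) (?DX (scons 0 (V v s))) (V w s) +
         bl (N (Z s)) (V v s) (?DX (scons 0 (V w s))) = 0" using h(1) unfolding P_def by blast
       then have "of_real h * of_real l * (bl (?DN (scons 1 (X (Z s)))) (V v s) (V w s) + bl (N (Z s)) (?DX (scons 0 (V v s))) (V w s) +
         bl (N (Z s)) (V v s) (?DX (scons 0 (V w s)))) = 0" by simp
       then show ?thesis unfolding sc by (simp add: algebra_simps)
      qed
      ultimately show ?thesis by simp
     qed
     then have "\<exists>c. \<forall>s\<in>{0..1}. E s = c" by (intro has_derivative_zero_constant) auto
     then have "E 1 = E 0" by auto
     then show "bl (M (y 1 x) + msc (of_real (s0 + l)) (f (y 1 x))) (fd (y 1) x v)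
      (fd (y 1) x w) = bl (M x + msc (of_real s0) (f x)) v w"
      using elim by (simp add: E_def NZ V_def)
    qed
   qed
  qed
 qed
qed

text \<open>The length of a step depends on the parameter, but the equivalence classes along the
  path M + s (M' - M) are open, and the real line is connected.\<close>

theorem moser:
 assumes M: "two_form M" and M': "two_form M'" and eq: "near0 y. y $ t = 0 --> M' y = M y"
  and d: "det (M 0 + swap_matrix a b) \<noteq> 0"
  and tan: "kernel1 a b (M 0) $ t = 0" "kernel2 a b (M 0) $ t = 0"
  and kz: "near0 y. y $ t = 0 --> pfaffian_factor a b (M y) = 0"
  and dk: "fd (\<lambda>y. pfaffian_factor a b (M y)) 0 (axis t 1) \<noteq> 0"
 shows "mequiv M M'"
proof -
 define m where "m y = M' y - M y" for y
 have m: "two_form m" unfolding m_def by (rule two_form_diff[OF M' M])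
 have z: "near0 y. y $ t = 0 --> m y = 0" using eq by (rule eventually_mono) (simp add: m_def)
 define L where "L s y = M y + msc (of_real s) (m y)" for s y
 have "mequiv (L 0) (L 1)"
 proof (rule connected_equivalence_relation[of "UNIV :: real set" 0 1 "\<lambda>s s'. mequiv (L s) (L s')"])
  fix s :: real
  obtain e where e: "e > 0" "\<forall>A. \<bar>A\<bar> < e --> mequiv (L s) (L (s + A))"
   using moser_step[OF M m z d tan kz dk, of s] unfolding L_def[abs_def] by blast
  have "mequiv (L s) (L x)" if "x \<in> ball s e" for x
   using e(2)[rule_format, of "x - s"] that by (simp add: dist_real_def abs_minus_commute)
  then show "\<exists>T. openin (top_of_set UNIV) T \<and> s \<in> T \<and> (\<forall>x\<in>T. mequiv (L s) (L x))"
   using e(1) by (intro exI[of _ "ball s e"]) (simp add: open_openin[symmetric])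
 qed (use mequiv_sym mequiv_trans in \<open>auto simp: connected_UNIV\<close>)
 moreover have "L 0 = M" "L 1 = M'" by (simp_all add: L_def m_def vec_eq_iff fun_eq_iff)
 ultimately show ?thesis by simp
qed

subsection \<open>Forms adapted to a hyperplane\<close>

lemma shrink_zero: "shrink t 0 v = v - v $ t *s axis t (1::'k)"
 by (simp add: shrink_def vec_eq_iff axis_def)

text \<open>The form after the hypersurface has been straightened to x_t = 0. The three tangent
  vectors record rank 2n - 4 of the restriction, and the last condition is structural smoothness
  expressed by the Pfaffian factor.\<close>

definition adapted :: "'m => 'm => 'm => ('k^'m => 'k^'m^'m) => bool" where
 "adapted t a b M \<longleftrightarrow> two_form M \<and> det (M 0 + swap_matrix a b) \<noteq> 0 \<and> a \<noteq> b \<and> a \<noteq> t \<and> b \<noteq> t \<and>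
   kernel1 a b (M 0) $ t = 0 \<and> kernel2 a b (M 0) $ t = 0 \<and>
   (near0 y. y $ t = 0 --> pfaffian_factor a b (M y) = 0) \<and>
   (\<exists>x y z. indep3 x y z \<and> x $ t = 0 \<and> y $ t = 0 \<and> z $ t = 0 \<and>
    (\<forall>j. j \<noteq> t --> (M 0 *v x) $ j = 0 \<and> (M 0 *v y) $ j = 0 \<and> (M 0 *v z) $ j = 0)) \<and>
   fd (\<lambda>y. pfaffian_factor a b (M y)) 0 (axis t 1) \<noteq> 0"

lemma rg_pf:
 assumes "rmat M" shows "rg (\<lambda>y. pf es n (M y))"
 unfolding pf_def bpow_def by (rule rg_wedge_power) (rule rg_bl[OF assms rmap_const rmap_const])

text \<open>The differential of the Pfaffian is nonzero, so by \<open>pf_derivative_corank3\<close>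
  the kernel at 0 has dimension at most two. \<open>tangential_kernel\<close> finds two tangent
  vectors in it, and a nonzero minor of them selects \<open>a\<close> and \<open>b\<close>, both
  different from \<open>t\<close>.\<close>

lemma adapted_exists:
 fixes M :: "'k^'m => 'k^'m^'m"
 assumes card: "CARD('m) = 2 * n" and es: "distinct es" "set es = (UNIV :: 'm set)"
  and M: "two_form M"
  and w0: "near0 y. y $ t = 0 --> pf es n (M y) = 0"
  and dw: "fd (\<lambda>y. pf es n (M y)) 0 v0 \<noteq> 0"
  and i3: "indep3 x y z" and tan: "x $ t = 0" "y $ t = 0" "z $ t = 0"
  and ker: "!!j. j \<noteq> t ==> (M 0 *v x) $ j = 0 \<and> (M 0 *v y) $ j = 0 \<and> (M 0 *v z) $ j = 0"
 obtains a b where "adapted t a b M"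
proof -
 note rM = two_formD(1)[OF M]
 have sk: "skew (M 0)" by (rule near0D[OF two_formD(2)[OF M]])
 note dM = near0D[OF rmat_deriv[OF rM], THEN conjunct1]
 note dpf = near0D[OF rg_deriv[OF rg_pf[OF rM, of es n]], THEN conjunct1]
 have no3: "\<not> indep3 u v w" if "M 0 *v u = 0" "M 0 *v v = 0" "M 0 *v w = 0" for u v w
 proof
  assume "indep3 u v w"
  from pf_derivative_corank3[OF card es dM sk this that dpf, of v0] show False using dw by simp
 qed
 obtain u v a b where uv: "M 0 *v u = 0" "M 0 *v v = 0" "u $ t = 0" "v $ t = 0" "u $ a * v $ b - u $ b * v $ a \<noteq> 0"
  using tangential_kernel[OF i3 tan ker] by blast
 have ab: "a \<noteq> b" "a \<noteq> t" "b \<noteq> t" using uv(3-5) by auto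
 have d: "det (M 0 + swap_matrix a b) \<noteq> 0" by (rule completion_exists[OF sk uv(1,2,5) no3])
 let ?p = "kernel1 a b (M 0)" and ?r = "kernel2 a b (M 0)"
 note kc = kernel_coordinates[OF sk d]
 have e: "w = w $ b *s ?p - w $ a *s ?r" if "M 0 *v w = 0" for w by (rule kernel_expansion[OF sk d that])
 have comp: "w $ l = w $ b * ?p $ l - w $ a * ?r $ l" if "M 0 *v w = 0" for w l
  using arg_cong[OF e[OF that], of "\<lambda>w. w $ l"] by simp
 have k0: "pfaffian_factor a b (M 0) = 0"
 proof -
  have "u $ b * pfaffian_factor a b (M 0) = 0" "u $ a * pfaffian_factor a b (M 0) = 0"
   using comp[OF uv(1), of b] comp[OF uv(1), of a] unfolding kc by algebra+
  then show ?thesis using uv(5) by auto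
 qed
 have e1: "u $ b * ?p $ t = u $ a * ?r $ t" "v $ b * ?p $ t = v $ a * ?r $ t"
  using comp[OF uv(1), of t] comp[OF uv(2), of t] uv(3,4) by simp_all
 have "?p $ t * (u $ a * v $ b - u $ b * v $ a) = 0" "?r $ t * (u $ a * v $ b - u $ b * v $ a) = 0"
  using e1 by algebra+
 then have pt: "?p $ t = 0" "?r $ t = 0" using uv(5) by auto
 let ?k = "\<lambda>y. pfaffian_factor a b (M y)" and ?W = "\<lambda>y. pf es n (M y + swap_matrix a b)"
 have rk: "rg ?k" by (rule rg_pfaffian_factor[OF rM d])
 have rW: "rg ?W" by (rule rg_pf[OF rmat_add[OF rM rmat_const]])
 have fac: "near0 y. pf es n (M y) = ?k y * ?W y"
  using two_formD(2)[OF M] completed_det_nonzero[OF rM d] by eventually_elim (rule pf_factor[OF card es])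
 have "((\<lambda>y. ?k y * ?W y) has_derivative (\<lambda>h. ?k 0 * fd ?W 0 h + fd ?k 0 h * ?W 0)) (at 0)"
  by (intro has_derivative_mult near0D[OF rg_deriv[OF rk], THEN conjunct1] near0D[OF rg_deriv[OF rW], THEN conjunct1])
 note D = fd_eq[OF this]
 have "fd (\<lambda>y. pf es n (M y)) 0 v0 = fd ?k 0 v0 * ?W 0"
  unfolding near0D[OF fd_cong[OF fac]] D by (simp add: k0)
 then have nz: "fd ?k 0 v0 \<noteq> 0" "?W 0 \<noteq> 0" using dw by auto
 have kz: "near0 y. y $ t = 0 --> ?k y = 0"
  using w0 fac rg_eventually_nonzero[OF rW nz(2)] by eventually_elim auto
 have "fd ?k 0 (axis t 1) \<noteq> 0"
 proof
  assume z: "fd ?k 0 (axis t 1) = 0"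
  obtain g where g: "rg g" "near0 y. ?k y = y $ t * g y" using hadamard[OF rk kz] by blast
  have "((\<lambda>y. y $ t * g y) has_derivative (\<lambda>h. 0 $ t * fd g 0 h + h $ t * g 0)) (at 0)"
   using near0D[OF rg_deriv[OF g(1)]]
   by (intro has_derivative_mult nth_has_derivative) auto
  note Dg = fd_eq[OF this]
  have "fd ?k 0 h = h $ t * g 0" for h
   unfolding near0D[OF fd_cong[OF g(2)]] Dg by simp
  then show False using z nz(1) by (simp add: axis_def)
 qed
 with M d ab pt kz have "adapted t a b M"
  unfolding adapted_def using i3 tan ker by (intro conjI exI[of _ x] exI[of _ y] exI[of _ z]) auto
 then show thesis by (rule that)
qed

text \<open>The first-order statement about the ideal: \<open>u\<close> is a direction in which the
  transversal components of both kernel fields are stationary. Then the derivative \<open>?D\<close>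
  of the form vanishes on pairs from \<open>x\<close>, \<open>y\<close>, \<open>z\<close>, and a
  count of arguments together with the case \<open>N = 2\<close> of \<open>wedge_power_jet\<close>
  finishes.\<close>

lemma power_jet:
 fixes A :: "'k^'m => 'k^'m^'m"
 assumes card: "CARD('m) = 2 * n" and A: "rmat A" and skew: "near0 y. skew (A y)"
  and d: "det (A 0 + swap_matrix a b) \<noteq> 0" and k: "near0 y. pfaffian_factor a b (A y) = 0"
  and i3: "indep3 x y z" and tan: "x $ t = 0" "y $ t = 0" "z $ t = 0"
  and ker: "!!j. j \<noteq> t ==> (A 0 *v x) $ j = 0 \<and> (A 0 *v y) $ j = 0 \<and> (A 0 *v z) $ j = 0"
  and u: "fd (\<lambda>y. kernel1 a b (A y) $ t) 0 u = 0" "fd (\<lambda>y. kernel2 a b (A y) $ t) 0 u = 0"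
  and vs: "length vs = 2 * (n - 1)" "!!v. v \<in> set vs ==> v $ t = 0"
 shows "bpow (A 0) (n - 1) vs = 0 \<and> fd (\<lambda>y. bpow (A y) (n - 1) vs) 0 u = 0"
proof -
 let ?p = "\<lambda>y. kernel1 a b (A y)" and ?r = "\<lambda>y. kernel2 a b (A y)" and ?D = "fd A 0 u"
 note dA = near0D[OF rmat_deriv[OF A], THEN conjunct1]
 have sk: "skew (A 0)" "skew ?D"
  using near0D[OF skew] near0D[OF skew_derivative[OF A skew]] by blast+
 have A0: "A 0 *v X = (A 0 *v X) $ t *s axis t 1" if "X \<in> {x, y, z}" for X
 proof -
  have "(A 0 *v X) $ j = 0" if "j \<noteq> t" for j using ker[OF that] \<open>X \<in> {x, y, z}\<close> by auto
  then show ?thesis unfolding vec_eq_iff by (simp add: axis_def)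
 qed
 \<comment> \<open>Differentiate the vanishing pairing of \<open>X\<close> with A q along
   \<open>u\<close>. Since \<open>A 0 *v X\<close> is a multiple of e_t, the term with the
   derivative of q sees only its component t, which is zero by assumption.\<close>
 have D0: "bl ?D X (q 0) = 0"
  if q: "rmap q" "near0 y. A y *v q y = 0" "fd (\<lambda>y. q y $ t) 0 u = 0" and X: "X \<in> {x, y, z}" for q X
 proof -
  note dq = near0D[OF rmap_deriv[OF q(1)]]
  have "near0 y. bl (A y) X (q y) = 0" using q(2) by eventually_elim (rule bl_kernel)
  from near0D[OF fd_cong[OF this]]
  have "fd (\<lambda>y. bl (A y) X (q y)) 0 u = 0"
by simp
  moreover note fd_eq[OF bl_has_derivative[OF dA has_derivative_const[of X] conjunct1[OF dq]]]
  ultimately have "bl ?D X (q 0) + bl (A 0) X (fd q 0 u) = 0" by simp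
  then show ?thesis using bl_eq[OF A0[OF X], of "fd q 0 u"] bl_skew[OF sk(1), of X] dq q(3) by simp
 qed
 have "near0 y. A y *v ?p y = 0 \<and> A y *v ?r y = 0"
  using skew k completed_det_nonzero[OF A d] by eventually_elim (simp add: mult_kernel)
 then have "near0 y. A y *v ?p y = 0" "near0 y. A y *v ?r y = 0" by (auto elim: eventually_mono)
 note Dk = D0[OF rmap_kernel1[OF A d] this(1) u(1)] D0[OF rmap_kernel2[OF A d] this(2) u(2)]
 have Dker: "bl ?D X w = 0" if "A 0 *v w = 0" "X \<in> {x, y, z}" for w X
  by (subst kernel_expansion[OF sk(1) d that(1)]) (simp add: bl_diff_right bl_scale_right Dk[OF that(2)])
 have D2: "bl ?D X Y = 0" if X: "X \<in> {x, y, z}" and Y: "Y \<in> {x, y, z}" for X Y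
 proof (cases "(A 0 *v Y) $ t = 0")
  case True
  then show ?thesis using A0[OF Y] by (intro Dker[OF _ X]) simp
 next
  case False
  \<comment> \<open>The combination of \<open>X\<close> and \<open>Y\<close> that lies in the
    kernel; paired with \<open>Y\<close> under the skew \<open>?D\<close> it leaves only a nonzero
    multiple of the wanted value.\<close>
  let ?w = "(A 0 *v Y) $ t *s X - (A 0 *v X) $ t *s Y"
  have "A 0 *v ?w = 0" unfolding matrix_vector_mult_diff_distrib vector_scalar_commute
   by (subst A0[OF X], subst A0[OF Y]) (simp add: mult.commute)
  from Dker[OF this Y] have "bl ?D Y X = 0" using False bl_self[OF sk(2)] by (simp add: bl_diff_right bl_scale_right)
  then show ?thesis using bl_skew[OF sk(2), of X Y] by simp
 qed
 let ?P = "shrink t 0 :: 'k^'m => 'k^'m" and ?E = "{axis t 1, x, y, z}"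
 have P: "?P v = v" if "v $ t = 0" for v using that by (simp add: shrink_zero)
 \<comment> \<open>Projecting the arguments makes e_t a fourth kernel vector at 0 and leaves the
   values on the tangential list \<open>vs\<close> unchanged.\<close>
 define g where "g y us = bl (A y) (?P (us ! 0)) (?P (us ! 1))" for y us
 define B where "B y = wedge_power (g y) (n - 1)" for y
 have mp: "map ?P vs = vs" using vs(2) P by (intro map_idI) auto
 have Bvs: "bpow (A y) (n - 1) vs = B y vs" for y
 proof -
  have "B y vs = wedge_power (\<lambda>us. bl (A y) (map ?P us ! 0) (map ?P us ! 1)) (n - 1) vs"
   unfolding B_def by (rule wedge_power_cong) (simp add: g_def)
  also have "... = bpow (A y) (n - 1) (map ?P vs)" unfolding bpow_def by (rule wedge_power_map[OF vs(1)])
  finally show ?thesis unfolding mp by (rule sym)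
 qed
 have lin: "?P (v + w) = ?P v + ?P w" "?P (c *s v) = c *s ?P v" for v w c
  by (simp_all add: shrink_zero vec_eq_iff algebra_simps)
 have "multilinear 2 (g y)" for y
  unfolding multilinear_def g_def
  by (auto simp: less_2_cases_iff lin bl_add_left bl_add_right bl_scale_left bl_scale_right)
 note ma = wedge_power_alternating_multilinear[OF this, of "n - 1", folded B_def]
 have rB: "rg (\<lambda>y. B y us)" for us
  unfolding B_def g_def by (rule rg_wedge_power) (rule rg_bl[OF A rmap_const rmap_const])
 note dB = near0D[OF rg_deriv[OF rB], THEN conjunct1]
 let ?B' = "\<lambda>us. fd (\<lambda>y. B y us) 0 u"
 have ml: "multilinear (2 * (n - 1)) ?B'"
  unfolding multilinear_def
 proof (intro allI impI conjI)
  fix us :: "('k^'m) list" and i v w c assume i: "length us = 2 * (n - 1) \<and> i < 2 * (n - 1)"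
  have e: "B y (us[i := v + w]) = B y (us[i := v]) + B y (us[i := w])" "B y (us[i := c *s v]) = c * B y (us[i := v])" for y
   using ma i unfolding multilinear_def by blast+
  show "?B' (us[i := v + w]) = ?B' (us[i := v]) + ?B' (us[i := w])"
   unfolding e by (simp add: fd_eq[OF has_derivative_add[OF dB dB]])
  show "?B' (us[i := c *s v]) = c * ?B' (us[i := v])"
   unfolding e by (simp add: fd_eq[OF has_derivative_mult_right[OF dB]])
 qed
 have a0: "g 0 us = 0" if us: "length us = 2" "set us \<inter> ?E \<noteq> {}" for us
 proof -
  have "bl (A 0) (?P v) (?P w) = 0" "bl (A 0) (?P w) (?P v) = 0" if "w \<in> ?E" for v w
  proof -
   show "bl (A 0) (?P v) (?P w) = 0"
   proof (cases "w = axis t 1")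
    case False
    then have w: "w \<in> {x, y, z}" using that by auto
    then have "w $ t = 0" using tan by auto
    then show ?thesis using bl_eq[OF A0[OF w], of "?P v"] P by (simp add: shrink_def)
   qed (simp add: shrink_zero)
   then show "bl (A 0) (?P w) (?P v) = 0" using bl_skew[OF sk(1), of "?P w" "?P v"] by simp
  qed
  moreover have "us ! 0 \<in> ?E \<or> us ! 1 \<in> ?E" using us by (auto simp: in_set_conv_nth less_2_cases_iff)
  ultimately show ?thesis unfolding g_def by blast
 qed
 have da: "((\<lambda>y. g y us) has_derivative (\<lambda>h. bl (fd A 0 h) (?P (us ! 0)) (?P (us ! 1)))) (at 0)" for us
  unfolding g_def using bl_has_derivative[OF dA has_derivative_const has_derivative_const] by simp
 have Da: "bl ?D (?P (us ! 0)) (?P (us ! 1)) = 0" if us: "length us = 2" "set us \<subseteq> ?E" for us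
 proof -
  have "us ! 0 \<in> ?E" "us ! 1 \<in> ?E" using us by (metis nth_mem subsetD one_less_numeral_iff semiring_norm(76) pos2)+
  then show ?thesis using D2 tan P by (auto simp: shrink_zero)
 qed
 have jet: "?B' us = 0 \<and> B 0 us = 0" if us: "length us = 2 * (n - 1)" "2 \<le> length (filter (\<lambda>v. v \<in> ?E) us)" for us
 proof
  have "\<exists>G. ((\<lambda>y. wedge_power (g y) (n - 1) us) has_derivative G) (at 0) \<and> (2 \<le> length (filter (\<lambda>v. v \<in> ?E) us) --> G u = 0)"
   by (rule wedge_power_jet[OF da a0 disjI2 us(1)]) (use Da in auto)
  then obtain G where G: "((\<lambda>y. B y us) has_derivative G) (at 0)" "G u = 0" using us(2) unfolding B_def by blast
  show "?B' us = 0" unfolding fd_eq[OF G(1)] by (rule G(2))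
  have "filter (\<lambda>v. v \<in> ?E) us \<noteq> []" using us(2) by auto
  then have "set us \<inter> ?E \<noteq> {}" by (fastforce simp: filter_empty_conv)
  then show "B 0 us = 0" unfolding B_def by (rule wedge_power_vanishes[where K = ?E, OF _ us(1), rotated]) (rule a0)
 qed
 note in3 = indep3_independent[OF i3]
 have "vec.span {x, y, z} \<subseteq> {v. v $ t = 0}" using tan by (intro vec.span_minimal) (auto simp: vec.subspace_def)
 then have "axis t 1 \<notin> vec.span {x, y, z}" by (auto simp: axis_def)
 then have "vec.independent ?E" by (intro vec.independent_insertI in3)
 then obtain f :: "'m => 'k^'m" where f: "inj f" "?E \<subseteq> range f" "vec.span (range f) = UNIV" by (rule extend_to_invertible)
 have cf: "card (range f) = 2 * n" using card_image[OF f(1)] card by simp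
 have cE: "card ?E = 4" using in3 tan by (auto simp: axis_def vec_eq_iff card_insert_if)
 \<comment> \<open>A list of 2n - 2 distinct members of a basis of 2n vectors omits only two of
   them, so it contains at least two of the four vectors in \<open>?E\<close>.\<close>
 have zero: "?B' us = 0 \<and> B 0 us = 0" if us: "length us = 2 * (n - 1)" "set us \<subseteq> range f" for us
 proof (cases "distinct us")
  case True
  have "card ?E + card (set us) = card (?E \<union> set us) + card (?E \<inter> set us)" by (intro card_Un_Int) auto
  moreover have "card (?E \<union> set us) \<le> 2 * n" unfolding cf[symmetric] using f us by (intro card_mono) auto
  moreover have "?E \<inter> set us = set (filter (\<lambda>v. v \<in> ?E) us)" by auto
  then have "card (?E \<inter> set us) = length (filter (\<lambda>v. v \<in> ?E) us)"
   using distinct_card[OF distinct_filter[OF True]] by metis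
  moreover have "card ?E \<le> card (range f)" using f(2) by (intro card_mono) auto
  ultimately have "2 \<le> length (filter (\<lambda>v. v \<in> ?E) us)" using distinct_card[OF True] us(1) cE cf by linarith
  then show ?thesis by (rule jet[OF us(1)])
 next
  case False
  then obtain i j where "i < j" "j < length us" "us ! i = us ! j" by (metis distinct_conv_nth nat_neq_iff)
  then have "B y us = 0" for y
   using ma[THEN conjunct2, unfolded alternating_def, rule_format, of us i j] us(1) by simp
  then show ?thesis by simp
 qed
 have "set vs \<subseteq> vec.span (range f)" using f(3) by simp
 then have "?B' vs = 0" "B 0 vs = 0"
  using zero by (auto intro!: multilinear_zero_on_span[OF ml _ vs(1)] multilinear_zero_on_span[OF conjunct1[OF ma] _ vs(1)])
 then show ?thesis unfolding Bvs by blast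
qed

subsection \<open>Agreement along the hyperplane\<close>

text \<open>Where \<open>f\<close> is nonzero, \<open>h\<close> would vanish on an open set,
  contrary to its nonzero derivative near 0.\<close>

lemma zero_product:
 assumes f: "rg f" and h: "rg h" and dh: "fd h 0 v \<noteq> 0"
  and prod: "near0 x. f x * h x = 0"
 shows "near0 x. f x = 0"
proof -
 have near: "near0 x. \<forall>\<^sub>F z in nhds x. f z * h z = 0" using prod by (simp add: eventually_eventually)
 have "near0 x. fd h x v \<noteq> 0" by (rule rg_eventually_nonzero[OF rg_frechet[OF h] dh])
 with near rg_deriv[OF f] show ?thesis
 proof eventually_elim
  case (elim x)
  show ?case
  proof (rule ccontr)
   assume nz: "f x \<noteq> 0"
   have "isCont f x" using elim(2) has_derivative_continuous by blast
   then have "(f \<longlongrightarrow> f x) (nhds x)" unfolding isCont_def using tendsto_at_iff_tendsto_nhds[of f x] by simp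
   from tendsto_imp_eventually_ne[OF this nz] elim(1) have "\<forall>\<^sub>F z in nhds x. h z = 0"
    by eventually_elim simp
   then obtain S where "open S" "x \<in> S" "!!z. z \<in> S ==> h z = 0" unfolding eventually_nhds by blast
   then have "fd h x = fd (\<lambda>_. 0) x" by (intro fd_cong_open)
   also have "... = (\<lambda>_. 0)" using frechet_derivative_at[OF has_derivative_const, of "0::'k" x] by simp
   finally show False using elim(3) by simp
  qed
 qed
qed

lemma rg_linear:
 assumes "rg f"
 shows "fd f 0 v = (\<Sum>i\<in>UNIV. v $ i * fd f 0 (axis i 1))"
proof -
 note d = near0D[OF rg_deriv[OF assms]]
 let ?D = "fd f 0"
 note lin = has_derivative_linear[OF conjunct1[OF d]]
 have sums: "?D (sum g I) = (\<Sum>i\<in>I. ?D (g i))" for g and I :: "'a set"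
  by (rule linear_sum[OF lin])
 have sc: "?D (c *s v) = c * ?D v" for c v using d by blast
 have "?D v = ?D (\<Sum>i\<in>UNIV. v $ i *s axis i 1)" by (simp add: basis_expansion)
 then show ?thesis unfolding sums sc .
qed

text \<open>Two proportional differentials are multiples of one linear form: the first of them
  unless it is zero, and otherwise the second.\<close>

lemma dependent_differentials:
 assumes h: "rg h1" "rg h2"
  and minors: "!!i j. fd h1 0 (axis i 1) * fd h2 0 (axis j 1) =
    fd h1 0 (axis j 1) * fd h2 0 (axis i 1)"
 obtains c :: "'k^'p" where
  "!!u. (\<Sum>i\<in>UNIV. u $ i * c $ i) = 0 ==> fd h1 0 u = 0 \<and> fd h2 0 u = 0"
proof (cases "\<exists>i. fd h1 0 (axis i 1) \<noteq> 0")
 case True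
 then obtain i where i: "fd h1 0 (axis i 1) \<noteq> 0" ..
 show thesis
 proof (rule that[of "\<chi> i. fd h1 0 (axis i 1)"])
  fix u :: "'k^'p" assume u: "(\<Sum>j\<in>UNIV. u $ j * (\<chi> i. fd h1 0 (axis i 1)) $ j) = 0"
  then have 1: "fd h1 0 u = 0" by (simp add: rg_linear[OF h(1), of u])
  have "fd h1 0 (axis i 1) * fd h2 0 u =
    (\<Sum>j\<in>UNIV. u $ j * (fd h1 0 (axis i 1) * fd h2 0 (axis j 1)))"
   unfolding rg_linear[OF h(2), of u] by (simp add: sum_distrib_left algebra_simps)
  also have "... = fd h1 0 u * fd h2 0 (axis i 1)"
   unfolding minors[of i] rg_linear[OF h(1), of u] by (simp add: sum_distrib_left mult.commute mult.left_commute)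
  finally show "fd h1 0 u = 0 \<and> fd h2 0 u = 0" using 1 i by simp
 qed
next
 case False
 show thesis
 proof (rule that[of "\<chi> i. fd h2 0 (axis i 1)"])
  fix u :: "'k^'p" assume "(\<Sum>j\<in>UNIV. u $ j * (\<chi> i. fd h2 0 (axis i 1)) $ j) = 0"
  then show "fd h1 0 u = 0 \<and> fd h2 0 u = 0"
   using False by (simp add: rg_linear[OF h(1), of u] rg_linear[OF h(2), of u])
 qed
qed

lemma mequiv_pull:
 assumes "rmap F" "F 0 = 0" "inj (fd F 0)"
 shows "mequiv (pull F M) M"
 unfolding mequiv_def
proof (intro exI[of _ F] conjI assms)
 show "near0 x. \<forall>v w. bl (M (F x)) (fd F x v) (fd F x w) = bl (pull F M x) v w"
  using bl_pull[OF assms(1), of M] by eventually_elim simp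
qed

text \<open>Composition with \<open>shrink t 0\<close> restricts to the hyperplane while keeping
  functions on the full space.\<close>

abbreviation (input) dk1 where "dk1 t a b M \<equiv> fd (\<lambda>y. kernel1 a b (M (shrink t 0 y)) $ t) 0"
abbreviation (input) dk2 where "dk2 t a b M \<equiv> fd (\<lambda>y. kernel2 a b (M (shrink t 0 y)) $ t) 0"

text \<open>The map is the identity on the hyperplane and its transversal derivative there is \<open>Z\<close>; the equation
 \<open>M\<^sub>0 Z = M\<^sub>1 e\<^sub>t + c e\<^sub>t\<close> for \<open>Z\<close> expresses agreement and is solvable if the right-hand side annihilates the kernel of \<open>M\<^sub>0\<close>.
 Both conditions on \<open>c\<close> are satisfied by one regular \<open>c\<close> because the transversal components of the kernel vectors form
 a regular sequence.\<close>

lemma agree_on_hyperplane: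
 fixes M0 M1 :: "'k^'m => 'k^'m^'m"
 assumes A0: "adapted t a b M0" and A1: "adapted t a1 b1 M1"
  and tan: "near0 y. y $ t = 0 --> (\<forall>i j. i \<noteq> t --> j \<noteq> t --> M0 y $ i $ j = M1 y $ i $ j)"
  and ind: "dk1 t a b M0 (axis i 1) * dk2 t a b M0 (axis j 1)
    \<noteq> dk1 t a b M0 (axis j 1) * dk2 t a b M0 (axis i 1)"
  and ind1: "dk1 t a1 b1 M1 v1 \<noteq> 0"
 shows "\<exists>F. rmap F \<and> F 0 = 0 \<and> inj (fd F 0) \<and> (near0 y. y $ t = 0 --> pull F M0 y = M1 y)"
proof -
 have tf0: "two_form M0" and d0: "det (M0 0 + swap_matrix a b) \<noteq> 0"
  and ab: "a \<noteq> b" "a \<noteq> t" "b \<noteq> t" and pt0: "kernel1 a b (M0 0) $ t = 0" "kernel2 a b (M0 0) $ t = 0"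
  and kz0: "near0 y. y $ t = 0 --> pfaffian_factor a b (M0 y) = 0" using A0 unfolding adapted_def by auto
 have tf1: "two_form M1" and d1: "det (M1 0 + swap_matrix a1 b1) \<noteq> 0"
  and pt1: "kernel1 a1 b1 (M1 0) $ t = 0" "kernel2 a1 b1 (M1 0) $ t = 0"
  and kz1: "near0 y. y $ t = 0 --> pfaffian_factor a1 b1 (M1 y) = 0" using A1 unfolding adapted_def by auto
 let ?P = "shrink t 0 :: 'k^'m => 'k^'m"
 have pt: "?P y $ t = 0" for y by (simp add: shrink_def)
 have sh: "rmap ?P" "?P 0 = 0" by (rule rmap_shrink, rule shrink_0)
 define A where "A y = M0 (?P y)" for y
 define B where "B y = M1 (?P y)" for y
 have rA: "rmat A" unfolding A_def by (rule rmat_compose[OF two_formD(1)[OF tf0] sh])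
 have rB: "rmat B" unfolding B_def by (rule rmat_compose[OF two_formD(1)[OF tf1] sh])
 have dA: "det (A 0 + swap_matrix a b) \<noteq> 0" and dB: "det (B 0 + swap_matrix a1 b1) \<noteq> 0" using d0 d1 by (simp_all add: A_def B_def)
 have skA: "near0 y. skew (A y)" and skB: "near0 y. skew (B y)"
  unfolding A_def B_def by (rule eventually_rmap[OF two_formD(2)[OF tf0] sh], rule eventually_rmap[OF two_formD(2)[OF tf1] sh])
 have kA: "near0 y. pfaffian_factor a b (A y) = 0" and kB: "near0 y. pfaffian_factor a1 b1 (B y) = 0"
  using eventually_rmap[OF kz0 sh] eventually_rmap[OF kz1 sh] by (simp_all add: A_def B_def pt)
 have tAB: "near0 y. \<forall>i j. i \<noteq> t --> j \<noteq> t --> A y $ i $ j = B y $ i $ j"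
  using eventually_rmap[OF tan sh] by (simp add: A_def B_def pt)
 let ?p = "\<lambda>y. kernel1 a b (A y)" and ?r = "\<lambda>y. kernel2 a b (A y)" and ?p1 = "\<lambda>y. kernel1 a1 b1 (B y)"
 note rp = rmap_kernel1[OF rA dA] and rr = rmap_kernel2[OF rA dA] and rp1 = rmap_kernel1[OF rB dB]
 define h1 where "h1 y = ?p y $ t" for y
 define h2 where "h2 y = ?r y $ t" for y
 define f1 where "f1 y = (B y *v ?p y) $ t" for y
 define f2 where "f2 y = (B y *v ?r y) $ t" for y
 have rg: "rg h1" "rg h2" "rg f1" "rg f2"
  unfolding h1_def h2_def f1_def f2_def using rmap_rg[OF rp] rmap_rg[OF rr] rmap_rg[OF rmap_mv[OF rB rp]] rmap_rg[OF rmap_mv[OF rB rr]] by blast+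
 have h0: "h1 0 = 0" "h2 0 = 0" using pt0 by (simp_all add: h1_def h2_def A_def)
 have tang: "(A y *v w) $ j = (B y *v w) $ j"
  if "\<forall>i j. i \<noteq> t --> j \<noteq> t --> A y $ i $ j = B y $ i $ j" "w $ t = 0" "j \<noteq> t" for y w j
  unfolding matrix_vector_mult_def vec_lambda_beta using that by (intro sum.cong refl) (metis mult_zero_right)
 have syz: "near0 y. h2 y * f1 y = h1 y * f2 y"
 proof -
  have "near0 y. h2 y * f1 y - h1 y * f2 y = 0"
  proof (rule zero_product[OF _ rmap_rg[OF rp1, of t]])
   show "rg (\<lambda>y. h2 y * f1 y - h1 y * f2 y)" by (intro rg_diff rg_mult rg)
   show "fd (\<lambda>x. ?p1 x $ t) 0 v1 \<noteq> 0" using ind1 by (simp add: B_def)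
   show "near0 y. (h2 y * f1 y - h1 y * f2 y) * ?p1 y $ t = 0"
    using skA skB kA kB tAB completed_det_nonzero[OF rA dA] completed_det_nonzero[OF rB dB]
   proof eventually_elim
    case (elim y)
    \<comment> \<open>A kernel vector of \<open>A y\<close> tangent to the hyperplane. As the
      tangential blocks agree, \<open>B y\<close> sends it to a multiple of e_t, and this multiple
      is the defect of the syzygy. Pairing with the kernel vector \<open>?p1 y\<close> of
      \<open>B y\<close> kills the defect up to the factor \<open>?p1 y $ t\<close>.\<close>
    define q where "q = h2 y *s ?p y - h1 y *s ?r y"
    have qt: "q $ t = 0" by (simp add: q_def h1_def h2_def mult.commute)
    have "A y *v q = 0" unfolding q_def matrix_vector_mult_diff_distrib vector_scalar_commute mult_kernel[OF elim(1,6)] elim(3) by simp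
    then have "(B y *v q) $ j = 0" if "j \<noteq> t" for j using tang[OF elim(5) qt that] by simp
    moreover have "(B y *v q) $ t = h2 y * f1 y - h1 y * f2 y"
     unfolding q_def matrix_vector_mult_diff_distrib vector_scalar_commute by (simp add: f1_def f2_def)
    ultimately have "B y *v q = (h2 y * f1 y - h1 y * f2 y) *s axis t 1" by (auto simp: vec_eq_iff axis_def)
    from bl_eq[OF this, of "?p1 y"] have "bl (B y) (?p1 y) q = (h2 y * f1 y - h1 y * f2 y) * ?p1 y $ t" .
    moreover have "bl (B y) q (?p1 y) = 0" by (rule bl_kernel) (simp add: mult_kernel[OF elim(2,7)] elim(4))
    ultimately show ?case using bl_skew[OF elim(2), of "?p1 y" q] by simp
   qed
  qed
  then show ?thesis by eventually_elim simp
 qed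
 have ind': "fd h1 0 (axis i 1) * fd h2 0 (axis j 1) \<noteq> fd h1 0 (axis j 1) * fd h2 0 (axis i 1)"
  using ind by (simp add: h1_def[abs_def] h2_def[abs_def] A_def)
 obtain c where c: "rg c" "near0 y. f1 y = c y * h1 y \<and> f2 y = c y * h2 y"
  using koszul[OF rg(3,4,1,2) h0 ind' syz] by blast
 define h where "h y = B y *v axis t 1 + c y *s axis t 1" for y
 have rh: "rmap h" unfolding h_def by (rule rmap_add[OF rmap_mv[OF rB rmap_const] rmap_scale[OF c(1) rmap_const]])
 define Z where "Z y = completed_inverse a b (A y) *v h y" for y
 have rZ: "rmap Z" unfolding Z_def by (rule rmap_mv[OF rmat_completed_inverse[OF rA dA] rh])
 have AZ: "near0 y. A y *v Z y = h y"
  using skA skB c(2) completed_det_nonzero[OF rA dA]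
 proof eventually_elim
  case (elim y)
  note sd = elim(1,4)
  have th: "(\<Sum>i\<in>UNIV. u $ i * h y $ i) = - (B y *v u) $ t + c y * u $ t" for u
  proof -
   have "(\<Sum>i\<in>UNIV. u $ i * h y $ i) = bl (B y) u (axis t 1) + c y * (\<Sum>i\<in>UNIV. u $ i * axis t (1::'k) $ i)"
    by (simp add: h_def bl_def distrib_left sum.distrib sum_distrib_left algebra_simps)
   also have "(\<Sum>i\<in>UNIV. u $ i * axis t (1::'k) $ i) = u $ t" by (rule sum_times_axis)
   also have "bl (B y) u (axis t 1) = - (B y *v u) $ t" using bl_skew[OF elim(2), of u "axis t 1"] by (simp add: bl_axis_left)
   finally show ?thesis .
  qed
  \<comment> \<open>These coordinates are minus the pairings of \<open>h y\<close> with the two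
    kernel vectors, and \<open>c\<close> was chosen to make both zero. The added matrix then acts
    trivially on \<open>Z y\<close>, so the completed system solves the original one.\<close>
  have "Z y $ a = 0" "Z y $ b = 0"
   unfolding Z_def completed_inverse_nth[OF sd] th f1_def[symmetric] f2_def[symmetric] using elim(3) by (simp_all add: h1_def h2_def)
  then show ?case using completed_mult[OF sd, of "Z y"] completed_inverse_mult(1)[OF sd, of "h y"] by (simp add: Z_def)
 qed
 \<comment> \<open>Otherwise e_t - Z is sent by \<open>B 0\<close> to a multiple of e_t. Pairing
   with itself and skewness make the multiple zero, so a vector with component 1 along e_t lies in
   the kernel, which is tangent to the hyperplane at 0.\<close>
 have Zt: "Z 0 $ t \<noteq> 0"
 proof
  assume z: "Z 0 $ t = 0"
  have sk1: "skew (B 0)" by (rule near0D[OF skB])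
  note t0 = near0D[OF tAB]
  define u where "u = axis t 1 - Z 0"
  have ut: "u $ t = 1" by (simp add: u_def z axis_def)
  have "(B 0 *v u) $ j = 0" if "j \<noteq> t" for j
  proof -
   have "(B 0 *v Z 0) $ j = (A 0 *v Z 0) $ j" using tang[OF t0 z that] by simp
   also have "... = h 0 $ j" using near0D[OF AZ] by simp
   also have "... = (B 0 *v axis t 1) $ j" using that by (simp add: h_def axis_def)
   finally show ?thesis by (simp add: u_def matrix_vector_mult_diff_distrib)
  qed
  then have e: "B 0 *v u = (B 0 *v u) $ t *s axis t 1" by (auto simp: vec_eq_iff axis_def)
  have "(B 0 *v u) $ t = 0" using bl_eq[OF e, of u] bl_self[OF sk1, of u] ut by simp
  then have "B 0 *v u = 0" using e by simp
  from arg_cong[OF kernel_expansion[OF sk1 dB this], of "\<lambda>w. w $ t"] have "u $ t = 0"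
   using pt1 by (simp add: B_def)
  then show False using ut by simp
 qed
 define F where "F y = ?P y + y $ t *s Z y" for y
 have rF: "rmap F" unfolding F_def by (rule rmap_add[OF sh(1) rmap_scale[OF rg_nth rZ]])
 have F0: "F 0 = 0" by (simp add: F_def)
 have DF: "near0 y. y $ t = 0 --> (\<forall>v. fd F y v = ?P v + v $ t *s Z y)"
  using rmap_deriv[OF rZ] rmap_deriv[OF rF]
 proof eventually_elim
  case (elim y)
  show ?case
  proof (intro impI allI)
   fix v assume yt: "y $ t = 0"
   have "fd F y v $ l = (?P v + v $ t *s Z y) $ l" for l
   proof -
    note nth = nth_has_derivative
    have "((\<lambda>y. (y $ l - y $ t * axis t 1 $ l) + y $ t * Z y $ l) has_derivative
      (\<lambda>v. (v $ l - v $ t * axis t 1 $ l) + (y $ t * fd Z y v $ l + v $ t * Z y $ l))) (at y)"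
     by (intro has_derivative_add has_derivative_diff has_derivative_mult has_derivative_mult_left nth bounded_linear.has_derivative[OF bounded_linear_nth])
       (use elim(1) in blast)
    moreover have "(\<lambda>y. F y $ l) = (\<lambda>y. (y $ l - y $ t * axis t 1 $ l) + y $ t * Z y $ l)"
     by (simp add: F_def shrink_zero fun_eq_iff)
    ultimately have "((\<lambda>y. F y $ l) has_derivative
      (\<lambda>v. (v $ l - v $ t * axis t 1 $ l) + (y $ t * fd Z y v $ l + v $ t * Z y $ l))) (at y)" by simp
    note e = fd_eq[OF this]
    have "fd F y v $ l = fd (\<lambda>y. F y $ l) y v" using elim(2) by simp
    then show ?thesis unfolding e by (simp add: yt shrink_zero)
   qed
   then show "fd F y v = ?P v + v $ t *s Z y" by (simp add: vec_eq_iff)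
  qed
 qed
 have inj: "inj (fd F 0)"
 proof -
  have D0: "fd F 0 v = ?P v + v $ t *s Z 0" for v
   using near0D[OF DF] by simp
  have "v = w" if "fd F 0 v = fd F 0 w" for v w
  proof -
   have e: "?P v $ l + v $ t * Z 0 $ l = ?P w $ l + w $ t * Z 0 $ l" for l
    using arg_cong[OF that[unfolded D0], of "\<lambda>x. x $ l"] by simp
   have vt: "v $ t = w $ t" using e[of t] Zt by (simp add: pt)
   have "v $ l = w $ l" for l using e[of l] vt by (cases "l = t") (auto simp: shrink_def)
   then show ?thesis by (simp add: vec_eq_iff)
  qed
  then show ?thesis by (rule injI)
 qed
 have "near0 y. y $ t = 0 --> pull F M0 y = M1 y"
  using DF AZ skA skB tAB
 proof eventually_elim
  case (elim y)
  show ?case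
  proof
   assume yt: "y $ t = 0"
   have py: "?P y = y" using yt by (simp add: shrink_def vec_eq_iff)
   have Fy: "F y = y" using yt py by (simp add: F_def)
   have M: "M0 y = A y" "M1 y = B y" by (simp_all add: A_def B_def py)
   have DFy: "fd F y v = ?P v + v $ t *s Z y" for v using elim(1) yt by blast
   have Z1: "bl (A y) u (Z y) = bl (B y) u (axis t 1)" if "u $ t = 0" for u
   proof -
    have "bl (A y) u (Z y) = bl (B y) u (axis t 1) + c y * (\<Sum>i\<in>UNIV. u $ i * axis t (1::'k) $ i)"
     unfolding bl_def[of "A y"] elim(2) by (simp add: h_def bl_def distrib_left sum.distrib sum_distrib_left algebra_simps)
    also have "(\<Sum>i\<in>UNIV. u $ i * axis t (1::'k) $ i) = u $ t" by (rule sum_times_axis)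
    finally show ?thesis using that by simp
   qed
   have AB: "bl (A y) u w = bl (B y) u w" if "u $ t = 0" "w $ t = 0" for u w
    unfolding bl_def
   proof (intro sum.cong refl)
    fix j show "u $ j * (A y *v w) $ j = u $ j * (B y *v w) $ j"
     using tang[OF elim(5) that(2), of j] that(1) by (cases "j = t") auto
   qed
   have dec: "v = ?P v + v $ t *s axis t 1" for v by (simp add: shrink_zero)
   have "bl (A y) (?P v + v $ t *s Z y) (?P w + w $ t *s Z y) = bl (B y) v w" for v w
   proof -
    have 1: "bl (A y) (Z y) (?P w) = bl (B y) (axis t 1) (?P w)"
     using Z1[OF pt[of w]] bl_skew[OF elim(3), of "Z y" "?P w"] bl_skew[OF elim(4), of "axis t 1" "?P w"] by simp
    have "bl (B y) v w = bl (B y) (?P v + v $ t *s axis t 1) (?P w + w $ t *s axis t 1)" using dec by simp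
    then show ?thesis
     unfolding bl_add_left bl_add_right bl_scale_left bl_scale_right
     using Z1[OF pt[of v]] 1 AB[OF pt[of v] pt[of w]] bl_self[OF elim(3), of "Z y"] bl_self[OF elim(4), of "axis t 1"] by simp
   qed
   then show "pull F M0 y = M1 y" unfolding pull_def DFy Fy M by (simp add: bl_axes vec_eq_iff)
  qed
 qed
 then show ?thesis using rF F0 inj by blast
qed

text \<open>The assumption on 1-jets, without choosing generators: no linear form \<open>c\<close> controls all coefficients of the power to first order.\<close>

definition jet_rank2 :: "'m => nat => ('k^'m => 'k^'m^'m) => bool" where
 "jet_rank2 t m M \<longleftrightarrow> (\<forall>c. \<exists>vs u. length vs = 2 * m \<and> (\<forall>v\<in>set vs. v $ t = 0) \<and> (\<Sum>i\<in>UNIV. u $ i * c $ i) = 0 \<and>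
   (bpow (M 0) m vs \<noteq> 0 \<or> fd (\<lambda>y. bpow (M (shrink t 0 y)) m vs) 0 u \<noteq> 0))"

text \<open>Tangential arguments may be replaced by their projections, after which only the
  tangential entries of the matrix are read.\<close>

lemma jet_rank2_cong:
 fixes M N :: "'k^'m => 'k^'m^'m"
 assumes tan: "near0 y. y $ t = 0 --> (\<forall>i j. i \<noteq> t --> j \<noteq> t --> M y $ i $ j = N y $ i $ j)"
  and M: "jet_rank2 t m M"
 shows "jet_rank2 t m N"
proof -
 let ?p = "shrink t 0 :: 'k^'m => 'k^'m"
 have *: "(bpow (M 0) m vs = bpow (N 0) m vs) \<and> fd (\<lambda>y. bpow (M (?p y)) m vs) 0 = fd (\<lambda>y. bpow (N (?p y)) m vs) 0"
  if vs: "length vs = 2 * m" "\<forall>v\<in>set vs. v $ t = 0" for vs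
 proof -
  have "near0 y. bpow (M (?p y)) m vs = bpow (N (?p y)) m vs"
   using eventually_rmap[OF tan rmap_shrink[of t 0] shrink_0]
  proof eventually_elim
   case (elim y)
   have e: "bl (M (?p y)) (?p v) (?p w) = bl (N (?p y)) (?p v) (?p w)" for v w
    unfolding bl_sum
   proof (intro sum.cong refl)
    fix i j show "?p v $ i * M (?p y) $ i $ j * ?p w $ j = ?p v $ i * N (?p y) $ i $ j * ?p w $ j"
     using elim by (cases "i = t"; cases "j = t") (auto simp: shrink_def)
   qed
   have mp: "map ?p vs = vs" using vs(2) by (intro map_idI) (auto simp: shrink_zero)
   have "bpow (M (?p y)) m (map ?p vs) = bpow (N (?p y)) m (map ?p vs)"
    unfolding bpow_def wedge_power_map[OF vs(1), symmetric] by (rule wedge_power_cong) (simp add: e)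
   then show ?case unfolding mp .
  qed
  from near0D[OF this] near0D[OF fd_cong[OF this]]
  show ?thesis by simp
 qed
 show ?thesis
  unfolding jet_rank2_def
 proof
  fix c
  obtain vs u where "length vs = 2 * m" "\<forall>v\<in>set vs. v $ t = 0" "(\<Sum>i\<in>UNIV. u $ i * c $ i) = 0"
   "bpow (M 0) m vs \<noteq> 0 \<or> fd (\<lambda>y. bpow (M (?p y)) m vs) 0 u \<noteq> 0"
   using M unfolding jet_rank2_def by blast
  with *[of vs] show "\<exists>vs u. length vs = 2 * m \<and> (\<forall>v\<in>set vs. v $ t = 0) \<and> (\<Sum>i\<in>UNIV. u $ i * c $ i) = 0 \<and>
   (bpow (N 0) m vs \<noteq> 0 \<or> fd (\<lambda>y. bpow (N (?p y)) m vs) 0 u \<noteq> 0)"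
   by (intro exI[of _ vs] exI[of _ u]) simp
 qed
qed

text \<open>If the two differentials were dependent, the linear form from
  \<open>dependent_differentials\<close> would control all coefficients to first order by
  \<open>power_jet\<close>, against \<open>jet_rank2\<close>.\<close>

lemma kernel_differentials:
 fixes M :: "'k^'m => 'k^'m^'m"
 assumes card: "CARD('m) = 2 * n" and A: "adapted t a b M" and jet: "jet_rank2 t (n - 1) M"
 shows "\<exists>i j. dk1 t a b M (axis i 1) * dk2 t a b M (axis j 1)
   \<noteq> dk1 t a b M (axis j 1) * dk2 t a b M (axis i 1)"
  (is "\<exists>i j. ?p i * ?r j \<noteq> ?p j * ?r i")
proof (rule ccontr)
 let ?P = "shrink t 0 :: 'k^'m => 'k^'m"
 assume "\<not> ?thesis"
 then have minors: "?p i * ?r j = ?p j * ?r i" for i j by blast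
 have tf: "two_form M" and d: "det (M (?P 0) + swap_matrix a b) \<noteq> 0"
  and k: "near0 y. y $ t = 0 --> pfaffian_factor a b (M y) = 0" using A unfolding adapted_def by auto
 obtain x y z where xyz: "indep3 x y z" "x $ t = 0" "y $ t = 0" "z $ t = 0"
  "!!j. j \<noteq> t ==> (M (?P 0) *v x) $ j = 0 \<and> (M (?P 0) *v y) $ j = 0 \<and> (M (?P 0) *v z) $ j = 0"
  using A unfolding adapted_def shrink_0 by blast
 note sh = rmap_shrink[where 'm = 'm, of t 0] shrink_0
 note r = rmat_compose[OF two_formD(1)[OF tf] sh] and s = eventually_rmap[OF two_formD(2)[OF tf] sh]
 have k': "near0 y. pfaffian_factor a b (M (?P y)) = 0"
  using eventually_rmap[OF k sh] by (simp add: shrink_def)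
 obtain c where c: "!!u. (\<Sum>i\<in>UNIV. u $ i * c $ i) = 0 ==>
   dk1 t a b M u = 0 \<and> dk2 t a b M u = 0"
  by (rule dependent_differentials[OF rmap_rg[OF rmap_kernel1[OF r d]] rmap_rg[OF rmap_kernel2[OF r d]] minors]) (rule that)
 obtain vs u where vs: "length vs = 2 * (n - 1)" "\<forall>v\<in>set vs. v $ t = 0" "(\<Sum>i\<in>UNIV. u $ i * c $ i) = 0"
  "bpow (M 0) (n - 1) vs \<noteq> 0 \<or> fd (\<lambda>y. bpow (M (?P y)) (n - 1) vs) 0 u \<noteq> 0"
  using jet unfolding jet_rank2_def by blast
 from power_jet[OF card r s d k' xyz conjunct1[OF c[OF vs(3)]] conjunct2[OF c[OF vs(3)]] vs(1)] vs(2,4)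
 show False by simp
qed

theorem equivalent_of_restriction:
 fixes M0 M1 :: "'k^'m => 'k^'m^'m"
 assumes card: "CARD('m) = 2 * n" and A0: "adapted t a b M0" and A1: "adapted t a1 b1 M1"
  and tan: "near0 y. y $ t = 0 --> (\<forall>i j. i \<noteq> t --> j \<noteq> t --> M0 y $ i $ j = M1 y $ i $ j)"
  and jets: "jet_rank2 t (n - 1) M0"
 shows "mequiv M1 M0"
proof -
 obtain i j where ij: "dk1 t a b M0 (axis i 1) * dk2 t a b M0 (axis j 1)
   \<noteq> dk1 t a b M0 (axis j 1) * dk2 t a b M0 (axis i 1)"
  using kernel_differentials[OF card A0 jets] by blast
 obtain v1 where v1: "dk1 t a1 b1 M1 v1 \<noteq> 0"
  using kernel_differentials[OF card A1 jet_rank2_cong[OF tan jets]] by (metis mult_zero_left)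
 obtain F where F: "rmap F" "F 0 = 0" "inj (fd F 0)" "near0 y. y $ t = 0 --> pull F M0 y = M1 y"
  using agree_on_hyperplane[OF A0 A1 tan ij v1] by blast
 have tf: "two_form M0" "two_form M1" using A0 A1 unfolding adapted_def by auto
 have "mequiv M1 (pull F M0)"
  using A1 unfolding adapted_def by (intro moser[OF tf(2) two_form_pull[OF tf(1) F(1,2)] F(4)]) auto
 then show ?thesis by (rule mequiv_trans[OF _ mequiv_pull[OF F(1-3)]])
qed

end

subsection \<open>Forms, coordinates and jets\<close>

definition form_matrix :: "('k::real_normed_field, 'm::finite) form => 'k^'m => 'k^'m^'m" where
 "form_matrix w x = (\<chi> i j. w x [axis i 1, axis j 1])"

lemma length2: "length vs = 2 ==> vs = [vs ! 0, vs ! 1]"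
 by (auto simp: numeral_2_eq_2 length_Suc_conv)

lemma wedge_power_two:
 assumes "!!v w. u [v, w] = bl A v w"
 shows "wedge_power u n vs = wedge_power (\<lambda>us. bl A (us ! 0) (us ! 1)) n vs"
proof (rule wedge_power_cong)
 fix us :: "('a^'b) list" assume "length us = 2"
 then show "u us = bl A (us ! 0) (us ! 1)" using length2[of us] assms[of "us ! 0" "us ! 1"] by simp
qed

context regular_class
begin

lemma two_form_of_form:
 fixes W :: "('k, 'm::finite) form"
 assumes RG: "!!f :: 'k^'m => 'k. regular_germ r f \<longleftrightarrow> rg f"
  and W: "form_germ r 2 W" and cl: "form_germ_eq 3 (ext_deriv 2 W) (\<lambda>_ _. 0)"
 shows "two_form (form_matrix W)" "near0 x. \<forall>v w. W x [v, w] = bl (form_matrix W x) v w"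
proof -
 have al: "near0 x. alternating_multilinear 2 (W x)"
  using W unfolding form_germ_def by (rule conjunct1)
 have reg: "rg (\<lambda>p. W p vs)" if "length vs = 2" for vs
  using W that RG[of "\<lambda>p. W p vs"] unfolding form_germ_def by simp
 show "near0 x. \<forall>v w. W x [v, w] = bl (form_matrix W x) v w"
  using al
 proof eventually_elim
  case (elim x)
  show ?case unfolding form_matrix_def by (intro allI multilinear_two_matrix[OF elim])
 qed
 have rm: "rmat (form_matrix W)" unfolding rmat_def form_matrix_def by (simp add: reg)
 have sk: "near0 x. skew (form_matrix W x)"
  using al unfolding form_matrix_def by eventually_elim (rule skew_two_matrix)
 have "near0 x. closed2 (form_matrix W) x"
  using cl[unfolded form_germ_eq_def] rmat_linear[OF rm] rmat_deriv[OF rm] skew_derivative[OF rm sk]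
 proof eventually_elim
  case (elim x)
  let ?D = "fd (form_matrix W) x"
  have D: "fd (\<lambda>x. W x [axis i 1, axis j 1]) x u = ?D u $ i $ j" for i j u
   using conjunct2[OF elim(3), rule_format, of i j u] by (simp add: form_matrix_def)
  show ?case
  proof (rule closed2_axes)
   show "?D u $ j $ k = (\<Sum>i\<in>UNIV. u $ i * ?D (axis i 1) $ j $ k)" for u j k using elim(2) by blast
   show "?D (axis i 1) $ j $ k + ?D (axis j 1) $ k $ i + ?D (axis k 1) $ i $ j = 0" for i j k
   proof -
    have "ext_deriv 2 W x [axis i 1, axis j 1, axis k 1] = 0" using elim(1) by simp
    then have "?D (axis i 1) $ j $ k - ?D (axis j 1) $ i $ k + ?D (axis k 1) $ i $ j = 0"
     by (simp add: ext_deriv_def numeral_2_eq_2 lessThan_Suc D algebra_simps)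
    moreover have "?D (axis j 1) $ i $ k = - ?D (axis j 1) $ k $ i" using elim(4) skewD by blast
    ultimately show ?thesis by simp
   qed
  qed
 qed
 with sk show "two_form (form_matrix W)" unfolding two_form_def using rm by (simp add: eventually_conj_iff)
qed

text \<open>The volume form has a nonzero value on the basis, so the Pfaffian is the defining
  function \<open>f\<close> times a unit and shares its zero and its nonzero differential at
  0.\<close>

lemma pf_of_form:
 fixes u :: "('k, 'm::finite) form"
 assumes RG: "!!f :: 'k^'m => 'k. regular_germ r f \<longleftrightarrow> rg f"
  and card: "CARD('m) = 2 * n" and es: "distinct es" "set es = (UNIV :: 'm set)"
  and u: "near0 x. \<forall>v w. u x [v, w] = bl (form_matrix u x) v w"
  and ss: "structurally_smooth_martinet r n u"
 shows "near0 x. x \<in> martinet_set n u --> pf es n (form_matrix u x) = 0"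
  "pf es n (form_matrix u 0) = 0" "\<exists>v. fd (\<lambda>x. pf es n (form_matrix u x)) 0 v \<noteq> 0"
proof -
 let ?E = "map (\<lambda>i. axis i (1::'k)) es :: ('k^'m) list"
 have len: "length ?E = 2 * n" using es card distinct_card by fastforce
 have pfE: "near0 x. pf es n (form_matrix u x) = wedge_power (u x) n ?E"
  using u
 proof eventually_elim
  case (elim x)
  show ?case unfolding pf_def bpow_def by (rule wedge_power_two[symmetric]) (use elim in blast)
 qed
 show "near0 x. x \<in> martinet_set n u --> pf es n (form_matrix u x) = 0"
  using pfE by eventually_elim (use len in \<open>auto simp: martinet_set_def\<close>)
 obtain f W where f: "martinet_equation r n u f W" "f 0 = 0" "\<exists>v. fd f 0 v \<noteq> 0"
  using ss unfolding structurally_smooth_martinet_def by blast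
 have rf: "rg f" and vol: "volume_form_germ r W" and eq: "form_germ_eq (2 * n) (\<lambda>p. wedge_power (u p) n) (\<lambda>p vs. f p * W p vs)"
  using f(1) unfolding martinet_equation_def RG by auto
 have rW: "rg (\<lambda>p. W p ?E)" and al: "near0 p. alternating_multilinear (2 * n) (W p)"
  and nz: "near0 p. \<exists>vs. length vs = 2 * n \<and> W p vs \<noteq> 0"
  using vol len unfolding volume_form_germ_def form_germ_def RG card by auto
 have E0: "W 0 ?E \<noteq> 0"
 proof
  assume z: "W 0 ?E = 0"
  obtain vs where "length vs = 2 * n" "W 0 vs \<noteq> 0" using near0D[OF nz] by blast
  moreover have "multilinear (2 * n) (W 0)" "alternating (2 * n) (W 0)"
   using near0D[OF al] by (simp_all add: alternating_multilinear_iff)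
  ultimately show False using alternating_zero_top[where a = "W 0" and k = "2 * n" and es = ?E, OF _ _ len span_axes[OF es] z] by blast
 qed
 have e: "near0 x. pf es n (form_matrix u x) = f x * W x ?E"
  using pfE eq[unfolded form_germ_eq_def] by eventually_elim (use len in simp)
 show "pf es n (form_matrix u 0) = 0" using near0D[OF e] f(2) by simp
 have "((\<lambda>x. f x * W x ?E) has_derivative (\<lambda>h. f 0 * fd (\<lambda>x. W x ?E) 0 h + fd f 0 h * W 0 ?E)) (at 0)"
  by (intro has_derivative_mult near0D[OF rg_deriv[OF rf], THEN conjunct1] near0D[OF rg_deriv[OF rW], THEN conjunct1])
 note D = fd_eq[OF this]
 show "\<exists>v. fd (\<lambda>x. pf es n (form_matrix u x)) 0 v \<noteq> 0"
  unfolding near0D[OF fd_cong[OF e]] D using f(2,3) E0 by auto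
qed

lemma pf_pull:
 fixes M :: "'k^'m => 'k^'m^'m"
 assumes card: "CARD('m) = 2 * n" and es: "distinct es" "set es = (UNIV :: 'm set)"
  and M: "rmat M" and F: "rmap F" "F 0 = 0" "inj (fd F 0)"
  and w0: "pf es n (M 0) = 0" and dw: "fd (\<lambda>x. pf es n (M x)) 0 v \<noteq> 0"
  and z: "near0 y. y $ t = 0 --> pf es n (M (F y)) = 0"
 shows "near0 y. y $ t = 0 --> pf es n (pull F M y) = 0"
  "\<exists>v. fd (\<lambda>y. pf es n (pull F M y)) 0 v \<noteq> 0"
proof -
 let ?d = "\<lambda>y. det (\<chi> i. fd F y (axis i 1))" and ?w = "\<lambda>x. pf es n (M x)"
 have e: "pf es n (pull F M y) = ?d y * ?w (F y)" for y
  by (rule pf_congruence[OF card es]) (simp add: pull_def)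
 show "near0 y. y $ t = 0 --> pf es n (pull F M y) = 0" using z by eventually_elim (simp add: e)
 have rd: "rg ?d" by (rule rg_det) (simp add: rmap_rg[OF rmap_frechet[OF F(1)]])
 have rw: "rg ?w" by (rule rg_pf[OF M])
 have rw': "rg (\<lambda>y. ?w (F y))" by (rule rg_compose[OF rw F(1,2)])
 note DF = near0D[OF rmap_deriv[OF F(1)]]
 let ?D = "fd F 0"
 have J: "?D v = jacobian F 0 *v v" for v using DF by blast
 obtain Q where Q: "Q ** jacobian F 0 = mat 1"
  using F(3) matrix_left_invertible_injective[of "jacobian F 0"] unfolding J[abs_def] by blast
 have d0: "?d 0 \<noteq> 0"
 proof -
  have "(\<chi> i. ?D (axis i 1)) = transpose (jacobian F 0)" by (simp add: J matrix_axis transpose_def vec_eq_iff)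
  then have "?d 0 = det (jacobian F 0)" by (simp add: det_transpose)
  then show ?thesis using Q by (metis det_I det_mul mult_zero_right zero_neq_one)
 qed
 have "jacobian F 0 ** Q = mat 1" by (rule matrix_left_right_inverse[THEN iffD1, OF Q])
 then have "?D (Q *v v) = v" by (simp add: J matrix_vector_mul_assoc)
 moreover have "((\<lambda>y. ?w (F y)) has_derivative (\<lambda>h. fd ?w 0 (?D h))) (at 0)"
  by (rule has_derivative_compose[OF conjunct1[OF DF]]) (simp add: F(2) near0D[OF rg_deriv[OF rw]])
 note dwF = this
 have "((\<lambda>y. ?d y * ?w (F y)) has_derivative (\<lambda>h. ?d 0 * fd ?w 0 (?D h) + fd ?d 0 h * ?w (F 0))) (at 0)"
  by (intro has_derivative_mult dwF near0D[OF rg_deriv[OF rd], THEN conjunct1])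
 note D = fd_eq[OF this]
 ultimately have "fd (\<lambda>y. pf es n (pull F M y)) 0 (Q *v v) = ?d 0 * fd ?w 0 v"
  unfolding e D by (simp add: F(2) w0)
 then show "\<exists>v. fd (\<lambda>y. pf es n (pull F M y)) 0 v \<noteq> 0"
  using d0 dw by (intro exI[of _ "Q *v v"]) simp
qed

end

section \<open>Coordinates on the hypersurface\<close>

text \<open>Inclusion of a coordinate subspace: \<open>b\<close> labels its coordinates among those
  of the ambient space, and \<open>restrict_coords b\<close> is a left inverse for injective
  \<open>b\<close>.\<close>

definition embed :: "('p => 'm) => 'k::zero^'p => 'k^'m" where
 "embed b q = (\<chi> l. if l \<in> range b then q $ inv b l else 0)"

definition restrict_coords :: "('p => 'm) => 'k^'m => 'k^'p" where
 "restrict_coords b y = (\<chi> i. y $ b i)"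

lemma restrict_coords_nth [simp]: "restrict_coords b y $ i = y $ b i" by (simp add: restrict_coords_def)

lemma embed_nth: "inj b ==> embed b q $ b i = q $ i" "l \<notin> range b ==> embed b q $ l = 0"
 by (simp_all add: embed_def inv_f_f)

lemma restrict_embed: "inj b ==> restrict_coords b (embed b q) = q"
 by (simp add: vec_eq_iff embed_nth)

lemma embed_axis: "inj b ==> embed b (axis i 1) = axis (b i) (1::'k::zero_neq_one)"
 by (auto simp: vec_eq_iff embed_def axis_def inv_f_f)

lemma embed_0 [simp]: "embed b 0 = 0" by (simp add: embed_def vec_eq_iff)

lemma embed_has_derivative: "(embed b has_derivative embed b) (at (x :: 'k::real_normed_field^'p) within S)"
proof -
 have "((\<lambda>q :: 'k^'p. embed b q $ l) has_derivative (\<lambda>h. if l \<in> range b then h $ inv b l else 0)) (at x within S)" for l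
  by (cases "l \<in> range b") (simp_all add: embed_def nth_has_derivative)
 from vec_has_derivative[OF this] show ?thesis by (simp add: embed_def[abs_def])
qed

lemma restrict_coords_has_derivative:
 "(restrict_coords b has_derivative restrict_coords b) (at (x :: 'k::real_normed_field^'m) within S)"
proof -
 have "((\<lambda>y :: 'k^'m. restrict_coords b y $ i) has_derivative (\<lambda>h. h $ b i)) (at x within S)" for i
  by (simp add: nth_has_derivative)
 from vec_has_derivative[OF this] show ?thesis by (simp add: restrict_coords_def[abs_def])
qed

context regular_class
begin

lemma rmap_embed: "rmap (embed b :: 'k^'p => 'k^'m)"
 unfolding rmap_def embed_def vec_lambda_beta by (intro allI rg_if rg_nth rg_const)

lemma rmap_restrict: "rmap (restrict_coords b :: 'k^'m => 'k^'p)"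
 unfolding rmap_def by (simp add: rg_nth)

text \<open>A linear form that violated \<open>jet_rank2\<close> would make every coefficient vanish
  at 0 with differential proportional to it. All 1-jets would then lie on the line of
  \<open>J\<close>, and their span would have dimension at most 1.\<close>

lemma span_jet1_rank2:
 fixes M :: "'k^'m => 'k^'m^'m" and S :: "('k, 'p::{finite,linorder}) form" and b :: "'p => 'm"
 assumes card: "CARD('p) = 2 * n - 1" and b: "inj b" "range b = UNIV - {t}" and M: "rmat M"
  and S: "near0 q. \<forall>v w. S q [v, w] = bl (M (embed b q)) (embed b v) (embed b w)"
  and dim: "vec.dim (span_jet1 (\<lambda>q. wedge_power (S q) (n - 1))) = 2"
 shows "jet_rank2 t (n - 1) M"
proof (rule ccontr)
 let ?a = "embed b :: ('k, 'p) vec => 'k^'m"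
 have ri: "rmap ?a" "?a 0 = 0" by (rule rmap_embed, simp)
 have it: "?a q $ t = 0" for q using b(2) by (intro embed_nth(2)) auto
 have sh: "shrink t 0 (?a q) = ?a q" for q by (simp add: shrink_zero it)
 assume "\<not> ?thesis"
 then obtain c' where c': "!!vs u. length vs = 2 * (n - 1) ==> (\<forall>v\<in>set vs. v $ t = 0) ==> (\<Sum>i\<in>UNIV. u $ i * c' $ i) = 0 ==>
   bpow (M 0) (n - 1) vs = 0 \<and> fd (\<lambda>y. bpow (M (shrink t 0 y)) (n - 1) vs) 0 u = 0"
  unfolding jet_rank2_def by blast
 define c where "c = restrict_coords b c'"
 have c: "(\<Sum>i\<in>UNIV. ?a u $ i * c' $ i) = (\<Sum>i\<in>UNIV. u $ i * c $ i)" for u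
 proof -
  have "(\<Sum>i\<in>UNIV. ?a u $ i * c' $ i) = (\<Sum>i\<in>range b. ?a u $ i * c' $ i)"
   by (rule sum.mono_neutral_right) (auto simp: embed_nth(2))
  also have "... = (\<Sum>i\<in>UNIV. u $ i * c $ i)"
   by (subst sum.reindex[OF b(1)]) (simp add: c_def embed_nth(1)[OF b(1)])
  finally show ?thesis .
 qed
 define J where "J = (\<chi> i. case i of None => 0 | Some j => c $ j)"
 have "jet1 (corank1_coeff (\<lambda>q. wedge_power (S q) (n - 1)) i) \<in> vec.span {J}" for i
 proof -
  let ?L = "map (\<lambda>j. axis j 1) (sorted_list_of_set (UNIV - {i})) :: (('k, 'p) vec) list"
  let ?g = "corank1_coeff (\<lambda>q. wedge_power (S q) (n - 1)) i"
  let ?h = "\<lambda>y. bpow (M (shrink t 0 y)) (n - 1) (map ?a ?L)"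
  have len: "length ?L = 2 * (n - 1)" using card by (simp add: card_Diff_subset)
  have rh: "rg ?h" unfolding bpow_def
   by (rule rg_wedge_power) (rule rg_bl[OF rmat_compose[OF M rmap_shrink shrink_0] rmap_const rmap_const])
  have eq: "near0 q. ?g q = ?h (?a q)"
   using S
  proof eventually_elim
   case (elim q)
   have "?g q = wedge_power (S q) (n - 1) ?L" by (simp add: corank1_coeff_def)
   also have "... = wedge_power (\<lambda>us. bl (M (?a q)) (map ?a us ! 0) (map ?a us ! 1)) (n - 1) ?L"
   proof (rule wedge_power_cong)
    fix us :: "(('k, 'p) vec) list" assume "length us = 2"
    then show "S q us = bl (M (?a q)) (map ?a us ! 0) (map ?a us ! 1)"
     using length2[of us] elim[rule_format, of "us ! 0" "us ! 1"] by simp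
   qed
   also have "... = ?h (?a q)" unfolding bpow_def sh by (rule wedge_power_map[OF len])
   finally show ?case .
  qed
  note dh = near0D[OF rg_deriv[OF rh], THEN conjunct1]
  let ?G = "\<lambda>u. fd ?h 0 (?a u)"
  have "((\<lambda>q. ?h (?a q)) has_derivative ?G) (at 0)"
   by (rule has_derivative_compose[OF embed_has_derivative]) (unfold ri(2), rule dh)
  note dg = this fd_eq[OF this]
  have G: "?G u = 0" "?h 0 = 0" if "(\<Sum>i\<in>UNIV. u $ i * c $ i) = 0" for u
   using c'[of "map ?a ?L" "?a u"] len that c by (simp_all add: it)
  \<comment> \<open>A scalar-linear functional that vanishes on the kernel of \<open>c\<close> is a
    multiple of \<open>c\<close>.\<close>
  have "\<exists>d. \<forall>j. ?G (axis j 1) = d * c $ j"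
  proof (cases "c = 0")
   case True
   then show ?thesis using G by (intro exI[of _ 0]) simp
  next
   case False
   then obtain l where l: "c $ l \<noteq> 0" by (auto simp: vec_eq_iff)
   have "?G (axis j 1) = (?G (axis l 1) / c $ l) * c $ j" for j
   proof -
    let ?u = "axis j 1 - (c $ j / c $ l) *s axis l 1"
    have "(\<Sum>i\<in>UNIV. ?u $ i * c $ i) = (\<Sum>i\<in>UNIV. c $ i * axis j (1::'k) $ i) - (c $ j / c $ l) * (\<Sum>i\<in>UNIV. c $ i * axis l (1::'k) $ i)"
     by (simp add: sum_distrib_left sum_subtractf algebra_simps)
    then have "?G ?u = 0" unfolding sum_times_axis using l by (intro G) simp
    moreover have "?a ((c $ j / c $ l) *s axis l 1) = (c $ j / c $ l) *s ?a (axis l 1)" by (simp add: embed_def vec_eq_iff)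
    then have "?G ?u = ?G (axis j 1) - (c $ j / c $ l) * ?G (axis l 1)"
     using linear_diff[OF has_derivative_linear[OF dg(1)], of "axis j 1" "(c $ j / c $ l) *s axis l 1"]
      near0D[OF rg_deriv[OF rh]] by simp
    ultimately show ?thesis by simp
   qed
   then show ?thesis by blast
  qed
  then obtain d where d: "\<forall>j. ?G (axis j 1) = d * c $ j" ..
  have "jet1 ?g = d *s J"
   using d G(2)[of 0] near0D[OF eq] near0D[OF fd_cong[OF eq]] dg(2)
   by (simp add: jet1_def J_def vec_eq_iff ri(2) split: option.split)
  then show ?thesis by (simp add: vec.span_scale vec.span_base)
 qed
 then have "span_jet1 (\<lambda>q. wedge_power (S q) (n - 1)) \<subseteq> vec.span {J}"
  unfolding span_jet1_def by (intro vec.span_minimal) auto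
 from vec.dim_le_card[OF this] have "vec.dim (span_jet1 (\<lambda>q. wedge_power (S q) (n - 1))) \<le> 1" by simp
 then show False using dim by simp
qed

text \<open>For reasons of dimension some vector e lies outside the image of the differential.
  Adding y_t e to the parametrization gives a chart that carries the hyperplane y_t = 0 to the
  parametrized hypersurface.\<close>

lemma adapted_chart:
 fixes f :: "('k, 'p::finite) vec => 'k^'m"
 assumes card: "CARD('m) = CARD('p) + 1" and f: "rmap f" "f 0 = 0" "inj (fd f 0)"
 obtains t :: 'm and b :: "'p => 'm" and F where "inj b" "range b = UNIV - {t}" "rmap F" "F 0 = 0" "inj (fd F 0)"
  "!!y. y $ t = 0 ==> F y = f (restrict_coords b y)"
  "near0 y. \<forall>v. v $ t = 0 --> fd F y v = fd f (restrict_coords b y) (restrict_coords b v)"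
proof -
 \<comment> \<open>Any coordinate can serve as the transversal one.\<close>
 fix t :: 'm
 have "card (UNIV - {t}) = CARD('p)" using card by (simp add: card_Diff_subset)
 then obtain b :: "'p => 'm" where bij: "bij_betw b UNIV (UNIV - {t})"
  using finite_same_card_bij[of "UNIV :: 'p set" "UNIV - {t}"] by auto
 then have b: "inj b" "range b = UNIV - {t}" by (auto simp: bij_betw_def)
 let ?D = "fd f 0" and ?r = "restrict_coords b :: 'k^'m => ('k, 'p) vec"
 note Df = near0D[OF rmap_deriv[OF f(1)]]
 have J: "?D v = jacobian f 0 *v v" for v using Df by blast
 have "range ?D \<noteq> UNIV"
 proof
  assume "range ?D = UNIV"
  moreover have "vec.dim (range ((*v) (jacobian f 0))) \<le> vec.dim (UNIV :: ('k, 'p) vec set)"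
   by (rule vec.dim_image_le[OF matrix_vector_mul_linear_gen])
  ultimately have "vec.dim (UNIV :: ('k^'m) set) \<le> vec.dim (UNIV :: ('k, 'p) vec set)" unfolding J[abs_def] by simp
  then show False using card by (simp add: vec_dim_card card_cart_basis)
 qed
 then obtain e where e: "e \<notin> range ?D" by blast
 define F where "F y = f (?r y) + y $ t *s e" for y
 have r0: "?r 0 = 0" by (simp add: vec_eq_iff)
 note rf = rmap_compose[OF f(1) rmap_restrict r0]
 have rF: "rmap F" unfolding F_def by (rule rmap_add[OF rf rmap_scale[OF rg_nth rmap_const]])
 have DR: "fd ?r y = ?r" for y
  using frechet_derivative_at[OF restrict_coords_has_derivative, of b y] by simp
 have DF: "near0 y. \<forall>v. fd F y v = fd f (?r y) (?r v) + v $ t *s e"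
  using eventually_rmap[OF rmap_deriv[OF f(1)] rmap_restrict r0]
 proof eventually_elim
  case (elim y)
  have d1: "((\<lambda>y. f (?r y)) has_derivative (\<lambda>v. fd f (?r y) (?r v))) (at y)"
   by (rule has_derivative_compose[OF restrict_coords_has_derivative conjunct1[OF elim]])
  have "((\<lambda>y. (y $ t *s e) $ l) has_derivative (\<lambda>v. (v $ t *s e) $ l)) (at y)" for l
   using has_derivative_mult_left[OF nth_has_derivative] by simp
  from vec_has_derivative[OF this] have d2: "((\<lambda>y. y $ t *s e) has_derivative (\<lambda>v. v $ t *s e)) (at y)" by (simp add: vector_scalar_mult_def)
  have "(F has_derivative (\<lambda>v. fd f (?r y) (?r v) + v $ t *s e)) (at y)"
   unfolding F_def[abs_def] by (rule has_derivative_add[OF d1 d2])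
  from fd_eq[OF this] show ?case by simp
 qed
 have D0: "fd F 0 v = ?D (?r v) + v $ t *s e" for v
  using near0D[OF DF] r0 by simp
 have "inj (fd F 0)"
 proof (rule injI)
  fix v w assume "fd F 0 v = fd F 0 w"
  then have eq: "?D (?r v) + v $ t *s e = ?D (?r w) + w $ t *s e" unfolding D0 .
  have vt: "v $ t = w $ t"
  proof (rule ccontr)
   assume ne: "v $ t \<noteq> w $ t"
   have "(v $ t - w $ t) *s e = ?D (?r w) - ?D (?r v)"
    using eq by (simp add: vector_sub_rdistrib algebra_simps)
   then have "e = (1 / (v $ t - w $ t)) *s (?D (?r w) - ?D (?r v))"
    using ne by (metis vector_smult_assoc nonzero_divide_eq_eq right_minus_eq times_divide_eq_left mult_1 vector_smult_lid)
   also have "... = ?D ((1 / (v $ t - w $ t)) *s (?r w - ?r v))"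
    unfolding J by (simp add: matrix_vector_mult_diff_distrib vector_scalar_commute)
   finally show False using e by blast
  qed
  then have "?D (?r v) = ?D (?r w)" using eq by simp
  then have "?r v = ?r w" by (rule injD[OF f(3)])
  then have nth: "v $ b i = w $ b i" for i by (simp add: vec_eq_iff)
  have "v $ l = w $ l" for l
  proof (cases "l = t")
   case False
   then obtain i where "l = b i" using b(2) by (metis DiffI UNIV_I imageE singletonD)
   then show ?thesis using nth by simp
  qed (simp add: vt)
  then show "v = w" by (simp add: vec_eq_iff)
 qed
 moreover have "near0 y. \<forall>v. v $ t = 0 --> fd F y v = fd f (?r y) (?r v)"
  using DF by eventually_elim simp
 moreover have "F 0 = 0" by (simp add: F_def r0 f(2))
 moreover have "F y = f (?r y)" if "y $ t = 0" for y by (simp add: F_def that)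
 ultimately show thesis using b rF that[of b t F] by blast
qed

text \<open>The parametrization extends to a chart \<open>d\<close>; pulled back by it, both forms
  are adapted and have the same tangential block. Their equivalence is then carried back through the
  chart.\<close>

theorem martinet_equivalence:
 fixes w0 w1 :: "('k, 'm::finite) form" and F :: "('k, 'p::{finite,linorder}) vec => 'k^'m" and g :: "('k, 'p) form"
 assumes RGm: "!!f :: 'k^'m => 'k. regular_germ r f \<longleftrightarrow> rg f" and RGp: "!!f :: ('k, 'p) vec => 'k. regular_germ r f \<longleftrightarrow> rg f"
  and card: "CARD('m) = 2 * n" "CARD('p) = 2 * n - 1"
  and ss: "singular_symplectic_germ r n w0" "singular_symplectic_germ r n w1"
  and sm: "structurally_smooth_martinet r n w0" "structurally_smooth_martinet r n w1"
  and common: "near0 p. p \<in> martinet_set n w0 \<longleftrightarrow> p \<in> martinet_set n w1"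
  and par: "local_parametrization r (martinet_set n w0) F"
  and rank: "form2_rank (pullback F w0 0) + 4 = 2 * n"
  and g: "form_germ_eq 2 (pullback F w0) g" "form_germ_eq 2 (pullback F w1) g"
  and dim: "vec.dim (span_jet1 (\<lambda>q. wedge_power (g q) (n - 1))) = 2"
 shows "\<exists>P. diffeo_germ r P \<and> form_germ_eq 2 (pullback P w1) w0"
proof -
 obtain es :: "'m list" where "set es = UNIV \<and> distinct es" using finite_distinct_list[of "UNIV :: 'm set"] by auto
 then have es: "distinct es" "set es = UNIV" by simp_all
 have F: "rmap F" "F 0 = 0" "inj (fd F 0)"
  using par unfolding local_parametrization_def regular_map_germ_def RGp rmap_def by simp_all
 obtain U W h where U: "open U" "0 \<in> U" "homeomorphism U (martinet_set n w0 \<inter> W) F h"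
  using par unfolding local_parametrization_def by (elim conjE exE) (rule that)
 have cmp: "CARD('m) = CARD('p) + 1" using card zero_less_card_finite[where 'a = 'm] by simp
 obtain t :: 'm and B :: "'p => 'm" and d where B: "inj B" "range B = UNIV - {t}"
  and d: "rmap d" "d 0 = 0" "inj (fd d 0)"
  and Ft: "!!y. y $ t = 0 ==> d y = F (restrict_coords B y)"
  and DF: "near0 y. \<forall>v. v $ t = 0 --> fd d y v = fd F (restrict_coords B y) (restrict_coords B v)"
  by (rule adapted_chart[OF cmp F]) (rule that)
 let ?R = "restrict_coords B :: 'k^'m => ('k, 'p) vec" and ?J = "embed B :: ('k, 'p) vec => 'k^'m"
 have R: "rmap ?R" "?R 0 = 0" by (rule rmap_restrict, simp add: vec_eq_iff)
 have J: "rmap ?J" "?J 0 = 0" by (rule rmap_embed, simp)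
 have it: "?J q $ t = 0" for q using B(2) by (intro embed_nth(2)) auto
 have z0: "near0 y. y $ t = 0 --> d y \<in> martinet_set n w0"
 proof -
  have "near0 q. q \<in> U" using U by (intro eventually_nhds_in_open)
  from eventually_rmap[OF this R] show ?thesis
  proof eventually_elim
   case (elim y)
   then have "F (?R y) \<in> martinet_set n w0" using U(3) unfolding homeomorphism_def by blast
   then show ?case using Ft by simp
  qed
 qed
 have z1: "near0 y. y $ t = 0 --> d y \<in> martinet_set n w1"
  using z0 eventually_rmap[OF common d(1,2)] by eventually_elim blast
 have data: "two_form (pull d (form_matrix u)) \<and>
   (near0 y. y $ t = 0 --> (\<forall>v w. v $ t = 0 --> w $ t = 0 --> bl (pull d (form_matrix u) y) v w = g (?R y) [?R v, ?R w])) \<and>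
   (\<exists>a b. adapted t a b (pull d (form_matrix u))) \<and>
   (near0 x. \<forall>v w. u x [v, w] = bl (form_matrix u x) v w)"
  if ss: "singular_symplectic_germ r n u" and sm: "structurally_smooth_martinet r n u"
   and z: "near0 y. y $ t = 0 --> d y \<in> martinet_set n u" and s': "form_germ_eq 2 (pullback F u) g" for u
 proof -
  let ?M = "form_matrix u" and ?N = "pull d (form_matrix u)"
  have "form_germ r 2 u" "form_germ_eq 3 (ext_deriv 2 u) (\<lambda>_ _. 0)" using ss unfolding singular_symplectic_germ_def by blast+
  note tf = two_form_of_form[OF RGm this]
  note pff = pf_of_form[OF RGm card(1) es tf(2) sm]
  obtain v0 where v0: "fd (\<lambda>x. pf es n (?M x)) 0 v0 \<noteq> 0" using pff(3) ..
  have zp: "near0 y. y $ t = 0 --> pf es n (?M (d y)) = 0"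
   using z eventually_rmap[OF pff(1) d(1,2)] by eventually_elim blast
  note pfp = pf_pull[OF card(1) es two_formD(1)[OF tf(1)] d pff(2) v0 zp]
  have tN: "two_form ?N" by (rule two_form_pull[OF tf(1) d(1,2)])
  have rest: "near0 y. y $ t = 0 --> (\<forall>v w. v $ t = 0 --> w $ t = 0 --> bl (?N y) v w = g (?R y) [?R v, ?R w])"
   using bl_pull[OF d(1), of ?M] DF eventually_rmap[OF tf(2) d(1,2)] eventually_rmap[OF s'[unfolded form_germ_eq_def] R]
  proof eventually_elim
   case (elim y)
   show ?case
   proof (intro impI allI)
    fix v w :: "'k^'m" assume yt: "y $ t = 0" and vw: "v $ t = 0" "w $ t = 0"
    have "bl (?N y) v w = u (d y) [fd d y v, fd d y w]"
     using elim(1,3) by simp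
    also have "... = pullback F u (?R y) [?R v, ?R w]"
     using elim(2) vw by (simp add: pullback_def Ft[OF yt])
    also have "... = g (?R y) [?R v, ?R w]" using elim(4) by simp
    finally show "bl (?N y) v w = g (?R y) [?R v, ?R w]" .
   qed
  qed
  \<comment> \<open>The tangential block at 0 of the straightened form, through the common
    restriction \<open>g\<close>. Rank 2n - 4 in dimension 2n - 1 leaves three independent kernel
    vectors.\<close>
  let ?S = "\<chi> i j. pullback F w0 0 [axis i 1, axis j 1]"
  have S: "?S $ i $ j = ?N 0 $ B i $ B j" for i j
  proof -
   have "?N 0 $ B i $ B j = bl (?N 0) (?J (axis i 1)) (?J (axis j 1))" by (simp add: embed_axis[OF B(1)] bl_axes)
   also have "... = g 0 [axis i 1, axis j 1]"
    using near0D[OF rest] by (simp add: it R(2) restrict_embed[OF B(1)])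
   also have "... = pullback F w0 0 [axis i 1, axis j 1]"
    using near0D[OF g(1)[unfolded form_germ_eq_def]] by simp
   finally show ?thesis by simp
  qed
  have "rank ?S + 3 = CARD('p)" using rank card(2) unfolding form2_rank_def by simp
  then obtain x y z where xyz: "indep3 x y z" "?S *v x = 0" "?S *v y = 0" "?S *v z = 0" using rank_kernel3 by blast
  have i3: "indep3 (?J x) (?J y) (?J z)"
   unfolding indep3_def
  proof (intro allI impI)
   fix a b c assume e: "a *s ?J x + b *s ?J y + c *s ?J z = 0"
   have "(a *s x + b *s y + c *s z) $ i = 0" for i
    using arg_cong[OF e, of "\<lambda>w. w $ B i"] by (simp add: embed_nth(1)[OF B(1)])
   then have "a *s x + b *s y + c *s z = 0" by (simp add: vec_eq_iff)
   then show "a = 0 \<and> b = 0 \<and> c = 0" using xyz(1) unfolding indep3_def by blast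
  qed
  have ker: "(?N 0 *v ?J x) $ j = 0" if Sx: "?S *v x = 0" and jt: "j \<noteq> t" for x j
  proof -
   obtain i where i: "j = B i" using jt B(2) by (metis DiffI UNIV_I imageE singletonD)
   have "(?N 0 *v ?J x) $ j = (\<Sum>l\<in>range B. ?N 0 $ j $ l * ?J x $ l)"
    unfolding matrix_vector_mult_def vec_lambda_beta by (rule sum.mono_neutral_right) (auto simp: embed_nth(2))
   also have "... = (\<Sum>k\<in>UNIV. ?N 0 $ j $ B k * x $ k)"
    by (subst sum.reindex[OF B(1)]) (simp add: embed_nth(1)[OF B(1)])
   also have "... = (?S *v x) $ i" unfolding i matrix_vector_mult_def vec_lambda_beta S[symmetric] by simp
   finally show ?thesis using Sx by simp
  qed
  obtain v1 where v1: "fd (\<lambda>y. pf es n (?N y)) 0 v1 \<noteq> 0" using pfp(2) ..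
  obtain a b where "adapted t a b ?N"
   using adapted_exists[OF card(1) es tN pfp(1) v1 i3 it it it] ker xyz(2-4) by blast
  then show ?thesis using tN rest tf(2) by blast
 qed
 let ?N0 = "pull d (form_matrix w0)" and ?N1 = "pull d (form_matrix w1)"
 note d0 = data[OF ss(1) sm(1) z0 g(1)] and d1 = data[OF ss(2) sm(2) z1 g(2)]
 obtain a b where A0: "adapted t a b ?N0" using d0 by blast
 obtain a1 b1 where A1: "adapted t a1 b1 ?N1" using d1 by blast
 have r0: "near0 y. y $ t = 0 --> (\<forall>v w. v $ t = 0 --> w $ t = 0 --> bl (?N0 y) v w = g (?R y) [?R v, ?R w])" using d0 by blast
 have r1: "near0 y. y $ t = 0 --> (\<forall>v w. v $ t = 0 --> w $ t = 0 --> bl (?N1 y) v w = g (?R y) [?R v, ?R w])" using d1 by blast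
 have tan: "near0 y. y $ t = 0 --> (\<forall>i j. i \<noteq> t --> j \<noteq> t --> ?N0 y $ i $ j = ?N1 y $ i $ j)"
  using r0 r1
 proof eventually_elim
  case (elim y)
  show ?case
  proof (intro impI allI)
   fix i j assume yt: "y $ t = 0" and ij: "i \<noteq> t" "j \<noteq> t"
   have ax: "axis i (1::'k) $ t = 0" "axis j (1::'k) $ t = 0" using ij by (simp_all add: axis_def)
   have "bl (?N0 y) (axis i 1) (axis j 1) = bl (?N1 y) (axis i 1) (axis j 1)"
    using elim yt ax by simp
   then show "?N0 y $ i $ j = ?N1 y $ i $ j" unfolding bl_axes .
  qed
 qed
 have s0: "near0 q. \<forall>v w. g q [v, w] = bl (?N0 (?J q)) (?J v) (?J w)"
  using eventually_rmap[OF r0 J] by eventually_elim (simp add: it restrict_embed[OF B(1)])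
 have tf0: "two_form ?N0" using d0 by blast
 have "mequiv ?N1 ?N0"
  by (rule equivalent_of_restriction[OF card(1) A0 A1 tan span_jet1_rank2[OF card(2) B two_formD(1)[OF tf0] s0 dim]])
 \<comment> \<open>Each form is equivalent to its pullback by the chart, so symmetry and
   transitivity close the chain.\<close>
 with mequiv_pull[OF d, of "form_matrix w0"] mequiv_pull[OF d, of "form_matrix w1"]
 have "mequiv (form_matrix w0) (form_matrix w1)"
  using mequiv_trans mequiv_sym by blast
 then obtain P where P: "rmap P" "P 0 = 0" "inj (fd P 0)"
   "near0 x. \<forall>v w. bl (form_matrix w1 (P x)) (fd P x v) (fd P x w) = bl (form_matrix w0 x) v w"
  unfolding mequiv_def by blast
 obtain H where H: "rmap H" "H 0 = 0" "near0 x. H (P x) = x" "near0 y. P (H y) = y"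
  using rmap_inverse[OF P(1-3)] .
 have "diffeo_germ r P"
  unfolding diffeo_germ_def regular_map_germ_def RGm using P(1,2) H unfolding rmap_def by blast
 moreover have "form_germ_eq 2 (pullback P w1) w0"
 proof -
  have m: "near0 x. \<forall>v w. w0 x [v, w] = bl (form_matrix w0 x) v w" "near0 x. \<forall>v w. w1 x [v, w] = bl (form_matrix w1 x) v w"
   using d0 d1 by blast+
  show ?thesis unfolding form_germ_eq_def
   using P(4) m(1) eventually_rmap[OF m(2) P(1,2)]
  proof eventually_elim
   case (elim x)
   show ?case
   proof (intro allI impI)
    fix vs :: "('k^'m) list" assume "length vs = 2"
    then have vs: "vs = [vs ! 0, vs ! 1]" by (rule length2)
    have "pullback P w1 x [vs ! 0, vs ! 1] = w0 x [vs ! 0, vs ! 1]"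
     using elim by (simp add: pullback_def)
    then show "pullback P w1 x vs = w0 x vs" using vs by simp
   qed
  qed
 qed
 ultimately show ?thesis by blast
qed

end

section \<open>The smooth, real analytic and complex analytic categories\<close>

lemma real_smooth_iff: "smooth_germ (f :: real^'m => real) \<longleftrightarrow> kgerm f"
proof
 assume "smooth_germ f"
 then obtain U where U: "open U" "0 \<in> U" "!!k. Ck_on k U f" unfolding smooth_germ_def by blast
 have "fd f x (c *s v) = c * fd f x v" if "x \<in> U" for x c v
 proof -
  have "(f has_derivative fd f x) (at x)" by (rule Ck_on_has_derivative[OF U(3) that])
  from linear_scale[OF has_derivative_linear[OF this], of c v] show ?thesis by (simp add: scalar_mult_eq_scaleR)
 qed
 then show "kgerm f" using U unfolding kgerm_def kreg_on_def by blast
next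
 assume "kgerm f"
 then show "smooth_germ f" unfolding kgerm_def kreg_on_def smooth_germ_def by blast
qed

lemma bounded_linear_of_real_vec: "bounded_linear (of_real_vec :: real^'m => complex^'m)"
proof (rule bounded_linear_intro[of _ 1])
 show "norm (of_real_vec x :: complex^'m) \<le> norm x * 1" for x :: "real^'m"
  by (simp add: of_real_vec_def norm_vec_def)
qed (simp_all add: of_real_vec_def vec_eq_iff scaleR_conv_of_real[where 'a = complex])

text \<open>Near 0 the germ is the real part of a holomorphic function composed with the linear
  inclusion of real points.\<close>

lemma real_analytic_imp_kgerm:
 assumes "analytic_germ (f :: real^'m => real)"
 shows "kgerm f"
proof -
 obtain F where F: "kgerm F" "near0 x. F (of_real_vec x) = of_real (f x)" using assms unfolding real_analytic_iff by blast
 obtain V where V: "0 \<in> V" "kreg_on V F" using F(1) unfolding kgerm_def by blast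
 obtain S where S: "open S" "0 \<in> S" "!!x. x \<in> S ==> F (of_real_vec x) = of_real (f x)" using F(2) unfolding eventually_nhds by blast
 let ?U = "S \<inter> of_real_vec -` V"
 have U: "open ?U" using S(1) kreg_on_open[OF V(2)]
  by (intro open_Int open_vimage linear_continuous_on bounded_linear_of_real_vec)
 have nth: "of_real_vec x $ i = of_real (x $ i)" for x :: "real^'m" and i by (simp add: of_real_vec_def)
 have "Ck_on k ?U f" for k
 proof -
  have "Tk k ?U (\<lambda>s x. of_real_vec x $ i)" for i
   unfolding nth by (rule Tk_bounded_linear[OF bounded_linear_of_real U kreg_on_Tk[OF kreg_on_nth[OF U]]])
  then have "Tk k ?U (\<lambda>s x. of_real_vec x)" by (rule Tk_vec[OF U])
  then have "Tk k ?U (\<lambda>s x. F (of_real_vec x))"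
   by (rule Tk_compose[OF U kreg_on_open[OF V(2)] kreg_on_Tk[OF V(2)]]) simp
  from Tk_bounded_linear[OF bounded_linear_Re U this] have "Ck_on k ?U (\<lambda>x. Re (F (of_real_vec x)))" unfolding Ck_on_eq_Tk .
  moreover have "Ck_on k ?U (\<lambda>x. Re (F (of_real_vec x))) = Ck_on k ?U f" by (rule Ck_on_cong[OF U]) (simp add: S(3))
  ultimately show ?thesis by simp
 qed
 moreover have "0 \<in> ?U" using S(2) V(1) by (simp add: of_real_vec_def zero_vec_def)
 ultimately have "smooth_germ f" using U unfolding smooth_germ_def by blast
 then show ?thesis unfolding real_smooth_iff .
qed

theorem theorem4p1:
  fixes n :: nat
  assumes "CARD('m::finite) = 2 * n" and "CARD('p::{finite,linorder}) = 2 * n - 1"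
  shows
    "(\<forall>r (\<omega>0 :: (real, 'm::finite) form) (\<omega>1 :: (real, 'm) form)
          (\<phi> :: real^'p::{finite,linorder} \<Rightarrow> real^'m) (\<sigma> :: (real, 'p) form).
      singular_symplectic_germ r n \<omega>0 \<and> singular_symplectic_germ r n \<omega>1 \<and>
      structurally_smooth_martinet r n \<omega>0 \<and> structurally_smooth_martinet r n \<omega>1 \<and>
      (\<forall>\<^sub>F p in nhds 0. p \<in> martinet_set n \<omega>0 \<longleftrightarrow> p \<in> martinet_set n \<omega>1) \<and>
      local_parametrization r (martinet_set n \<omega>0) \<phi> \<and>
      form2_rank (pullback \<phi> \<omega>0 0) + 4 = 2 * n \<and>
      form2_rank (pullback \<phi> \<omega>1 0) + 4 = 2 * n \<and>
      form_germ_eq 2 (pullback \<phi> \<omega>0) \<sigma> \<and> form_germ_eq 2 (pullback \<phi> \<omega>1) \<sigma> \<and>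
      canonical_orientation r n \<omega>0 \<phi> = canonical_orientation r n \<omega>1 \<phi> \<and>
      vec.dim (span_jet1 (\<lambda>q. wedge_power (\<sigma> q) (n - 1))) = 2
      \<longrightarrow> (\<exists>\<Psi>. diffeo_germ r \<Psi> \<and> form_germ_eq 2 (pullback \<Psi> \<omega>1) \<omega>0))
    \<and>
    (\<forall>(\<omega>0 :: (complex, 'm::finite) form) (\<omega>1 :: (complex, 'm) form)
          (\<phi> :: complex^'p::{finite,linorder} \<Rightarrow> complex^'m) (\<sigma> :: (complex, 'p) form).
      singular_symplectic_germ Analytic n \<omega>0 \<and> singular_symplectic_germ Analytic n \<omega>1 \<and>
      structurally_smooth_martinet Analytic n \<omega>0 \<and> structurally_smooth_martinet Analytic n \<omega>1 \<and>
      (\<forall>\<^sub>F p in nhds 0. p \<in> martinet_set n \<omega>0 \<longleftrightarrow> p \<in> martinet_set n \<omega>1) \<and>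
      local_parametrization Analytic (martinet_set n \<omega>0) \<phi> \<and>
      form2_rank (pullback \<phi> \<omega>0 0) + 4 = 2 * n \<and>
      form2_rank (pullback \<phi> \<omega>1 0) + 4 = 2 * n \<and>
      form_germ_eq 2 (pullback \<phi> \<omega>0) \<sigma> \<and> form_germ_eq 2 (pullback \<phi> \<omega>1) \<sigma> \<and>
      vec.dim (span_jet1 (\<lambda>q. wedge_power (\<sigma> q) (n - 1))) = 2
      \<longrightarrow> (\<exists>\<Psi>. diffeo_germ Analytic \<Psi> \<and> form_germ_eq 2 (pullback \<Psi> \<omega>1) \<omega>0))"
proof (intro conjI allI impI; elim conjE)
 fix r and \<omega>0 \<omega>1 :: "(real, 'm) form" and \<phi> :: "(real, 'p) vec => real^'m" and \<sigma> :: "(real, 'p) form"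
 assume h: "singular_symplectic_germ r n \<omega>0" "singular_symplectic_germ r n \<omega>1"
   "structurally_smooth_martinet r n \<omega>0" "structurally_smooth_martinet r n \<omega>1"
   "near0 p. p \<in> martinet_set n \<omega>0 \<longleftrightarrow> p \<in> martinet_set n \<omega>1"
   "local_parametrization r (martinet_set n \<omega>0) \<phi>"
   "form2_rank (pullback \<phi> \<omega>0 0) + 4 = 2 * n"
   "form_germ_eq 2 (pullback \<phi> \<omega>0) \<sigma>" "form_germ_eq 2 (pullback \<phi> \<omega>1) \<sigma>"
   "vec.dim (span_jet1 (\<lambda>q. wedge_power (\<sigma> q) (n - 1))) = 2"
 show "\<exists>\<Psi>. diffeo_germ r \<Psi> \<and> form_germ_eq 2 (pullback \<Psi> \<omega>1) \<omega>0"
 proof (cases r)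
  case Smooth
  interpret regular_class False "of_real :: real => complex"
   by (rule regular_class.intro) (rule bounded_linear_of_real, simp_all)
  have RG: "regular_germ r f \<longleftrightarrow> rg f" for f :: "real^'l => real"
   by (simp add: Smooth real_smooth_iff rg_def)
  show ?thesis by (rule martinet_equivalence[OF RG RG assms h])
 next
  case Analytic
  interpret regular_class True "of_real :: real => complex"
   by (rule regular_class.intro) (rule bounded_linear_of_real, simp_all)
  have cxv: "cxv = (of_real_vec :: real^'l => complex^'l)"
   by (simp add: fun_eq_iff cxv_def of_real_vec_def)
  have RG: "regular_germ r f \<longleftrightarrow> rg f" for f :: "real^'l => real"
  proof -
   \<comment> \<open>An analytic germ is scalar-regular, so the conjunction can be introduced to
     match \<open>rg\<close> with the flag \<open>True\<close>.\<close>
   have "regular_germ r f \<longleftrightarrow> kgerm f \<and> analytic_germ f" using real_analytic_imp_kgerm[of f] by (auto simp: Analytic)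
   then show ?thesis unfolding rg_def extends_def cxv real_analytic_iff by simp
  qed
  show ?thesis by (rule martinet_equivalence[OF RG RG assms h])
 qed
next
 fix \<omega>0 \<omega>1 :: "(complex, 'm) form" and \<phi> :: "(complex, 'p) vec => complex^'m" and \<sigma> :: "(complex, 'p) form"
 assume h: "singular_symplectic_germ Analytic n \<omega>0" "singular_symplectic_germ Analytic n \<omega>1"
   "structurally_smooth_martinet Analytic n \<omega>0" "structurally_smooth_martinet Analytic n \<omega>1"
   "near0 p. p \<in> martinet_set n \<omega>0 \<longleftrightarrow> p \<in> martinet_set n \<omega>1"
   "local_parametrization Analytic (martinet_set n \<omega>0) \<phi>"
   "form2_rank (pullback \<phi> \<omega>0 0) + 4 = 2 * n"
   "form_germ_eq 2 (pullback \<phi> \<omega>0) \<sigma>" "form_germ_eq 2 (pullback \<phi> \<omega>1) \<sigma>"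
   "vec.dim (span_jet1 (\<lambda>q. wedge_power (\<sigma> q) (n - 1))) = 2"
 \<comment> \<open>Over the complex numbers scalar-regular germs are already the analytic ones, so
   no extension has to be demanded.\<close>
 interpret regular_class False "id :: complex => complex"
  by (rule regular_class.intro) (unfold id_def, rule bounded_linear_ident, simp_all)
 have RG: "regular_germ Analytic f \<longleftrightarrow> rg f" for f :: "complex^'l => complex"
  using kgerm_imp_analytic[of f] analytic_imp_kgerm[of f] by (auto simp: rg_def)
 show "\<exists>\<Psi>. diffeo_germ Analytic \<Psi> \<and> form_germ_eq 2 (pullback \<Psi> \<omega>1) \<omega>0"
  by (rule martinet_equivalence[OF RG RG assms h])
qed

end
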